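(* (i) For any choice of parameters $\alpha$ and $\beta$ there exists a unique Poisson bracket $\mathcal P_{\alpha,\beta}$ on the Grassmannian $G_k(n)$ such that for any network $N$ with $k$ sources, $n-k$ sinks and edge weights given by products of flag coordinates, the Grassmannian boundary measurement map $X_N:(\mathbb R\setminus 0)^{|E|}\to G_k(n)$ is Poisson, provided the parameters $\alpha_{ij}$ and $\beta_{ij}$ defining the bracket $\{\cdot,\cdot\}_N$ on $(\mathbb R\setminus 0)^{|E|}$ satisfy $$\alpha=\alpha_{23}+\alpha_{13}-\alpha_{12},\qquad\beta=\beta_{23}+\beta_{13}-\beta_{12}.$$ (ii) For any $I\subset\{1,\dots,n\}$, $|I|=k$, $I=\{i_1<\dots<i_k\}$, and $J=\{1,\dots,n\}\setminus I$, the restriction of $\mathcal P_{\alpha,\beta}$ to the cell $G_k^I(n)$ coincides with the bracket $\{\cdot,\cdot\}_{I,J}$ given in the coordinates $m^I_{pj}$ by $$\{m^I_{pj},m^I_{\bar p\bar\jmath}\}_{I,J}=(\alpha-\beta)\,s_=(i_p,j,i_{\bar p},\bar\jmath)\,m^I_{p\bar\jmath}m^I_{\bar pj}+(\alpha+\beta)\,s_\times(i_p,j,i_{\bar p},\bar\jmath)\,m^I_{pj}m^I_{\bar p\bar\jmath},$$ $p,\bar p\in\{1,\dots,k\}$, $j,\bar\jmath\in J$.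
   Context: **Networks.** $G=(V,E)$ is a directed planar graph without loops and parallel edges drawn in a disk. Exactly $n$ vertices $b_1,\dots,b_n$ lie on the boundary circle, labelled counterclockwise; each is a source (exactly one outgoing edge, no incoming edges) or a sink (exactly one incoming edge, no outgoing edges). $I=\{i_1<\dots<i_k\}$ is the set of indices of sources, $J=\{j_1<\dots<j_{n-k}\}$ that of sinks. All internal vertices have degree 3 and are either white (exactly one incoming edge) or black (exactly one outgoing edge). **Weights and brackets.** A flag is a pair $(v,e)$ with $v$ an endpoint of $e$. To each internal vertex $v$ attach coordinates $x_v^1,x_v^2,x_v^3\in\mathbb R\setminus 0$ labelling the three flags at $v$: $x_v^1$ labels the flag of the unique incoming edge if $v$ is white, of the unique outgoing edge if $v$ is black, and the flags labelled $x_v^1,x_v^2,x_v^3$ follow each other clockwise around $v$. To each boundary vertex attach one coordinate in $\mathbb R\setminus 0$ labelling its unique flag. The weight $w_e$ of an edge is the product of the coordinates labelling its two flags; the space of edge weights is $(\mathbb R\setminus 0)^{|E|}$. For constants $\alpha_{ij}=-\alpha_{ji}$, $\beta_{ij}=-\beta_{ji}$ ($i,j\in\{1,2,3\}$), put $\{x_v^i,x_v^j\}=\alpha_{ij}x_v^ix_v^j$ at white $v$, $\{x_v^i,x_v^j\}=\beta_{ij}x_v^ix_v^j$ at black $v$, all other brackets of coordinates being zero; $\{\cdot,\cdot\}_N$ is the pushforward to $(\mathbb R\setminus 0)^{|E|}$, a well-defined Poisson bracket. **Boundary measurements.** For a closed oriented polygonal plane curve $C$ (collinear consecutive segments having the same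 direction) and an oriented line $l$ not collinear to any segment of $C$, let $c(C)\in\mathbb Z/2\mathbb Z$ be the number mod 2 of pairs $(e',e'')$ of consecutive segments such that the direction vector of $l$ lies in the interior of the cone spanned by $e',e''$ (independent of $l$). Draw $N$ with straight edges and all internal vertices in the interior of the convex hull of the boundary vertices. For a path $P$ from a source $b_i$ to a sink $b_j$, $C_P$ is obtained by adding to $P$ the path from $b_j$ to $b_i$ going counterclockwise along the boundary of the convex hull, and $w_P=(-1)^{c(C_P)-1}\prod_{e\in P}w_e$. $M(i,j)$ is the sum of $w_P$ over all paths from $b_i$ to $b_j$ (a formal series representing a rational function of the edge weights). **Grassmannian map.** $\bar X_N$ is the $k\times n$ matrix whose columns indexed by $I$ form the identity matrix and whose $(p,j)$-entry for $j\in J$ is $(-1)^{s(p,j)}M(i_p,j)$, where $s(p,j)$ is the number of elements of $I$ lying strictly between $\min\{i_p,j\}$ and $\max\{i_p,j\}$. $X_N\in G_k(n)$ is the row span of $\bar X_N$; this defines the rational map $X_N$. $G_k(n)$ is the Grassmannian of $k$-dimensional subspaces of $\mathbb R^n$; $x_I$ is the Plücker coordinate (minor with columns $I$); $G_k^I(n)=\{X:x_I\ne0\}$; $m^I_{pj}$ ($1\le p\le k$, $j\in J$) are the coordinates on $G_k^I(n)$ given by the $(p,j)$-entry of the unique $k\times n$ matrix representative whose columns indexed by $I$ form the identity matrix. **The functions $s_=$ and $s_\times$.** $a\prec b\prec c\prec\cdots$ means that the (distinct) indices occur in this counterclockwise cyclic order on the boundary circle (i.e. in cyclic order modulo $n$).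 For $i,i'\in I$, $j,j'\in J$, $$s_=(i,j,i',j')=\begin{cases}1&\text{if } i\prec i'\prec j'\prec j,\\ -1&\text{if } i'\prec i\prec j\prec j',\\ \tfrac12&\text{if } i=i'\prec j'\prec j\text{ or } i\prec i'\prec j'=j,\\ -\tfrac12&\text{if } i'=i\prec j\prec j'\text{ or } i'\prec i\prec j=j',\\ 0&\text{otherwise,}\end{cases}$$ $$s_\times(i,j,i',j')=\begin{cases}1&\text{if } i'\prec i\prec j'\prec j,\\ -1&\text{if } i\prec i'\prec j\prec j',\\ \tfrac12&\text{if } i'=i\prec j'\prec j\text{ or } i'\prec i\prec j'=j,\\ -\tfrac12&\text{if } i=i'\prec j\prec j'\text{ or } i\prec i'\prec j=j',\\ 0&\text{otherwise.}\end{cases}$$ *)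

theory Defs
  imports
    "HOL-Analysis.Analysis"
    "HOL-Library.FuncSet"
    "HOL-Library.Multiset"
    "HOL-Analysis.Finite_Function_Topology"
    "Jordan_Normal_Form.Determinant"
begin

section \<open>Smooth functions and Poisson brackets\<close>

text \<open>
  Points of a space with coordinates indexed by a finite set \<open>K\<close> are functions \<open>x :: 'i \<Rightarrow> real\<close> of
  which only the values on \<open>K\<close> matter; \<open>pdiff i F x\<close> is the partial derivative in direction \<open>i\<close>.
\<close>

definition pdiff :: "'i \<Rightarrow> (('i \<Rightarrow> real) \<Rightarrow> real) \<Rightarrow> ('i \<Rightarrow> real) \<Rightarrow> real" where
  "pdiff i F x = deriv (\<lambda>t. F (x(i := t))) (x i)"

fun Ck_on :: "nat \<Rightarrow> 'i set \<Rightarrow> ('i \<Rightarrow> real) set \<Rightarrow> (('i \<Rightarrow> real) \<Rightarrow> real) \<Rightarrow> bool" where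
  "Ck_on 0 K U F \<longleftrightarrow> continuous_on U F"
| "Ck_on (Suc r) K U F \<longleftrightarrow> continuous_on U F \<and>
     (\<forall>i\<in>K. (\<forall>x\<in>U. (\<lambda>t. F (x(i := t))) differentiable (at (x i))) \<and> Ck_on r K U (pdiff i F))"

definition Cinf_on :: "'i set \<Rightarrow> ('i \<Rightarrow> real) set \<Rightarrow> (('i \<Rightarrow> real) \<Rightarrow> real) \<Rightarrow> bool" where
  "Cinf_on K U F \<longleftrightarrow> (\<forall>r. Ck_on r K U F)"

text \<open>
  \<open>A\<close> is an algebra of functions on \<open>U\<close>; its elements are extensional (they are \<open>undefined\<close> outside
  \<open>U\<close>), so that equality in \<open>A\<close> is equality on \<open>U\<close>. Linearity and the Leibniz rule in the second
  argument follow from skew symmetry.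
\<close>

definition poisson_bracket ::
    "'m set \<Rightarrow> ('m \<Rightarrow> real) set \<Rightarrow> (('m \<Rightarrow> real) \<Rightarrow> ('m \<Rightarrow> real) \<Rightarrow> ('m \<Rightarrow> real)) \<Rightarrow> bool" where
  "poisson_bracket U A B \<longleftrightarrow>
     B \<in> A \<rightarrow>\<^sub>E (A \<rightarrow>\<^sub>E A) \<and>
     (\<forall>f\<in>A. \<forall>g\<in>A. \<forall>h\<in>A. \<forall>a b.
        B (\<lambda>X\<in>U. a * f X + b * g X) h = (\<lambda>X\<in>U. a * B f h X + b * B g h X)) \<and>
     (\<forall>f\<in>A. \<forall>g\<in>A. B f g = (\<lambda>X\<in>U. - B g f X)) \<and>
     (\<forall>f\<in>A. \<forall>g\<in>A. \<forall>h\<in>A.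
        B (\<lambda>X\<in>U. f X * g X) h = (\<lambda>X\<in>U. f X * B g h X + B f h X * g X)) \<and>
     (\<forall>f\<in>A. \<forall>g\<in>A. \<forall>h\<in>A.
        (\<lambda>X\<in>U. B f (B g h) X + B g (B h f) X + B h (B f g) X) = (\<lambda>X\<in>U. 0))"

text \<open>\<open>B'\<close> on the open subset \<open>W\<close> is the restriction of the bracket \<open>B\<close> on the algebra \<open>A\<close>.\<close>

definition bracket_restricts ::
    "('m \<Rightarrow> real) set \<Rightarrow> (('m \<Rightarrow> real) \<Rightarrow> ('m \<Rightarrow> real) \<Rightarrow> ('m \<Rightarrow> real)) \<Rightarrow>
     'm set \<Rightarrow> (('m \<Rightarrow> real) \<Rightarrow> ('m \<Rightarrow> real) \<Rightarrow> ('m \<Rightarrow> real)) \<Rightarrow> bool" where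
  "bracket_restricts A B W B' \<longleftrightarrow>
     (\<forall>f\<in>A. \<forall>g\<in>A. restrict (B f g) W = B' (restrict f W) (restrict g W))"


section \<open>The Grassmannian\<close>

text \<open>
  \<open>\<real>\<^sup>n\<close> is the space of finitely supported vectors \<open>v :: nat \<Rightarrow>\<^sub>0 real\<close> with support in \<open>{1..n}\<close>. A
  \<open>k \<times> n\<close> matrix is a function \<open>A :: nat \<Rightarrow> nat \<Rightarrow> real\<close> of which the entries \<open>A p j\<close> with
  \<open>1 \<le> p \<le> k\<close> and \<open>1 \<le> j \<le> n\<close> are used.
\<close>

type_synonym subsp = "(nat \<Rightarrow>\<^sub>0 real) set"

definition Gr :: "nat \<Rightarrow> nat \<Rightarrow> subsp set" where
  "Gr k n = {X. subspace X \<and> dim X = k \<and> (\<forall>v\<in>X. Poly_Mapping.keys v \<subseteq> {1..n})}"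

definition row_vec :: "nat \<Rightarrow> (nat \<Rightarrow> nat \<Rightarrow> real) \<Rightarrow> nat \<Rightarrow> (nat \<Rightarrow>\<^sub>0 real)" where
  "row_vec n A p = (\<Sum>j\<in>{1..n}. Poly_Mapping.single j (A p j))"

definition row_span :: "nat \<Rightarrow> nat \<Rightarrow> (nat \<Rightarrow> nat \<Rightarrow> real) \<Rightarrow> subsp" where
  "row_span k n A = span (row_vec n A ` {1..k})"

text \<open>\<open>elt I p\<close> is \<open>i\<^sub>p\<close>, where \<open>I = {i\<^sub>1 < i\<^sub>2 < \<dots>}\<close>.\<close>

definition elt :: "nat set \<Rightarrow> nat \<Rightarrow> nat" where
  "elt I p = sorted_list_of_set I ! (p - 1)"

definition minor :: "nat \<Rightarrow> nat set \<Rightarrow> (nat \<Rightarrow> nat \<Rightarrow> real) \<Rightarrow> real" where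
  "minor k I A = Determinant.det (Matrix.mat k k (\<lambda>(r, c). A (r + 1) (elt I (c + 1))))"

text \<open>
  The Pluecker coordinate \<open>x\<^sub>I\<close> of \<open>X\<close> is defined up to a nonzero factor, by the choice of a matrix
  with row span \<open>X\<close>; its vanishing does not depend on this choice.
\<close>

definition cell :: "nat \<Rightarrow> nat \<Rightarrow> nat set \<Rightarrow> subsp set" where
  "cell k n I = {X \<in> Gr k n. \<exists>A. row_span k n A = X \<and> minor k I A \<noteq> 0}"

abbreviation coord_idx :: "nat \<Rightarrow> nat \<Rightarrow> nat set \<Rightarrow> (nat \<times> nat) set" where
  "coord_idx k n I \<equiv> {1..k} \<times> ({1..n} - I)"

definition cell_matrix :: "nat set \<Rightarrow> (nat \<times> nat \<Rightarrow> real) \<Rightarrow> nat \<Rightarrow> nat \<Rightarrow> real" where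
  "cell_matrix I x p j = (if j \<in> I then (if j = elt I p then 1 else 0) else x (p, j))"

definition cell_param :: "nat \<Rightarrow> nat \<Rightarrow> nat set \<Rightarrow> (nat \<times> nat \<Rightarrow> real) \<Rightarrow> subsp" where
  "cell_param k n I x = row_span k n (cell_matrix I x)"

definition cell_coord :: "nat \<Rightarrow> nat \<Rightarrow> nat set \<Rightarrow> nat \<Rightarrow> nat \<Rightarrow> subsp \<Rightarrow> real" where
  "cell_coord k n I p j = (\<lambda>X \<in> cell k n I.
     (THE x. x \<in> extensional (coord_idx k n I) \<and> cell_param k n I x = X) (p, j))"

text \<open>
  \<open>C\<^sup>\<infinity>(U)\<close> for an open subset \<open>U\<close> of the Grassmannian: functions that are smooth in each of the
  charts \<open>cell_param k n I\<close>.
\<close>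

definition Gr_smooth :: "nat \<Rightarrow> nat \<Rightarrow> subsp set \<Rightarrow> (subsp \<Rightarrow> real) set" where
  "Gr_smooth k n U = {f \<in> extensional U. \<forall>I. I \<subseteq> {1..n} \<and> card I = k \<longrightarrow>
     Cinf_on (coord_idx k n I) {x. cell_param k n I x \<in> U} (\<lambda>x. f (cell_param k n I x))}"


section \<open>Networks\<close>

text \<open>
  A network is given by a straight-line drawing in the closed unit disk: vertices are points of the
  plane, and the edge \<open>(u, v)\<close> is the segment from \<open>u\<close> to \<open>v\<close>. The boundary vertices are
  \<open>bdry N 1, \<dots>, bdry N n\<close>.
\<close>

record network =
  bdry :: "nat \<Rightarrow> complex"
  inner :: "complex set"
  edges :: "(complex \<times> complex) set"

definition in_edges :: "network \<Rightarrow> complex \<Rightarrow> (complex \<times> complex) set" where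
  "in_edges N v = {e \<in> edges N. snd e = v}"

definition out_edges :: "network \<Rightarrow> complex \<Rightarrow> (complex \<times> complex) set" where
  "out_edges N v = {e \<in> edges N. fst e = v}"

definition is_source :: "network \<Rightarrow> complex \<Rightarrow> bool" where
  "is_source N v \<longleftrightarrow> card (out_edges N v) = 1 \<and> in_edges N v = {}"

definition is_sink :: "network \<Rightarrow> complex \<Rightarrow> bool" where
  "is_sink N v \<longleftrightarrow> card (in_edges N v) = 1 \<and> out_edges N v = {}"

definition white :: "network \<Rightarrow> complex \<Rightarrow> bool" where
  "white N v \<longleftrightarrow> v \<in> inner N \<and> card (in_edges N v) = 1"

definition black :: "network \<Rightarrow> complex \<Rightarrow> bool" where
  "black N v \<longleftrightarrow> v \<in> inner N \<and> card (out_edges N v) = 1"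

definition sources :: "nat \<Rightarrow> network \<Rightarrow> nat set" where
  "sources n N = {i \<in> {1..n}. is_source N (bdry N i)}"

definition sinks :: "nat \<Rightarrow> network \<Rightarrow> nat set" where
  "sinks n N = {j \<in> {1..n}. is_sink N (bdry N j)}"

definition left_of :: "complex \<Rightarrow> complex \<Rightarrow> bool" where
  "left_of d z \<longleftrightarrow> Im (cnj d * z) > 0"

text \<open>
  For \<open>n \<le> 2\<close> the convex hull of the boundary vertices has no interior. In that case the internal
  vertices lie in the open disk and, if there are a source \<open>i\<close> and a sink \<open>j\<close>, to the left of the
  segment from \<open>bdry N j\<close> to \<open>bdry N i\<close>, which closes up the paths from \<open>i\<close> to \<open>j\<close>.

  The planarity condition also excludes antiparallel pairs of edges, which do not occur in a
  straight-line drawing.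
\<close>

definition network :: "nat \<Rightarrow> network \<Rightarrow> bool" where
  "network n N \<longleftrightarrow>
     finite (inner N) \<and>
     (\<forall>i\<in>{1..n}. norm (bdry N i) = 1) \<and>
     strict_mono_on {1..n} (\<lambda>i. Arg2pi (bdry N i / bdry N 1)) \<and>
     inner N \<subseteq> ball 0 1 \<and>
     (n \<ge> 3 \<longrightarrow> inner N \<subseteq> interior (convex hull (bdry N ` {1..n}))) \<and>
     (n \<le> 2 \<longrightarrow> (\<forall>v\<in>inner N. \<forall>i\<in>sources n N. \<forall>j\<in>sinks n N.
        left_of (bdry N i - bdry N j) (v - bdry N j))) \<and>
     edges N \<subseteq> (inner N \<union> bdry N ` {1..n}) \<times> (inner N \<union> bdry N ` {1..n}) \<and>
     (\<forall>(u, v)\<in>edges N. u \<noteq> v) \<and>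
     (\<forall>(u, v)\<in>edges N. \<forall>(u', v')\<in>edges N. (u, v) \<noteq> (u', v') \<longrightarrow>
        closed_segment u v \<inter> closed_segment u' v' \<subseteq> {u, v} \<inter> {u', v'}) \<and>
     (\<forall>i\<in>{1..n}. is_source N (bdry N i) \<or> is_sink N (bdry N i)) \<and>
     (\<forall>v\<in>inner N. card (in_edges N v) + card (out_edges N v) = 3 \<and> (white N v \<or> black N v))"


section \<open>Flag coordinates and the bracket on the space of edge weights\<close>

type_synonym flag = "complex \<times> (complex \<times> complex)"

definition flags :: "network \<Rightarrow> flag set" where
  "flags N = {(v, e). e \<in> edges N \<and> (v = fst e \<or> v = snd e)}"

definition flag_dir :: "flag \<Rightarrow> complex" where
  "flag_dir = (\<lambda>(v, e). (if v = fst e then snd e else fst e) - v)"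

definition first_flag :: "network \<Rightarrow> complex \<Rightarrow> flag" where
  "first_flag N v = (v, if white N v then the_elem (in_edges N v) else the_elem (out_edges N v))"

text \<open>\<open>Arg2pi (d / d')\<close> is the angle by which \<open>d\<close> is to be turned clockwise to point along \<open>d'\<close>.\<close>

definition clockwise_angle :: "network \<Rightarrow> flag \<Rightarrow> real" where
  "clockwise_angle N \<phi> = Arg2pi (flag_dir (first_flag N (fst \<phi>)) / flag_dir \<phi>)"

text \<open>The number \<open>i\<close> such that the flag \<open>\<phi>\<close> at the internal vertex \<open>v\<close> carries the coordinate
  \<open>x\<^sub>v\<^sup>i\<close>.\<close>

definition flag_number :: "network \<Rightarrow> flag \<Rightarrow> nat" where
  "flag_number N \<phi> = 1 + card {\<psi> \<in> flags N. fst \<psi> = fst \<phi> \<and>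
     clockwise_angle N \<psi> < clockwise_angle N \<phi>}"

definition flag_coeff ::
    "(nat \<Rightarrow> nat \<Rightarrow> real) \<Rightarrow> (nat \<Rightarrow> nat \<Rightarrow> real) \<Rightarrow> network \<Rightarrow> flag \<Rightarrow> flag \<Rightarrow> real" where
  "flag_coeff a b N \<phi> \<psi> =
     (if fst \<phi> = fst \<psi> \<and> white N (fst \<phi>) then a (flag_number N \<phi>) (flag_number N \<psi>)
      else if fst \<phi> = fst \<psi> \<and> black N (fst \<phi>) then b (flag_number N \<phi>) (flag_number N \<psi>)
      else 0)"

definition flag_bracket ::
    "(nat \<Rightarrow> nat \<Rightarrow> real) \<Rightarrow> (nat \<Rightarrow> nat \<Rightarrow> real) \<Rightarrow> network \<Rightarrow>
     ((flag \<Rightarrow> real) \<Rightarrow> real) \<Rightarrow> ((flag \<Rightarrow> real) \<Rightarrow> real) \<Rightarrow> (flag \<Rightarrow> real) \<Rightarrow> real" where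
  "flag_bracket a b N F G x = (\<Sum>\<phi>\<in>flags N. \<Sum>\<psi>\<in>flags N.
     flag_coeff a b N \<phi> \<psi> * x \<phi> * x \<psi> * pdiff \<phi> F x * pdiff \<psi> G x)"

definition flag_space :: "network \<Rightarrow> (flag \<Rightarrow> real) set" where
  "flag_space N = flags N \<rightarrow>\<^sub>E (UNIV - {0})"

type_synonym weights = "complex \<times> complex \<Rightarrow> real"

definition weight_space :: "network \<Rightarrow> weights set" where
  "weight_space N = edges N \<rightarrow>\<^sub>E (UNIV - {0})"

definition weight_map :: "network \<Rightarrow> (flag \<Rightarrow> real) \<Rightarrow> weights" where
  "weight_map N x = (\<lambda>e\<in>edges N. x (fst e, e) * x (snd e, e))"

text \<open>The pushforward of the bracket on the flag coordinates: the value at \<open>w\<close> is the common value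
  of \<open>{F \<circ> weight_map, G \<circ> weight_map}\<close> at all preimages of \<open>w\<close>.\<close>

definition edge_bracket ::
    "(nat \<Rightarrow> nat \<Rightarrow> real) \<Rightarrow> (nat \<Rightarrow> nat \<Rightarrow> real) \<Rightarrow> network \<Rightarrow>
     (weights \<Rightarrow> real) \<Rightarrow> (weights \<Rightarrow> real) \<Rightarrow> weights \<Rightarrow> real" where
  "edge_bracket a b N F G w = (THE c. \<forall>x\<in>flag_space N. weight_map N x = w \<longrightarrow>
     c = flag_bracket a b N (F \<circ> weight_map N) (G \<circ> weight_map N) x)"


section \<open>Boundary measurements\<close>

text \<open>
  The interior of the cone spanned by two consecutive segments of a closed polygonal curve. Opposite
  consecutive segments occur in the curves \<open>C\<^sub>P\<close> only if \<open>P\<close> is a single edge from \<open>b\<^sub>i\<close> to \<open>b\<^sub>j\<close> where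
  \<open>b\<^sub>i\<close> is the counterclockwise neighbour of \<open>b\<^sub>j\<close>. Then \<open>C\<^sub>P\<close> runs along this edge and back, and it is
  read as the limit of simple counterclockwise curves: both of its turns are left turns by \<open>\<pi>\<close>.
\<close>

definition turn_cone :: "complex \<Rightarrow> complex \<Rightarrow> complex set" where
  "turn_cone e' e'' =
     (if \<exists>c>0. e'' = - (c *\<^sub>R e') then {l. left_of e' l}
      else interior {s *\<^sub>R e' + t *\<^sub>R e'' | s t. s \<ge> 0 \<and> t \<ge> 0})"

text \<open>The closed polygonal curve with successive vertices \<open>ps\<close>.\<close>

definition segments :: "complex list \<Rightarrow> complex list" where
  "segments ps = map (\<lambda>(p, q). q - p) (zip ps (rotate1 ps))"

definition concordance_wrt :: "complex \<Rightarrow> complex list \<Rightarrow> nat" where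
  "concordance_wrt l ps =
     length (filter (\<lambda>(e', e''). l \<in> turn_cone e' e'') (zip (segments ps) (rotate1 (segments ps)))) mod 2"

text \<open>The concordance number does not depend on the choice of the direction \<open>l\<close>.\<close>

definition concordance :: "complex list \<Rightarrow> nat" where
  "concordance ps = concordance_wrt
     (SOME l. l \<noteq> 0 \<and> (\<forall>s\<in>set (segments ps). \<not> collinear {0, l, s})) ps"

text \<open>A path (vertices and edges may repeat) is the list of its vertices.\<close>

definition net_path :: "network \<Rightarrow> complex \<Rightarrow> complex \<Rightarrow> complex list \<Rightarrow> bool" where
  "net_path N u v vs \<longleftrightarrow>
     vs \<noteq> [] \<and> hd vs = u \<and> last vs = v \<and> successively (\<lambda>x y. (x, y) \<in> edges N) vs"

definition path_edges :: "complex list \<Rightarrow> (complex \<times> complex) multiset" where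
  "path_edges vs = mset (zip vs (tl vs))"

text \<open>The indices strictly between \<open>j\<close> and \<open>i\<close> in counterclockwise order.\<close>

definition ccw_between :: "nat \<Rightarrow> nat \<Rightarrow> nat \<Rightarrow> nat list" where
  "ccw_between n j i = (if j < i then [j + 1..<i] else [j + 1..<n + 1] @ [1..<i])"

definition closed_path :: "nat \<Rightarrow> network \<Rightarrow> nat \<Rightarrow> nat \<Rightarrow> complex list \<Rightarrow> complex list" where
  "closed_path n N i j vs = vs @ map (bdry N) (ccw_between n j i)"

text \<open>
  \<open>M(i, j)\<close> as a formal power series in the edge weights. Monomials are multisets of edges; the
  coefficient of a monomial is the sum of the signs \<open>(-1)\<^bsup>c(C\<^sub>P) - 1\<^esup>\<close> of the finitely many paths \<open>P\<close>
  whose edges form this multiset.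
\<close>

definition M_series :: "nat \<Rightarrow> network \<Rightarrow> nat \<Rightarrow> nat \<Rightarrow> (complex \<times> complex) multiset \<Rightarrow> real" where
  "M_series n N i j m =
     (\<Sum>vs | net_path N (bdry N i) (bdry N j) vs \<and> path_edges vs = m.
        (-1) powi (int (concordance (closed_path n N i j vs)) - 1))"

type_synonym edge_poly = "(complex \<times> complex) multiset \<Rightarrow>\<^sub>0 real"

definition edge_polys :: "network \<Rightarrow> edge_poly set" where
  "edge_polys N = {P. \<forall>m\<in>Poly_Mapping.keys P. set_mset m \<subseteq> edges N}"

definition poly_at :: "edge_poly \<Rightarrow> weights \<Rightarrow> real" where
  "poly_at P w = (\<Sum>m\<in>Poly_Mapping.keys P. Poly_Mapping.lookup P m * (\<Prod>e\<in>#m. w e))"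

text \<open>The series \<open>S\<close> represents the rational function \<open>P / Q\<close>: \<open>Q \<noteq> 0\<close> and \<open>Q * S = P\<close>.\<close>

definition represents_fraction ::
    "((complex \<times> complex) multiset \<Rightarrow> real) \<Rightarrow> edge_poly \<Rightarrow> edge_poly \<Rightarrow> bool" where
  "represents_fraction S P Q \<longleftrightarrow> Q \<noteq> 0 \<and>
     (\<forall>m. (\<Sum>m' | m' \<subseteq># m. Poly_Mapping.lookup Q m' * S (m - m')) = Poly_Mapping.lookup P m)"

definition M_regular :: "nat \<Rightarrow> network \<Rightarrow> nat \<Rightarrow> nat \<Rightarrow> weights \<Rightarrow> bool" where
  "M_regular n N i j w \<longleftrightarrow> (\<exists>P\<in>edge_polys N. \<exists>Q\<in>edge_polys N.
     represents_fraction (M_series n N i j) P Q \<and> poly_at Q w \<noteq> 0)"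

definition M_value :: "nat \<Rightarrow> network \<Rightarrow> nat \<Rightarrow> nat \<Rightarrow> weights \<Rightarrow> real" where
  "M_value n N i j w = (THE c. \<exists>P\<in>edge_polys N. \<exists>Q\<in>edge_polys N.
     represents_fraction (M_series n N i j) P Q \<and> poly_at Q w \<noteq> 0 \<and> c = poly_at P w / poly_at Q w)"

definition num_between :: "nat set \<Rightarrow> nat \<Rightarrow> nat \<Rightarrow> nat" where
  "num_between I i j = card {i' \<in> I. min i j < i' \<and> i' < max i j}"

definition X_matrix :: "nat \<Rightarrow> network \<Rightarrow> weights \<Rightarrow> nat \<Rightarrow> nat \<Rightarrow> real" where
  "X_matrix n N w p j = (let I = sources n N in
     if j \<in> I then (if j = elt I p then 1 else 0)
     else (-1) ^ num_between I (elt I p) j * M_value n N (elt I p) j w)"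

definition X_map :: "nat \<Rightarrow> network \<Rightarrow> weights \<Rightarrow> subsp" where
  "X_map n N w = row_span (card (sources n N)) n (X_matrix n N w)"

definition X_domain :: "nat \<Rightarrow> network \<Rightarrow> weights set" where
  "X_domain n N = {w \<in> weight_space N. \<forall>i\<in>sources n N. \<forall>j\<in>sinks n N. M_regular n N i j w}"

text \<open>
  The rational map \<open>X\<^sub>N\<close> is Poisson with respect to the bracket \<open>{\<cdot>,\<cdot>}\<^sub>N\<close> with constants \<open>a\<close> (white
  vertices) and \<open>b\<close> (black vertices) on edge weights and the bracket \<open>B\<close> on the Grassmannian.
\<close>

definition X_poisson ::
    "nat \<Rightarrow> nat \<Rightarrow> (nat \<Rightarrow> nat \<Rightarrow> real) \<Rightarrow> (nat \<Rightarrow> nat \<Rightarrow> real) \<Rightarrow> network \<Rightarrow>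
     ((subsp \<Rightarrow> real) \<Rightarrow> (subsp \<Rightarrow> real) \<Rightarrow> (subsp \<Rightarrow> real)) \<Rightarrow> bool" where
  "X_poisson k n a b N B \<longleftrightarrow>
     (\<forall>f\<in>Gr_smooth k n (Gr k n). \<forall>g\<in>Gr_smooth k n (Gr k n). \<forall>w\<in>X_domain n N.
        edge_bracket a b N (f \<circ> X_map n N) (g \<circ> X_map n N) w = B f g (X_map n N w))"

definition skew3 :: "(nat \<Rightarrow> nat \<Rightarrow> real) \<Rightarrow> bool" where
  "skew3 a \<longleftrightarrow> (\<forall>i\<in>{1, 2, 3}. \<forall>j\<in>{1, 2, 3}. a i j = - a j i)"

text \<open>\<open>B\<close> is a Poisson bracket on the Grassmannian for which all the maps \<open>X\<^sub>N\<close> are Poisson.\<close>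

definition network_compatible ::
    "nat \<Rightarrow> nat \<Rightarrow> real \<Rightarrow> real \<Rightarrow> ((subsp \<Rightarrow> real) \<Rightarrow> (subsp \<Rightarrow> real) \<Rightarrow> (subsp \<Rightarrow> real)) \<Rightarrow> bool" where
  "network_compatible k n \<alpha> \<beta> B \<longleftrightarrow>
     poisson_bracket (Gr k n) (Gr_smooth k n (Gr k n)) B \<and>
     (\<forall>a b N. skew3 a \<and> skew3 b \<and> \<alpha> = a 2 3 + a 1 3 - a 1 2 \<and> \<beta> = b 2 3 + b 1 3 - b 1 2 \<and>
        network n N \<and> card (sources n N) = k \<longrightarrow> X_poisson k n a b N B)"


section \<open>The functions \<open>s\<^sub>=\<close> and \<open>s\<^sub>\<times>\<close>\<close>

text \<open>The indices are distinct and occur in the given order cyclically.\<close>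

definition cyc_ordered :: "nat list \<Rightarrow> bool" where
  "cyc_ordered xs \<longleftrightarrow> (\<exists>m. sorted_wrt (<) (rotate m xs))"

definition s_eq :: "nat \<Rightarrow> nat \<Rightarrow> nat \<Rightarrow> nat \<Rightarrow> real" where
  "s_eq i j i' j' =
     (if cyc_ordered [i, i', j', j] then 1
      else if cyc_ordered [i', i, j, j'] then - 1
      else if i = i' \<and> cyc_ordered [i, j', j] \<or> j' = j \<and> cyc_ordered [i, i', j] then 1/2
      else if i' = i \<and> cyc_ordered [i, j, j'] \<or> j = j' \<and> cyc_ordered [i', i, j] then - 1/2
      else 0)"

definition s_times :: "nat \<Rightarrow> nat \<Rightarrow> nat \<Rightarrow> nat \<Rightarrow> real" where
  "s_times i j i' j' =
     (if cyc_ordered [i', i, j', j] then 1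
      else if cyc_ordered [i, i', j, j'] then - 1
      else if i' = i \<and> cyc_ordered [i, j', j] \<or> j' = j \<and> cyc_ordered [i', i, j] then 1/2
      else if i = i' \<and> cyc_ordered [i, j, j'] \<or> j = j' \<and> cyc_ordered [i, i', j] then - 1/2
      else 0)"

end

theory Submission
 imports Defs "HOL-Computational_Algebra.Polynomial_FPS"
begin

text \<open>Two paths bracket locally, where they part (at white vertices, with factor \<open>\<alpha>\<close>) and where they meet
  (at black vertices, with factor \<open>\<beta>\<close>). The signed numbers of partings and meetings add up to
  \<open>2 s\<^sub>\<times>\<close>, which only depends on the ends of the paths. Exchanging the tails of two paths at a common
  vertex keeps the product of the weights and changes the sign in a controlled way; summed over all pairs of
  paths, this turns partings minus meetings into \<open>2 s\<^sub>=\<close> times the product of the boundary measurements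
  with exchanged sinks. As paths may run through cycles, all this happens in power series in \<open>t\<close>,
  with weights scaled by \<open>t\<close>, and is then evaluated at \<open>t = 1\<close>.

  On the Grassmannian the bracket is a quadratic expression in the infinitesimal action of \<open>GL(n)\<close>, and hence does
  not depend on the chart. It is unique, because the boundary measurements of a rectangular grid fill a dense subset
  of a cell.\<close>

section \<open>Cyclic order and turning numbers\<close>

text \<open>Paths may run through a common vertex many times, so their partings and meetings are
  counted by a telescoping argument and not by following the curves. After a generic rotation all
  vertices have different heights. Two edges that meet only in common ends keep their left-right
  order at all heights they share; this expresses the local signs at common ends by differences of
  the function \<open>hsgn\<close>, which tells on which side of an edge a vertex lies. Along two
  paths these differences telescope, and what remains at the ends is decided by the order on the
  circle. Signs of paths are treated likewise: a concordance number is a number of turns through a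
  fixed direction, additive under cutting at an edge, and the closing arc contributes a function of
  the sink plus a function of the source, up to the question whether it passes from
  \<open>b n\<close> to \<open>b 1\<close>. The signs of the matrix entries cancel exactly the sign
  that this question leaves. For uniqueness the boundary measurements of the grid are not inverted:
  one edge per matrix entry carries a free weight, and the entries are triangular in these
  weights.\<close>

abbreviation biimp (infixr "<->" 25) where "A <-> B == (A::bool) = B"

abbreviation lk where "lk \<equiv> Poly_Mapping.lookup"

definition isgn :: "nat => nat => real" where
 "isgn a b = (if a < b then 1 else if b < a then -1 else 0)"

lemma cyc_ordered_iff:
 "cyc_ordered xs <-> xs = [] | (EX m:set [0..<length xs]. sorted_wrt (<) (rotate m xs))"
proof (cases "xs = []")
 case False
 have "EX m<length xs. rotate m' xs = rotate m xs" for m'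
  using False by (intro exI[of _ "m' mod length xs"]) (auto simp: rotate_conv_mod[symmetric])
 thus ?thesis
  unfolding cyc_ordered_def using False by (simp add: atLeast0LessThan) (metis lessThan_iff)
qed (simp add: cyc_ordered_def)

lemma cyc_ordered_3:
 "cyc_ordered [a, b, c] <-> a < b & b < c | b < c & c < a | c < a & a < b"
 by (auto simp: cyc_ordered_iff upt_rec)

lemma cyc_ordered_4:
 "cyc_ordered [a, b, c, d] <-> cyc_ordered [a, b, c] & cyc_ordered [a, c, d]"
 by (simp add: cyc_ordered_iff upt_rec) linarith

lemma cyc_ordered_rotate: "cyc_ordered [a, b, c, d] <-> cyc_ordered [b, c, d, a]"
 unfolding cyc_ordered_4 cyc_ordered_3 by auto

lemma cyc_ordered_rotate3: "cyc_ordered [a, b, c] <-> cyc_ordered [b, c, a]"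
 unfolding cyc_ordered_3 by auto

lemma cyc_ordered_swap3:
 "a ~= b ==> b ~= c ==> a ~= c ==> cyc_ordered [a, c, b] <-> ~ cyc_ordered [a, b, c]"
 unfolding cyc_ordered_3 by auto

lemma isgn_cyc:
 assumes "a ~= b" "b ~= c" "a ~= c"
 shows "isgn a b + isgn b c - isgn a c = (if cyc_ordered [a, b, c] then 1 else -1)"
 using assms unfolding cyc_ordered_3 isgn_def by auto

lemma not_cyc_ordered [simp]:
 "~ cyc_ordered [a, a, b]" "~ cyc_ordered [a, b, b]" "~ cyc_ordered [a, b, a]"
 unfolding cyc_ordered_3 by auto

lemma isgn_self [simp]: "isgn a a = 0" by (simp add: isgn_def)

lemma isgn_swap: "isgn a b = - isgn b a" by (simp add: isgn_def)

text \<open>The right side is -1/2 times the bilinear extension of \<open>isgn\<close> to formal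
  sums, evaluated at \<open>j - i\<close> and \<open>j' - i'\<close>: a signed crossing number of
  the chords from \<open>i\<close> to \<open>j\<close> and from \<open>i'\<close> to
  \<open>j'\<close>, with halves for a common end. By \<open>isgn_cyc\<close> every cyclic order of
  three indices is a sum of signs. In this form the coefficient is additive in the ends of the
  paths, as a telescoping sum requires.\<close>

lemma s_times_isgn:
 assumes "i ~= j" "i ~= j'" "i' ~= j" "i' ~= j'"
 shows "s_times i j i' j' = - (isgn j j' - isgn j i' - isgn i j' + isgn i i') / 2"
proof -
 let ?P = "cyc_ordered [i, i', j]" and ?Q = "cyc_ordered [i, j, j']"
 have 1: "cyc_ordered [i', i, j', j] <-> cyc_ordered [i, j', j] & cyc_ordered [i, j, i']"
  by (subst cyc_ordered_rotate) (rule cyc_ordered_4)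
 have 2: "cyc_ordered [i, i', j, j'] <-> ?P & ?Q"
  by (rule cyc_ordered_4)
 have 3: "i ~= i' ==> cyc_ordered [i, j, i'] <-> ~ ?P" and 4: "j ~= j' ==> cyc_ordered [i, j', j] <-> ~ ?Q"
  using assms cyc_ordered_swap3[of i i' j] cyc_ordered_swap3[of i j j'] by auto
 have 5: "isgn i i' - isgn j i' - isgn i j = (if i = i' then 0 else if ?P then 1 else -1)"
  using isgn_cyc[of i i' j] assms isgn_swap[of j i'] by (auto simp: isgn_swap[of j i])
 have 6: "isgn i j + isgn j j' - isgn i j' = (if j = j' then 0 else if ?Q then 1 else -1)"
  using isgn_cyc[of i j j'] assms by auto
 have 7: "cyc_ordered [i', i, j] <-> cyc_ordered [i, j, i']"
  by (rule cyc_ordered_rotate3)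
 have sum: "isgn j j' - isgn j i' - isgn i j' + isgn i i' =
  (if i = i' then 0 else if ?P then 1 else -1) + (if j = j' then 0 else if ?Q then 1 else -1)"
  unfolding 5[symmetric] 6[symmetric] by simp
 show ?thesis
  unfolding sum unfolding s_times_def 1 2 7 using 3 4
  by (cases "i = i'"; cases "j = j'") auto
qed

text \<open>Two chords that run side by side become crossing chords when they exchange their sinks.
  For this reason one count of partings and meetings, made before and after an exchange of tails,
  yields both terms of the bracket.\<close>

lemma s_eq_s_times:
 assumes "i ~= j" "i ~= j'" "i' ~= j" "i' ~= j'"
 shows "s_eq i j i' j' = - s_times i j' i' j"
proof -
 let ?P = "cyc_ordered [i, i', j]" and ?P' = "cyc_ordered [i, i', j']" and ?Q = "cyc_ordered [i, j, j']"
 have 1: "cyc_ordered [i, i', j', j] <-> ?P' & cyc_ordered [i, j', j]"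
  by (rule cyc_ordered_4)
 have 2: "cyc_ordered [i', i, j, j'] <-> ?Q & cyc_ordered [i, j', i']"
  by (subst cyc_ordered_rotate) (rule cyc_ordered_4)
 have 7: "cyc_ordered [i', i, j'] <-> cyc_ordered [i, j', i']"
  by (rule cyc_ordered_rotate3)
 have 3: "j ~= j' ==> cyc_ordered [i, j', j] <-> ~ ?Q"
   "i ~= i' ==> cyc_ordered [i, j', i'] <-> ~ ?P'"
  using assms cyc_ordered_swap3[of i j j'] cyc_ordered_swap3[of i i' j'] by auto
 show ?thesis
  unfolding s_eq_def s_times_def 1 2 7 using 3
  by (cases "i = i'"; cases "j = j'") (auto simp: 7)
qed

section \<open>Signed incidences of plane segments\<close>

definition cross :: "complex => complex => real" where
 "cross a b = Re a * Im b - Im a * Re b"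

lemma left_of_cross: "left_of d z <-> cross d z > 0"
 by (simp add: left_of_def cross_def)

lemma cross_swap: "cross a b = - cross b a"
 by (simp add: cross_def)

lemma cross_self [simp]: "cross a a = 0" "cross 0 a = 0" "cross a 0 = 0"
 by (simp_all add: cross_def)

lemma cross_minus [simp]: "cross (- a) b = - cross a b" "cross a (- b) = - cross a b"
 by (simp_all add: cross_def)

lemma cross_scaleR [simp]: "cross (c *\<^sub>R a) b = c * cross a b" "cross a (c *\<^sub>R b) = c * cross a b"
 by (simp_all add: cross_def algebra_simps)

lemma cross_add: "cross (a + b) c = cross a c + cross b c" "cross c (a + b) = cross c a + cross c b"
 by (simp_all add: cross_def algebra_simps)

lemma cross_diff: "cross (a - b) c = cross a c - cross b c" "cross c (a - b) = cross c a - cross c b"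
 by (simp_all add: cross_def algebra_simps)

text \<open>The orientation of two directions, cut off to pairs in the same open half plane above or
  below the horizontal. These are the pairs of edges at a vertex that a horizontal sweep line meets
  together, so that their left-right order makes sense.\<close>

definition half_sgn :: "complex => complex => real" where
 "half_sgn a b = (if Im a * Im b > 0 then sgn (cross a b) else 0)"

text \<open>The side of the segment on which the point lies, recorded only if the horizontal line
  through the point meets the segment strictly between its ends.\<close>

definition hsgn :: "complex => complex => complex => real" where
 "hsgn a b v =
  (if Im a < Im v & Im v < Im b | Im b < Im v & Im v < Im a then sgn (cross (b - a) (v - a)) else 0)"

text \<open>The orientations at all common ends of two oriented segments, counted with the factor -1
  where one of them starts and the other stops.\<close>

definition end_sgn :: "complex => complex => complex => complex => real" where
 "end_sgn a b p q =
  (if a = p then half_sgn (b - a) (q - p) else 0) - (if a = q then half_sgn (b - a) (p - q) else 0) -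
  (if b = p then half_sgn (a - b) (q - p) else 0) + (if b = q then half_sgn (a - b) (p - q) else 0)"

lemma hsgn_rev: "hsgn b a v = - hsgn a b v"
proof -
 have "cross (a - b) (v - b) = - cross (b - a) (v - a)"
  by (simp add: cross_def algebra_simps)
 thus ?thesis by (auto simp: hsgn_def sgn_minus)
qed

lemma end_sgn_rev: "end_sgn b a p q = - end_sgn a b p q" "end_sgn a b q p = - end_sgn a b p q"
 by (simp_all add: end_sgn_def)

text \<open>To be applied to the horizontal distance of two segments as a function of the height.
  The last two conclusions reach beyond the interval, because a zero at one end determines an affine
  function up to a factor.\<close>

lemma affine_sgn:
 fixes d0 d1 :: real
 assumes "lo < hi" and nz: "!!t. lo < t ==> t < hi ==> d0 + d1 * t ~= 0"
 obtains s where
  "!!t. lo < t ==> t < hi ==> sgn (d0 + d1 * t) = s"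
  "d0 + d1 * lo ~= 0 ==> sgn (d0 + d1 * lo) = s" "d0 + d1 * hi ~= 0 ==> sgn (d0 + d1 * hi) = s"
  "!!t. d0 + d1 * lo = 0 ==> lo < t ==> sgn (d0 + d1 * t) = s"
  "!!t. d0 + d1 * hi = 0 ==> t < hi ==> sgn (d0 + d1 * t) = s"
proof -
 let ?d = "%t. d0 + d1 * t"
 have same: "sgn (?d t) = sgn (?d u)" if "lo <= t" "t <= hi" "lo <= u" "u <= hi" "?d t ~= 0" "?d u ~= 0" for t u
 proof (rule ccontr)
  assume ne: "sgn (?d t) ~= sgn (?d u)"
  hence "?d t * ?d u < 0" using that by (auto simp: sgn_if mult_less_0_iff split: if_splits)
  hence tu: "?d t < 0 & 0 < ?d u | 0 < ?d t & ?d u < 0" by (auto simp: mult_less_0_iff)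
  hence d1: "d1 ~= 0" by auto
  define r where "r = - d0 / d1"
  have r: "?d r = 0" using d1 by (simp add: r_def)
  have lin: "?d x = d1 * (x - r)" for x using r by (simp add: algebra_simps)
  have "t < r & r < u | u < r & r < t"
   using tu unfolding lin by (auto simp: mult_less_0_iff zero_less_mult_iff)
  hence "lo < r" "r < hi" using that by auto
  with nz[of r] r show False by simp
 qed
 obtain m where m: "lo < m" "m < hi" using \<open>lo < hi\<close> dense by blast
 note nm = nz[OF m]
 show ?thesis
 proof (rule that[of "sgn (?d m)"])
  show "sgn (?d t) = sgn (?d m)" if "lo < t" "t < hi" for t
   using same[of t m] that m nm nz[OF that] by auto
  show "sgn (?d lo) = sgn (?d m)" if "?d lo ~= 0" using same[of lo m] that m nm by auto
  show "sgn (?d hi) = sgn (?d m)" if "?d hi ~= 0" using same[of hi m] that m nm by auto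
  show "sgn (?d t) = sgn (?d m)" if "?d lo = 0" "lo < t" for t
  proof -
   have "?d x = d1 * (x - lo)" for x using that(1) by (simp add: algebra_simps)
   thus ?thesis using that(2) m by (simp add: sgn_mult)
  qed
  show "sgn (?d t) = sgn (?d m)" if "?d hi = 0" "t < hi" for t
  proof -
   have "?d x = d1 * (x - hi)" for x using that(1) by (simp add: algebra_simps)
   thus ?thesis using that(2) m by (simp add: sgn_mult)
  qed
 qed
qed

definition slope :: "complex => complex => real" where
 "slope a b = (Re b - Re a) / (Im b - Im a)"

definition height_x :: "complex => complex => real => real" where
 "height_x a b t = Re a + (t - Im a) * slope a b"

lemma slope: "Im a ~= Im b ==> Re b = Re a + (Im b - Im a) * slope a b"
 by (simp add: slope_def)

lemma height_x_ends:
 assumes "Im a ~= Im b"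
 shows "height_x a b (Im a) = Re a" "height_x a b (Im b) = Re b"
 using assms by (auto simp: height_x_def slope_def)

lemma cross_height_x:
 assumes "Im a ~= Im b"
 shows "cross (b - a) (v - a) = (Im b - Im a) * (height_x a b (Im v) - Re v)"
proof -
 note r = slope[OF assms]
 show ?thesis unfolding cross_def height_x_def minus_complex.sel r by (simp add: algebra_simps)
qed

lemma height_x_in_segment:
 assumes "Im a < Im b" "Im a <= t" "t <= Im b"
 shows "Complex (height_x a b t) t : closed_segment a b"
proof -
 define u where "u = (t - Im a) / (Im b - Im a)"
 have "0 <= u" "u <= 1" using assms by (auto simp: u_def field_simps)
 moreover have "Complex (height_x a b t) t = (1 - u) *\<^sub>R a + u *\<^sub>R b"
 proof -
  have u: "u * (Im b - Im a) = t - Im a" using assms by (simp add: u_def)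
  have "Re a + (t - Im a) * slope a b = (1 - u) * Re a + u * (Re a + (Im b - Im a) * slope a b)"
   unfolding u[symmetric] by (simp add: algebra_simps)
  hence "Re (Complex (height_x a b t) t) = Re ((1 - u) *\<^sub>R a + u *\<^sub>R b)"
   using slope[of a b] assms by (simp add: height_x_def)
  moreover have "Im (Complex (height_x a b t) t) = Im ((1 - u) *\<^sub>R a + u *\<^sub>R b)"
   using u by (simp add: algebra_simps)
  ultimately show ?thesis by (rule complex_eqI)
 qed
 ultimately show ?thesis by (auto simp: in_segment)
qed

text \<open>Two upward segments that meet only in common ends keep one left-right order
  \<open>s\<close> at all heights they share. At the lowest shared height this order is read off
  from a common lower end or from the lower end of one segment as seen from the other; at the
  highest shared height the same terms appear with the opposite sign. The sum of both readings is
  zero, which is the claim.\<close>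

lemma end_sgn_eq_up:
 assumes up: "Im a < Im b" "Im p < Im q" and ne: "(a, b) ~= (p, q)"
  and gen: "!!u v. u : {a, b} ==> v : {p, q} ==> Im u = Im v ==> u = v"
  and disj: "closed_segment a b Int closed_segment p q <= {a, b} Int {p, q}"
 shows "end_sgn a b p q = hsgn a b q - hsgn a b p - hsgn p q b + hsgn p q a"
proof -
 consider "Im b <= Im p" | "Im q <= Im a" | "max (Im a) (Im p) < min (Im b) (Im q)"
  using up by linarith
 thus ?thesis
 proof cases
  case 1
  hence "a ~= p" "a ~= q" "b ~= q" using up by auto
  moreover have "half_sgn (a - b) (q - p) = 0" using up by (auto simp: half_sgn_def zero_less_mult_iff)
  ultimately show ?thesis using 1 up by (auto simp: end_sgn_def hsgn_def)
 next
  case 2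
  hence "a ~= p" "b ~= p" "b ~= q" using up by auto
  moreover have "half_sgn (b - a) (p - q) = 0" using up by (auto simp: half_sgn_def zero_less_mult_iff)
  ultimately show ?thesis using 2 up by (auto simp: end_sgn_def hsgn_def)
 next
  case 3
  define lo hi where "lo = max (Im a) (Im p)" and "hi = min (Im b) (Im q)"
  define d1 where "d1 = slope a b - slope p q"
  define d0 where "d0 = Re a - Im a * slope a b - (Re p - Im p * slope p q)"
  have d: "height_x a b t - height_x p q t = d0 + d1 * t" for t
   by (simp add: height_x_def d0_def d1_def algebra_simps)
  have common: "Complex (height_x a b t) t : {a, b} Int {p, q}" if "lo <= t" "t <= hi" "d0 + d1 * t = 0" for t
  proof -
   have "height_x a b t = height_x p q t" using d[of t] that(3) by simp
   hence "Complex (height_x a b t) t : closed_segment a b Int closed_segment p q"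
    using height_x_in_segment[of a b t] height_x_in_segment[of p q t] up that by (auto simp: lo_def hi_def)
   thus ?thesis using disj by blast
  qed
  have hts: "t : {Im a, Im b} Int {Im p, Im q}" if "lo <= t" "t <= hi" "d0 + d1 * t = 0" for t
  proof -
   have "Im (Complex (height_x a b t) t) : Im ` {a, b} Int Im ` {p, q}"
    using common[OF that] by blast
   thus ?thesis by simp
  qed
  have aq: "Im a ~= Im q" "Im b ~= Im p" using 3 by auto
  have lohi: "lo < hi" using 3 by (simp add: lo_def hi_def)
  have ends: "height_x a b (Im a) = Re a" "height_x a b (Im b) = Re b"
    "height_x p q (Im p) = Re p" "height_x p q (Im q) = Re q"
   using up by (auto simp: height_x_ends)
  obtain s where s:
   "d0 + d1 * lo ~= 0 ==> sgn (d0 + d1 * lo) = s" "d0 + d1 * hi ~= 0 ==> sgn (d0 + d1 * hi) = s"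
   "!!t. d0 + d1 * lo = 0 ==> lo < t ==> sgn (d0 + d1 * t) = s"
   "!!t. d0 + d1 * hi = 0 ==> t < hi ==> sgn (d0 + d1 * t) = s"
  proof (rule affine_sgn[OF lohi, of d0 d1])
   show "d0 + d1 * t ~= 0" if "lo < t" "t < hi" for t
    using hts[of t] that by (auto simp: lo_def hi_def)
  qed blast
  have cr: "sgn (cross (b - a) (v - a)) = sgn (height_x a b (Im v) - Re v)"
   "sgn (cross (q - p) (v - p)) = sgn (height_x p q (Im v) - Re v)" for v
   using up by (auto simp: cross_height_x sgn_mult)
  have vals: "height_x a b (Im q) - Re q = d0 + d1 * Im q" "height_x a b (Im p) - Re p = d0 + d1 * Im p"
   "height_x p q (Im a) - Re a = - (d0 + d1 * Im a)" "height_x p q (Im b) - Re b = - (d0 + d1 * Im b)"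
   using ends by (simp_all add: d[symmetric])
  have bot: "(if a = p then half_sgn (b - a) (q - p) else 0) + hsgn a b p - hsgn p q a = s"
  proof (cases "a = p")
   case True
   have 0: "d0 + d1 * lo = 0" using ends True d[of lo] by (simp add: lo_def)
   have "half_sgn (b - a) (q - p) = sgn (cross (b - a) (q - a))"
    using up True by (simp add: half_sgn_def)
   also have "... = sgn (d0 + d1 * Im q)" by (simp only: cr vals)
   also have "... = s" using s(3)[OF 0, of "Im q"] up True by (simp add: lo_def)
   finally show ?thesis using True by (simp add: hsgn_def)
  next
   case False
   hence ne': "Im a ~= Im p" using gen[of a p] by auto
   have 0: "d0 + d1 * lo ~= 0"
    using hts[of lo] lohi ne' aq by (auto simp: lo_def max_def hi_def split: if_splits)
   note s1 = s(1)[OF 0]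
   show ?thesis
   proof (cases "Im a < Im p")
    case True
    have "hsgn a b p = sgn (d0 + d1 * Im p)"
     unfolding hsgn_def cr vals using True 3 by simp
    moreover have "hsgn p q a = 0" using True up by (simp add: hsgn_def)
    ultimately show ?thesis using s1 True False by (simp add: lo_def max_def)
   next
    case F: False
    have "hsgn p q a = sgn (- (d0 + d1 * Im a))"
     unfolding hsgn_def cr vals using F ne' 3 by simp
    moreover have "hsgn a b p = 0" using F up by (simp add: hsgn_def)
    ultimately show ?thesis using s1 F False ne' unfolding sgn_minus by (simp add: lo_def max_def)
   qed
  qed
  have top: "(if b = q then half_sgn (a - b) (p - q) else 0) - hsgn a b q + hsgn p q b = - s"
  proof (cases "b = q")
   case True
   have 0: "d0 + d1 * hi = 0" using ends True d[of hi] by (simp add: hi_def)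
   have "cross (a - b) (p - q) = - cross (b - a) (p - a)" using True by (simp add: cross_def algebra_simps)
   hence "half_sgn (a - b) (p - q) = - sgn (cross (b - a) (p - a))"
    using up True by (simp add: half_sgn_def sgn_minus zero_less_mult_iff)
   also have "... = - sgn (d0 + d1 * Im p)" by (simp only: cr vals)
   also have "... = - s" using s(4)[OF 0, of "Im p"] up True by (simp add: hi_def)
   finally show ?thesis using True by (simp add: hsgn_def)
  next
   case False
   hence ne': "Im b ~= Im q" using gen[of b q] by auto
   have 0: "d0 + d1 * hi ~= 0"
    using hts[of hi] lohi ne' aq by (auto simp: hi_def min_def lo_def split: if_splits)
   note s2 = s(2)[OF 0]
   show ?thesis
   proof (cases "Im b < Im q")
    case True
    have "hsgn p q b = sgn (- (d0 + d1 * Im b))"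
     unfolding hsgn_def cr vals using True 3 by simp
    moreover have "hsgn a b q = 0" using True up by (simp add: hsgn_def)
    ultimately show ?thesis using s2 True False unfolding sgn_minus by (simp add: hi_def min_def)
   next
    case F: False
    have "hsgn a b q = sgn (d0 + d1 * Im q)"
     unfolding hsgn_def cr vals using F ne' 3 by simp
    moreover have "hsgn p q b = 0" using F up by (simp add: hsgn_def)
    ultimately show ?thesis using s2 F False ne' by (simp add: hi_def min_def)
   qed
  qed
  have "a ~= q" "b ~= p" using aq by auto
  hence "end_sgn a b p q =
   (if a = p then half_sgn (b - a) (q - p) else 0) + (if b = q then half_sgn (a - b) (p - q) else 0)"
   by (simp add: end_sgn_def)
  thus ?thesis using bot top by linarith
 qed
qed

text \<open>Both sides change sign when one of the segments is reversed, which reduces the claim to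
  upward segments.\<close>

lemma end_sgn_eq:
 assumes ab: "Im a ~= Im b" "Im p ~= Im q" and ne: "(a, b) ~= (p, q)"
  and gen: "!!u v. u : {a, b} ==> v : {p, q} ==> Im u = Im v ==> u = v"
  and disj: "closed_segment a b Int closed_segment p q <= {a, b} Int {p, q}"
 shows "end_sgn a b p q = hsgn a b q - hsgn a b p - hsgn p q b + hsgn p q a"
proof -
 \<comment> \<open>A segment and its reverse would have their midpoint in common, which is not an
   end.\<close>
 have ne': "(b, a) ~= (p, q)"
 proof
  assume "(b, a) = (p, q)"
  hence "closed_segment p q = closed_segment a b" by (simp add: closed_segment_commute)
  hence sub: "closed_segment a b <= {a, b}" using disj by blast
  have "midpoint a b : {a, b}"
   by (rule subsetD[OF sub midpoint_in_closed_segment])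
  moreover have "midpoint a b ~= a" "midpoint a b ~= b"
   using ab(1) by (auto simp: midpoint_eq_endpoint)
  ultimately show False by simp
 qed
 have ne2: "(a, b) ~= (q, p)" and ne3: "(b, a) ~= (q, p)" using ne ne' by auto
 have gens: "!!u v. u : {b, a} ==> v : {p, q} ==> Im u = Im v ==> u = v"
  "!!u v. u : {a, b} ==> v : {q, p} ==> Im u = Im v ==> u = v"
  "!!u v. u : {b, a} ==> v : {q, p} ==> Im u = Im v ==> u = v"
  using gen by blast+
 have disjs: "closed_segment b a Int closed_segment p q <= {b, a} Int {p, q}"
  "closed_segment a b Int closed_segment q p <= {a, b} Int {q, p}"
  "closed_segment b a Int closed_segment q p <= {b, a} Int {q, p}"
  using disj unfolding closed_segment_commute[of b a] closed_segment_commute[of q p] by blast+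
 consider "Im a < Im b" "Im p < Im q" | "Im b < Im a" "Im p < Im q" | "Im a < Im b" "Im q < Im p" | "Im b < Im a" "Im q < Im p"
  using ab by linarith
 thus ?thesis
 proof cases
  case 1
  thus ?thesis using ne gen disj by (rule end_sgn_eq_up)
 next
  case 2
  hence "end_sgn b a p q = hsgn b a q - hsgn b a p - hsgn p q a + hsgn p q b"
   using ne' gens(1) disjs(1) by (rule end_sgn_eq_up)
  thus ?thesis by (simp add: end_sgn_rev(1)[of a b] hsgn_rev[of a b])
 next
  case 3
  hence "end_sgn a b q p = hsgn a b p - hsgn a b q - hsgn q p b + hsgn q p a"
   using ne2 gens(2) disjs(2) by (rule end_sgn_eq_up)
  thus ?thesis by (simp add: end_sgn_rev(2)[of a b p q] hsgn_rev[of p q])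
 next
  case 4
  hence "end_sgn b a q p = hsgn b a p - hsgn b a q - hsgn q p a + hsgn q p b"
   using ne3 gens(3) disjs(3) by (rule end_sgn_eq_up)
  thus ?thesis
   using end_sgn_rev(1)[of b a q p] end_sgn_rev(2)[of a b q p] hsgn_rev[of q p a] hsgn_rev[of q p b]
    hsgn_rev[of b a p] hsgn_rev[of b a q] by linarith
 qed
qed

section \<open>Concordance numbers as numbers of turns\<close>

lemma collinear_cross:
 assumes "l ~= 0" "s ~= 0"
 shows "collinear {0, l, s} <-> cross l s = 0"
proof
 assume "collinear {0, l, s}"
 then obtain c where "s = c *\<^sub>R l" using assms by (auto simp: collinear_lemma)
 thus "cross l s = 0" by simp
next
 assume c: "cross l s = 0"
 have "EX c. s = c *\<^sub>R l"
 proof (cases "Re l = 0")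
  case True
  hence "Im l ~= 0" using assms by (auto simp: complex_eq_iff)
  thus ?thesis using c True by (intro exI[of _ "Im s / Im l"]) (auto simp: complex_eq_iff cross_def)
 next
  case False
  thus ?thesis using c by (intro exI[of _ "Re s / Re l"]) (auto simp: complex_eq_iff cross_def field_simps)
 qed
 thus "collinear {0, l, s}" using assms by (auto simp: collinear_lemma)
qed

lemma exists_generic:
 assumes "finite S" "0 ~: S"
 shows "EX l. l ~= 0 & (ALL s:S. cross l s ~= 0)"
proof -
 obtain t where t: "t ~: (%s. Im s / Re s) ` S"
  using ex_new_if_finite[OF infinite_UNIV_char_0, of "(%s. Im s / Re s) ` S"] assms by auto
 have "cross (Complex 1 t) s ~= 0" if "s : S" for s
 proof
  assume 0: "cross (Complex 1 t) s = 0"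
  hence "Im s = t * Re s" by (simp add: cross_def)
  moreover from this have "Re s ~= 0" using assms that complex_eq_iff[of s 0] by auto
  ultimately have "t = Im s / Re s" by simp
  thus False using t that by blast
 qed
 thus ?thesis by (intro exI[of _ "Complex 1 t"]) (auto simp: complex_eq_iff)
qed

text \<open>The open set described by the inequalities lies in the cone, as the two coefficients can
  be computed by Cramer's rule, and hence lies in its interior. Conversely a point of the cone that
  is not parallel to either side has positive coefficients.\<close>

lemma turn_cone_cross:
 assumes l: "cross l e' ~= 0" "cross l e'' ~= 0"
 shows "l : turn_cone e' e'' <->
  (if EX c>0. e'' = - (c *\<^sub>R e') then cross e' l > 0
  else cross e' l * cross e' e'' > 0 & cross l e'' * cross e' e'' > 0)"
proof (cases "EX c>0. e'' = - (c *\<^sub>R e')")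
 case True
 thus ?thesis unfolding turn_cone_def by (simp add: left_of_cross)
next
 case False
 let ?S = "{s *\<^sub>R e' + t *\<^sub>R e'' | s t. s >= 0 & t >= 0}"
 let ?T = "{x. cross e' x * cross e' e'' > 0 & cross x e'' * cross e' e'' > 0}"
 have nz: "e' ~= 0" "e'' ~= 0" "l ~= 0" using l by auto
 have "l : interior ?S <-> l : ?T"
 proof
  assume "l : interior ?S"
  hence "l : ?S" by (rule subsetD[OF interior_subset])
  then obtain s t where st: "l = s *\<^sub>R e' + t *\<^sub>R e''" "s >= 0" "t >= 0" by blast
  have 1: "cross e' l = t * cross e' e''" "cross l e'' = s * cross e' e''" "cross l e' = - t * cross e' e''"
   unfolding st(1) cross_add by (simp_all add: cross_swap[of e'' e'])
  hence "t > 0" "s > 0" "cross e' e'' ~= 0" using l st(2,3) by auto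
  hence "t * (cross e' e'' * cross e' e'') > 0" "s * (cross e' e'' * cross e' e'') > 0"
   by (simp_all add: zero_less_mult_iff linorder_neq_iff) linarith+
  thus "l : ?T" using 1 by (simp add: mult.assoc)
 next
  assume lT: "l : ?T"
  have "open ?T"
   unfolding cross_def by (intro open_Collect_conj open_Collect_less continuous_intros)
  moreover have "?T <= ?S"
  proof
   fix x assume x: "x : ?T"
   let ?C = "cross e' e''"
   have C: "?C ~= 0" using x by auto
   define s t where "s = cross x e'' / ?C" and "t = cross e' x / ?C"
   have "s > 0" "t > 0" using x C
    by (auto simp: s_def t_def zero_less_divide_iff zero_less_mult_iff)
   moreover have "?C *\<^sub>R x = cross x e'' *\<^sub>R e' + cross e' x *\<^sub>R e''"
    by (simp add: complex_eq_iff cross_def algebra_simps)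
   hence "x = s *\<^sub>R e' + t *\<^sub>R e''"
    unfolding s_def t_def using C by (simp add: complex_eq_iff field_simps)
   ultimately show "x : ?S" using less_imp_le by blast
  qed
  ultimately show "l : interior ?S" using lT interior_maximal[of ?T ?S] by blast
 qed
 thus ?thesis unfolding turn_cone_def if_not_P[OF False] by simp
qed

lemma antiparallel_iff:
 assumes "e' ~= 0" "e'' ~= 0" "cross e' e'' = 0"
 shows "EX c. c ~= 0 & e'' = c *\<^sub>R e'"
proof -
 have "collinear {0, e', e''}" using collinear_cross[of e' e''] assms by simp
 then obtain c where "e'' = c *\<^sub>R e'" using assms by (auto simp: collinear_lemma)
 thus ?thesis using assms by (intro exI[of _ c]) auto
qed

text \<open>Rotating \<open>l\<close> to \<open>l'\<close> changes the number of turns of a closed curve through \<open>l\<close> whenever a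
  segment direction is passed, and every segment belongs to two turns.\<close>

definition in_sector :: "complex => complex => complex => bool" where
 "in_sector l l' e <-> cross l e * cross l l' > 0 & cross e l' * cross l l' > 0"

lemma turn_cone_cocycle:
 assumes l: "cross l e' ~= 0" "cross l e'' ~= 0" and l': "cross l' e' ~= 0" "cross l' e'' ~= 0"
  and L: "cross l l' ~= 0"
 shows "((l : turn_cone e' e'') ~= (l' : turn_cone e' e'')) = (in_sector l l' e' ~= in_sector l l' e'')"
proof -
 have nz: "e' ~= 0" "e'' ~= 0" using l by auto
 define A B A' B' where "A = cross l e'" and "B = cross l e''" and "A' = cross l' e'" and "B' = cross l' e''"
 have sw: "cross e' l = - A" "cross e' l' = - A'" "cross e'' l = - B" "cross e'' l' = - B'"
  unfolding A_def B_def A'_def B'_def by (simp_all add: cross_def)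
 have nz': "A ~= 0" "B ~= 0" "A' ~= 0" "B' ~= 0" using l l' by (simp_all add: A_def B_def A'_def B'_def)
 note tc = turn_cone_cross[OF l] turn_cone_cross[OF l'] in_sector_def
 show ?thesis
 proof (cases "cross e' e'' = 0")
  case True
  then obtain c where c: "c ~= 0" "e'' = c *\<^sub>R e'" using antiparallel_iff[OF nz] by blast
  have B: "B = c * A" "B' = c * A'" by (simp_all add: A_def B_def A'_def B'_def c)
  show ?thesis
  proof (cases "c > 0")
   case True
   have no: "~ (EX d>0. e'' = - (d *\<^sub>R e'))"
   proof
    assume "EX d>0. e'' = - (d *\<^sub>R e')"
    then obtain d where d: "d > 0" "c *\<^sub>R e' = - (d *\<^sub>R e')" using c by auto
    hence "(c + d) *\<^sub>R e' = 0" by (simp add: scaleR_add_left)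
    thus False using nz True d by simp
   qed
   have "in_sector l l' e' = in_sector l l' e''"
    using True unfolding in_sector_def c(2) by (simp add: zero_less_mult_iff mult_less_0_iff)
   thus ?thesis unfolding tc(1,2) if_not_P[OF no] using \<open>cross e' e'' = 0\<close> by simp
  next
   case False
   hence ex: "EX d>0. e'' = - (d *\<^sub>R e')" using c by (intro exI[of _ "- c"]) auto
   have "in_sector l l' e'' <-> A * cross l l' < 0 & - A' * cross l l' < 0"
    unfolding in_sector_def sw B B_def[symmetric] using False c(1)
    by (auto simp: zero_less_mult_iff mult_less_0_iff)
   moreover have "in_sector l l' e' <-> A * cross l l' > 0 & - A' * cross l l' > 0"
    unfolding in_sector_def sw A_def[symmetric] by simp
   moreover have "A * cross l l' < 0 <-> (A > 0 <-> ~ cross l l' > 0)"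
    "A * cross l l' > 0 <-> (A > 0 <-> cross l l' > 0)"
    "- A' * cross l l' < 0 <-> (A' > 0 <-> cross l l' > 0)"
    "- A' * cross l l' > 0 <-> (A' > 0 <-> ~ cross l l' > 0)"
    "- A > 0 <-> ~ A > 0" "- A' > 0 <-> ~ A' > 0"
    using nz' L by (auto simp: zero_less_mult_iff mult_less_0_iff)
   ultimately show ?thesis unfolding tc(1,2) if_P[OF ex] sw by blast
  qed
 next
  case False
  define C L where "C = cross e' e''" and "L = cross l l'"
  have C: "C ~= 0" "L ~= 0" using False L by (simp_all add: C_def L_def)
  \<comment> \<open>The Pluecker relation of the four vectors \<open>l\<close>, \<open>l'\<close>,
    \<open>e'\<close>, \<open>e''\<close>. It excludes the two sign patterns \<open>no1\<close> and
    \<open>no2\<close> in which the parities could differ.\<close>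
  have pl: "L * C = A * B' - B * A'" unfolding A_def B_def A'_def B'_def C_def L_def
   by (simp add: cross_def algebra_simps)
  have no: "~ (EX d>0. e'' = - (d *\<^sub>R e'))" using False by auto
  have LC: "L * C > 0 <-> (L > 0 <-> C > 0)" "A * B' > 0 <-> (A > 0 <-> B' > 0)" "B * A' > 0 <-> (B > 0 <-> A' > 0)"
   "L * C ~= 0" "A * B' ~= 0" "B * A' ~= 0"
   using C nz' by (auto simp: zero_less_mult_iff)
  have iff: "- A * C > 0 <-> (A > 0 <-> ~ C > 0)" "B * C > 0 <-> (B > 0 <-> C > 0)"
   "- A' * C > 0 <-> (A' > 0 <-> ~ C > 0)" "B' * C > 0 <-> (B' > 0 <-> C > 0)"
   "A * L > 0 <-> (A > 0 <-> L > 0)" "- A' * L > 0 <-> (A' > 0 <-> ~ L > 0)"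
   "B * L > 0 <-> (B > 0 <-> L > 0)" "- B' * L > 0 <-> (B' > 0 <-> ~ L > 0)"
   using C nz' by (auto simp: zero_less_mult_iff mult_less_0_iff)
  have t1: "l : turn_cone e' e'' <-> - A * C > 0 & B * C > 0"
   unfolding tc(1) if_not_P[OF no] by (simp add: sw C_def B_def)
  have t2: "l' : turn_cone e' e'' <-> - A' * C > 0 & B' * C > 0"
   unfolding tc(2) if_not_P[OF no] by (simp add: sw C_def B'_def)
  have s: "in_sector l l' e' <-> A * L > 0 & - A' * L > 0" "in_sector l l' e'' <-> B * L > 0 & - B' * L > 0"
   unfolding in_sector_def by (simp_all add: sw L_def A_def B_def)
  have no1: "~ (L * C > 0 & ~ A * B' > 0 & B * A' > 0)" and no2: "~ (~ L * C > 0 & A * B' > 0 & ~ B * A' > 0)"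
   using pl LC by linarith+
  show ?thesis
   using no1 no2 unfolding t1 t2 s iff LC by blast
 qed
qed

fun turns :: "complex => complex list => nat" where
 "turns l (p # q # r # xs) = of_bool (l : turn_cone (q - p) (r - q)) + turns l (q # r # xs)"
| "turns l _ = 0"

text \<open>The segment from \<open>p\<close> to \<open>q\<close> is kept in both pieces, so every
  pair of consecutive segments is counted exactly once.\<close>

lemma turns_append: "turns l (xs @ p # q # ys) = turns l (xs @ [p, q]) + turns l (p # q # ys)"
proof (induction xs)
 case Nil
 thus ?case by simp
next
 case (Cons x xs)
 thus ?case by (cases xs; cases "tl xs") auto
qed

definition steps :: "complex list => complex list" where
 "steps ps = map (%(p, q). q - p) (zip ps (tl ps))"

lemma turns_steps:
 "turns l ps = length (filter (%(e', e''). l : turn_cone e' e'') (zip (steps ps) (tl (steps ps))))"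
 by (induction l ps rule: turns.induct) (auto simp: steps_def)

lemma closed_steps:
 assumes "ps = p # q # xs"
 shows "steps (ps @ [p, q]) = segments ps @ [hd (segments ps)]"
proof -
 have 1: "zip (ps @ [p, q]) (tl (ps @ [p, q])) = zip ps (rotate1 ps) @ [(p, q)]"
  using zip_append[of ps "rotate1 ps" "[p, q]" "[q]"] assms by simp
 show ?thesis unfolding steps_def 1 segments_def by (simp add: assms)
qed

text \<open>Repeating the first two vertices opens the closed polygon into a chain with the same
  pairs of consecutive sides, including the two turns next to the seam.\<close>

lemma concordance_wrt_turns:
 assumes "ps = p # q # xs"
 shows "concordance_wrt l ps = turns l (ps @ [p, q]) mod 2"
proof -
 define S where "S = segments ps"
 have "S ~= []" using assms by (simp add: S_def segments_def)
 then obtain s S' where S: "S = s # S'" by (cases S) auto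
 have "zip (S @ [hd S]) (tl (S @ [hd S])) = zip S (rotate1 S)"
  using zip_append1[of "s # S'" "[s]" "S' @ [s]"] by (simp add: S)
 thus ?thesis
  unfolding concordance_wrt_def turns_steps closed_steps[OF assms] S_def by simp
qed

lemma concordance_wrt_parity:
 assumes g: "!!s. s : set (segments ps) ==> cross l s ~= 0 & cross l' s ~= 0" and L: "cross l l' ~= 0"
 shows "concordance_wrt l ps = concordance_wrt l' ps"
proof -
 define S where "S = segments ps"
 let ?c = "%P zs. length (filter P zs)"
 have *: "even (?c (%(e', e''). l : turn_cone e' e'') zs + ?c (%(e', e''). l' : turn_cone e' e'') zs +
   (?c (in_sector l l') (map fst zs) + ?c (in_sector l l') (map snd zs)))"
  if "set zs <= set S \<times> set S" for zs
  using that
 proof (induction zs)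
  case (Cons z zs)
  obtain e' e'' where z: "z = (e', e'')" by (cases z)
  have "((l : turn_cone e' e'') ~= (l' : turn_cone e' e'')) = (in_sector l l' e' ~= in_sector l l' e'')"
   using Cons.prems g L unfolding z S_def by (intro turn_cone_cocycle) auto
  thus ?case using Cons by (auto simp: z)
 qed simp
 have sub: "set (zip S (rotate1 S)) <= set S \<times> set S"
  by (auto dest: set_zip_leftD set_zip_rightD)
 have "?c (in_sector l l') (rotate1 S) = ?c (in_sector l l') S"
  by (cases S) auto
 hence "even (?c (%(e', e''). l : turn_cone e' e'') (zip S (rotate1 S)) +
   ?c (%(e', e''). l' : turn_cone e' e'') (zip S (rotate1 S)))"
  using *[OF sub] by simp
 moreover have "even (a + b) ==> a mod 2 = b mod 2" for a b :: nat by presburger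
 ultimately show ?thesis unfolding concordance_wrt_def S_def by blast
qed

lemma set_segments_nonzero:
 assumes "l ~= 0" "!!s. s : set (segments ps) ==> s ~= 0"
 shows "(ALL s:set (segments ps). ~ collinear {0, l, s}) <-> (ALL s:set (segments ps). cross l s ~= 0)"
 using collinear_cross assms by blast

lemma concordance_eq:
 assumes nz: "!!s. s : set (segments ps) ==> s ~= 0"
  and l: "l ~= 0" "!!s. s : set (segments ps) ==> cross l s ~= 0"
 shows "concordance ps = concordance_wrt l ps"
proof -
 let ?P = "%l. l ~= 0 & (ALL s:set (segments ps). ~ collinear {0, l, s})"
 define l' where "l' = (SOME l. ?P l)"
 have "?P l" using set_segments_nonzero[OF l(1) nz] l by blast
 hence l'P: "?P l'" unfolding l'_def by (rule someI)
 hence l': "l' ~= 0" "!!s. s : set (segments ps) ==> cross l' s ~= 0"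
  using set_segments_nonzero[of l' ps] nz by blast+
 \<comment> \<open>The chosen direction \<open>l'\<close> may be parallel to \<open>l\<close>, while
   the parity argument compares independent directions. Both are therefore compared with a third
   one.\<close>
 obtain m where m: "m ~= 0" "ALL s:insert l (insert l' (set (segments ps))). cross m s ~= 0"
  using exists_generic[of "insert l (insert l' (set (segments ps)))"] nz l(1) l'(1) by auto
 have "concordance_wrt m ps = concordance_wrt l' ps" "concordance_wrt m ps = concordance_wrt l ps"
  using m l l' by (intro concordance_wrt_parity; blast)+
 thus ?thesis unfolding concordance_def l'_def[symmetric] by simp
qed

section \<open>Turns and order of points on the circle\<close>

lemma cross_cis: "cross (r *\<^sub>R cis s) (q *\<^sub>R cis t) = r * q * sin (t - s)"
 by (simp add: cross_def sin_diff algebra_simps)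

lemma cis_diff: "cis b - cis a = (2 * sin ((b - a) / 2)) *\<^sub>R cis ((a + b) / 2 + pi / 2)"
proof (rule complex_eqI)
 have "sin ((a - b) / 2) = - sin ((b - a) / 2)"
  by (metis minus_diff_eq minus_divide_left sin_minus)
 thus "Re (cis b - cis a) = Re ((2 * sin ((b - a) / 2)) *\<^sub>R cis ((a + b) / 2 + pi / 2))"
  using cos_diff_cos[of b a] by (simp add: cos_add add.commute)
 show "Im (cis b - cis a) = Im ((2 * sin ((b - a) / 2)) *\<^sub>R cis ((a + b) / 2 + pi / 2))"
  using sin_diff_sin[of b a] by (simp add: sin_add add.commute)
qed

lemma floor_shift: "\<lfloor>(x + 2 * pi * real_of_int k) / (2 * pi)\<rfloor> = \<lfloor>x / (2 * pi)\<rfloor> + k"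
proof -
 have "(x + 2 * pi * real_of_int k) / (2 * pi) = x / (2 * pi) + real_of_int k"
  by (simp add: field_simps)
 thus ?thesis by simp
qed

text \<open>A left turn by at most \<open>pi\<close> passes the direction \<open>l\<close> exactly
  when the angle, counted in full turns from \<open>Arg l\<close>, passes an integer; in this form
  turns can be summed along a polygon. The angle \<open>pi\<close> is included, where
  \<open>turn_cone\<close> is an open half plane by convention.\<close>

lemma turn_cone_cis:
 assumes r: "r > 0" "r' > 0" and st: "s < t" "t <= s + pi" and l: "l ~= 0"
  and gen: "cross l (r *\<^sub>R cis s) ~= 0" "cross l (r' *\<^sub>R cis t) ~= 0"
 shows "int (of_bool (l : turn_cone (r *\<^sub>R cis s) (r' *\<^sub>R cis t))) =
  \<lfloor>(t - Arg l) / (2 * pi)\<rfloor> - \<lfloor>(s - Arg l) / (2 * pi)\<rfloor>"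
proof -
 \<comment> \<open>With this choice \<open>u\<close> is the first argument of \<open>l\<close> after
   \<open>s\<close>, that is, \<open>s < u\<close> and \<open>u <= s + 2 * pi\<close>.\<close>
 define k where "k = - \<lfloor>(s - Arg l) / (2 * pi)\<rfloor> - 1"
 define u where "u = Arg l - 2 * pi * k"
 define q where "q = norm l"
 have q: "q > 0" using l by (simp add: q_def)
 have lq: "l = q *\<^sub>R cis u"
 proof -
  have "cis u = cis (Arg l)"
   unfolding u_def by (simp add: cis_divide[symmetric] cis_multiple_2pi)
  thus ?thesis using rcis_cmod_Arg[of l] by (simp add: rcis_def scaleR_conv_of_real q_def)
 qed
 have fl: "\<lfloor>(x - Arg l) / (2 * pi)\<rfloor> = \<lfloor>(x - u) / (2 * pi)\<rfloor> - k" for x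
  using floor_shift[of "x - u" "- k"] by (simp add: u_def algebra_simps)
 have su: "\<lfloor>(s - u) / (2 * pi)\<rfloor> = -1" using fl[of s] by (simp add: k_def)
 hence "-1 <= (s - u) / (2 * pi)" "(s - u) / (2 * pi) < 0" by linarith+
 hence su1: "u - s <= 2 * pi" "s < u" by (auto simp: field_simps)
 have sn: "sin (u - s) ~= 0" "sin (t - u) ~= 0"
  using gen r q unfolding lq cross_cis by (auto simp: sin_minus[of "u - s", symmetric] simp del: sin_minus)
   (metis minus_diff_eq neg_equal_0_iff_equal sin_minus)+
 have us: "u - s ~= 2 * pi" "u ~= t" "u - s ~= pi" using sn by auto
 have main: "sin (u - s) > 0 & sin (t - u) > 0 <-> u < t"
 proof (cases "u < t")
  case True
  hence "0 < u - s" "u - s < pi" "0 < t - u" "t - u < pi" using su1 st by auto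
  thus ?thesis using True by (auto intro!: sin_gt_zero)
 next
  case False
  hence "u > t" using us by auto
  show ?thesis
  proof (cases "u - s < pi")
   case True
   hence "0 < u - t" "u - t < pi" using \<open>u > t\<close> st by auto
   hence "sin (u - t) > 0" by (rule sin_gt_zero)
   thus ?thesis using False sin_minus[of "u - t"] by auto
  next
   case F: False
   hence "sin (u - s) < 0" using su1 us by (intro sin_lt_zero) auto
   thus ?thesis using False by auto
  qed
 qed
 have "\<lfloor>(t - u) / (2 * pi)\<rfloor> = (if u < t then 0 else -1)"
 proof (cases "u < t")
  case True
  hence "0 <= (t - u) / (2 * pi)" "(t - u) / (2 * pi) < 1" using su1 st pi_gt_zero by (auto simp: field_simps)
  thus ?thesis using True by (simp add: floor_eq_iff)
 next
  case False
  hence "-1 <= (t - u) / (2 * pi)" "(t - u) / (2 * pi) < 0" using su1 st us pi_gt_zero by (auto simp: field_simps)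
  thus ?thesis using False by (simp add: floor_eq_iff)
 qed
 hence fin: "\<lfloor>(t - Arg l) / (2 * pi)\<rfloor> - \<lfloor>(s - Arg l) / (2 * pi)\<rfloor> = of_bool (u < t)"
  unfolding fl su by auto
 have C: "cross (r *\<^sub>R cis s) (r' *\<^sub>R cis t) = r * r' * sin (t - s)" by (rule cross_cis)
 have cr: "cross (r *\<^sub>R cis s) l = r * q * sin (u - s)" "cross l (r' *\<^sub>R cis t) = q * r' * sin (t - u)"
  unfolding lq cross_cis by simp_all
 have "l : turn_cone (r *\<^sub>R cis s) (r' *\<^sub>R cis t) <-> sin (u - s) > 0 & sin (t - u) > 0"
 proof (cases "t = s + pi")
  case True
  have "r' *\<^sub>R cis t = - ((r' / r) *\<^sub>R (r *\<^sub>R cis s))"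
   using r by (simp add: True cis_mult[symmetric])
  hence ex: "EX c>0. r' *\<^sub>R cis t = - (c *\<^sub>R (r *\<^sub>R cis s))"
   using r by (intro exI[of _ "r' / r"]) auto
  have "sin (t - u) = sin (u - s)" using sin_pi_minus[of "u - s"] by (simp add: True algebra_simps)
  thus ?thesis unfolding turn_cone_cross[OF gen] if_P[OF ex] cr using r q by (simp add: zero_less_mult_iff mult_less_0_iff)
 next
  case False
  hence sp: "sin (t - s) > 0" using st by (intro sin_gt_zero) auto
  hence pos: "cross (r *\<^sub>R cis s) (r' *\<^sub>R cis t) > 0" unfolding C using r by simp
  have no: "~ (EX c>0. r' *\<^sub>R cis t = - (c *\<^sub>R (r *\<^sub>R cis s)))"
  proof
   assume "EX c>0. r' *\<^sub>R cis t = - (c *\<^sub>R (r *\<^sub>R cis s))"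
   then obtain c where c: "r' *\<^sub>R cis t = - (c *\<^sub>R (r *\<^sub>R cis s))" by blast
   show False using pos unfolding c by simp
  qed
  show ?thesis unfolding turn_cone_cross[OF gen] if_not_P[OF no] cr C using r q sp
   by (simp add: zero_less_mult_iff mult_less_0_iff)
 qed
 thus ?thesis unfolding fin using main by simp
qed

text \<open>The directions of the sides of a polygon inscribed in a circle turn monotonically through
  \<open>2 * pi\<close>.\<close>

lemma inscribed_polygon_turns:
 fixes psi :: "nat => real"
 assumes n: "n >= 2" and inc: "!!m. psi m < psi (Suc m)" and per: "!!m. psi (m + n) = psi m + 2 * pi"
  and l: "l ~= 0" and gen: "!!m. cross l (cis (psi (Suc m)) - cis (psi m)) ~= 0"
 shows "turns l (map (%m. cis (psi m)) [s..<s + n + 2]) = 1"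
proof -
 have mono: "psi a <= psi b" if "a <= b" for a b
  using lift_Suc_mono_le[of psi, OF less_imp_le[OF inc] that] .
 define F where "F m = \<lfloor>((psi m + psi (Suc m)) / 2 + pi / 2 - Arg l) / (2 * pi)\<rfloor>" for m
 have dir: "cis (psi (Suc m)) - cis (psi m) = (2 * sin ((psi (Suc m) - psi m) / 2)) *\<^sub>R cis ((psi m + psi (Suc m)) / 2 + pi / 2)" for m
  by (rule cis_diff)
 \<comment> \<open>For \<open>n = 2\<close> this is an equality: the polygon is a chord run back and
   forth, and its turns are by exactly \<open>pi\<close>.\<close>
 have two: "psi (Suc (Suc m)) <= psi m + 2 * pi" for m
  using mono[of "Suc (Suc m)" "m + n"] n per[of m] by simp
 have pos: "2 * sin ((psi (Suc m) - psi m) / 2) > 0" for m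
  using inc[of m] inc[of "Suc m"] two[of m] by (intro mult_pos_pos sin_gt_zero) auto
 have step: "int (of_bool (l : turn_cone (cis (psi (Suc m)) - cis (psi m)) (cis (psi (Suc (Suc m))) - cis (psi (Suc m))))) = F (Suc m) - F m" for m
 proof -
  have 1: "(psi m + psi (Suc m)) / 2 + pi / 2 < (psi (Suc m) + psi (Suc (Suc m))) / 2 + pi / 2"
   using inc[of m] inc[of "Suc m"] by (simp add: field_simps)
  have 2: "(psi (Suc m) + psi (Suc (Suc m))) / 2 + pi / 2 <= (psi m + psi (Suc m)) / 2 + pi / 2 + pi"
   using two[of m] by (simp add: field_simps)
  show ?thesis
   using turn_cone_cis[OF pos pos 1 2 l gen[unfolded dir] gen[unfolded dir]] unfolding F_def dir .
 qed
 have tele: "int (turns l (map (%m. cis (psi m)) [s..<s + k + 2])) = F (s + k) - F s" for k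
 proof (induction k)
  case 0
  thus ?case by (simp add: upt_rec)
 next
  case (Suc k)
  have "[s..<s + Suc k + 2] = [s..<s + k] @ [s + k, Suc (s + k), Suc (Suc (s + k))]"
   by (simp add: numeral_2_eq_2)
  hence 1: "map (%m. cis (psi m)) [s..<s + Suc k + 2] =
    map (%m. cis (psi m)) [s..<s + k] @ cis (psi (s + k)) # cis (psi (Suc (s + k))) # [cis (psi (Suc (Suc (s + k))))]"
   by simp
  have "[s..<s + k + 2] = [s..<s + k] @ [s + k, Suc (s + k)]"
   by (simp add: numeral_2_eq_2)
  hence 2: "map (%m. cis (psi m)) [s..<s + k + 2] =
    map (%m. cis (psi m)) [s..<s + k] @ [cis (psi (s + k)), cis (psi (Suc (s + k)))]"
   by simp
  show ?case
   using Suc step[of "s + k"] unfolding 1 2 turns_append[of l _ _ _ "[cis (psi (Suc (Suc (s + k))))]"]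
   by simp
 qed
 have "F (s + n) = F s + 1"
  using floor_shift[of "(psi s + psi (Suc s)) / 2 + pi / 2 - Arg l" 1] per[of s] per[of "Suc s"]
  unfolding F_def by (simp add: algebra_simps add_divide_distrib)
 thus ?thesis using tele[of n] by simp
qed

definition side :: "complex => real" where
 "side z = - sgn (Re z)"

text \<open>It jumps at the angles where \<open>Re (cis psi) = 0\<close> and so numbers the right
  and left halves of the circle in the order in which they are passed.\<close>

definition half_turn :: "real => int" where
 "half_turn psi = \<lfloor>(psi + pi / 2) / pi\<rfloor>"

lemma half_turn_cis:
 assumes "cos psi ~= 0"
 obtains u where "psi = u + pi * half_turn psi" "- (pi / 2) < u" "u < pi / 2"
  "cos psi = (if even (half_turn psi) then cos u else - cos u)"
  "sin psi = (if even (half_turn psi) then sin u else - sin u)"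
proof -
 define k where "k = half_turn psi"
 define u where "u = psi - pi * k"
 have "real_of_int k <= (psi + pi / 2) / pi" "(psi + pi / 2) / pi < real_of_int k + 1"
  unfolding k_def half_turn_def by linarith+
 hence u: "- (pi / 2) <= u" "u < pi / 2"
  by (auto simp: u_def field_simps)
 have psi: "psi = u + pi * k" by (simp add: u_def)
 have "cos psi = (if even k then cos u else - cos u) & sin psi = (if even k then sin u else - sin u)"
 proof (cases "even k")
  case True
  then obtain j where "k = 2 * j" by blast
  hence "psi = u + 2 * pi * j" using psi by simp
  thus ?thesis using True by (simp add: cos_add sin_add)
 next
  case False
  then obtain j where "k = 2 * j + 1" by (metis oddE)
  hence "psi = (u + pi) + 2 * pi * j" using psi by (simp add: algebra_simps)
  thus ?thesis using False by (simp add: cos_add sin_add)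
 qed
 moreover from this have "u ~= - (pi / 2)" using assms by (auto split: if_splits)
 ultimately show ?thesis using that[of u] u psi unfolding k_def by auto
qed

text \<open>Heights order two points on the same side of the circle, and for points on opposite
  sides the left hand side is zero. What is missing for the order along the circle is a difference
  of a function of each point alone, which cancels in the four-term sums where this is
  applied.\<close>

lemma circle_order:
 assumes ab: "psi < phi" "phi < psi + 2 * pi" and c: "cos psi ~= 0" "cos phi ~= 0"
 shows "(side (cis psi) + side (cis phi)) * sgn (sin psi - sin phi) / 2 = 1 + half_turn psi - half_turn phi"
proof -
 obtain u where u: "psi = u + pi * half_turn psi" "- (pi / 2) < u" "u < pi / 2"
  "cos psi = (if even (half_turn psi) then cos u else - cos u)"
  "sin psi = (if even (half_turn psi) then sin u else - sin u)"
  using half_turn_cis[OF c(1)] by blast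
 obtain v where v: "phi = v + pi * half_turn phi" "- (pi / 2) < v" "v < pi / 2"
  "cos phi = (if even (half_turn phi) then cos v else - cos v)"
  "sin phi = (if even (half_turn phi) then sin v else - sin v)"
  using half_turn_cis[OF c(2)] by blast
 define k d where "k = half_turn psi" and "d = half_turn phi - half_turn psi"
 have cu: "cos u > 0" "cos v > 0" using u v by (auto intro: cos_gt_zero_pi)
 have vu: "phi - psi = v - u + pi * d" using u(1) v(1) by (simp add: d_def algebra_simps)
 have b: "\<bar>v - u\<bar> < pi" using u v by linarith
 have "pi * (-1) < pi * d" "pi * d < pi * 3" using vu ab b by linarith+
 hence "real_of_int (-1) < d" "d < real_of_int 3"
  using mult_less_cancel_left_pos[OF pi_gt_zero, of "-1" d] mult_less_cancel_left_pos[OF pi_gt_zero, of d 3] by simp_all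
 hence "-1 < d" "d < 3" unfolding of_int_less_iff by simp_all
 then consider "d = 0" | "d = 1" | "d = 2" by linarith
 thus ?thesis
 proof cases
  case 1
  hence h: "half_turn phi = half_turn psi" by (simp add: d_def)
  have "u < v" using vu ab 1 by simp
  hence "sin u < sin v" using u v by (intro sin_monotone_2pi) auto
  thus ?thesis unfolding side_def cis.sel u(4,5) v(4,5) h using cu by (auto simp: sgn_if)
 next
  case 2
  hence h: "half_turn phi = half_turn psi + 1" by (simp add: d_def)
  show ?thesis unfolding side_def cis.sel u(4,5) v(4,5) h using cu by (auto simp: sgn_if)
 next
  case 3
  hence h: "half_turn phi = half_turn psi + 2" by (simp add: d_def)
  have "v < u" using vu ab 3 by simp
  hence "sin v < sin u" using u v by (intro sin_monotone_2pi) auto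
  thus ?thesis unfolding side_def cis.sel u(4,5) v(4,5) h using cu by (auto simp: sgn_if)
 qed
qed

text \<open>The cut-off to a half plane changes the comparison of arguments only by a difference of
  a function of one direction, and such a difference drops out of cyclic sums.\<close>

lemma half_sgn_Arg2pi:
 assumes "Im a ~= 0" "Im b ~= 0"
 shows "half_sgn a b = sgn (Arg2pi b - Arg2pi a) - (sgn (Im a) - sgn (Im b)) / 2"
proof -
 have cr: "sgn (cross a b) = sgn (sin (Arg2pi b - Arg2pi a))"
 proof -
  have nz: "a ~= 0" "b ~= 0" using assms by auto
  have "cross a b = norm a * norm b * sin (Arg2pi b - Arg2pi a)"
   unfolding cross_def cos_Arg2pi[symmetric] sin_Arg2pi[symmetric]
   by (simp add: sin_diff algebra_simps)
  thus ?thesis using nz by (simp add: sgn_mult)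
 qed
 have half: "0 < Im z ==> 0 < Arg2pi z & Arg2pi z < pi" "Im z < 0 ==> pi < Arg2pi z & Arg2pi z < 2 * pi" for z
  using Arg2pi_lt_pi[of z] Arg2pi_le_pi[of z] Arg2pi_lt_2pi[of z] by auto
 have sgn_sin: "sgn (sin x) = sgn x" if "- pi < x" "x < pi" for x
  using sin_gt_zero[of x] sin_gt_zero[of "-x"] that by (cases x "0::real" rule: linorder_cases) auto
 consider "Im a > 0" "Im b > 0" | "Im a < 0" "Im b < 0" | "Im a > 0" "Im b < 0" | "Im a < 0" "Im b > 0"
  using assms by linarith
 thus ?thesis
 proof cases
  case 1
  thus ?thesis using half(1)[of a] half(1)[of b] by (simp add: half_sgn_def cr sgn_sin)
 next
  case 2
  thus ?thesis using half(2)[of a] half(2)[of b] by (simp add: half_sgn_def cr sgn_sin mult_neg_neg)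
 next
  case 3
  thus ?thesis using half(1)[of a] half(2)[of b] by (simp add: half_sgn_def zero_less_mult_iff)
 next
  case 4
  thus ?thesis using half(2)[of a] half(1)[of b] by (simp add: half_sgn_def zero_less_mult_iff)
 qed
qed

text \<open>The corrections in \<open>half_sgn_Arg2pi\<close> cancel, and the remaining three
  comparisons depend only on the cyclic order of the directions. Hence the rotation
  \<open>om\<close> disappears and the clockwise angles from \<open>r\<close> to \<open>g\<close>
  and to \<open>h\<close> appear.\<close>

lemma half_sgn_cyclic:
 assumes im: "Im (om * r) ~= 0" "Im (om * g) ~= 0" "Im (om * h) ~= 0"
  and ne: "Arg2pi (r / g) ~= Arg2pi (r / h)" "Arg2pi (r / g) ~= 0" "Arg2pi (r / h) ~= 0"
 shows "half_sgn (om * g) (om * h) - half_sgn (om * g) (om * r) - half_sgn (om * r) (om * h) =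
  sgn (Arg2pi (r / g) - Arg2pi (r / h))"
proof -
 let ?A = "%z. Arg2pi (om * z)"
 have nz: "om ~= 0" "om * r ~= 0" "om * g ~= 0" "om * h ~= 0" using im by auto
 have 1: "?A r - ?A x = (if ?A x <= ?A r then Arg2pi (r / x) else Arg2pi (r / x) - 2 * pi)" if "om * x ~= 0" for x
  using Arg2pi_diff[of "om * r" "om * x"] nz that by simp
 note d = 1[OF nz(3)] 1[OF nz(4)]
 note b = Arg2pi_lt_2pi[of "r / g"] Arg2pi_lt_2pi[of "r / h"] Arg2pi_ge_0[of "r / g"] Arg2pi_ge_0[of "r / h"]
 have "sgn (?A h - ?A g) - sgn (?A r - ?A g) - sgn (?A h - ?A r) = sgn (Arg2pi (r / g) - Arg2pi (r / h))"
 proof (cases "?A g <= ?A r"; cases "?A h <= ?A r")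
  assume *: "?A g <= ?A r" "?A h <= ?A r"
  hence "?A r - ?A g = Arg2pi (r / g)" "?A r - ?A h = Arg2pi (r / h)" using d by auto
  thus ?thesis using ne b by (auto simp: sgn_if)
 next
  assume *: "?A g <= ?A r" "~ ?A h <= ?A r"
  hence "?A r - ?A g = Arg2pi (r / g)" "?A r - ?A h = Arg2pi (r / h) - 2 * pi" using d by auto
  thus ?thesis using ne b * Arg2pi_lt_2pi[of "om * h"] Arg2pi_ge_0[of "om * g"] by (auto simp: sgn_if)
 next
  assume *: "~ ?A g <= ?A r" "?A h <= ?A r"
  hence "?A r - ?A g = Arg2pi (r / g) - 2 * pi" "?A r - ?A h = Arg2pi (r / h)" using d by auto
  thus ?thesis using ne b * Arg2pi_lt_2pi[of "om * g"] Arg2pi_ge_0[of "om * h"] by (auto simp: sgn_if)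
 next
  assume *: "~ ?A g <= ?A r" "~ ?A h <= ?A r"
  hence "?A r - ?A g = Arg2pi (r / g) - 2 * pi" "?A r - ?A h = Arg2pi (r / h) - 2 * pi" using d by auto
  thus ?thesis using ne b * by (auto simp: sgn_if)
 qed
 thus ?thesis
  using half_sgn_Arg2pi[OF im(2,3)] half_sgn_Arg2pi[OF im(2,1)] half_sgn_Arg2pi[OF im(1,3)]
  by (simp add: diff_divide_distrib)
qed

section \<open>The bracket of two paths\<close>

locale planar_network =
 fixes n :: nat and N :: network
 assumes net: "network n N"
begin

abbreviation "E \<equiv> edges N"
abbreviation "b \<equiv> bdry N"
abbreviation "Src \<equiv> sources n N"
abbreviation "Snk \<equiv> sinks n N"
abbreviation "V \<equiv> inner N Un b ` {1..n}"

lemma finite_inner: "finite (inner N)"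
 and bdry_norm: "i : {1..n} ==> norm (b i) = 1"
 and bdry_mono: "strict_mono_on {1..n} (%i. Arg2pi (b i / b 1))"
 and inner_ball: "inner N <= ball 0 1"
 and edges_V: "E <= V \<times> V"
 and edge_ne: "(u, v) : E ==> u ~= v"
 and edge_cross: "(u, v) : E ==> (u', v') : E ==> (u, v) ~= (u', v') ==>
  closed_segment u v Int closed_segment u' v' <= {u, v} Int {u', v'}"
 and bdry_source_sink: "i : {1..n} ==> is_source N (b i) | is_sink N (b i)"
 and inner_degree: "v : inner N ==> card (in_edges N v) + card (out_edges N v) = 3"
 and inner_colour: "v : inner N ==> white N v | black N v"
proof -
 note c = net[unfolded network_def]
 show "finite (inner N)" using c by (elim conjE)
 have "ALL i:{1..n}. norm (b i) = 1" using c by (elim conjE)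
 thus "i : {1..n} ==> norm (b i) = 1" by (rule bspec)
 show "strict_mono_on {1..n} (%i. Arg2pi (b i / b 1))" using c by (elim conjE)
 show "inner N <= ball 0 1" using c by (elim conjE)
 show "E <= V \<times> V" using c by (elim conjE)
 have "ALL (u, v):E. u ~= v" using c by (elim conjE)
 thus "(u, v) : E ==> u ~= v" by (auto dest: bspec)
 have X: "ALL (u, v):E. ALL (u', v'):E. (u, v) ~= (u', v') -->
    closed_segment u v Int closed_segment u' v' <= {u, v} Int {u', v'}" using c by (elim conjE)
 show "closed_segment u v Int closed_segment u' v' <= {u, v} Int {u', v'}"
  if "(u, v) : E" "(u', v') : E" "(u, v) ~= (u', v')"
  by (rule mp[OF bspec[OF bspec[OF X that(1), unfolded prod.case] that(2), unfolded prod.case] that(3)])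
 have "ALL i:{1..n}. is_source N (b i) | is_sink N (b i)" using c by (elim conjE)
 thus "i : {1..n} ==> is_source N (b i) | is_sink N (b i)" by (rule bspec)
 have *: "ALL v:inner N. card (in_edges N v) + card (out_edges N v) = 3 & (white N v | black N v)" using c by (elim conjE)
 show "card (in_edges N v) + card (out_edges N v) = 3" if "v : inner N"
  using bspec[OF * that] by (rule conjunct1)
 show "white N v | black N v" if "v : inner N" using bspec[OF * that] by (rule conjunct2)
qed

lemma finite_V: "finite V" using finite_inner by simp

lemma finite_edges: "finite E" using finite_V edges_V by (meson finite_SigmaI finite_subset)

lemma bdry_not_inner: "i : {1..n} ==> b i ~: inner N"
 using bdry_norm inner_ball by force

lemma bdry_inj: "i : {1..n} ==> j : {1..n} ==> b i = b j <-> i = j"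
 using inj_onD[OF strict_mono_on_imp_inj_on[OF bdry_mono], of i j] by auto

lemma V_ball: "v : V ==> norm v <= 1"
 using bdry_norm inner_ball by force

lemma in_edges_iff: "e : in_edges N v <-> e : E & snd e = v"
 and out_edges_iff: "e : out_edges N v <-> e : E & fst e = v"
 by (auto simp: in_edges_def out_edges_def)

lemma source_sink_disjoint: "i : Src ==> j : Snk ==> i ~= j"
 unfolding sources_def sinks_def is_source_def is_sink_def by auto

lemma sinks_eq: "Snk = {1..n} - Src"
 using bdry_source_sink source_sink_disjoint unfolding sources_def sinks_def by blast

lemma bdry_one_edge:
 assumes "i : {1..n}" "e : E" "e' : E" "b i : {fst e, snd e}" "b i : {fst e', snd e'}"
 shows "e = e'"
proof -
 obtain f where f: "in_edges N (b i) Un out_edges N (b i) = {f}"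
  using bdry_source_sink[OF assms(1)] unfolding is_source_def is_sink_def by (auto simp: card_1_singleton_iff)
 have "e : in_edges N (b i) Un out_edges N (b i)" "e' : in_edges N (b i) Un out_edges N (b i)"
  using assms by (auto simp: in_edges_iff out_edges_iff)
 thus ?thesis unfolding f by simp
qed

lemma source_no_in: "i : Src ==> (u, b i) ~: E"
 and sink_no_out: "j : Snk ==> (b j, u) ~: E"
 unfolding sources_def sinks_def is_source_def is_sink_def by (auto simp: in_edges_def out_edges_def)

lemma through_inner:
 assumes "(x, v) : E" "(v, y) : E"
 shows "v : inner N"
proof (rule ccontr)
 assume "v ~: inner N"
 then obtain i where i: "i : {1..n}" "v = b i" using assms edges_V by auto
 thus False using bdry_source_sink[of i] assms
  unfolding is_source_def is_sink_def by (auto simp: in_edges_def out_edges_def)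
qed

text \<open>Two edges leaving a vertex in the same direction would overlap near it, against
  planarity. This makes the clockwise order of the flags at a vertex strict.\<close>

lemma flag_dir_distinct:
 assumes e: "e : E" "e' : E" "e ~= e'" and v: "v : {fst e, snd e}" "v : {fst e', snd e'}" and c: "c > 0"
 shows "flag_dir (v, e') ~= c *\<^sub>R flag_dir (v, e)"
proof
 assume eq: "flag_dir (v, e') = c *\<^sub>R flag_dir (v, e)"
 define z where "z = (if v = fst e then snd e else fst e)"
 define z' where "z' = (if v = fst e' then snd e' else fst e')"
 have z: "closed_segment (fst e) (snd e) = closed_segment v z" "{fst e, snd e} = {v, z}" "v ~= z"
  and z': "closed_segment (fst e') (snd e') = closed_segment v z'" "{fst e', snd e'} = {v, z'}" "v ~= z'"
  using v edge_ne[of "fst e" "snd e"] edge_ne[of "fst e'" "snd e'"] e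
  by (auto simp: z_def z'_def closed_segment_commute)
 have d: "z' - v = c *\<^sub>R (z - v)" using eq by (simp add: flag_dir_def z_def z'_def)
 have sub: "closed_segment v z Int closed_segment v z' <= {v, z} Int {v, z'}"
  using edge_cross[of "fst e" "snd e" "fst e'" "snd e'"] e z z' by (auto simp: prod_eq_iff)
 \<comment> \<open>Half the length of the shorter of the two edges in units of \<open>z - v\<close>,
   so that \<open>w\<close> lies on both.\<close>
 define t where "t = min 1 c / 2"
 have t: "0 < t" "t < 1" "t < c" "t / c < 1" "0 < t / c" using c by (auto simp: t_def min_def field_simps)
 define w where "w = v + t *\<^sub>R (z - v)"
 have "w = (1 - t) *\<^sub>R v + t *\<^sub>R z" by (simp add: w_def algebra_simps)
 hence 1: "w : closed_segment v z" using t unfolding in_segment by (intro exI[of _ t]) auto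
 have "w = v + (t / c) *\<^sub>R (z' - v)" using c by (simp add: w_def d)
 hence "w = (1 - t / c) *\<^sub>R v + (t / c) *\<^sub>R z'" by (simp add: algebra_simps)
 hence 2: "w : closed_segment v z'" using t unfolding in_segment by (intro exI[of _ "t / c"]) auto
 have "w ~= v" using t z by (auto simp: w_def)
 moreover have "w ~= z"
 proof
  assume "w = z"
  moreover have "z - w = (1 - t) *\<^sub>R (z - v)" by (simp add: w_def algebra_simps)
  ultimately show False using t z by simp
 qed
 ultimately show False using sub 1 2 by blast
qed

lemma flag_dir_nz:
 assumes "e : E" "v : {fst e, snd e}"
 shows "flag_dir (v, e) ~= 0"
 using assms edge_ne[of "fst e" "snd e"] by (auto simp: flag_dir_def)

lemma first_flag_edge:
 assumes "v : inner N"
 obtains e where "e : E" "v : {fst e, snd e}" "first_flag N v = (v, e)"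
  "white N v ==> in_edges N v = {e}" "~ white N v ==> out_edges N v = {e}"
proof -
 define e where "e = (if white N v then the_elem (in_edges N v) else the_elem (out_edges N v))"
 have w: "in_edges N v = {e}" if "white N v"
 proof -
  have "card (in_edges N v) = 1" using that unfolding white_def by blast
  then obtain x where "in_edges N v = {x}" by (rule card_1_singletonE)
  thus ?thesis using that by (simp add: e_def)
 qed
 have b: "out_edges N v = {e}" if "~ white N v"
 proof -
  have "card (out_edges N v) = 1" using that inner_colour[OF assms] unfolding black_def by blast
  then obtain x where "out_edges N v = {x}" by (rule card_1_singletonE)
  thus ?thesis using that by (simp add: e_def)
 qed
 have "e : E & v : {fst e, snd e}"
 proof (cases "white N v")
  case True
  hence "e : in_edges N v" using w by simp
  thus ?thesis by (auto simp: in_edges_def)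
 next
  case False
  hence "e : out_edges N v" using b by simp
  thus ?thesis by (auto simp: out_edges_def)
 qed
 moreover have "first_flag N v = (v, e)" by (simp add: first_flag_def e_def)
 ultimately show ?thesis using that[of e] w b by blast
qed

lemma first_flag_ex:
 assumes "v : inner N"
 shows "EX e. e : E & v : {fst e, snd e} & first_flag N v = (v, e)"
 by (rule first_flag_edge[OF assms]) (intro exI conjI)

lemma clockwise_angle_inj:
 assumes v: "v : inner N" and e: "e : E" "v : {fst e, snd e}" and e': "e' : E" "v : {fst e', snd e'}"
  and eq: "clockwise_angle N (v, e) = clockwise_angle N (v, e')"
 shows "e = e'"
proof (rule ccontr)
 assume ne: "e ~= e'"
 obtain f where f: "f : E" "v : {fst f, snd f}" "first_flag N v = (v, f)" using first_flag_ex[OF v] by blast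
 let ?r = "flag_dir (v, f)" and ?g = "flag_dir (v, e)" and ?h = "flag_dir (v, e')"
 have nz: "?r ~= 0" "?g ~= 0" "?h ~= 0"
  using flag_dir_nz[OF f(1,2)] flag_dir_nz[OF e] flag_dir_nz[OF e'] by blast+
 have "Arg2pi (?r / ?g) = Arg2pi (?r / ?h)" using eq by (simp add: clockwise_angle_def f(3))
 moreover have "?r / ?g ~= 0" "?r / ?h ~= 0" using nz by simp_all
 ultimately obtain x where x: "x > 0" "?r / ?g = of_real x * (?r / ?h)"
  using Arg2pi_eq_iff[of "?r / ?g" "?r / ?h"] by blast
 have "?r * ?h = ?r * (of_real x * ?g)" using x(2) nz by (simp add: divide_simps mult_ac)
 hence "?h = x *\<^sub>R ?g" using nz(1) by (simp add: scaleR_conv_of_real)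
 thus False using flag_dir_distinct[OF e(1) e'(1) ne e(2) e'(2) x(1)] by blast
qed

lemma clockwise_angle_first:
 assumes "v : inner N" "first_flag N v = (v, f)"
 shows "clockwise_angle N (v, f) = 0"
proof -
 obtain f' where "f' : E" "v : {fst f', snd f'}" "first_flag N v = (v, f')" using first_flag_ex[OF assms(1)] by blast
 hence "flag_dir (v, f) ~= 0" using assms flag_dir_nz by auto
 thus ?thesis by (simp add: clockwise_angle_def assms Arg2pi_eq_0)
qed

lemma clockwise_angle_pos:
 assumes "v : inner N" "first_flag N v = (v, f)" "e : E" "v : {fst e, snd e}" "e ~= f"
 shows "clockwise_angle N (v, e) > 0"
proof -
 obtain f' where f': "f' : E" "v : {fst f', snd f'}" "first_flag N v = (v, f')" using first_flag_ex[OF assms(1)] by blast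
 hence "clockwise_angle N (v, e) ~= 0"
  using clockwise_angle_first[OF assms(1,2)] clockwise_angle_inj[OF assms(1,3,4), of f] assms(2,5) f' by (metis prod.inject)
 moreover have "clockwise_angle N (v, e) >= 0" by (simp add: clockwise_angle_def Arg2pi_ge_0)
 ultimately show ?thesis by simp
qed

lemma flag_number_values:
 assumes v: "v : inner N" and f: "first_flag N v = (v, f)"
  and g: "g : E" "v : {fst g, snd g}" "g ~= f" and h: "h : E" "v : {fst h, snd h}" "h ~= f" and gh: "g ~= h"
 shows "flag_number N (v, f) = 1"
  "flag_number N (v, g) = (if clockwise_angle N (v, g) < clockwise_angle N (v, h) then 2 else 3)"
proof -
 obtain f' where f': "f' : E" "v : {fst f', snd f'}" "first_flag N v = (v, f')" using first_flag_ex[OF v] by blast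
 hence fE: "f : E" "v : {fst f, snd f}" using f by auto
 define S where "S = in_edges N v Un out_edges N v"
 have S: "S = {e : E. v : {fst e, snd e}}" unfolding S_def by (auto simp: in_edges_def out_edges_def)
 have fin: "finite (in_edges N v)" "finite (out_edges N v)"
  using finite_edges by (auto simp: in_edges_def out_edges_def)
 have "card S <= 3" unfolding S_def using card_Un_le[of "in_edges N v" "out_edges N v"] inner_degree[OF v] by simp
 moreover have "{f, g, h} <= S" using fE g h by (auto simp: S)
 moreover have "card {f, g, h} = 3" using g h gh by auto
 moreover have "finite S" using fin by (simp add: S_def)
 ultimately have Sfgh: "S = {f, g, h}" by (metis card_seteq)
 have fl: "flag_number N (v, e) = 1 + card {e' : {f, g, h}. clockwise_angle N (v, e') < clockwise_angle N (v, e)}" for e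
 proof -
  have "{psi : flags N. fst psi = fst (v, e) & clockwise_angle N psi < clockwise_angle N (v, e)} =
   Pair v ` {e' : S. clockwise_angle N (v, e') < clockwise_angle N (v, e)}"
   unfolding flags_def S by auto
  thus ?thesis unfolding flag_number_def Sfgh by (simp add: card_image inj_on_def)
 qed
 note f0 = clockwise_angle_first[OF v f]
 have gp: "clockwise_angle N (v, g) > 0" "clockwise_angle N (v, h) > 0"
  using clockwise_angle_pos[OF v f] g h by auto
 have ne: "clockwise_angle N (v, g) ~= clockwise_angle N (v, h)"
  using clockwise_angle_inj[OF v g(1,2) h(1,2)] gh by auto
 have "{e' : {f, g, h}. clockwise_angle N (v, e') < clockwise_angle N (v, f)} = {}"
  using f0 gp by auto
 thus "flag_number N (v, f) = 1" unfolding fl by (simp only: card.empty)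
 have "{e' : {f, g, h}. clockwise_angle N (v, e') < clockwise_angle N (v, g)} =
  (if clockwise_angle N (v, g) < clockwise_angle N (v, h) then {f} else {f, h})"
  using f0 gp ne by auto
 thus "flag_number N (v, g) = (if clockwise_angle N (v, g) < clockwise_angle N (v, h) then 2 else 3)"
  unfolding fl using h by (auto simp: card_insert_if)
qed

end

lemma sum_ends:
 fixes f g :: "nat => real"
 assumes "L >= 1"
 shows "(SUM a<L. f a + g a) = f 0 + g (L - 1) + (SUM a=1..<L. f a + g (a - 1))"
 using assms
proof (induction L rule: dec_induct)
 case (step L)
 have "(SUM a=1..<Suc L. f a + g (a - 1)) = (SUM a=1..<L. f a + g (a - 1)) + (f L + g (L - 1))"
  using step.hyps by simp
 thus ?case using step by simp
qed simp

text \<open>\<open>T True\<close> and \<open>T False\<close> stand for the start and the end of an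
  edge of a path. The end of one edge is the start of the next, so a sum over edges and their ends
  becomes a sum over the inner positions of the paths.\<close>

lemma double_sum_ends:
 fixes T :: "bool => bool => nat => nat => real"
 assumes L: "L >= 1" "L' >= 1"
  and v: "!!s c. T True s 0 c = 0" "!!s c. T False s (L - 1) c = 0"
   "!!s c. T s True c 0 = 0" "!!s c. T s False c (L' - 1) = 0"
 shows "(SUM a<L. SUM c<L'. T True True a c + T True False a c + T False True a c + T False False a c) =
  (SUM a=1..<L. SUM c=1..<L'. T True True a c + T True False a (c - 1) + T False True (a - 1) c + T False False (a - 1) (c - 1))"
proof -
 have inner: "(SUM c<L'. T s True a c + T s False a c) = (SUM c=1..<L'. T s True a c + T s False a (c - 1))" for s a
  unfolding sum_ends[OF L(2)] v by simp
 have "(SUM a<L. SUM c<L'. T True True a c + T True False a c + T False True a c + T False False a c) =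
  (SUM a<L. (SUM c<L'. T True True a c + T True False a c) + (SUM c<L'. T False True a c + T False False a c))"
  by (simp add: sum.distrib[symmetric] add.assoc)
 also have "... = (SUM a=1..<L. (SUM c<L'. T True True a c + T True False a c) + (SUM c<L'. T False True (a - 1) c + T False False (a - 1) c))"
  unfolding sum_ends[OF L(1)] v by simp
 also have "... = (SUM a=1..<L. SUM c=1..<L'. T True True a c + T True False a (c - 1) + T False True (a - 1) c + T False False (a - 1) (c - 1))"
  unfolding inner by (simp add: sum.distrib[symmetric] add.assoc)
 finally show ?thesis .
qed

text \<open>At the height of \<open>z\<close> the whole disk lies on one side of \<open>z\<close>. A
  segment in the disk can pass \<open>z\<close> only on that side, and only its direction up or down
  remains to be recorded.\<close>

lemma hsgn_circle:
 assumes z: "norm z = 1" "Re z ~= 0" and uv: "norm u <= 1" "norm v <= 1"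
  and zseg: "z ~: closed_segment u v" and h: "Im u ~= Im z" "Im v ~= Im z" "Im u ~= Im v"
 shows "hsgn u v z = side z * ((sgn (Im v - Im z) - sgn (Im u - Im z)) / 2)"
proof (cases "Im u < Im z & Im z < Im v | Im v < Im z & Im z < Im u")
 case False
 hence "sgn (Im v - Im z) = sgn (Im u - Im z)" using h by (auto simp: sgn_if)
 thus ?thesis unfolding hsgn_def if_not_P[OF False] by simp
next
 case True
 let ?x = "height_x u v (Im z)"
 let ?p = "Complex ?x (Im z)"
 have seg: "?p : closed_segment u v"
 proof (cases "Im u < Im v")
  case True
  thus ?thesis using height_x_in_segment[of u v "Im z"] \<open>Im u < Im z & _ | _\<close> by auto
 next
  case F: False
  have "height_x u v (Im z) = height_x v u (Im z)"
  proof -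
   have s: "slope u v = slope v u" unfolding slope_def
    by (metis minus_diff_eq minus_divide_divide)
   have "Re v = Re u + (Im v - Im u) * slope u v" using slope[OF h(3)] .
   thus ?thesis unfolding height_x_def s[symmetric] by (simp add: algebra_simps)
  qed
  thus ?thesis using height_x_in_segment[of v u "Im z"] F True h
   by (auto simp: closed_segment_commute)
 qed
 have "closed_segment u v <= cball 0 1"
  using uv by (intro closed_segment_subset) auto
 hence "norm ?p <= 1" using seg by auto
 hence "?x\<^sup>2 + (Im z)\<^sup>2 <= 1" by (simp add: cmod_def)
 moreover have "(Re z)\<^sup>2 + (Im z)\<^sup>2 = 1" using z(1) cmod_power2[of z] by simp
 ultimately have sq: "?x\<^sup>2 <= (Re z)\<^sup>2" by simp
 hence ab: "\<bar>?x\<bar> <= \<bar>Re z\<bar>" by (simp add: abs_le_square_iff)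
 have ne: "?x ~= Re z"
 proof
  assume "?x = Re z"
  hence "?p = z" by (simp add: complex_eq_iff)
  thus False using seg zseg by simp
 qed
 have sx: "sgn (?x - Re z) = side z"
  using ab ne z(2) unfolding side_def by (auto simp: sgn_if abs_if split: if_splits)
 have "hsgn u v z = sgn (Im v - Im u) * side z"
  using True unfolding hsgn_def cross_height_x[OF h(3)] sgn_mult sx by simp
 moreover have "(sgn (Im v - Im z) - sgn (Im u - Im z)) / 2 = sgn (Im v - Im u)"
  using True by (auto simp: sgn_if)
 ultimately show ?thesis by simp
qed

context planar_network
begin

text \<open>A rotation after which all vertices have different heights and no boundary vertex is the
  top or the bottom of the circle.\<close>

definition gen_rot :: "complex => bool" where
 "gen_rot om <-> norm om = 1 & (ALL u:V. ALL v:V. Im (om * u) = Im (om * v) --> u = v) &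
  (ALL i:{1..n}. Re (om * b i) ~= 0)"

lemma gen_rot_exists: "EX om. gen_rot om"
proof -
 define S where "S = {u - v | u v. u : V & v : V & u ~= v} Un (%i. \<i> * b i) ` {1..n}"
 have "finite {u - v | u v. u : V & v : V & u ~= v}"
  by (rule finite_subset[of _ "(%(u, v). u - v) ` (V \<times> V)"]) (use finite_V in auto)
 hence "finite S" by (simp add: S_def)
 moreover have "0 ~: S" using bdry_norm by (force simp: S_def)
 ultimately obtain l where l: "l ~= 0" "ALL s:S. cross l s ~= 0" using exists_generic by blast
 define om where "om = (1 / norm l) *\<^sub>R cnj l"
 have im: "Im (om * z) = cross l z / norm l" for z
  by (simp add: om_def cross_def field_simps)
 have re: "Re (om * z) = cross l (\<i> * z) / norm l" for z
  by (simp add: om_def cross_def field_simps)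
 have "norm om = 1" using l by (simp add: om_def)
 moreover have "u = v" if uv: "u : V" "v : V" "Im (om * u) = Im (om * v)" for u v
 proof (rule ccontr)
  assume "u ~= v"
  hence "u - v : S" using uv unfolding S_def by blast
  hence "cross l (u - v) ~= 0" using l by blast
  thus False using uv(3) l unfolding im by (simp add: cross_diff)
 qed
 moreover have "Re (om * b i) ~= 0" if "i : {1..n}" for i
  using that l unfolding re S_def by auto
 ultimately show ?thesis unfolding gen_rot_def by blast
qed

text \<open>The contribution of an internal vertex to the bracket of two paths: paths can only part at a white
  vertex (towards \<open>y\<close> and \<open>y'\<close>) and meet at a black one (coming from \<open>x\<close> and \<open>x'\<close>).\<close>

definition part_sgn :: "complex => complex => complex => real" where
 "part_sgn v y y' = (if white N v then
  sgn (real (flag_number N (v, (v, y'))) - real (flag_number N (v, (v, y)))) else 0)"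

definition meet_sgn :: "complex => complex => complex => real" where
 "meet_sgn v x x' = (if white N v then 0 else
  sgn (real (flag_number N (v, (x', v))) - real (flag_number N (v, (x, v)))))"

lemma white_unique_in: "white N v ==> (x, v) : E ==> (x', v) : E ==> x = x'"
proof -
 assume *: "white N v" "(x, v) : E" "(x', v) : E"
 then obtain e where "in_edges N v = {e}" unfolding white_def by (metis card_1_singletonE)
 moreover have "(x, v) : in_edges N v" "(x', v) : in_edges N v" using * by (auto simp: in_edges_iff)
 ultimately show "x = x'" by auto
qed

lemma black_unique_out: "v : inner N ==> ~ white N v ==> (v, y) : E ==> (v, y') : E ==> y = y'"
proof -
 assume *: "v : inner N" "~ white N v" "(v, y) : E" "(v, y') : E"
 then obtain e where "out_edges N v = {e}" using inner_colour unfolding black_def by (metis card_1_singletonE)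
 moreover have "(v, y) : out_edges N v" "(v, y') : out_edges N v" using * by (auto simp: out_edges_iff)
 ultimately show "y = y'" by auto
qed

lemma white_first: "white N v ==> (x, v) : E ==> first_flag N v = (v, (x, v))"
proof -
 assume *: "white N v" "(x, v) : E"
 then obtain e where e: "in_edges N v = {e}" unfolding white_def by (metis card_1_singletonE)
 moreover have "(x, v) : in_edges N v" using * by (auto simp: in_edges_iff)
 ultimately show ?thesis using * by (simp add: first_flag_def)
qed

lemma black_first: "v : inner N ==> ~ white N v ==> (v, y) : E ==> first_flag N v = (v, (v, y))"
proof -
 assume *: "v : inner N" "~ white N v" "(v, y) : E"
 then obtain e where e: "out_edges N v = {e}" using inner_colour unfolding black_def by (metis card_1_singletonE)
 moreover have "(v, y) : out_edges N v" using * by (auto simp: out_edges_iff)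
 ultimately show ?thesis using * by (simp add: first_flag_def)
qed

lemma flag_number_le:
 assumes v: "v : inner N" and e: "e : E" "v : {fst e, snd e}"
 shows "flag_number N (v, e) : {1, 2, 3}"
proof -
 define S where "S = in_edges N v Un out_edges N v"
 have fin: "finite S" using finite_edges by (auto simp: S_def in_edges_def out_edges_def)
 have "e : S" using e by (auto simp: S_def in_edges_iff out_edges_iff)
 moreover have "card S <= 3" unfolding S_def using card_Un_le[of "in_edges N v" "out_edges N v"] inner_degree[OF v] by simp
 ultimately have c: "card (S - {e}) <= 2" using fin by simp
 have "{psi : flags N. fst psi = fst (v, e) & clockwise_angle N psi < clockwise_angle N (v, e)} <= Pair v ` (S - {e})"
  by (auto simp: flags_def S_def in_edges_iff out_edges_iff)
 hence "card {psi : flags N. fst psi = fst (v, e) & clockwise_angle N psi < clockwise_angle N (v, e)} <= card (Pair v ` (S - {e}))"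
  using fin by (intro card_mono) auto
 also have "... <= card (S - {e})" using fin by (intro card_image_le) auto
 finally show ?thesis using c unfolding flag_number_def by auto
qed

context
 fixes v x y x' y' :: complex
 assumes edges: "(x, v) : E" "(v, y) : E" "(x', v) : E" "(v, y') : E"
begin

lemma v_inner: "v : inner N" using through_inner edges by blast

lemma ne: "x ~= v" "v ~= y" "x' ~= v" "v ~= y'" using edge_ne edges by blast+

text \<open>The origin of the two combinations of constants. At a white vertex both paths enter
  through the flag with number 1; if they part, they leave through the flags 2 and 3, and the
  logarithms of the products of flag coordinates on the two paths have the bracket
  \<open>p 1 3 + p 2 1 + p 2 3\<close> up to sign. At a black vertex the outgoing flag has the
  number 1 and the same holds for the incoming flags. Paths that use the same flags contribute zero
  by skew symmetry.\<close>

lemma flag_local: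
 assumes "skew3 p" "skew3 q" and al: "al = p 2 3 + p 1 3 - p 1 2" and be: "be = q 2 3 + q 1 3 - q 1 2"
 shows "flag_coeff p q N (v, (v, y)) (v, (v, y')) + flag_coeff p q N (v, (v, y)) (v, (x', v)) +
  flag_coeff p q N (v, (x, v)) (v, (v, y')) + flag_coeff p q N (v, (x, v)) (v, (x', v)) =
  al * part_sgn v y y' + be * meet_sgn v x x'"
proof -
 let ?fn = "%e. flag_number N (v, e)"
 have rng: "?fn (v, y) : {1, 2, 3}" "?fn (v, y') : {1, 2, 3}" "?fn (x, v) : {1, 2, 3}" "?fn (x', v) : {1, 2, 3}"
  using flag_number_le[OF v_inner] edges by auto
 have sk: "r i j = - r j i" if "skew3 r" "i : {1, 2, 3}" "j : {1, 2, 3}" for r i j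
  using that unfolding skew3_def by blast
 have sk0: "r i i = 0" if "skew3 r" "i : {1, 2, 3}" for r i using sk[OF that(1,2,2)] by simp
 show ?thesis
 proof (cases "white N v")
  case True
  have xx: "x' = x" using white_unique_in[OF True] edges by blast
  have f: "first_flag N v = (v, (x, v))" using white_first[OF True edges(1)] .
  have fc: "flag_coeff p q N (v, e) (v, e') = p (?fn e) (?fn e')" for e e' using True by (simp add: flag_coeff_def)
  show ?thesis
  proof (cases "y = y'")
   case Y: True
   thus ?thesis using sk[OF assms(1) rng(1) rng(3)] sk0[OF assms(1)] rng True
    unfolding fc xx by (simp add: part_sgn_def meet_sgn_def)
  next
   case False
   have n1: "?fn (x, v) = 1" "?fn (v, y) = (if clockwise_angle N (v, (v, y)) < clockwise_angle N (v, (v, y')) then 2 else 3)"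
    using flag_number_values[OF v_inner f edges(2) _ _ edges(4)] ne False by auto
   have n2: "?fn (v, y') = (if clockwise_angle N (v, (v, y')) < clockwise_angle N (v, (v, y)) then 2 else 3)"
    using flag_number_values[OF v_inner f edges(4) _ _ edges(2)] ne False by auto
   have "clockwise_angle N (v, (v, y)) ~= clockwise_angle N (v, (v, y'))"
    using clockwise_angle_inj[OF v_inner edges(2) _ edges(4)] False by auto
   then consider "?fn (v, y) = 2" "?fn (v, y') = 3" | "?fn (v, y) = 3" "?fn (v, y') = 2"
    using n1 n2 by (cases "clockwise_angle N (v, (v, y))" "clockwise_angle N (v, (v, y'))" rule: linorder_cases) auto
   thus ?thesis
   proof cases
    case 1
    thus ?thesis using sk[OF assms(1), of 2 1] sk0[OF assms(1)] True
     unfolding fc xx n1(1) by (simp add: part_sgn_def meet_sgn_def al)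
   next
    case 2
    thus ?thesis using sk[OF assms(1), of 3 1] sk[OF assms(1), of 3 2] sk0[OF assms(1)] True
     unfolding fc xx n1(1) by (simp add: part_sgn_def meet_sgn_def al)
   qed
  qed
 next
  case False
  have yy: "y' = y" using black_unique_out[OF v_inner False] edges by blast
  have f: "first_flag N v = (v, (v, y))" using black_first[OF v_inner False edges(2)] .
  have fc: "flag_coeff p q N (v, e) (v, e') = q (?fn e) (?fn e')" for e e'
   using False inner_colour[OF v_inner] by (simp add: flag_coeff_def)
  show ?thesis
  proof (cases "x = x'")
   case X: True
   thus ?thesis using sk[OF assms(2) rng(1) rng(3)] sk0[OF assms(2)] rng False
    unfolding fc yy by (simp add: part_sgn_def meet_sgn_def)
  next
   case X: False
   have n1: "?fn (v, y) = 1" "?fn (x, v) = (if clockwise_angle N (v, (x, v)) < clockwise_angle N (v, (x', v)) then 2 else 3)"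
    using flag_number_values[OF v_inner f edges(1) _ _ edges(3)] ne X by auto
   have n2: "?fn (x', v) = (if clockwise_angle N (v, (x', v)) < clockwise_angle N (v, (x, v)) then 2 else 3)"
    using flag_number_values[OF v_inner f edges(3) _ _ edges(1)] ne X by auto
   have "clockwise_angle N (v, (x, v)) ~= clockwise_angle N (v, (x', v))"
    using clockwise_angle_inj[OF v_inner edges(1) _ edges(3)] X by auto
   then consider "?fn (x, v) = 2" "?fn (x', v) = 3" | "?fn (x, v) = 3" "?fn (x', v) = 2"
    using n1 n2 by (cases "clockwise_angle N (v, (x, v))" "clockwise_angle N (v, (x', v))" rule: linorder_cases) auto
   thus ?thesis
   proof cases
    case 1
    thus ?thesis using sk[OF assms(2), of 2 1] sk0[OF assms(2)] False
     unfolding fc yy n1(1) by (simp add: part_sgn_def meet_sgn_def be)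
   next
    case 2
    thus ?thesis using sk[OF assms(2), of 3 1] sk[OF assms(2), of 3 2] sk0[OF assms(2)] False
     unfolding fc yy n1(1) by (simp add: part_sgn_def meet_sgn_def be)
   qed
  qed
 qed
qed

text \<open>Two paths through a vertex of degree three share the flag with number 1, so the four
  terms reduce to the cyclic order of three directions, and this is what the numbering of the flags
  records.\<close>

lemma half_sgn_local:
 assumes om: "gen_rot om"
 shows "half_sgn (om * (y - v)) (om * (y' - v)) - half_sgn (om * (y - v)) (om * (x' - v)) -
  half_sgn (om * (x - v)) (om * (y' - v)) + half_sgn (om * (x - v)) (om * (x' - v)) =
  - (part_sgn v y y' + meet_sgn v x x')"
proof -
 have hs0: "half_sgn z z = 0" and hssw: "half_sgn z w = - half_sgn w z" for z w
  unfolding half_sgn_def using cross_swap[of z w] by (auto simp: sgn_minus mult.commute)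
 have im: "Im (om * (z - v)) ~= 0" if "z : V" "z ~= v" for z
  using om that v_inner unfolding gen_rot_def by (auto simp: algebra_simps)
 have inV: "x : V" "y : V" "x' : V" "y' : V" using edges edges_V by blast+
 have fd: "flag_dir (v, (v, y)) = y - v" "flag_dir (v, (v, y')) = y' - v"
   "flag_dir (v, (x, v)) = x - v" "flag_dir (v, (x', v)) = x' - v"
  using ne by (auto simp: flag_dir_def)
 show ?thesis
 proof (cases "white N v")
  case True
  have xx: "x' = x" using white_unique_in[OF True] edges by blast
  have f: "first_flag N v = (v, (x, v))" using white_first[OF True edges(1)] .
  show ?thesis
  proof (cases "y = y'")
   case Y: True
   thus ?thesis using True hssw[of "om * (x - v)" "om * (y' - v)"] unfolding xx
    by (simp add: hs0 part_sgn_def meet_sgn_def)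
  next
   case False
   have ca: "clockwise_angle N (v, (v, y)) = Arg2pi ((x - v) / (y - v))"
    "clockwise_angle N (v, (v, y')) = Arg2pi ((x - v) / (y' - v))"
    by (simp_all add: clockwise_angle_def f fd)
   have pos: "clockwise_angle N (v, (v, y)) > 0" "clockwise_angle N (v, (v, y')) > 0"
    using clockwise_angle_pos[OF v_inner f edges(2)] clockwise_angle_pos[OF v_inner f edges(4)] ne by auto
   have dist: "clockwise_angle N (v, (v, y)) ~= clockwise_angle N (v, (v, y'))"
    using clockwise_angle_inj[OF v_inner edges(2) _ edges(4)] False by auto
   have n1: "flag_number N (v, (v, y)) = (if clockwise_angle N (v, (v, y)) < clockwise_angle N (v, (v, y')) then 2 else 3)"
    using flag_number_values[OF v_inner f edges(2) _ _ edges(4)] ne False by auto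
   have n2: "flag_number N (v, (v, y')) = (if clockwise_angle N (v, (v, y')) < clockwise_angle N (v, (v, y)) then 2 else 3)"
    using flag_number_values[OF v_inner f edges(4) _ _ edges(2)] ne False by auto
   have "part_sgn v y y' = - sgn (clockwise_angle N (v, (v, y)) - clockwise_angle N (v, (v, y')))"
    unfolding part_sgn_def n1 n2 using True dist by (auto simp: sgn_if)
   moreover have "half_sgn (om * (y - v)) (om * (y' - v)) - half_sgn (om * (y - v)) (om * (x - v)) -
    half_sgn (om * (x - v)) (om * (y' - v)) = sgn (clockwise_angle N (v, (v, y)) - clockwise_angle N (v, (v, y')))"
    unfolding ca
    by (rule half_sgn_cyclic) (use im inV ne pos dist in \<open>auto simp: ca\<close>)
   ultimately show ?thesis unfolding xx using True by (simp add: hs0 meet_sgn_def)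
  qed
 next
  case False
  have yy: "y' = y" using black_unique_out[OF v_inner False] edges by blast
  have f: "first_flag N v = (v, (v, y))" using black_first[OF v_inner False edges(2)] .
  show ?thesis
  proof (cases "x = x'")
   case X: True
   thus ?thesis using False hssw[of "om * (x' - v)" "om * (y - v)"] unfolding yy
    by (simp add: hs0 part_sgn_def meet_sgn_def)
  next
   case X: False
   have ca: "clockwise_angle N (v, (x, v)) = Arg2pi ((y - v) / (x - v))"
    "clockwise_angle N (v, (x', v)) = Arg2pi ((y - v) / (x' - v))"
    by (simp_all add: clockwise_angle_def f fd)
   have pos: "clockwise_angle N (v, (x, v)) > 0" "clockwise_angle N (v, (x', v)) > 0"
    using clockwise_angle_pos[OF v_inner f edges(1)] clockwise_angle_pos[OF v_inner f edges(3)] ne by auto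
   have dist: "clockwise_angle N (v, (x, v)) ~= clockwise_angle N (v, (x', v))"
    using clockwise_angle_inj[OF v_inner edges(1) _ edges(3)] X by auto
   have n1: "flag_number N (v, (x, v)) = (if clockwise_angle N (v, (x, v)) < clockwise_angle N (v, (x', v)) then 2 else 3)"
    using flag_number_values[OF v_inner f edges(1) _ _ edges(3)] ne X by auto
   have n2: "flag_number N (v, (x', v)) = (if clockwise_angle N (v, (x', v)) < clockwise_angle N (v, (x, v)) then 2 else 3)"
    using flag_number_values[OF v_inner f edges(3) _ _ edges(1)] ne X by auto
   have "meet_sgn v x x' = - sgn (clockwise_angle N (v, (x, v)) - clockwise_angle N (v, (x', v)))"
    unfolding meet_sgn_def n1 n2 using False dist by (auto simp: sgn_if)
   moreover have "half_sgn (om * (x - v)) (om * (x' - v)) - half_sgn (om * (x - v)) (om * (y - v)) -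
    half_sgn (om * (y - v)) (om * (x' - v)) = sgn (clockwise_angle N (v, (x, v)) - clockwise_angle N (v, (x', v)))"
    unfolding ca
    by (rule half_sgn_cyclic) (use im inV ne pos dist in \<open>auto simp: ca\<close>)
   ultimately show ?thesis unfolding yy using False by (simp add: hs0 part_sgn_def)
  qed
 qed
qed

end

end

context planar_network
begin

section \<open>Partings and meetings of two boundary paths\<close>

definition bpath :: "nat => nat => complex list => bool" where
 "bpath i j vs <-> i : Src & j : Snk & net_path N (b i) (b j) vs"

lemma bpath_ends: "bpath i j vs ==> vs ! 0 = b i" "bpath i j vs ==> vs ! (length vs - 1) = b j"
 by (auto simp: bpath_def net_path_def hd_conv_nth last_conv_nth)

lemma bpath_idx: "bpath i j vs ==> i : {1..n}" "bpath i j vs ==> j : {1..n}" "bpath i j vs ==> i ~= j"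
 using source_sink_disjoint by (auto simp: bpath_def sources_def sinks_def)

lemma bp_len: assumes "bpath i j vs" shows "length vs >= 2"
proof -
 have "vs ~= []" using assms by (simp add: bpath_def net_path_def)
 moreover have "b i ~= b j" using bpath_idx[OF assms] bdry_inj by blast
 hence "length vs ~= 1" using bpath_ends[OF assms] by auto
 moreover have "length vs ~= 0" using \<open>vs ~= []\<close> by simp
 ultimately show ?thesis by linarith
qed

lemma bp_step: "bpath i j vs ==> Suc a < length vs ==> (vs ! a, vs ! Suc a) : E"
 by (auto simp: bpath_def net_path_def successively_conv_nth)

lemma bpath_inner: "bpath i j vs ==> 0 < a ==> Suc a < length vs ==> vs ! a : inner N"
 using bp_step[of i j vs "a - 1"] bp_step[of i j vs a] through_inner by fastforce

definition step :: "complex list => nat => complex \<times> complex" where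
 "step vs a = (vs ! a, vs ! Suc a)"

definition edge_end :: "bool => complex \<times> complex => complex" where
 "edge_end s e = (if s then fst e else snd e)"

definition at_ends ::
  "(bool => complex \<times> complex => bool => complex \<times> complex => real) => bool => bool =>
   complex \<times> complex => complex \<times> complex => real" where
 "at_ends G s s' e e' = (if edge_end s e = edge_end s' e' then G s e s' e' else 0)"

text \<open>Coincident ends of edges are regrouped by pairs of passages through the same inner
  vertex, where each path has an incoming and an outgoing edge. The lemma is applied to Poisson
  coefficients and to orientations, which is how the two become comparable.\<close>

lemma sum_at_ends:
 assumes vs: "bpath i j vs" and vs': "bpath i' j' vs'"
  and G: "!!m s e s' e'. m : {1..n} ==> e : E ==> e' : E ==> edge_end s e = b m ==> edge_end s' e' = b m ==> G s e s' e' = 0"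
 shows "(SUM a<length vs - 1. SUM c<length vs' - 1.
   at_ends G True True (step vs a) (step vs' c) + at_ends G True False (step vs a) (step vs' c) +
   at_ends G False True (step vs a) (step vs' c) + at_ends G False False (step vs a) (step vs' c)) =
  (SUM a=1..<length vs - 1. SUM c=1..<length vs' - 1. if vs ! a = vs' ! c then
   G True (step vs a) True (step vs' c) + G True (step vs a) False (step vs' (c - 1)) +
   G False (step vs (a - 1)) True (step vs' c) + G False (step vs (a - 1)) False (step vs' (c - 1)) else 0)"
proof -
 define T where "T s s' a c = (if a < length vs - 1 & c < length vs' - 1 then at_ends G s s' (step vs a) (step vs' c) else 0)" for s s' a c
 have E1: "step vs a : E" if "a < length vs - 1" for a
  using bp_step[OF vs, of a] that by (simp add: step_def)
 have E2: "step vs' a : E" if "a < length vs' - 1" for a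
  using bp_step[OF vs', of a] that by (simp add: step_def)
 have L: "length vs - 1 >= 1" "length vs' - 1 >= 1" using bp_len[OF vs] bp_len[OF vs'] by auto
 have ends: "edge_end True (step vs 0) = b i" "edge_end False (step vs (length vs - 1 - 1)) = b j"
  using bpath_ends[OF vs] bp_len[OF vs] by (auto simp: edge_end_def step_def Suc_diff_Suc numeral_2_eq_2)
 have ends': "edge_end True (step vs' 0) = b i'" "edge_end False (step vs' (length vs' - 1 - 1)) = b j'"
  using bpath_ends[OF vs'] bp_len[OF vs'] by (auto simp: edge_end_def step_def Suc_diff_Suc numeral_2_eq_2)
 note idx = bpath_idx[OF vs] bpath_idx[OF vs']
 have "(SUM a<length vs - 1. SUM c<length vs' - 1. T True True a c + T True False a c + T False True a c + T False False a c) =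
  (SUM a=1..<length vs - 1. SUM c=1..<length vs' - 1. T True True a c + T True False a (c - 1) + T False True (a - 1) c + T False False (a - 1) (c - 1))"
 proof (rule double_sum_ends[OF L])
  show "T True s 0 c = 0" for s c
   unfolding T_def at_ends_def using E1[of 0] E2[of c] ends(1) G[OF idx(1), of "step vs 0" "step vs' c" True s] by auto
  show "T False s (length vs - 1 - 1) c = 0" for s c
   unfolding T_def at_ends_def
   using E1[of "length vs - 1 - 1"] E2[of c] ends(2) G[OF idx(2), of "step vs (length vs - 1 - 1)" "step vs' c" False s] by auto
  show "T s True c 0 = 0" for s c
   unfolding T_def at_ends_def using E1[of c] E2[of 0] ends'(1) G[OF idx(4), of "step vs c" "step vs' 0" s True] by auto
  show "T s False c (length vs' - 1 - 1) = 0" for s c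
   unfolding T_def at_ends_def
   using E1[of c] E2[of "length vs' - 1 - 1"] ends'(2) G[OF idx(5), of "step vs c" "step vs' (length vs' - 1 - 1)" s False] by auto
 qed
 moreover have "(SUM a<length vs - 1. SUM c<length vs' - 1.
   at_ends G True True (step vs a) (step vs' c) + at_ends G True False (step vs a) (step vs' c) +
   at_ends G False True (step vs a) (step vs' c) + at_ends G False False (step vs a) (step vs' c)) =
  (SUM a<length vs - 1. SUM c<length vs' - 1. T True True a c + T True False a c + T False True a c + T False False a c)"
  by (intro sum.cong refl) (simp add: T_def)
 moreover have "(SUM a=1..<length vs - 1. SUM c=1..<length vs' - 1.
   T True True a c + T True False a (c - 1) + T False True (a - 1) c + T False False (a - 1) (c - 1)) =
  (SUM a=1..<length vs - 1. SUM c=1..<length vs' - 1. if vs ! a = vs' ! c then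
   G True (step vs a) True (step vs' c) + G True (step vs a) False (step vs' (c - 1)) +
   G False (step vs (a - 1)) True (step vs' c) + G False (step vs (a - 1)) False (step vs' (c - 1)) else 0)"
 proof (intro sum.cong refl)
  fix a c assume a: "a : {1..<length vs - 1}" and c: "c : {1..<length vs' - 1}"
  have "edge_end True (step vs a) = vs ! a" "edge_end False (step vs (a - 1)) = vs ! a"
   "edge_end True (step vs' c) = vs' ! c" "edge_end False (step vs' (c - 1)) = vs' ! c"
   using a c by (auto simp: edge_end_def step_def)
  moreover have "a < length vs - 1" "a - 1 < length vs - 1" "c < length vs' - 1" "c - 1 < length vs' - 1"
   using a c by auto
  ultimately show "T True True a c + T True False a (c - 1) + T False True (a - 1) c + T False False (a - 1) (c - 1) =
   (if vs ! a = vs' ! c then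
   G True (step vs a) True (step vs' c) + G True (step vs a) False (step vs' (c - 1)) +
   G False (step vs (a - 1)) True (step vs' c) + G False (step vs (a - 1)) False (step vs' (c - 1)) else 0)"
   unfolding T_def at_ends_def by (simp only: if_True simp_thms) (simp only: split: if_split, simp)
 qed
 ultimately show ?thesis by (simp only:)
qed

text \<open>The ranges leave out the boundary vertices. A vertex that is passed repeatedly counts
  once for every pair of passages.\<close>

definition part_sum :: "complex list => complex list => real" where
 "part_sum vs vs' = (SUM a=1..<length vs - 1. SUM c=1..<length vs' - 1.
  if vs ! a = vs' ! c then part_sgn (vs ! a) (vs ! Suc a) (vs' ! Suc c) else 0)"

definition meet_sum :: "complex list => complex list => real" where
 "meet_sum vs vs' = (SUM a=1..<length vs - 1. SUM c=1..<length vs' - 1.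
  if vs ! a = vs' ! c then meet_sgn (vs ! a) (vs ! (a - 1)) (vs' ! (c - 1)) else 0)"

text \<open>The bracket of the logarithms of the weights of \<open>e\<close> and \<open>e'\<close>,
  which is a constant.\<close>

definition ecoef :: "(nat => nat => real) => (nat => nat => real) => complex \<times> complex => complex \<times> complex => real" where
 "ecoef p q e e' = (let G = (%s e s' e'. flag_coeff p q N (edge_end s e, e) (edge_end s' e', e')) in
  at_ends G True True e e' + at_ends G True False e e' + at_ends G False True e e' + at_ends G False False e e')"

text \<open>The left side is the bracket of the logarithms of two path weights, so the bracket of
  the weights is their product times this number.\<close>

lemma ecoef_sum:
 assumes vs: "bpath i j vs" and vs': "bpath i' j' vs'"
  and sk: "skew3 p" "skew3 q" and al: "al = p 2 3 + p 1 3 - p 1 2" and be: "be = q 2 3 + q 1 3 - q 1 2"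
 shows "(SUM a<length vs - 1. SUM c<length vs' - 1. ecoef p q (step vs a) (step vs' c)) =
  al * part_sum vs vs' + be * meet_sum vs vs'"
proof -
 define G where "G s e s' e' = flag_coeff p q N (edge_end s e, e) (edge_end s' e', e')" for s e s' e'
 have "(SUM a<length vs - 1. SUM c<length vs' - 1. ecoef p q (step vs a) (step vs' c)) =
  (SUM a<length vs - 1. SUM c<length vs' - 1.
   at_ends G True True (step vs a) (step vs' c) + at_ends G True False (step vs a) (step vs' c) +
   at_ends G False True (step vs a) (step vs' c) + at_ends G False False (step vs a) (step vs' c))"
  unfolding ecoef_def Let_def G_def[abs_def] ..
 also have "... = (SUM a=1..<length vs - 1. SUM c=1..<length vs' - 1. if vs ! a = vs' ! c then
   G True (step vs a) True (step vs' c) + G True (step vs a) False (step vs' (c - 1)) +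
   G False (step vs (a - 1)) True (step vs' c) + G False (step vs (a - 1)) False (step vs' (c - 1)) else 0)"
  by (rule sum_at_ends[OF vs vs']) (auto simp: G_def flag_coeff_def white_def black_def bdry_not_inner)
 also have "... = (SUM a=1..<length vs - 1. SUM c=1..<length vs' - 1. if vs ! a = vs' ! c then
   al * part_sgn (vs ! a) (vs ! Suc a) (vs' ! Suc c) + be * meet_sgn (vs ! a) (vs ! (a - 1)) (vs' ! (c - 1)) else 0)"
 proof (intro sum.cong refl if_cong)
  fix a c assume a: "a : {1..<length vs - 1}" and c: "c : {1..<length vs' - 1}" and eq: "vs ! a = vs' ! c"
  have "(vs ! (a - 1), vs ! a) : E" "(vs ! a, vs ! Suc a) : E" "(vs' ! (c - 1), vs ! a) : E" "(vs ! a, vs' ! Suc c) : E"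
   using a c bp_step[OF vs, of "a - 1"] bp_step[OF vs, of a] bp_step[OF vs', of "c - 1"] bp_step[OF vs', of c]
   by (auto simp: eq)
  from flag_local[OF this sk al be]
  show "G True (step vs a) True (step vs' c) + G True (step vs a) False (step vs' (c - 1)) +
   G False (step vs (a - 1)) True (step vs' c) + G False (step vs (a - 1)) False (step vs' (c - 1)) =
   al * part_sgn (vs ! a) (vs ! Suc a) (vs' ! Suc c) + be * meet_sgn (vs ! a) (vs ! (a - 1)) (vs' ! (c - 1))"
   using a c eq by (simp add: G_def step_def edge_end_def)
 qed
 also have "... = al * part_sum vs vs' + be * meet_sum vs vs'"
  unfolding part_sum_def meet_sum_def sum_distrib_left sum.distrib[symmetric] by (intro sum.cong refl) auto
 finally show ?thesis .
qed

text \<open>The value that \<open>hsgn_circle\<close> gives to \<open>hsgn\<close> for an edge from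
  \<open>u\<close> to \<open>v\<close> and a boundary vertex \<open>z\<close> away from it. It is a
  difference of one function at \<open>v\<close> and at \<open>u\<close>, hence telescopes along a
  path.\<close>

definition pht :: "complex => complex => complex => complex => real" where
 "pht om u v z = side (om * z) * ((sgn (Im (om * v) - Im (om * z)) - sgn (Im (om * u) - Im (om * z))) / 2)"

context
 fixes om assumes om: "gen_rot om"
begin

lemma om_facts: "norm om = 1" "om ~= 0" "u : V ==> v : V ==> Im (om * u) = Im (om * v) ==> u = v"
 "m : {1..n} ==> Re (om * b m) ~= 0"
proof -
 note w = om[unfolded gen_rot_def]
 show "norm om = 1" using w by (rule conjunct1)
 thus "om ~= 0" by (metis norm_zero zero_neq_one)
 show "u = v" if "u : V" "v : V" "Im (om * u) = Im (om * v)"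
  using bspec[OF bspec[OF w[THEN conjunct2, THEN conjunct1] that(1)] that(2)] that(3) by (rule mp)
 show "Re (om * b m) ~= 0" if "m : {1..n}"
  using bspec[OF w[THEN conjunct2, THEN conjunct2] that] .
qed

lemma rotate_segment: "closed_segment (om * u) (om * v) = (*) om ` closed_segment u v"
 by (rule closed_segment_linear_image) (rule bounded_linear.linear, rule bounded_linear_mult_right)

lemma end_sgn_edges:
 assumes e: "(u, v) : E" "(u', v') : E"
 shows "end_sgn (om * u) (om * v) (om * u') (om * v') =
  hsgn (om * u) (om * v) (om * v') - hsgn (om * u) (om * v) (om * u') -
  hsgn (om * u') (om * v') (om * v) + hsgn (om * u') (om * v') (om * u)"
proof (cases "(u, v) = (u', v')")
 case True
 thus ?thesis using edge_ne[OF e(1)] om_facts(2)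
  by (simp add: end_sgn_def hsgn_def half_sgn_def)
next
 case False
 have inV: "u : V" "v : V" "u' : V" "v' : V" using e edges_V by blast+
 show ?thesis
 proof (rule end_sgn_eq)
  show "Im (om * u) ~= Im (om * v)" "Im (om * u') ~= Im (om * v')"
   using om_facts(3)[OF inV(1,2)] om_facts(3)[OF inV(3,4)] edge_ne[OF e(1)] edge_ne[OF e(2)] by blast+
  show "(om * u, om * v) ~= (om * u', om * v')" using False om_facts(2) by auto
  show "z = w" if zw0: "z : {om * u, om * v}" "w : {om * u', om * v'}" "Im z = Im w" for z w
  proof -
   have "z : (*) om ` {u, v}" "w : (*) om ` {u', v'}" using zw0(1,2) by simp_all
   then obtain z0 w0 where zw: "z = om * z0" "z0 : {u, v}" "w = om * w0" "w0 : {u', v'}"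
    by (elim imageE)
   have "z0 : V" "w0 : V" using zw(2,4) inV by (elim insertE emptyE; simp)+
   thus ?thesis using om_facts(3)[of z0 w0] zw0(3) zw(1,3) by simp
  qed
  have inj: "inj ((*) om)" using om_facts(2) by (auto simp: inj_def)
  have "(*) om ` (closed_segment u v Int closed_segment u' v') <= (*) om ` ({u, v} Int {u', v'})"
   using edge_cross[OF e False] by (rule image_mono)
  thus "closed_segment (om * u) (om * v) Int closed_segment (om * u') (om * v') <=
   {om * u, om * v} Int {om * u', om * v'}"
   unfolding rotate_segment image_Int[OF inj] by simp
 qed
qed

text \<open>At an end of the edge \<open>hsgn\<close> vanishes while \<open>pht\<close> may not,
  hence the correction.\<close>

lemma hsgn_bdry:
 assumes e: "(u, v) : E" and m: "m : {1..n}"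
 shows "hsgn (om * u) (om * v) (om * b m) =
  pht om u v (b m) - (if b m : {u, v} then pht om u v (b m) else 0)"
proof (cases "b m : {u, v}")
 case True
 thus ?thesis by (auto simp: hsgn_def)
next
 case False
 have inV: "u : V" "v : V" "b m : V" using e m edges_V by blast+
 have "hsgn (om * u) (om * v) (om * b m) = pht om u v (b m)"
  unfolding pht_def
 proof (rule hsgn_circle)
  show "norm (om * b m) = 1" using om_facts(1) bdry_norm[OF m] by (simp add: norm_mult)
  show "Re (om * b m) ~= 0" using om_facts(4)[OF m] .
  show "norm (om * u) <= 1" "norm (om * v) <= 1" using om_facts(1) V_ball inV by (auto simp: norm_mult)
  show "Im (om * u) ~= Im (om * b m)" "Im (om * v) ~= Im (om * b m)" "Im (om * u) ~= Im (om * v)"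
   using om_facts(3)[OF inV(1,3)] om_facts(3)[OF inV(2,3)] om_facts(3)[OF inV(1,2)] False edge_ne[OF e] by auto
  show "om * b m ~: closed_segment (om * u) (om * v)"
  proof
   assume "om * b m : closed_segment (om * u) (om * v)"
   hence seg: "b m : closed_segment u v" unfolding rotate_segment using om_facts(2) by auto
   hence "b m : open_segment u v" using False by (simp add: open_segment_def)
   moreover have "u ~= v" using edge_ne[OF e] .
   ultimately have "norm (b m) < 1"
    using dist_decreases_open_segment[of "b m" u v 0] V_ball[OF inV(1)] V_ball[OF inV(2)] by auto
   thus False using bdry_norm[OF m] by simp
  qed
 qed
 thus ?thesis using False by simp
qed

lemma pht_sum:
 assumes vs: "bpath i j vs"
 shows "(SUM a<length vs - 1. pht om (vs ! a) (vs ! Suc a) z) = pht om (b i) (b j) z"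
proof -
 define f where "f a = side (om * z) * (sgn (Im (om * vs ! a) - Im (om * z)) / 2)" for a
 have "(SUM a<length vs - 1. pht om (vs ! a) (vs ! Suc a) z) = (SUM a<length vs - 1. f (Suc a) - f a)"
  by (simp only: pht_def f_def diff_divide_distrib right_diff_distrib)
 also have "... = f (length vs - 1) - f 0" by (rule sum_lessThan_telescope)
 finally show ?thesis using bpath_ends[OF vs] by (simp only: f_def pht_def diff_divide_distrib right_diff_distrib)
qed

end

end

lemma unit_cis_Arg2pi: "norm z = 1 ==> z = cis (Arg2pi z)"
 using cos_Arg2pi[of z] sin_Arg2pi[of z] by (intro complex_eqI) auto

lemma sum_diff_swap:
 fixes X Y :: "'a => 'b => real"
 shows "(SUM a:A. SUM c:C. X a c - Y a c) = (SUM a:A. SUM c:C. X a c) - (SUM c:C. SUM a:A. Y a c)"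
 unfolding sum_subtractf sum.swap[of "%c a. Y a c" A C] ..

context planar_network
begin

definition bdry_angle :: "nat => real" where
 "bdry_angle m = Arg2pi (b m / b 1)"

lemma bdry_angle_less: "m < k ==> m : {1..n} ==> k : {1..n} ==> bdry_angle m < bdry_angle k"
 using strict_mono_onD[OF bdry_mono, of m k] by (simp add: bdry_angle_def)

lemma bdry_angle_range: "0 <= bdry_angle m" "bdry_angle m < 2 * pi"
 by (simp_all add: bdry_angle_def Arg2pi_ge_0 Arg2pi_lt_2pi)

lemma rotated_bdry:
 assumes "norm om = 1" "m : {1..n}"
 shows "om * b m = cis (Arg2pi (om * b 1) + bdry_angle m)"
proof -
 have 1: "1 : {1..n}" using assms by auto
 have "norm (om * b 1) = 1" "norm (b m / b 1) = 1"
  using bdry_norm[OF 1] bdry_norm[OF assms(2)] assms(1) by (simp_all add: norm_mult norm_divide)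
 hence "om * b 1 = cis (Arg2pi (om * b 1))" "b m / b 1 = cis (bdry_angle m)"
  unfolding bdry_angle_def by (metis unit_cis_Arg2pi)+
 moreover have "b 1 ~= 0" using bdry_norm[OF 1] by (metis norm_zero zero_neq_one)
 ultimately have "om * b m = cis (Arg2pi (om * b 1)) * cis (bdry_angle m)"
  by (metis mult.assoc nonzero_mult_div_cancel_left times_divide_eq_right)
 thus ?thesis by (simp only: cis_mult)
qed

text \<open>The labels start at \<open>b 1\<close>, whose position after the rotation is arbitrary.
  The function \<open>f\<close> accounts for this and for the halves of the circle that have been
  passed.\<close>

lemma bdry_order:
 assumes om: "gen_rot om"
 obtains f where "!!a c. a : {1..n} ==> c : {1..n} ==>
  (side (om * b a) + side (om * b c)) * sgn (Im (om * b a) - Im (om * b c)) / 2 = isgn a c + f a - f c"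
proof -
 define psi where "psi m = Arg2pi (om * b 1) + bdry_angle m" for m
 define f where "f m = real_of_int (half_turn (psi m))" for m
 define h where "h a c = (side (om * b a) + side (om * b c)) * sgn (Im (om * b a) - Im (om * b c)) / 2" for a c
 have z: "om * b m = cis (psi m)" if "m : {1..n}" for m
  using rotated_bdry[OF _ that, of om] om_facts(1)[OF om] by (simp add: psi_def)
 have lt: "h a c = 1 + f a - f c" if "a < c" "a : {1..n}" "c : {1..n}" for a c
 proof -
  have "psi a < psi c" "psi c < psi a + 2 * pi"
   using bdry_angle_less[OF that] bdry_angle_range[of a] bdry_angle_range[of c] by (auto simp: psi_def)
  moreover have "cos (psi a) ~= 0" "cos (psi c) ~= 0"
   using om_facts(4)[OF om that(2)] om_facts(4)[OF om that(3)] unfolding z[OF that(2)] z[OF that(3)] by simp_all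
  ultimately show ?thesis using circle_order[of "psi a" "psi c"] unfolding h_def f_def z[OF that(2)] z[OF that(3)] by simp
 qed
 have sw: "h a c = - h c a" for a c
 proof -
  have "sgn (Im (om * b a) - Im (om * b c)) = - sgn (Im (om * b c) - Im (om * b a))"
   by (metis minus_diff_eq sgn_minus)
  thus ?thesis unfolding h_def by (simp only: add.commute[of "side (om * b a)"] mult_minus_right minus_divide_left)
 qed
 have "h a c = isgn a c + f a - f c" if "a : {1..n}" "c : {1..n}" for a c
 proof (cases a c rule: linorder_cases)
  case less
  thus ?thesis using lt[OF less that] by (simp add: isgn_def)
 next
  case equal
  thus ?thesis by (simp add: h_def)
 next
  case greater
  thus ?thesis using lt[OF greater that(2,1)] sw[of a c] by (simp add: isgn_def)
 qed
 thus ?thesis using that[of f] unfolding h_def by blast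
qed

text \<open>A path touches the boundary only at its ends, so a source can be met only by the first
  edge of the path, and only if the path starts there.\<close>

lemma correction_source:
 assumes vs: "bpath i j vs" and m: "m : Src"
 shows "(SUM a<length vs - 1. if b m : {vs ! a, vs ! Suc a} then F (vs ! a) (vs ! Suc a) else 0) =
  (if m = i then F (b i) (vs ! 1) else (0::real))"
proof -
 have m1: "m : {1..n}" using m by (simp add: sources_def)
 have "(if b m : {vs ! a, vs ! Suc a} then F (vs ! a) (vs ! Suc a) else 0) =
  (if a = 0 then (if m = i then F (b i) (vs ! 1) else 0) else 0)" if "a < length vs - 1" for a
 proof -
  have e: "(vs ! a, vs ! Suc a) : E" using bp_step[OF vs] that by auto
  have "b m ~= vs ! Suc a" using source_no_in[OF m] e by metis
  moreover have "b m = vs ! a <-> a = 0 & m = i"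
  proof (cases "a = 0")
   case True
   thus ?thesis using bpath_ends(1)[OF vs] bdry_inj[OF m1 bpath_idx(1)[OF vs]] by auto
  next
   case False
   thus ?thesis using bpath_inner[OF vs, of a] that bdry_not_inner[OF m1] by auto
  qed
  ultimately show ?thesis using bpath_ends(1)[OF vs] by auto
 qed
 hence "(SUM a<length vs - 1. if b m : {vs ! a, vs ! Suc a} then F (vs ! a) (vs ! Suc a) else 0) =
  (SUM a<length vs - 1. if a = 0 then (if m = i then F (b i) (vs ! 1) else 0) else 0)"
  by (intro sum.cong) auto
 thus ?thesis using bp_len[OF vs] by (simp add: sum.delta)
qed

lemma correction_sink:
 assumes vs: "bpath i j vs" and m: "m : Snk"
 shows "(SUM a<length vs - 1. if b m : {vs ! a, vs ! Suc a} then F (vs ! a) (vs ! Suc a) else 0) =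
  (if m = j then F (vs ! (length vs - 2)) (b j) else (0::real))"
proof -
 have m1: "m : {1..n}" using m by (simp add: sinks_def)
 have "(if b m : {vs ! a, vs ! Suc a} then F (vs ! a) (vs ! Suc a) else 0) =
  (if a = length vs - 2 then (if m = j then F (vs ! (length vs - 2)) (b j) else 0) else 0)" if "a < length vs - 1" for a
 proof -
  have e: "(vs ! a, vs ! Suc a) : E" using bp_step[OF vs] that by auto
  have "b m ~= vs ! a" using sink_no_out[OF m] e by metis
  moreover have "b m = vs ! Suc a <-> a = length vs - 2 & m = j"
  proof (cases "a = length vs - 2")
   case True
   hence "Suc a = length vs - 1" using that by auto
   thus ?thesis using bpath_ends(2)[OF vs] bdry_inj[OF m1 bpath_idx(2)[OF vs]] True by auto
  next
   case False
   thus ?thesis using bpath_inner[OF vs, of "Suc a"] that bdry_not_inner[OF m1] by auto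
  qed
  moreover have "a = length vs - 2 ==> vs ! Suc a = b j"
   using bpath_ends(2)[OF vs] that by (metis Suc_diff_1 Suc_1 Suc_diff_Suc diff_Suc_1 diff_diff_left le_add_diff_inverse less_nat_zero_code not_gr_zero numeral_2_eq_2 plus_1_eq_Suc zero_less_diff)
  ultimately show ?thesis by auto
 qed
 hence "(SUM a<length vs - 1. if b m : {vs ! a, vs ! Suc a} then F (vs ! a) (vs ! Suc a) else 0) =
  (SUM a<length vs - 1. if a = length vs - 2 then (if m = j then F (vs ! (length vs - 2)) (b j) else 0) else 0)"
  by (intro sum.cong) auto
 moreover have "length vs - 2 < length vs - 1" using bp_len[OF vs] by arith
 ultimately show ?thesis by (simp add: sum.delta)
qed

lemma first_step_unique: "bpath i j vs ==> bpath i j' vs' ==> vs ! 1 = vs' ! 1"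
proof -
 assume a: "bpath i j vs" "bpath i j' vs'"
 have "(b i, vs ! 1) : E" "(b i, vs' ! 1) : E"
  using bp_step[OF a(1), of 0] bp_step[OF a(2), of 0] bp_len[OF a(1)] bp_len[OF a(2)]
   bpath_ends(1)[OF a(1)] bpath_ends(1)[OF a(2)] by auto
 thus ?thesis using bdry_one_edge[OF bpath_idx(1)[OF a(1)], of "(b i, vs ! 1)" "(b i, vs' ! 1)"] by simp
qed

lemma last_step_unique: "bpath i j vs ==> bpath i' j vs' ==> vs ! (length vs - 2) = vs' ! (length vs' - 2)"
proof -
 assume a: "bpath i j vs" "bpath i' j vs'"
 have s: "Suc (length vs - 2) = length vs - 1" "Suc (length vs' - 2) = length vs' - 1"
  using bp_len[OF a(1)] bp_len[OF a(2)] by auto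
 have "(vs ! (length vs - 2), b j) : E" "(vs' ! (length vs' - 2), b j) : E"
  using bp_step[OF a(1), of "length vs - 2"] bp_step[OF a(2), of "length vs' - 2"] bp_len[OF a(1)] bp_len[OF a(2)]
   bpath_ends(2)[OF a(1)] bpath_ends(2)[OF a(2)] unfolding s by auto
 thus ?thesis using bdry_one_edge[OF bpath_idx(2)[OF a(1)], of "(vs ! (length vs - 2), b j)" "(vs' ! (length vs' - 2), b j)"] by simp
qed

text \<open>Up to the factor -1 the local signs at common vertices are the signs
  \<open>end_sgn\<close> of pairs of edges. As edges meet only in common ends, these are differences
  of \<open>hsgn\<close> along one path and along the other. Summation leaves the values at the ends
  of the paths, which are given by the positions of the ends on the circle.\<close>

lemma part_meet_sum:
 assumes vs: "bpath i j vs" and vs': "bpath i' j' vs'"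
 shows "part_sum vs vs' + meet_sum vs vs' = 2 * s_times i j i' j'"
proof -
 obtain om where om: "gen_rot om" using gen_rot_exists by blast
 note om0 = om_facts(2)[OF om]
 define G where "G s e s' e' = (if s = s' then 1 else -1) *
  half_sgn (om * (edge_end (~ s) e - edge_end s e)) (om * (edge_end (~ s') e' - edge_end s' e'))" for s e s' e'
 let ?H = "%u v z. hsgn (om * u) (om * v) (om * z)"
 let ?L = "length vs - 1" and ?L' = "length vs' - 1"
 note idx = bpath_idx[OF vs] bpath_idx[OF vs']
 have src: "i : Src" "i' : Src" "j : Snk" "j' : Snk" using vs vs' by (auto simp: bpath_def)
 have E: "(vs ! a, vs ! Suc a) : E" if "a < ?L" for a using bp_step[OF vs] that by auto
 have E': "(vs' ! a, vs' ! Suc a) : E" if "a < ?L'" for a using bp_step[OF vs'] that by auto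
 have ends: "at_ends G True True e e' + at_ends G True False e e' + at_ends G False True e e' + at_ends G False False e e' =
  end_sgn (om * fst e) (om * snd e) (om * fst e') (om * snd e')" for e e'
  using om0 by (simp add: at_ends_def G_def edge_end_def end_sgn_def right_diff_distrib)
 \<comment> \<open>A boundary vertex has only one edge, so two coincident ends there are the same
   end of the same edge.\<close>
 have van: "G s e s' e' = 0"
  if "m : {1..n}" "e : E" "e' : E" "edge_end s e = b m" "edge_end s' e' = b m" for m s e s' e'
 proof -
  have "e = e'" using that bdry_one_edge[OF that(1-3)] by (auto simp: edge_end_def split: if_splits)
  moreover have "s = s'" using that edge_ne[of "fst e" "snd e"] \<open>e = e'\<close> by (auto simp: edge_end_def split: if_splits)
  ultimately show ?thesis by (simp add: G_def half_sgn_def)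
 qed
 have "(SUM a<?L. SUM c<?L'. at_ends G True True (step vs a) (step vs' c) + at_ends G True False (step vs a) (step vs' c) +
   at_ends G False True (step vs a) (step vs' c) + at_ends G False False (step vs a) (step vs' c)) =
  (SUM a=1..<?L. SUM c=1..<?L'. if vs ! a = vs' ! c then
   G True (step vs a) True (step vs' c) + G True (step vs a) False (step vs' (c - 1)) +
   G False (step vs (a - 1)) True (step vs' c) + G False (step vs (a - 1)) False (step vs' (c - 1)) else 0)"
  by (rule sum_at_ends[OF vs vs']) (rule van)
 hence "(SUM a<?L. SUM c<?L'. end_sgn (om * vs ! a) (om * vs ! Suc a) (om * vs' ! c) (om * vs' ! Suc c)) =
  (SUM a=1..<?L. SUM c=1..<?L'. if vs ! a = vs' ! c then
   G True (step vs a) True (step vs' c) + G True (step vs a) False (step vs' (c - 1)) +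
   G False (step vs (a - 1)) True (step vs' c) + G False (step vs (a - 1)) False (step vs' (c - 1)) else 0)"
  unfolding ends by (simp only: step_def fst_conv snd_conv)
 also have "... = (SUM a=1..<?L. SUM c=1..<?L'. if vs ! a = vs' ! c then
   - (part_sgn (vs ! a) (vs ! Suc a) (vs' ! Suc c) + meet_sgn (vs ! a) (vs ! (a - 1)) (vs' ! (c - 1))) else 0)"
 proof (intro sum.cong refl if_cong)
  fix a c assume a: "a : {1..<?L}" and c: "c : {1..<?L'}" and eq: "vs ! a = vs' ! c"
  have "(vs ! (a - 1), vs ! a) : E" "(vs ! a, vs ! Suc a) : E" "(vs' ! (c - 1), vs ! a) : E" "(vs ! a, vs' ! Suc c) : E"
   using a c E[of "a - 1"] E[of a] E'[of "c - 1"] E'[of c] by (auto simp: eq)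
  from half_sgn_local[OF this om]
  show "G True (step vs a) True (step vs' c) + G True (step vs a) False (step vs' (c - 1)) +
   G False (step vs (a - 1)) True (step vs' c) + G False (step vs (a - 1)) False (step vs' (c - 1)) =
   - (part_sgn (vs ! a) (vs ! Suc a) (vs' ! Suc c) + meet_sgn (vs ! a) (vs ! (a - 1)) (vs' ! (c - 1)))"
   using a c eq by (simp add: G_def step_def edge_end_def)
 qed
 also have "... = - (part_sum vs vs' + meet_sum vs vs')"
  unfolding part_sum_def meet_sum_def sum_negf[symmetric] sum.distrib[symmetric] by (intro sum.cong refl) auto
 finally have 1: "part_sum vs vs' + meet_sum vs vs' =
  - (SUM a<?L. SUM c<?L'. end_sgn (om * vs ! a) (om * vs ! Suc a) (om * vs' ! c) (om * vs' ! Suc c))" by simp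
 have "(SUM a<?L. SUM c<?L'. end_sgn (om * vs ! a) (om * vs ! Suc a) (om * vs' ! c) (om * vs' ! Suc c)) =
  (SUM a<?L. SUM c<?L'. (?H (vs ! a) (vs ! Suc a) (vs' ! Suc c) - ?H (vs ! a) (vs ! Suc a) (vs' ! c)) -
   (?H (vs' ! c) (vs' ! Suc c) (vs ! Suc a) - ?H (vs' ! c) (vs' ! Suc c) (vs ! a)))"
  by (intro sum.cong refl) (simp add: end_sgn_edges[OF om E E'])
 also have "... = (SUM a<?L. SUM c<?L'. ?H (vs ! a) (vs ! Suc a) (vs' ! Suc c) - ?H (vs ! a) (vs ! Suc a) (vs' ! c)) -
   (SUM c<?L'. SUM a<?L. ?H (vs' ! c) (vs' ! Suc c) (vs ! Suc a) - ?H (vs' ! c) (vs' ! Suc c) (vs ! a))"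
  by (rule sum_diff_swap)
 also have "... = (SUM a<?L. ?H (vs ! a) (vs ! Suc a) (b j') - ?H (vs ! a) (vs ! Suc a) (b i')) -
   (SUM c<?L'. ?H (vs' ! c) (vs' ! Suc c) (b j) - ?H (vs' ! c) (vs' ! Suc c) (b i))"
  unfolding sum_lessThan_telescope[of "%c. ?H _ _ (vs' ! c)"] sum_lessThan_telescope[of "%c. ?H _ _ (vs ! c)"]
   bpath_ends[OF vs] bpath_ends[OF vs'] ..
 also have "... = ((SUM a<?L. ?H (vs ! a) (vs ! Suc a) (b j')) - (SUM a<?L. ?H (vs ! a) (vs ! Suc a) (b i'))) -
   ((SUM c<?L'. ?H (vs' ! c) (vs' ! Suc c) (b j)) - (SUM c<?L'. ?H (vs' ! c) (vs' ! Suc c) (b i)))"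
  by (simp add: sum_subtractf)
 finally have 2: "(SUM a<?L. SUM c<?L'. end_sgn (om * vs ! a) (om * vs ! Suc a) (om * vs' ! c) (om * vs' ! Suc c)) =
  ((SUM a<?L. ?H (vs ! a) (vs ! Suc a) (b j')) - (SUM a<?L. ?H (vs ! a) (vs ! Suc a) (b i'))) -
   ((SUM c<?L'. ?H (vs' ! c) (vs' ! Suc c) (b j)) - (SUM c<?L'. ?H (vs' ! c) (vs' ! Suc c) (b i)))" .
 have H: "(SUM a<length ws - 1. ?H (ws ! a) (ws ! Suc a) (b m)) = pht om (b p) (b q) (b m) -
   (SUM a<length ws - 1. if b m : {ws ! a, ws ! Suc a} then pht om (ws ! a) (ws ! Suc a) (b m) else 0)"
  if ws: "bpath p q ws" and m: "m : {1..n}" for ws p q m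
 proof -
  have "(SUM a<length ws - 1. ?H (ws ! a) (ws ! Suc a) (b m)) = (SUM a<length ws - 1. pht om (ws ! a) (ws ! Suc a) (b m) -
   (if b m : {ws ! a, ws ! Suc a} then pht om (ws ! a) (ws ! Suc a) (b m) else 0))"
   using bp_step[OF ws] by (intro sum.cong refl hsgn_bdry[OF om _ m]) auto
  thus ?thesis unfolding sum_subtractf pht_sum[OF om ws] .
 qed
 \<comment> \<open>Paths with a common source have the same first edge, and paths with a common sink
   the same last edge. So the corrections are the same numbers for both paths and cancel in the
   difference.\<close>
 define c1 where "c1 = (if i = i' then pht om (b i) (vs ! 1) (b i) else 0)"
 define c2 where "c2 = (if j = j' then pht om (vs ! (length vs - 2)) (b j) (b j) else 0)"
 have h: "(SUM a<?L. ?H (vs ! a) (vs ! Suc a) (b j')) = pht om (b i) (b j) (b j') - c2"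
  "(SUM a<?L. ?H (vs ! a) (vs ! Suc a) (b i')) = pht om (b i) (b j) (b i') - c1"
  "(SUM a<?L'. ?H (vs' ! a) (vs' ! Suc a) (b j)) = pht om (b i') (b j') (b j) - c2"
  "(SUM a<?L'. ?H (vs' ! a) (vs' ! Suc a) (b i)) = pht om (b i') (b j') (b i) - c1"
  using first_step_unique[of i j vs j' vs'] last_step_unique[of i j vs i' vs'] vs vs'
  unfolding H[OF vs idx(5)] H[OF vs idx(4)] H[OF vs' idx(2)] H[OF vs' idx(1)]
   correction_source[OF vs src(2), of "%u v. pht om u v (b i')"]
   correction_sink[OF vs src(4), of "%u v. pht om u v (b j')"]
   correction_source[OF vs' src(1), of "%u v. pht om u v (b i)"]
   correction_sink[OF vs' src(3), of "%u v. pht om u v (b j)"] c1_def c2_def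
  by auto
 obtain f where f: "!!a c. a : {1..n} ==> c : {1..n} ==>
  (side (om * b a) + side (om * b c)) * sgn (Im (om * b a) - Im (om * b c)) / 2 = isgn a c + f a - f c"
  using bdry_order[OF om] by blast
 define S s where "S a = side (om * b a)" and "s a c = sgn (Im (om * b a) - Im (om * b c))" for a c
 have sw: "s a c = - s c a" for a c unfolding s_def by (metis minus_diff_eq sgn_minus)
 have f': "(S a + S c) * s a c / 2 = isgn a c + f a - f c" if "a : {1..n}" "c : {1..n}" for a c
  using f[OF that] by (simp add: S_def s_def)
 have ph: "pht om (b p) (b q) (b m) = S m * ((s q m - s p m) / 2)" for p q m
  by (simp add: pht_def S_def s_def)
 have "pht om (b i) (b j) (b j') - pht om (b i) (b j) (b i') -
  (pht om (b i') (b j') (b j) - pht om (b i') (b j') (b i)) =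
  (S j + S j') * s j j' / 2 - (S i + S j') * s i j' / 2 - (S j + S i') * s j i' / 2 + (S i + S i') * s i i' / 2"
  unfolding ph sw[of j' j] sw[of i' j] sw[of j' i] sw[of i' i]
  by (simp add: algebra_simps add_divide_distrib diff_divide_distrib)
 \<comment> \<open>Every value of \<open>f\<close> occurs with both signs and cancels.\<close>
 also have "... = isgn j j' - isgn i j' - isgn j i' + isgn i i'"
  unfolding f'[OF idx(2) idx(5)] f'[OF idx(1) idx(5)] f'[OF idx(2) idx(4)] f'[OF idx(1) idx(4)] by simp
 finally have 3: "pht om (b i) (b j) (b j') - pht om (b i) (b j) (b i') -
  (pht om (b i') (b j') (b j) - pht om (b i') (b j') (b i)) =
  isgn j j' - isgn i j' - isgn j i' + isgn i i'" .
 have "s_times i j i' j' = - (isgn j j' - isgn j i' - isgn i j' + isgn i i') / 2"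
  using source_sink_disjoint src by (intro s_times_isgn) auto
 thus ?thesis using 1 2 3 unfolding h by simp
qed

end

section \<open>Signs of paths\<close>

lemma steps_Cons: "steps (x # y # zs) = (y - x) # steps (y # zs)"
 by (simp add: steps_def)

lemma successively_steps:
 assumes "successively R ws" "s : set (steps ws)"
 shows "EX x y. R x y & s = y - x"
 using assms
proof (induction ws rule: induct_list012)
 case (3 x y zs)
 from "3.prems"(2) have "s = y - x | s : set (steps (y # zs))" unfolding steps_Cons by simp
 thus ?case
 proof
  assume "s = y - x"
  thus ?thesis using "3.prems"(1) by auto
 next
  assume "s : set (steps (y # zs))"
  thus ?thesis using "3.prems"(1) by (intro "3.IH"(2)) auto
 qed
qed (auto simp: steps_def)

lemma distinct_successively: "distinct xs ==> successively (~=) xs"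
 by (induction xs rule: induct_list012) auto

lemma upt_split: "i <= j ==> j <= k ==> [i..<k] = [i..<j] @ [j..<k]"
 using upt_add_eq_append[of i j "k - j"] by simp

lemma upt_snoc2: "j < i ==> [j..<i + 1] = [j..<i - 1] @ [i - 1, i]"
 by (cases i) auto

lemma concordance_sign:
 assumes "c = t mod 2"
 shows "(-1) powi (int c - 1) = - ((-1) ^ t :: real)"
proof (cases "even t")
 case True
 hence "c = 0" using assms by simp
 thus ?thesis using True by (simp add: power_int_def)
next
 case False
 hence "c = 1" using assms by presburger
 thus ?thesis using False by simp
qed

context planar_network
begin

definition psig :: "nat => nat => complex list => real" where
 "psig i j vs = (-1) powi (int (concordance (closed_path n N i j vs)) - 1)"

text \<open>All paths to a sink pass its only neighbour \<open>pre\<close>, and all paths from a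
  source pass \<open>post\<close>. Thus the closing arc together with the two adjacent edges depends
  on \<open>i\<close> and \<open>j\<close> only.\<close>

definition pre :: "nat => complex" where "pre j = fst (the_elem (in_edges N (b j)))"
definition post :: "nat => complex" where "post i = snd (the_elem (out_edges N (b i)))"

lemma post: "bpath i j vs ==> vs ! 1 = post i"
proof -
 assume a: "bpath i j vs"
 have e: "(b i, vs ! 1) : E" using bp_step[OF a, of 0] bp_len[OF a] bpath_ends(1)[OF a] by auto
 have "card (out_edges N (b i)) = 1" using a by (auto simp: bpath_def sources_def is_source_def)
 then obtain x where x: "out_edges N (b i) = {x}" by (rule card_1_singletonE)
 have "(b i, vs ! 1) : out_edges N (b i)" using e by (simp add: out_edges_iff)
 thus ?thesis unfolding x post_def by auto
qed

lemma pre: "bpath i j vs ==> vs ! (length vs - 2) = pre j"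
proof -
 assume a: "bpath i j vs"
 have s: "Suc (length vs - 2) = length vs - 1" using bp_len[OF a] by auto
 have e: "(vs ! (length vs - 2), b j) : E"
  using bp_step[OF a, of "length vs - 2"] bp_len[OF a] bpath_ends(2)[OF a] unfolding s by auto
 have "card (in_edges N (b j)) = 1" using a by (auto simp: bpath_def sinks_def is_sink_def)
 then obtain x where x: "in_edges N (b j) = {x}" by (rule card_1_singletonE)
 have "(vs ! (length vs - 2), b j) : in_edges N (b j)" using e by (simp add: in_edges_iff)
 thus ?thesis unfolding x pre_def by auto
qed

definition gen_dir :: "complex => bool" where
 "gen_dir l <-> l ~= 0 & (ALL u:V. ALL v:V. u ~= v --> cross l (v - u) ~= 0)"

lemma gen_dir_exists: "EX l. gen_dir l"
proof -
 define S where "S = (%(u, v). v - u) ` {(u, v) : V \<times> V. u ~= v}"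
 have "finite S" unfolding S_def using finite_V by (intro finite_imageI) (auto intro: finite_subset[of _ "V \<times> V"])
 moreover have "0 ~: S" by (auto simp: S_def)
 ultimately obtain l where l: "l ~= 0" "ALL s:S. cross l s ~= 0" using exists_generic by blast
 have "cross l (v - u) ~= 0" if "u : V" "v : V" "u ~= v" for u v
  using l(2) that by (intro bspec[OF l(2)]) (auto simp: S_def)
 thus ?thesis using l(1) unfolding gen_dir_def by blast
qed

lemma ccw_chain:
 assumes "i : {1..n}" "j : {1..n}" "i ~= j"
 shows "distinct (j # ccw_between n j i @ [i])" "set (j # ccw_between n j i @ [i]) <= {1..n}"
 using assms by (auto simp: ccw_between_def)

text \<open>The turns of the closing arc, including those at \<open>b j\<close> and
  \<open>b i\<close>, where it is joined to the path.\<close>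

definition closing :: "complex => nat => nat => nat" where
 "closing l i j = turns l (pre j # b j # map b (ccw_between n j i) @ [b i, post i])"

lemma bpath_last: "bpath i j vs ==> vs = take (length vs - 2) vs @ [pre j, b j]"
proof -
 assume a: "bpath i j vs"
 note l = bp_len[OF a]
 have "drop (length vs - 2) vs = [vs ! (length vs - 2), vs ! (length vs - 1)]"
  using l by (intro nth_equalityI) (auto simp: less_Suc_eq numeral_2_eq_2 Suc_diff_Suc)
 thus ?thesis using append_take_drop_id[of "length vs - 2" vs] pre[OF a] bpath_ends(2)[OF a] by simp
qed

lemma bpath_first: "bpath i j vs ==> EX ws. vs = b i # post i # ws"
proof -
 assume a: "bpath i j vs"
 obtain x y ws where "vs = x # y # ws" using bp_len[OF a]
  by (metis Suc_le_length_iff numeral_2_eq_2)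
 thus ?thesis using bpath_ends(1)[OF a] post[OF a] by auto
qed

text \<open>Cutting the closed curve at the last edge of the path separates the turns inside the
  path from those of the closing arc.\<close>

lemma psig_turns:
 assumes vs: "bpath i j vs" and l: "gen_dir l"
 shows "psig i j vs = - ((-1) ^ (turns l vs + closing l i j))"
proof -
 let ?R = "%x y. x : V & y : V & x ~= y"
 obtain ws where ws: "vs = b i # post i # ws" using bpath_first[OF vs] by blast
 define ps where "ps = closed_path n N i j vs"
 have ps: "ps = b i # post i # (ws @ map b (ccw_between n j i))" by (simp add: ps_def closed_path_def ws)
 have full: "ps @ [b i, post i] = vs @ map b (ccw_between n j i) @ [b i, post i]"
  by (simp add: ps_def closed_path_def)
 note idx = bpath_idx[OF vs]
 note cc = ccw_chain[OF idx]
 have post: "(b i, post i) : E"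
  using bp_step[OF vs, of 0] bp_len[OF vs] ws by auto
 have s1: "successively ?R vs"
  using vs edges_V edge_ne unfolding bpath_def net_path_def by (auto elim!: successively_mono)
 have "successively (~=) (map b (j # ccw_between n j i @ [i]))"
 proof (rule distinct_successively)
  have "inj_on b {1..n}" using bdry_inj by (intro inj_onI) blast
  thus "distinct (map b (j # ccw_between n j i @ [i]))"
   unfolding distinct_map using cc inj_on_subset by blast
 qed
 moreover have "set (map b (j # ccw_between n j i @ [i])) <= V" using cc(2) by auto
 ultimately have "successively ?R (map b (j # ccw_between n j i @ [i]))"
  by (elim successively_mono) auto
 hence s2: "successively ?R (b j # map b (ccw_between n j i) @ [b i])" by simp
 have "successively ?R (butlast vs @ (b j # map b (ccw_between n j i) @ [b i]) @ [post i])"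
 proof -
  have "vs = butlast vs @ [b j]" using vs bp_len[OF vs] unfolding bpath_def net_path_def by (metis append_butlast_last_id)
  hence "successively ?R (butlast vs @ [b j])" using s1 by simp
  hence B: "successively ?R (butlast vs)" "butlast vs = [] | ?R (last (butlast vs)) (b j)"
   unfolding successively_append_iff by simp_all
  have "?R (b i) (post i)" using post edges_V edge_ne[OF post] by blast
  hence Y: "successively ?R ((b j # map b (ccw_between n j i) @ [b i]) @ [post i])"
   using s2 unfolding successively_append_iff[of ?R "b j # map b (ccw_between n j i) @ [b i]"] by simp
  show ?thesis
   unfolding successively_append_iff[of ?R "butlast vs"] using B Y by simp
 qed
 moreover have "butlast vs @ (b j # map b (ccw_between n j i) @ [b i]) @ [post i] = ps @ [b i, post i]"
 proof -
  have "butlast vs @ [b j] = vs" using vs unfolding bpath_def net_path_def by (metis append_butlast_last_id)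
  thus ?thesis unfolding full by (metis append.assoc append_Cons append_Nil)
 qed
 ultimately have suc: "successively ?R (ps @ [b i, post i])" by (simp only:)
 have segs: "EX x y. ?R x y & s = y - x" if "s : set (segments ps)" for s
  using successively_steps[OF suc, of s] that unfolding closed_steps[OF ps] by auto
 have "concordance ps = concordance_wrt l ps"
 proof (rule concordance_eq)
  show "s ~= 0" if "s : set (segments ps)" for s using segs[OF that] by auto
  show "l ~= 0" using l by (simp add: gen_dir_def)
  show "cross l s ~= 0" if "s : set (segments ps)" for s
   using segs[OF that] l unfolding gen_dir_def by blast
 qed
 also have "... = turns l (ps @ [b i, post i]) mod 2" using concordance_wrt_turns[OF ps] by simp
 also have "turns l (ps @ [b i, post i]) = turns l vs + closing l i j"
 proof -
  have "ps @ [b i, post i] = take (length vs - 2) vs @ pre j # b j # (map b (ccw_between n j i) @ [b i, post i])"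
   unfolding full using bpath_last[OF vs] by (metis append.assoc append_Cons append_Nil)
  hence "turns l (ps @ [b i, post i]) = turns l (take (length vs - 2) vs @ [pre j, b j]) +
    turns l (pre j # b j # (map b (ccw_between n j i) @ [b i, post i]))"
   using turns_append[of l "take (length vs - 2) vs" "pre j" "b j" "map b (ccw_between n j i) @ [b i, post i]"]
   by (simp only:)
  also have "turns l (take (length vs - 2) vs @ [pre j, b j]) = turns l vs"
   by (rule arg_cong[OF bpath_last[OF vs], symmetric])
  finally show ?thesis unfolding closing_def .
 qed
 finally show ?thesis unfolding psig_def ps_def[symmetric] by (rule concordance_sign)
qed

text \<open>The chain is one full round of the boundary that starts and ends with the side from
  \<open>b (i - 1)\<close> to \<open>b i\<close>, so each turn of the polygon is counted
  once.\<close>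

lemma boundary_polygon_turns:
 assumes l: "gen_dir l" and i: "2 <= i" "i <= n"
 shows "turns l (map b [i - 1..<n + 1] @ map b [1..<i + 1]) = 1"
proof -
 \<comment> \<open>The angles of the boundary vertices, continued periodically: \<open>psi k\<close>
   belongs to the vertex with index \<open>k mod n + 1\<close> and grows by \<open>2 * pi\<close> in
   each round.\<close>
 define psi where "psi k = Arg2pi (b 1) + bdry_angle (k mod n + 1) + 2 * pi * real (k div n)" for k
 have n: "n >= 2" using i by simp
 have pt: "cis (psi k) = b (k mod n + 1)" for k
 proof -
  have "cis (psi k) = cis (Arg2pi (1 * b 1) + bdry_angle (k mod n + 1)) * cis (2 * pi * real (k div n))"
   unfolding psi_def cis_mult by simp
  also have "... = b (k mod n + 1)"
   using rotated_bdry[of 1 "k mod n + 1"] n by (simp add: Suc_le_eq cis_multiple_2pi)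
  finally show ?thesis .
 qed
 have nxt: "(Suc k) mod n = (if Suc (k mod n) = n then 0 else Suc (k mod n))"
  "(Suc k) div n = (if Suc (k mod n) = n then Suc (k div n) else k div n)" for k
  by (auto simp: mod_Suc div_Suc)
 have inc: "psi k < psi (Suc k)" for k
 proof (cases "Suc (k mod n) = n")
  case True
  thus ?thesis using bdry_angle_range(2)[of "k mod n + 1"] bdry_angle_range(1)[of 1]
   by (simp add: psi_def nxt algebra_simps)
 next
  case False
  have "k mod n < n" using n by simp
  hence "Suc (k mod n) < n" using False by linarith
  thus ?thesis using bdry_angle_less[of "k mod n + 1" "Suc (k mod n) + 1"] False
   by (simp add: psi_def nxt)
 qed
 have "turns l (map (%k. cis (psi k)) [i - 2..<i - 2 + n + 2]) = 1"
 proof (rule inscribed_polygon_turns[where psi = psi, OF n inc])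
  show "psi (m + n) = psi m + 2 * pi" for m using n by (simp add: psi_def algebra_simps)
  show "l ~= 0" using l by (simp add: gen_dir_def)
  show "cross l (cis (psi (Suc m)) - cis (psi m)) ~= 0" for m
  proof -
   have a: "m mod n + 1 : {1..n}" "Suc m mod n + 1 : {1..n}" using n by (auto simp: Suc_le_eq)
   moreover have "m mod n + 1 ~= Suc m mod n + 1" using n by (simp add: nxt)
   ultimately have "b (m mod n + 1) ~= b (Suc m mod n + 1)" using bdry_inj by blast
   thus ?thesis using l a unfolding gen_dir_def pt by blast
  qed
 qed
 also have "map (%k. cis (psi k)) [i - 2..<i - 2 + n + 2] = map b [i - 1..<n + 1] @ map b [1..<i + 1]"
 proof -
  have i2: "i - 2 <= n" "i - 2 + n + 2 = n + i" using i by auto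
  have "map b [i - 1..<n + 1] = map (%k. b (Suc k)) [i - 2..<n]"
  proof -
   have "[i - 1..<n + 1] = map Suc [i - 2..<n]"
   proof -
    have "Suc (i - 2) = i - 1" using i by auto
    thus ?thesis unfolding map_Suc_upt by (simp del: upt_Suc)
   qed
   thus ?thesis by (simp add: comp_def)
  qed
  also have "... = map (%k. cis (psi k)) [i - 2..<n]" by (simp add: pt)
  finally have 1: "map b [i - 1..<n + 1] = map (%k. cis (psi k)) [i - 2..<n]" .
  have "map b [1..<i + 1] = map (%k. b (Suc k)) [0..<i]"
  proof -
   have "[1..<i + 1] = map Suc [0..<i]" unfolding map_Suc_upt by simp
   thus ?thesis by (simp add: comp_def)
  qed
  also have "... = map (%k. cis (psi (k + n))) [0..<i]" using i by (auto simp: pt)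
  also have "... = map (%k. cis (psi k)) (map (%k. k + n) [0..<i])" by simp
  also have "map (%k. k + n) [0..<i] = [n..<n + i]" by (simp add: map_add_upt add.commute)
  finally have 2: "map b [1..<i + 1] = map (%k. cis (psi k)) [n..<n + i]" .
  have "[i - 2..<n + i] = [i - 2..<n] @ [n..<n + i]" using i2 by (intro upt_split) auto
  thus ?thesis unfolding 1 2 i2(2) by simp
 qed
 finally show ?thesis .
qed

text \<open>If \<open>i < j\<close>, the arc from \<open>b j\<close> to \<open>b i\<close> passes
  the side from \<open>b n\<close> to \<open>b 1\<close>, and cutting there separates the dependence
  on \<open>j\<close> from that on \<open>i\<close>. If \<open>j < i\<close>, it does not pass this
  side; one more round along the boundary makes it do so and costs exactly one turn.\<close>

lemma closing_parity:
 assumes l: "gen_dir l"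
 obtains A B where "!!i j. i : {1..n} ==> j : {1..n} ==> i ~= j ==>
  closing l i j + of_bool (j < i) = A j + (B i :: nat)"
proof
 define A where "A j = turns l (pre j # map b [j..<n + 1] @ [b 1])" for j
 define B where "B i = turns l (b n # map b [1..<i + 1] @ [post i])" for i
 fix i j assume i: "i : {1..n}" and j: "j : {1..n}" and ne: "i ~= j"
 have u1: "map b [j..<n + 1] = map b [j..<n] @ [b n]" using j by simp
 have u2: "map b [1..<i + 1] = b 1 # map b [2..<i + 1]" using i by (subst upt_conv_Cons) (simp_all add: numeral_2_eq_2 del: upt_Suc)
 have U: "turns l (pre j # map b [j..<n + 1] @ map b [1..<i + 1] @ [post i]) = A j + B i"
  using turns_append[of l "pre j # map b [j..<n]" "b n" "b 1" "map b [2..<i + 1] @ [post i]"]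
  unfolding A_def B_def u1 u2 by simp
 show "closing l i j + of_bool (j < i) = A j + B i"
 proof (cases "j < i")
  case False
  hence "i < j" using ne by simp
  hence "b j # map b (ccw_between n j i) @ [b i, post i] = map b [j..<n + 1] @ map b [1..<i + 1] @ [post i]"
  proof -
   have "[j..<n + 1] = j # [j + 1..<n + 1]" using j by (simp add: upt_conv_Cons del: upt_Suc)
   moreover have "[1..<i + 1] = [1..<i] @ [i]" using i by simp
   ultimately show ?thesis using \<open>i < j\<close> by (simp add: ccw_between_def del: upt_Suc)
  qed
  hence "closing l i j = A j + B i" unfolding closing_def using U by (simp only:)
  thus ?thesis using False by simp
 next
  case True
  have i2: "2 <= i" "i <= n" using True i j by auto
  have "b j # map b (ccw_between n j i) @ [b i] = map b [j..<i + 1]"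
   using True by (simp add: ccw_between_def upt_conv_Cons)
  also have "... = map b [j..<i - 1] @ [b (i - 1), b i]"
  proof -
   show ?thesis unfolding upt_snoc2[OF True] by simp
  qed
  finally have ch: "b j # map b (ccw_between n j i) @ [b i] = map b [j..<i - 1] @ [b (i - 1), b i]" .
  hence ch': "b j # map b (ccw_between n j i) @ [b i, post i] = map b [j..<i - 1] @ [b (i - 1), b i, post i]"
   by (metis append.assoc append_Cons append_Nil)
  have D: "closing l i j = turns l ((pre j # map b [j..<i - 1]) @ [b (i - 1), b i]) + turns l [b (i - 1), b i, post i]"
   using turns_append[of l "pre j # map b [j..<i - 1]" "b (i - 1)" "b i" "[post i]"]
   unfolding closing_def ch' by simp
  have e1: "map b [j..<n + 1] = map b [j..<i - 1] @ b (i - 1) # b i # map b [i + 1..<n + 1]"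
  proof -
   have "[j..<n + 1] = [j..<i - 1] @ [i - 1..<n + 1]"
    using True i2 by (intro upt_split) auto
   also have "[i - 1..<n + 1] = (i - 1) # i # [i + 1..<n + 1]"
    using i2 by (simp add: upt_conv_Cons del: upt_Suc)
   finally show ?thesis by simp
  qed
  have e2: "map b [1..<i + 1] = map b [1..<i - 1] @ [b (i - 1), b i]"
  proof -
   have "[1..<i + 1] = [1..<i - 1] @ [i - 1, i]" using i2 by (intro upt_snoc2) auto
   thus ?thesis by simp
  qed
  have "turns l (pre j # map b [j..<n + 1] @ map b [1..<i + 1] @ [post i]) =
   turns l ((pre j # map b [j..<i - 1]) @ [b (i - 1), b i]) +
   turns l (b (i - 1) # b i # map b [i + 1..<n + 1] @ map b [1..<i + 1] @ [post i])"
   unfolding e1 using turns_append[of l "pre j # map b [j..<i - 1]" "b (i - 1)" "b i" "map b [i + 1..<n + 1] @ map b [1..<i + 1] @ [post i]"]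
   by simp
  also have "turns l (b (i - 1) # b i # map b [i + 1..<n + 1] @ map b [1..<i + 1] @ [post i]) =
   turns l (b (i - 1) # b i # map b [i + 1..<n + 1] @ map b [1..<i + 1]) + turns l [b (i - 1), b i, post i]"
   unfolding e2 using turns_append[of l "b (i - 1) # b i # map b [i + 1..<n + 1] @ map b [1..<i - 1]" "b (i - 1)" "b i" "[post i]"]
   by simp
  also have "b (i - 1) # b i # map b [i + 1..<n + 1] @ map b [1..<i + 1] = map b [i - 1..<n + 1] @ map b [1..<i + 1]"
   using i2 by (simp add: upt_conv_Cons del: upt_Suc)
  also have "turns l ... = 1" by (rule boundary_polygon_turns[OF l i2])
  finally show ?thesis using U D True by (simp del: upt_Suc)
 qed
qed

text \<open>The part of the sign of a path that does not split into a factor for the source and a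
  factor for the sink.\<close>

definition osgn :: "nat => nat => real" where
 "osgn i j = (if j < i then -1 else 1)"

text \<open>Factors that depend on a single source or a single sink occur on both sides and cancel.
  What is left are the signs \<open>osgn\<close> of the four pairs.\<close>

lemma psig_swap:
 assumes l: "gen_dir l"
  and p: "bpath i j vs" "bpath i' j' vs'" "bpath i j' ws" "bpath i' j ws'"
  and t: "turns l vs + turns l vs' = turns l ws + turns l ws'"
 shows "psig i j vs * psig i' j' vs' =
  osgn i j * osgn i' j' * osgn i j' * osgn i' j * (psig i j' ws * psig i' j ws')"
proof -
 obtain A B where AB: "!!i j. i : {1..n} ==> j : {1..n} ==> i ~= j ==>
  closing l i j + of_bool (j < i) = A j + (B i :: nat)" using closing_parity[OF l] by blast
 have s: "psig i j vs = - (osgn i j * (-1) ^ (turns l vs + A j + B i))" if "bpath i j vs" for i j vs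
 proof -
  have "(-1::real) ^ closing l i j = osgn i j * (-1) ^ (closing l i j + of_bool (j < i))"
   by (simp add: osgn_def power_add)
  thus ?thesis unfolding psig_turns[OF that l] power_add AB[OF bpath_idx[OF that]]
   by (simp add: power_add)
 qed
 have o: "osgn p q * osgn p q = 1" for p q by (simp add: osgn_def)
 have e: "(-1::real) ^ (turns l vs + A j + B i) * (-1) ^ (turns l vs' + A j' + B i') =
  (-1) ^ (turns l ws + A j' + B i) * (-1) ^ (turns l ws' + A j + B i')"
  unfolding power_add[symmetric] using t by (intro arg_cong[where f = "(^) (-1)"]) simp
 have "psig i j vs * psig i' j' vs' = osgn i j * osgn i' j' *
   ((-1) ^ (turns l vs + A j + B i) * (-1) ^ (turns l vs' + A j' + B i'))"
  unfolding s[OF p(1)] s[OF p(2)] by (simp add: algebra_simps)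
 also have "... = osgn i j * osgn i' j' * ((osgn i j' * osgn i j') * (osgn i' j * osgn i' j)) *
   ((-1) ^ (turns l ws + A j' + B i) * (-1) ^ (turns l ws' + A j + B i'))"
  unfolding e o by simp
 also have "... = osgn i j * osgn i' j' * osgn i j' * osgn i' j * (psig i j' ws * psig i' j ws')"
  unfolding s[OF p(3)] s[OF p(4)] by (simp add: algebra_simps)
 finally show ?thesis .
qed

end

lemma path_edges_append: "path_edges (xs @ v # ys) = path_edges (xs @ [v]) + path_edges (v # ys)"
proof (induction xs)
 case (Cons x xs)
 thus ?case by (cases xs) (auto simp: path_edges_def)
qed (simp add: path_edges_def)

lemma size_path_edges: "size (path_edges vs) = length vs - 1"
 by (simp add: path_edges_def)

lemma length_decomposition:
 assumes "1 <= a" "a < length vs - 1"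
 obtains xs ys where "vs = xs @ vs ! (a - 1) # vs ! a # vs ! Suc a # ys"
  "take a vs = xs @ [vs ! (a - 1)]" "drop a vs = vs ! a # vs ! Suc a # ys"
proof -
 have d: "drop a vs = vs ! a # vs ! Suc a # drop (Suc (Suc a)) vs"
  using assms by (metis Cons_nth_drop_Suc Suc_lessD less_diff_conv Suc_eq_plus1)
 have t: "take a vs = take (a - 1) vs @ [vs ! (a - 1)]"
  using assms take_Suc_conv_app_nth[of "a - 1" vs] by auto
 have "vs = take a vs @ drop a vs" by simp
 hence "vs = take (a - 1) vs @ vs ! (a - 1) # vs ! a # vs ! Suc a # drop (Suc (Suc a)) vs"
  using d t by simp
 thus ?thesis using that d t by blast
qed

lemma sum_count_mset:
 assumes "finite A" "set_mset M <= A"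
 shows "(SUM e:A. real (count M e) * f e) = (\<Sum>e\<in>#M. f e)"
 using assms(2)
proof (induction M)
 case (add x M)
 have "(SUM e:A. real (count (add_mset x M) e) * f e) = (SUM e:A. real (count M e) * f e + (if e = x then f x else 0))"
  by (intro sum.cong refl) (auto simp: algebra_simps)
 thus ?case using add assms(1) by (simp add: sum.distrib)
qed simp

section \<open>Exchanging tails\<close>

context planar_network
begin

definition bpaths :: "nat => nat => nat => complex list set" where
 "bpaths i j l = {vs. bpath i j vs & length vs = Suc l}"

lemma bpath_subset_V: "bpath i j vs ==> set vs <= V"
proof
 fix x assume a: "bpath i j vs" "x : set vs"
 then obtain k where k: "k < length vs" "x = vs ! k" by (auto simp: in_set_conv_nth)
 show "x : V"
 proof (cases "Suc k < length vs")
  case True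
  thus ?thesis using bp_step[OF a(1) True] edges_V k by blast
 next
  case False
  hence "k = length vs - 1" using k by simp
  thus ?thesis using bpath_ends(2)[OF a(1)] bpath_idx(2)[OF a(1)] k by auto
 qed
qed

lemma finite_bpaths: "finite (bpaths i j l)"
 by (rule finite_subset[OF _ finite_lists_length_eq[OF finite_V, of "Suc l"]])
  (use bpath_subset_V in \<open>auto simp: bpaths_def\<close>)

definition bp_pairs :: "nat => nat => nat => nat => nat => (complex list \<times> complex list) set" where
 "bp_pairs i j i' j' m = {(vs, vs'). bpath i j vs & bpath i' j' vs' & length vs + length vs' = m + 2}"

lemma finite_bp_pairs: "finite (bp_pairs i j i' j' m)"
proof (rule finite_subset)
 show "bp_pairs i j i' j' m <= (UN l:{..m}. bpaths i j l) \<times> (UN l:{..m}. bpaths i' j' l)"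
 proof (clarify, intro conjI)
  fix vs vs' assume "(vs, vs') : bp_pairs i j i' j' m"
  hence p: "bpath i j vs" "bpath i' j' vs'" "length vs + length vs' = m + 2" by (auto simp: bp_pairs_def)
  hence "length vs >= 2" "length vs' >= 2" using bp_len by auto
  hence "vs : bpaths i j (length vs - 1)" "vs' : bpaths i' j' (length vs' - 1)" "length vs - 1 <= m" "length vs' - 1 <= m"
   using p by (auto simp: bpaths_def)
  thus "vs : (UN l:{..m}. bpaths i j l)" "vs' : (UN l:{..m}. bpaths i' j' l)" by blast+
 qed
qed (use finite_bpaths in auto)

lemma bp_pairs_alt: "bp_pairs i j i' j' m = {(vs, vs'). bpath i j vs & bpath i' j' vs' &
  length vs + length vs' = m + 2 & 2 <= length vs & 2 <= length vs'}"
 unfolding bp_pairs_def using bp_len by blast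

lemma bpaths_alt: "bpaths i j l = {vs. bpath i j vs & length vs = Suc l & 2 <= length vs}"
 unfolding bpaths_def using bp_len by blast

definition pwt :: "weights => complex list => real" where
 "pwt w vs = (\<Prod>e\<in>#path_edges vs. w e)"

text \<open>The power series in \<open>t\<close> obtained from a series in the edge weights by scaling the weights \<open>w\<close>
 by \<open>t\<close>.\<close>

definition pser :: "weights => (complex list => real) => nat => nat => real fps" where
 "pser w g i j = Abs_fps (%l. SUM vs:bpaths i j l. g vs * (psig i j vs * pwt w vs))"

text \<open>The coefficient at \<open>t^m\<close> in a product of two boundary measurements, where
  each pair of paths is weighted by \<open>G\<close>. The lists of vertices of two paths with
  \<open>m\<close> edges together have \<open>m + 2\<close> entries.\<close>

definition pair_sum :: "weights => (complex list => complex list => real) => nat => nat => nat => nat => nat => real" where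
 "pair_sum w G i j i' j' m = (SUM (vs, vs'):bp_pairs i j i' j' m.
  G vs vs' * (psig i j vs * psig i' j' vs' * (pwt w vs * pwt w vs')))"

lemma pser_mult:
 "fps_nth (pser w g i j * pser w h i' j') m = pair_sum w (%vs vs'. g vs * h vs') i j i' j' m"
proof -
 let ?f = "%vs. g vs * (psig i j vs * pwt w vs)" and ?f' = "%vs. h vs * (psig i' j' vs * pwt w vs)"
 have "fps_nth (pser w g i j * pser w h i' j') m =
  (SUM l=0..m. SUM (vs, vs'):bpaths i j l \<times> bpaths i' j' (m - l). ?f vs * ?f' vs')"
  unfolding fps_mult_nth pser_def by (simp add: sum_product sum.cartesian_product)
 also have "... = (SUM (l, vs, vs'):Sigma {0..m} (%l. bpaths i j l \<times> bpaths i' j' (m - l)). ?f vs * ?f' vs')"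
  using finite_bpaths by (subst sum.Sigma) (auto simp: case_prod_unfold)
 also have "... = (SUM (vs, vs'):bp_pairs i j i' j' m. ?f vs * ?f' vs')"
  by (rule sum.reindex_bij_witness[where i = "%(vs, vs'). (length vs - 1, vs, vs')" and j = "%(l, vs, vs'). (vs, vs')"])
   (auto simp: bpaths_alt bp_pairs_alt)
 finally show ?thesis unfolding pair_sum_def by (simp add: case_prod_unfold mult_ac)
qed

lemma zip_tl_steps: "zip vs (tl vs) = map (step vs) [0..<length vs - 1]"
 by (rule nth_equalityI) (auto simp: step_def nth_tl)

lemma sum_count_steps:
 assumes "bpath i j vs"
 shows "(SUM e:E. real (count (path_edges vs) e) * f e) = (SUM a<length vs - 1. f (step vs a))"
proof -
 have sub: "set_mset (path_edges vs) <= E"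
  using bp_step[OF assms] by (auto simp: path_edges_def zip_tl_steps step_def)
 have "(SUM a<length vs - 1. f (step vs a)) = (\<Sum>e\<in>#path_edges vs. f e)"
  unfolding path_edges_def zip_tl_steps by (simp add: sum_mset_sum_list interv_sum_list_conv_sum_set_nat atLeast0LessThan comp_def flip: mset_map)
 thus ?thesis using sum_count_mset[OF finite_edges sub, of f] by simp
qed

text \<open>A pair of passages through the same vertex is marked, so that the exchange of tails is a
  bijection even if the paths meet many times.\<close>

definition crossings :: "nat => nat => nat => nat => nat => (complex list \<times> complex list \<times> nat \<times> nat) set" where
 "crossings i j i' j' m = {(vs, vs', a, c). (vs, vs') : bp_pairs i j i' j' m &
  a : {1..<length vs - 1} & c : {1..<length vs' - 1} & vs ! a = vs' ! c}"

lemma crossing_sum: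
 "pair_sum w (%vs vs'. SUM a=1..<length vs - 1. SUM c=1..<length vs' - 1. if vs ! a = vs' ! c then H vs vs' a c else 0) i j i' j' m =
 (SUM (vs, vs', a, c):crossings i j i' j' m.
  H vs vs' a c * (psig i j vs * psig i' j' vs' * (pwt w vs * pwt w vs')))"
proof -
 let ?F = "%vs vs'. psig i j vs * psig i' j' vs' * (pwt w vs * pwt w vs')"
 let ?I = "%vs vs'. {(a, c) : {1..<length vs - 1} \<times> {1..<length vs' - 1}. vs ! a = vs' ! c}"
 have "(SUM a=1..<length vs - 1. SUM c=1..<length vs' - 1. if vs ! a = vs' ! c then H vs vs' a c else 0) * ?F vs vs' =
  (SUM (a, c):?I vs vs'. H vs vs' a c * ?F vs vs')" for vs vs'
 proof -
  have "(SUM a=1..<length vs - 1. SUM c=1..<length vs' - 1. if vs ! a = vs' ! c then H vs vs' a c else 0) =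
   (SUM x:{1..<length vs - 1} \<times> {1..<length vs' - 1}. if vs ! fst x = vs' ! snd x then H vs vs' (fst x) (snd x) else 0)"
   by (simp add: sum.cartesian_product case_prod_unfold)
  also have "... = (SUM x:?I vs vs'. H vs vs' (fst x) (snd x))"
   by (rule sum.mono_neutral_cong_right) auto
  finally show ?thesis by (simp add: sum_distrib_right case_prod_unfold)
 qed
 hence "pair_sum w (%vs vs'. SUM a=1..<length vs - 1. SUM c=1..<length vs' - 1. if vs ! a = vs' ! c then H vs vs' a c else 0) i j i' j' m =
  (SUM x:bp_pairs i j i' j' m. SUM y:?I (fst x) (snd x). H (fst x) (snd x) (fst y) (snd y) * ?F (fst x) (snd x))"
  unfolding pair_sum_def by (simp add: case_prod_unfold)
 also have "... = (SUM (x, y):Sigma (bp_pairs i j i' j' m) (%x. ?I (fst x) (snd x)).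
   H (fst x) (snd x) (fst y) (snd y) * ?F (fst x) (snd x))"
 proof (rule sum.Sigma)
  show "finite (bp_pairs i j i' j' m)" by (rule finite_bp_pairs)
  show "ALL x:bp_pairs i j i' j' m. finite (?I (fst x) (snd x))"
  proof
   fix x show "finite (?I (fst x) (snd x))"
    by (rule finite_subset[of _ "{1..<length (fst x) - 1} \<times> {1..<length (snd x) - 1}"]) auto
  qed
 qed
 also have "... = (SUM (vs, vs', a, c):crossings i j i' j' m. H vs vs' a c * ?F vs vs')"
  by (rule sum.reindex_bij_witness[where i = "%(vs, vs', a, c). ((vs, vs'), (a, c))" and j = "%((vs, vs'), (a, c)). (vs, vs', a, c)"])
   (auto simp: crossings_def)
 finally show ?thesis .
qed

definition tail_swap :: "complex list \<times> complex list \<times> nat \<times> nat => complex list \<times> complex list \<times> nat \<times> nat" where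
 "tail_swap = (%(vs, vs', a, c). (take a vs @ drop c vs', take c vs' @ drop a vs, a, c))"

definition swsgn :: "nat => nat => nat => nat => real" where
 "swsgn i j i' j' = osgn i j * osgn i' j' * osgn i j' * osgn i' j"

text \<open>The edges of both paths together stay the same, and so does the product of the weights.
  Turns away from the marked vertex are also kept. At that vertex the two turns are merely traded
  between the paths if these share the incoming or the outgoing edge, which is the condition for the
  sign rule.\<close>

lemma tail_swap_props:
 assumes x: "(vs, vs', a, c) : crossings i j i' j' m"
 defines "ws \<equiv> take a vs @ drop c vs'" and "ws' \<equiv> take c vs' @ drop a vs"
 shows "(ws, ws', a, c) : crossings i j' i' j m" "take a ws @ drop c ws' = vs" "take c ws' @ drop a ws = vs'"
  "ws ! a = vs ! a" "ws ! (a - 1) = vs ! (a - 1)" "ws' ! (c - 1) = vs' ! (c - 1)" "ws ! Suc a = vs' ! Suc c" "ws' ! Suc c = vs ! Suc a"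
  "pwt w ws * pwt w ws' = pwt w vs * pwt w vs'"
  "vs ! (a - 1) = vs' ! (c - 1) | vs ! Suc a = vs' ! Suc c ==>
   psig i j vs * psig i' j' vs' = swsgn i j i' j' * (psig i j' ws * psig i' j ws')"
proof -
 have p: "bpath i j vs" "bpath i' j' vs'" and len: "length vs + length vs' = m + 2"
  and a: "1 <= a" "a < length vs - 1" and c: "1 <= c" "c < length vs' - 1" and eq: "vs ! a = vs' ! c"
  using x by (auto simp: crossings_def bp_pairs_def)
 obtain xs ys where d: "vs = xs @ vs ! (a - 1) # vs ! a # vs ! Suc a # ys"
  "take a vs = xs @ [vs ! (a - 1)]" "drop a vs = vs ! a # vs ! Suc a # ys"
  using length_decomposition[OF a] by blast
 obtain xs' ys' where d': "vs' = xs' @ vs' ! (c - 1) # vs' ! c # vs' ! Suc c # ys'"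
  "take c vs' = xs' @ [vs' ! (c - 1)]" "drop c vs' = vs' ! c # vs' ! Suc c # ys'"
  using length_decomposition[OF c] by blast
 define v x y x' y' where "v = vs ! a" and "x = vs ! (a - 1)" and "y = vs ! Suc a" and "x' = vs' ! (c - 1)" and "y' = vs' ! Suc c"
 have v': "vs' ! c = v" using eq by (simp add: v_def)
 note D = d[folded v_def x_def y_def] and D' = d'[unfolded v', folded x'_def y'_def]
 have W: "ws = xs @ x # v # y' # ys'" "ws' = xs' @ x' # v # y # ys" by (simp_all add: ws_def ws'_def D(2,3) D'(2,3))
 have la: "length (take a vs) = a" "length (take c vs') = c" using a c by auto
 have succ: "successively (%x y. (x, y) : E) vs" "successively (%x y. (x, y) : E) vs'"
  and hl: "hd vs = b i" "last vs = b j" "hd vs' = b i'" "last vs' = b j'" and io: "i : Src" "i' : Src" "j : Snk" "j' : Snk"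
  using p by (auto simp: bpath_def net_path_def)
 have "successively (%x y. (x, y) : E) (xs @ x # v # y # ys)" "successively (%x y. (x, y) : E) (xs' @ x' # v # y' # ys')"
  using succ by (simp_all only: D(1)[symmetric] D'(1)[symmetric])
 hence s1: "successively (%x y. (x, y) : E) ws" and s2: "successively (%x y. (x, y) : E) ws'"
  unfolding W by (auto simp: successively_append_iff)
 have h1: "hd ws = b i" "last ws = b j'" "hd ws' = b i'" "last ws' = b j"
 proof -
  have "hd vs = hd (xs @ [x])" "hd vs' = hd (xs' @ [x'])" "last vs = last (v # y # ys)" "last vs' = last (v # y' # ys')"
   by (subst D(1), simp add: hd_append, subst D'(1), simp add: hd_append, subst D(1), simp, subst D'(1), simp)
  thus "hd ws = b i" "last ws = b j'" "hd ws' = b i'" "last ws' = b j" using hl by (simp_all add: W hd_append)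
 qed
 have bp: "bpath i j' ws" "bpath i' j ws'"
  using s1 s2 h1 io by (auto simp: bpath_def net_path_def W)
 have lens: "length ws = a + (length vs' - c)" "length ws' = c + (length vs - a)"
  using a c by (auto simp: ws_def ws'_def)
 show w1: "take a ws @ drop c ws' = vs" "take c ws' @ drop a ws = vs'"
  using la by (auto simp: ws_def ws'_def)
 show wa: "ws ! a = vs ! a" using la eq D'(3) by (auto simp: ws_def nth_append v_def)
 have wc: "ws' ! c = vs' ! c" using la eq D(3) by (auto simp: ws'_def nth_append v_def v')
 show "ws ! (a - 1) = vs ! (a - 1)" using la a by (auto simp: ws_def nth_append)
 show "ws' ! (c - 1) = vs' ! (c - 1)" using la c by (auto simp: ws'_def nth_append)
 show "ws ! Suc a = vs' ! Suc c" using la D'(3) by (auto simp: ws_def nth_append y'_def)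
 show "ws' ! Suc c = vs ! Suc a" using la D(3) by (auto simp: ws'_def nth_append y_def)
 show "(ws, ws', a, c) : crossings i j' i' j m"
  using bp lens len a c wa wc eq by (auto simp: crossings_def bp_pairs_def)
 show "pwt w ws * pwt w ws' = pwt w vs * pwt w vs'"
 proof -
  have "path_edges ws + path_edges ws' = path_edges vs + path_edges vs'"
   using path_edges_append[of "xs @ [x]" v "y' # ys'"] path_edges_append[of "xs' @ [x']" v "y # ys"]
    path_edges_append[of "xs @ [x]" v "y # ys"] path_edges_append[of "xs' @ [x']" v "y' # ys'"]
    arg_cong[OF D(1), of path_edges] arg_cong[OF D'(1), of path_edges]
   unfolding W by simp
  thus ?thesis unfolding pwt_def by (metis image_mset_union prod_mset.union)
 qed
 show "psig i j vs * psig i' j' vs' = swsgn i j i' j' * (psig i j' ws * psig i' j ws')"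
  if "vs ! (a - 1) = vs' ! (c - 1) | vs ! Suc a = vs' ! Suc c"
 proof -
  obtain l where l: "gen_dir l" using gen_dir_exists by blast
  have t: "turns l (us @ p # v # q # zs) = turns l (us @ [p, v]) + (of_bool (l : turn_cone (v - p) (q - v)) + turns l (v # q # zs))" for us p q zs
   using turns_append[of l us p v "q # zs"] by simp
  have "turns l vs + turns l vs' = turns l ws + turns l ws'"
   using that arg_cong[OF D(1), of "turns l"] arg_cong[OF D'(1), of "turns l"]
   unfolding W t[of xs x] t[of xs' x'] x_def[symmetric] y_def[symmetric] x'_def[symmetric] y'_def[symmetric] by auto
  from psig_swap[OF l p bp this] show ?thesis by (simp add: swsgn_def)
 qed
qed

text \<open>Where \<open>H\<close> is nonzero the paths share an edge at the marked vertex and the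
  sign rule applies; where \<open>H\<close> is zero both terms vanish.\<close>

lemma swap_sum:
 assumes H: "!!vs vs' a c ws ws'. (vs, vs', a, c) : crossings i j i' j' m ==> ws = take a vs @ drop c vs' ==> ws' = take c vs' @ drop a vs ==>
  H vs vs' a c = eps * H ws ws' a c &
  (H vs vs' a c ~= 0 --> vs ! (a - 1) = vs' ! (c - 1) | vs ! Suc a = vs' ! Suc c)"
 shows "(SUM (vs, vs', a, c):crossings i j i' j' m.
  H vs vs' a c * (psig i j vs * psig i' j' vs' * (pwt w vs * pwt w vs'))) =
 eps * swsgn i j i' j' * (SUM (vs, vs', a, c):crossings i j' i' j m.
  H vs vs' a c * (psig i j' vs * psig i' j vs' * (pwt w vs * pwt w vs')))"
 unfolding sum_distrib_left
proof (rule sum.reindex_bij_witness[where i = tail_swap and j = tail_swap])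
 fix x assume "x : crossings i j i' j' m"
 moreover obtain vs vs' a c where x: "x = (vs, vs', a, c)" by (cases x)
 ultimately have xc: "(vs, vs', a, c) : crossings i j i' j' m" by simp
 note tp = tail_swap_props[OF xc]
 show "tail_swap (tail_swap x) = x" using tp(2,3) by (simp add: tail_swap_def x)
 show "tail_swap x : crossings i j' i' j m" using tp(1) by (simp add: tail_swap_def x)
 define ws ws' where "ws = take a vs @ drop c vs'" and "ws' = take c vs' @ drop a vs"
 have h: "H vs vs' a c = eps * H ws ws' a c" "H vs vs' a c ~= 0 ==> vs ! (a - 1) = vs' ! (c - 1) | vs ! Suc a = vs' ! Suc c"
  using H[OF xc ws_def ws'_def] by blast+
 have "eps * swsgn i j i' j' * (H ws ws' a c * (psig i j' ws * psig i' j ws' * (pwt w ws * pwt w ws'))) =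
  H vs vs' a c * (psig i j vs * psig i' j' vs' * (pwt w vs * pwt w vs'))"
 proof (cases "H vs vs' a c = 0")
  case True
  hence "eps * H ws ws' a c = 0" using h(1) by simp
  thus ?thesis using True by auto
 next
  case False
  show ?thesis
   unfolding tp(10)[OF h(2)[OF False]] tp(9)[folded ws_def ws'_def] h(1) ws_def[symmetric] ws'_def[symmetric] by (simp add: mult_ac)
 qed
 thus "eps * swsgn i j i' j' * (case tail_swap x of (vs, vs', a, c) =>
   (H vs vs' a c * (psig i j' vs * psig i' j vs' * (pwt w vs * pwt w vs')))) =
  (case x of (vs, vs', a, c) => H vs vs' a c * (psig i j vs * psig i' j' vs' * (pwt w vs * pwt w vs')))"
  by (simp add: tail_swap_def x ws_def ws'_def)
next
 fix x assume "x : crossings i j' i' j m"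
 moreover obtain vs vs' a c where x: "x = (vs, vs', a, c)" by (cases x)
 ultimately have xc: "(vs, vs', a, c) : crossings i j' i' j m" by simp
 note tp = tail_swap_props[OF xc]
 show "tail_swap (tail_swap x) = x" using tp(2,3) by (simp add: tail_swap_def x)
 show "tail_swap x : crossings i j i' j' m" using tp(1) by (simp add: tail_swap_def x)
qed

text \<open>Paths part at white vertices, where they share the incoming edge. The exchange of tails
  interchanges the two outgoing edges and thereby the sign of the parting.\<close>

lemma part_sum_swap:
 "pair_sum w part_sum i j i' j' m = - swsgn i j i' j' * pair_sum w part_sum i j' i' j m"
proof -
 define H where "H vs vs' a c = part_sgn (vs ! a) (vs ! Suc a) (vs' ! Suc c)" for vs vs' :: "complex list" and a c
 have ps: "part_sum vs vs' = (SUM a=1..<length vs - 1. SUM c=1..<length vs' - 1. if vs ! a = vs' ! c then H vs vs' a c else 0)" for vs vs'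
  unfolding part_sum_def H_def ..
 have "H vs vs' a c = -1 * H ws ws' a c & (H vs vs' a c ~= 0 --> vs ! (a - 1) = vs' ! (c - 1) | vs ! Suc a = vs' ! Suc c)"
  if x: "(vs, vs', a, c) : crossings i j i' j' m" and ws: "ws = take a vs @ drop c vs'" "ws' = take c vs' @ drop a vs" for vs vs' a c ws ws'
 proof
  note tp = tail_swap_props[OF x, folded ws]
  have p: "bpath i j vs" "bpath i' j' vs'" and a: "1 <= a" "a < length vs - 1" and c: "1 <= c" "c < length vs' - 1" and eq: "vs ! a = vs' ! c"
   using x by (auto simp: crossings_def bp_pairs_def)
  have sg: "sgn (s - t) = - sgn (t - s)" for s t :: real by (metis minus_diff_eq sgn_minus)
  show "H vs vs' a c = -1 * H ws ws' a c"
   unfolding H_def tp(4,7,8) part_sgn_def by (simp add: sg[of "real (flag_number N (vs ! a, vs ! a, vs' ! Suc c))"])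
  show "H vs vs' a c ~= 0 --> vs ! (a - 1) = vs' ! (c - 1) | vs ! Suc a = vs' ! Suc c"
  proof
   assume "H vs vs' a c ~= 0"
   hence "white N (vs ! a)" unfolding H_def part_sgn_def by (auto split: if_splits)
   moreover have "(vs ! (a - 1), vs ! a) : E" "(vs' ! (c - 1), vs ! a) : E"
    using bp_step[OF p(1), of "a - 1"] bp_step[OF p(2), of "c - 1"] a c by (auto simp: eq)
   ultimately show "vs ! (a - 1) = vs' ! (c - 1) | vs ! Suc a = vs' ! Suc c" using white_unique_in by blast
  qed
 qed
 from swap_sum[of i j i' j' m H "-1" w, OF this]
 have sw: "(SUM (vs, vs', a, c):crossings i j i' j' m.
  H vs vs' a c * (psig i j vs * psig i' j' vs' * (pwt w vs * pwt w vs'))) =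
 -1 * swsgn i j i' j' * (SUM (vs, vs', a, c):crossings i j' i' j m.
  H vs vs' a c * (psig i j' vs * psig i' j vs' * (pwt w vs * pwt w vs')))" .
 have psf: "part_sum = (%vs vs'. SUM a=1..<length vs - 1. SUM c=1..<length vs' - 1. if vs ! a = vs' ! c then H vs vs' a c else 0)"
  by (intro ext) (rule ps)
 have e: "pair_sum w part_sum i j i' j' m = (SUM (vs, vs', a, c):crossings i j i' j' m.
  H vs vs' a c * (psig i j vs * psig i' j' vs' * (pwt w vs * pwt w vs')))" for i j i' j'
  unfolding psf by (rule crossing_sum)
 show ?thesis unfolding e sw by (simp only: mult_minus1)
qed

text \<open>Paths meet at black vertices, where they share the outgoing edge. The exchange of tails
  keeps the incoming edges, so no sign appears apart from \<open>swsgn\<close>.\<close>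

lemma meet_sum_swap:
 "pair_sum w meet_sum i j i' j' m = swsgn i j i' j' * pair_sum w meet_sum i j' i' j m"
proof -
 define H where "H vs vs' a c = meet_sgn (vs ! a) (vs ! (a - 1)) (vs' ! (c - 1))" for vs vs' :: "complex list" and a c
 have ps: "meet_sum vs vs' = (SUM a=1..<length vs - 1. SUM c=1..<length vs' - 1. if vs ! a = vs' ! c then H vs vs' a c else 0)" for vs vs'
  unfolding meet_sum_def H_def ..
 have "H vs vs' a c = 1 * H ws ws' a c & (H vs vs' a c ~= 0 --> vs ! (a - 1) = vs' ! (c - 1) | vs ! Suc a = vs' ! Suc c)"
  if x: "(vs, vs', a, c) : crossings i j i' j' m" and ws: "ws = take a vs @ drop c vs'" "ws' = take c vs' @ drop a vs" for vs vs' a c ws ws'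
 proof
  note tp = tail_swap_props[OF x, folded ws]
  have p: "bpath i j vs" "bpath i' j' vs'" and a: "1 <= a" "a < length vs - 1" and c: "1 <= c" "c < length vs' - 1" and eq: "vs ! a = vs' ! c"
   using x by (auto simp: crossings_def bp_pairs_def)
  show "H vs vs' a c = 1 * H ws ws' a c"
   unfolding H_def tp(4,5,6) by simp
  show "H vs vs' a c ~= 0 --> vs ! (a - 1) = vs' ! (c - 1) | vs ! Suc a = vs' ! Suc c"
  proof
   assume "H vs vs' a c ~= 0"
   hence "~ white N (vs ! a)" unfolding H_def meet_sgn_def by (auto split: if_splits)
   moreover have "vs ! a : inner N" using bpath_inner[OF p(1), of a] a by auto
   moreover have "(vs ! a, vs ! Suc a) : E" "(vs ! a, vs' ! Suc c) : E"
    using bp_step[OF p(1), of a] bp_step[OF p(2), of c] a c by (auto simp: eq)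
   ultimately show "vs ! (a - 1) = vs' ! (c - 1) | vs ! Suc a = vs' ! Suc c" using black_unique_out by blast
  qed
 qed
 from swap_sum[of i j i' j' m H 1 w, OF this]
 have sw: "(SUM (vs, vs', a, c):crossings i j i' j' m.
  H vs vs' a c * (psig i j vs * psig i' j' vs' * (pwt w vs * pwt w vs'))) =
 1 * swsgn i j i' j' * (SUM (vs, vs', a, c):crossings i j' i' j m.
  H vs vs' a c * (psig i j' vs * psig i' j vs' * (pwt w vs * pwt w vs')))" .
 have psf: "meet_sum = (%vs vs'. SUM a=1..<length vs - 1. SUM c=1..<length vs' - 1. if vs ! a = vs' ! c then H vs vs' a c else 0)"
  by (intro ext) (rule ps)
 have e: "pair_sum w meet_sum i j i' j' m = (SUM (vs, vs', a, c):crossings i j i' j' m.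
  H vs vs' a c * (psig i j vs * psig i' j' vs' * (pwt w vs * pwt w vs')))" for i j i' j'
  unfolding psf by (rule crossing_sum)
 show ?thesis unfolding e sw by (simp only: mult_1_left)
qed

lemma pair_sum_cong:
 "(!!vs vs'. bpath i j vs ==> bpath i' j' vs' ==> G vs vs' = G' vs vs') ==> pair_sum w G i j i' j' m = pair_sum w G' i j i' j' m"
 unfolding pair_sum_def by (intro sum.cong refl) (auto simp: bp_pairs_def)

lemma pair_sum_linear:
 "pair_sum w (%vs vs'. s * G vs vs' + t * G' vs vs') i j i' j' m = s * pair_sum w G i j i' j' m + t * pair_sum w G' i j i' j' m"
 unfolding pair_sum_def sum_distrib_left sum.distrib[symmetric] by (intro sum.cong refl) (auto simp: algebra_simps)

abbreviation "edge_count e \<equiv> %vs. real (count (path_edges vs) e)"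

text \<open>With \<open>P\<close> for the partings and \<open>M\<close> for the meetings,
  \<open>al * P + be * M\<close> is a combination of \<open>P + M\<close> and \<open>P - M\<close>.
  The sum is \<open>2 * s_times\<close> for every pair of paths. The exchange of tails turns the
  difference into such a sum for exchanged sinks, and there \<open>s_times\<close> is
  \<open>- s_eq\<close>.\<close>

lemma bracket_series:
 assumes sk: "skew3 p" "skew3 q" and al: "al = p 2 3 + p 1 3 - p 1 2" and be: "be = q 2 3 + q 1 3 - q 1 2"
  and io: "i : Src" "i' : Src" "j : Snk" "j' : Snk"
 shows "(SUM e:E. SUM e':E. fps_const (ecoef p q e e') *
   (pser w (edge_count e) i j * pser w (edge_count e') i' j')) =
  fps_const ((al - be) * (swsgn i j i' j' * s_eq i j i' j')) * (pser w (%_. 1) i j' * pser w (%_. 1) i' j) +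
  fps_const ((al + be) * s_times i j i' j') * (pser w (%_. 1) i j * pser w (%_. 1) i' j')"
proof (rule fps_ext)
 fix m
 let ?P = "%G. pair_sum w G i j i' j' m" and ?Q = "%G. pair_sum w G i j' i' j m"
 have "fps_nth (SUM e:E. SUM e':E. fps_const (ecoef p q e e') *
   (pser w (edge_count e) i j * pser w (edge_count e') i' j')) m =
  (SUM e:E. SUM e':E. ecoef p q e e' * ?P (%vs vs'. edge_count e vs * edge_count e' vs'))"
  by (simp add: fps_sum_nth pser_mult)
 also have "... = ?P (%vs vs'. SUM e:E. edge_count e vs * (SUM e':E. edge_count e' vs' * ecoef p q e e'))"
 proof -
  have "(SUM e:E. SUM e':E. ecoef p q e e' * ?P (%vs vs'. edge_count e vs * edge_count e' vs')) =
   (SUM x:bp_pairs i j i' j' m. SUM e:E. SUM e':E. ecoef p q e e' * (edge_count e (fst x) * edge_count e' (snd x) *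
    (psig i j (fst x) * psig i' j' (snd x) * (pwt w (fst x) * pwt w (snd x)))))"
   unfolding pair_sum_def sum_distrib_left case_prod_unfold
   by (subst (2) sum.swap) (subst sum.swap, rule refl)
  also have "... = ?P (%vs vs'. SUM e:E. edge_count e vs * (SUM e':E. edge_count e' vs' * ecoef p q e e'))"
   unfolding pair_sum_def case_prod_unfold sum_distrib_left sum_distrib_right by (intro sum.cong refl) (simp add: mult_ac)
  finally show ?thesis .
 qed
 also have "... = ?P (%vs vs'. al * part_sum vs vs' + be * meet_sum vs vs')"
  by (rule pair_sum_cong) (simp add: sum_count_steps ecoef_sum[OF _ _ sk al be, symmetric])
 also have "... = al * ?P part_sum + be * ?P meet_sum"
  by (rule pair_sum_linear)
 finally have 1: "fps_nth (SUM e:E. SUM e':E. fps_const (ecoef p q e e') *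
   (pser w (edge_count e) i j * pser w (edge_count e') i' j')) m = al * ?P part_sum + be * ?P meet_sum" .
 have 2: "pair_sum w part_sum i j i' j' m + pair_sum w meet_sum i j i' j' m =
   2 * s_times i j i' j' * fps_nth (pser w (%_. 1) i j * pser w (%_. 1) i' j') m" for i j i' j'
 proof -
  have "pair_sum w part_sum i j i' j' m + pair_sum w meet_sum i j i' j' m = pair_sum w (%vs vs'. 1 * part_sum vs vs' + 1 * meet_sum vs vs') i j i' j' m"
   unfolding pair_sum_linear by simp
  also have "... = pair_sum w (%vs vs'. 2 * s_times i j i' j' * (1 * 1) + 0 * 0) i j i' j' m"
   by (rule pair_sum_cong) (simp add: part_meet_sum)
  also have "... = 2 * s_times i j i' j' * pair_sum w (%vs vs'. 1 * 1) i j i' j' m"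
   unfolding pair_sum_linear by simp
  finally show ?thesis unfolding pser_mult .
 qed
 have 3: "s_eq i j i' j' = - s_times i j' i' j"
  using source_sink_disjoint io by (intro s_eq_s_times) auto
 have ps: "?P part_sum = - swsgn i j i' j' * ?Q part_sum" "?P meet_sum = swsgn i j i' j' * ?Q meet_sum"
  by (rule part_sum_swap meet_sum_swap)+
 have d: "?P part_sum - ?P meet_sum = - swsgn i j i' j' * (2 * s_times i j' i' j * fps_nth (pser w (%_. 1) i j' * pser w (%_. 1) i' j) m)"
  unfolding 2[of i j' i' j, symmetric] ps by (simp add: algebra_simps)
 have "al * ?P part_sum + be * ?P meet_sum = (al + be) / 2 * (?P part_sum + ?P meet_sum) + (al - be) / 2 * (?P part_sum - ?P meet_sum)"
  by (simp add: field_simps)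
 also have "... = (al - be) * (swsgn i j i' j' * s_eq i j i' j') * fps_nth (pser w (%_. 1) i j' * pser w (%_. 1) i' j) m +
  (al + be) * s_times i j i' j' * fps_nth (pser w (%_. 1) i j * pser w (%_. 1) i' j') m"
  unfolding 2 d 3 by (simp add: field_simps)
 finally show "fps_nth (SUM e:E. SUM e':E. fps_const (ecoef p q e e') *
   (pser w (edge_count e) i j * pser w (edge_count e') i' j')) m =
  fps_nth (fps_const ((al - be) * (swsgn i j i' j' * s_eq i j i' j')) * (pser w (%_. 1) i j' * pser w (%_. 1) i' j) +
  fps_const ((al + be) * s_times i j i' j') * (pser w (%_. 1) i j * pser w (%_. 1) i' j')) m"
  unfolding 1 by simp
qed

end

section \<open>From power series to values of rational functions\<close>

definition reg_at :: "real fps => real => bool" where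
 "reg_at f c <-> (EX p q. fps_of_poly q * f = fps_of_poly p & poly q 1 ~= 0 & c = poly p 1 / poly q 1)"

lemma reg_atI: "fps_of_poly q * f = fps_of_poly p ==> poly q 1 ~= 0 ==> c = poly p 1 / poly q 1 ==> reg_at f c"
 unfolding reg_at_def by blast

text \<open>Evaluation at \<open>t = 1\<close> is algebraic: cross-multiplication of the two
  polynomial fractions shows that the value is well defined, without any convergence of the
  series.\<close>

lemma reg_at_unique:
 assumes "reg_at f c" "reg_at f d"
 shows "c = d"
proof -
 obtain p q p' q' where a: "fps_of_poly q * f = fps_of_poly p" "poly q 1 ~= 0" "c = poly p 1 / poly q 1"
  and b: "fps_of_poly q' * f = fps_of_poly p'" "poly q' 1 ~= 0" "d = poly p' 1 / poly q' 1"
  using assms unfolding reg_at_def by blast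
 have "fps_of_poly (q' * p) = fps_of_poly (q * p')"
  unfolding fps_of_poly_mult a(1)[symmetric] b(1)[symmetric] by (simp add: mult_ac)
 hence "poly (q' * p) 1 = poly (q * p') 1" by (simp add: fps_of_poly_eq_iff)
 thus ?thesis unfolding a(3) b(3) using a(2) b(2) by (simp add: frac_eq_eq mult_ac)
qed

lemma reg_at_mult: "reg_at f c ==> reg_at g d ==> reg_at (f * g) (c * d)"
proof -
 assume "reg_at f c" "reg_at g d"
 then obtain p q p' q' where a: "fps_of_poly q * f = fps_of_poly p" "poly q 1 ~= 0" "c = poly p 1 / poly q 1"
  and b: "fps_of_poly q' * g = fps_of_poly p'" "poly q' 1 ~= 0" "d = poly p' 1 / poly q' 1"
  unfolding reg_at_def by blast
 show ?thesis
 proof (rule reg_atI[where p = "p * p'" and q = "q * q'"])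
  show "fps_of_poly (q * q') * (f * g) = fps_of_poly (p * p')"
   unfolding fps_of_poly_mult a(1)[symmetric] b(1)[symmetric] by (simp add: mult_ac)
 qed (use a b in auto)
qed

lemma reg_at_add: "reg_at f c ==> reg_at g d ==> reg_at (f + g) (c + d)"
proof -
 assume "reg_at f c" "reg_at g d"
 then obtain p q p' q' where a: "fps_of_poly q * f = fps_of_poly p" "poly q 1 ~= 0" "c = poly p 1 / poly q 1"
  and b: "fps_of_poly q' * g = fps_of_poly p'" "poly q' 1 ~= 0" "d = poly p' 1 / poly q' 1"
  unfolding reg_at_def by blast
 show ?thesis
 proof (rule reg_atI[where p = "q' * p + q * p'" and q = "q * q'"])
  show "fps_of_poly (q * q') * (f + g) = fps_of_poly (q' * p + q * p')"
   unfolding fps_of_poly_mult fps_of_poly_add a(1)[symmetric] b(1)[symmetric] by (simp add: algebra_simps)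
  show "poly (q * q') 1 ~= 0" using a(2) b(2) by simp
  show "c + d = poly (q' * p + q * p') 1 / poly (q * q') 1"
   unfolding a(3) b(3) using a(2) b(2) by (simp add: add_frac_eq mult_ac)
 qed
qed

lemma reg_at_const: "reg_at (fps_const c) c"
 by (rule reg_atI[where p = "[:c:]" and q = 1]) auto

lemma reg_at_sum: "finite A ==> (!!x. x : A ==> reg_at (f x) (c x)) ==> reg_at (SUM x:A. f x) (SUM x:A. c x)"
proof (induction A rule: finite_induct)
 case empty
 show ?case using reg_at_const[of 0] by simp
next
 case (insert x A)
 thus ?case by (simp add: reg_at_add)
qed

definition monomials :: "'a set => nat => 'a multiset set" where
 "monomials A l = {m. set_mset m <= A & size m = l}"

lemma finite_monomials: "finite A ==> finite (monomials A l)"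
proof (rule finite_subset)
 show "monomials A l <= mset ` {xs. set xs <= A & length xs = l}"
 proof
  fix m assume m: "m : monomials A l"
  obtain xs where "mset xs = m" using ex_mset by blast
  thus "m : mset ` {xs. set xs <= A & length xs = l}" using m by (auto simp: monomials_def)
 qed
qed (simp add: finite_lists_length_eq)

definition mono_val :: "('a => real) => 'a multiset => real" where
 "mono_val w m = (\<Prod>e\<in>#m. w e)"

lemma mono_val_add: "mono_val w (m + m') = mono_val w m * mono_val w m'"
 by (simp add: mono_val_def)

text \<open>Substitution of \<open>t * w\<close> for the edge weights, which turns formal series in
  many variables into power series in \<open>t\<close>.\<close>

definition series_at :: "'a set => ('a => real) => ('a multiset => real) => real fps" where
 "series_at A w S = Abs_fps (%l. SUM m:monomials A l. S m * mono_val w m)"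

definition conv :: "('a multiset => real) => ('a multiset => real) => 'a multiset => real" where
 "conv P Q m = (SUM m' | m' \<subseteq># m. P m' * Q (m - m'))"

lemma finite_submsets: "finite {m'. m' \<subseteq># m}"
proof (rule finite_subset)
 show "{m'. m' \<subseteq># m} <= (UN i:{..size m}. monomials (set_mset m) i)"
  by (auto simp: monomials_def dest: mset_subset_eqD size_mset_mono)
qed (simp add: finite_monomials)

lemma series_at_conv:
 assumes A: "finite A"
 shows "series_at A w (conv P Q) = series_at A w P * series_at A w Q"
proof (rule fps_ext)
 fix l
 have "fps_nth (series_at A w P * series_at A w Q) l =
  (SUM i=0..l. SUM (m, m'):monomials A i \<times> monomials A (l - i). (P m * mono_val w m) * (Q m' * mono_val w m'))"
  unfolding fps_mult_nth series_at_def by (simp add: sum_product sum.cartesian_product)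
 also have "... = (SUM (i, m, m'):Sigma {0..l} (%i. monomials A i \<times> monomials A (l - i)). (P m * mono_val w m) * (Q m' * mono_val w m'))"
  using finite_monomials[OF A] by (subst sum.Sigma) (auto simp: case_prod_unfold)
 also have "... = (SUM (m, m'):Sigma (monomials A l) (%m. {m'. m' \<subseteq># m}). P m' * Q (m - m') * mono_val w m)"
 proof (rule sum.reindex_bij_witness[where i = "%(m, m'). (size m', m', m - m')" and j = "%(i, m, m'). (m + m', m)"])
  fix x assume "x : Sigma (monomials A l) (%m. {m'. m' \<subseteq># m})"
  moreover obtain m m' where x: "x = (m, m')" by (cases x)
  ultimately have m: "set_mset m <= A" "size m = l" "m' \<subseteq># m" by (auto simp: monomials_def)
  show "(case (case x of (m, m') => (size m', m', m - m')) of (i, m, m') => (m + m', m)) = x"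
   using m(3) by (simp add: x)
  have "set_mset m' <= A" "set_mset (m - m') <= A" using m set_mset_mono[OF m(3)] in_diffD by (auto dest: in_diffD)
  thus "(case x of (m, m') => (size m', m', m - m')) : Sigma {0..l} (%i. monomials A i \<times> monomials A (l - i))"
   using m size_mset_mono[OF m(3)] by (auto simp: x monomials_def size_Diff_submset)
 qed (auto simp: monomials_def mono_val_add)
 also have "... = (SUM m:monomials A l. SUM m':{m'. m' \<subseteq># m}. P m' * Q (m - m') * mono_val w m)"
  using finite_monomials[OF A] finite_submsets by (subst sum.Sigma) auto
 also have "... = fps_nth (series_at A w (conv P Q)) l"
  by (simp add: series_at_def conv_def sum_distrib_right)
 finally show "fps_nth (series_at A w (conv P Q)) l = fps_nth (series_at A w P * series_at A w Q) l" by simp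
qed

lemma series_at_add: "series_at A w (%m. P m + Q m) = series_at A w P + series_at A w Q"
 by (rule fps_ext) (simp add: series_at_def algebra_simps sum.distrib)

lemma series_at_finite:
 assumes "finite A" "finite K" "!!m. m ~: K ==> P m = 0" "!!m. m : K ==> set_mset m <= A"
 shows "series_at A w P = fps_of_poly (SUM m:K. monom (P m * mono_val w m) (size m))"
proof (rule fps_ext)
 fix l
 have "fps_nth (series_at A w P) l = (SUM m:monomials A l. P m * mono_val w m)" by (simp add: series_at_def)
 also have "... = (SUM m:{m : K. size m = l}. P m * mono_val w m)"
  using assms finite_monomials[OF assms(1)]
  by (intro sum.mono_neutral_right) (auto simp: monomials_def)
 also have "... = (SUM m:K. if size m = l then P m * mono_val w m else 0)"
  using assms(2) by (subst sum.inter_filter) auto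
 also have "... = fps_nth (fps_of_poly (SUM m:K. monom (P m * mono_val w m) (size m))) l"
  by (simp add: coeff_sum coeff_monom eq_commute)
 finally show "fps_nth (series_at A w P) l = fps_nth (fps_of_poly (SUM m:K. monom (P m * mono_val w m) (size m))) l" .
qed

text \<open>The derivation \<open>w_e * d/dw_e\<close> of formal series.\<close>

definition euler :: "'a => ('a multiset => real) => 'a multiset => real" where
 "euler e S m = real (count m e) * S m"

lemma euler_conv: "euler e (conv P Q) m = conv (euler e P) Q m + conv P (euler e Q) m"
 unfolding conv_def euler_def sum.distrib[symmetric] sum_distrib_left
proof (rule sum.cong[OF refl])
 fix m' assume "m' : {m'. m' \<subseteq># m}"
 hence "count m e = count m' e + count (m - m') e" by (simp add: mset_subset_eq_count)
 thus "real (count m e) * (P m' * Q (m - m')) =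
  real (count m' e) * P m' * Q (m - m') + P m' * (real (count (m - m') e) * Q (m - m'))"
  by (simp add: algebra_simps)
qed

definition poly_euler :: "'a => ('a multiset \<Rightarrow>\<^sub>0 real) => ('a => real) => real" where
 "poly_euler e P w = (SUM m:Poly_Mapping.keys P. real (count m e) * lk P m * mono_val w m)"

context planar_network
begin

lemma poly_series:
 assumes "P : edge_polys N"
 obtains p where "series_at E w (lk P) = fps_of_poly p" "poly p 1 = poly_at P w"
proof
 show "series_at E w (lk P) =
  fps_of_poly (SUM m:Poly_Mapping.keys P. monom (lk P m * mono_val w m) (size m))"
  using assms by (intro series_at_finite finite_edges) (auto simp: edge_polys_def in_keys_iff)
 show "poly (SUM m:Poly_Mapping.keys P. monom (lk P m * mono_val w m) (size m)) 1 = poly_at P w"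
  by (simp add: poly_sum poly_monom poly_at_def mono_val_def)
qed

lemma poly_euler_series:
 assumes "P : edge_polys N"
 obtains p where "series_at E w (euler e (lk P)) = fps_of_poly p" "poly p 1 = poly_euler e P w"
proof
 show "series_at E w (euler e (lk P)) =
  fps_of_poly (SUM m:Poly_Mapping.keys P. monom (euler e (lk P) m * mono_val w m) (size m))"
  using assms by (intro series_at_finite finite_edges) (auto simp: edge_polys_def in_keys_iff euler_def)
 show "poly (SUM m:Poly_Mapping.keys P. monom (euler e (lk P) m * mono_val w m) (size m)) 1 = poly_euler e P w"
  by (simp add: poly_sum poly_monom poly_euler_def euler_def mono_val_def)
qed

lemma pser_series_at:
 assumes "i : Src" "j : Snk"
 shows "series_at E w (%m. g m * M_series n N i j m) = pser w (%vs. g (path_edges vs)) i j"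
proof (rule fps_ext)
 fix l
 have fib: "{vs. net_path N (b i) (b j) vs & path_edges vs = m} = {vs : bpaths i j l. path_edges vs = m}"
  if "m : monomials E l" for m
  using that assms by (auto simp: bpaths_def bpath_def net_path_def monomials_def size_path_edges[symmetric] Suc_diff_le)
   (auto simp: size_path_edges)
 have img: "path_edges ` bpaths i j l <= monomials E l"
 proof
  fix m assume "m : path_edges ` bpaths i j l"
  then obtain vs where vs: "bpath i j vs" "length vs = Suc l" "m = path_edges vs" by (auto simp: bpaths_def)
  thus "m : monomials E l"
   using bp_step[OF vs(1)] by (auto simp: monomials_def path_edges_def zip_tl_steps step_def)
 qed
 have "fps_nth (series_at E w (%m. g m * M_series n N i j m)) l =
  (SUM m:monomials E l. SUM vs:{vs : bpaths i j l. path_edges vs = m}. g (path_edges vs) * (psig i j vs * pwt w vs))"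
  unfolding series_at_def M_series_def
  by (simp add: fib sum_distrib_left sum_distrib_right psig_def pwt_def mono_val_def mult_ac cong: sum.cong)
   (intro sum.cong refl, auto)
 also have "... = (SUM vs:bpaths i j l. g (path_edges vs) * (psig i j vs * pwt w vs))"
  by (rule sum.group[OF finite_bpaths finite_monomials[OF finite_edges] img])
 finally show "fps_nth (series_at E w (%m. g m * M_series n N i j m)) l =
  fps_nth (pser w (%vs. g (path_edges vs)) i j) l" by (simp add: pser_def)
qed

text \<open>The value of \<open>w_e * d/dw_e\<close> on the fraction \<open>P / Q\<close>, by the
  quotient rule.\<close>

definition M_euler :: "nat => nat => complex \<times> complex => edge_poly => edge_poly => weights => real" where
 "M_euler i j e P Q w = (poly_euler e P w * poly_at Q w - poly_at P w * poly_euler e Q w) / (poly_at Q w)\<^sup>2"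

text \<open>Substituting \<open>t * w\<close> in the equation \<open>Q * S = P\<close> and in its
  image under the derivation \<open>euler e\<close> gives linear equations for the two series, with
  polynomial coefficients in \<open>t\<close>. The coefficients of the unknown series become
  \<open>q\<close> and \<open>q * q\<close> and are nonzero at \<open>t = 1\<close>.\<close>

lemma fraction_series:
 assumes io: "i : Src" "j : Snk" and PQ: "P : edge_polys N" "Q : edge_polys N"
  and rep: "represents_fraction (M_series n N i j) P Q" and nz: "poly_at Q w ~= 0"
 shows "reg_at (pser w (%_. 1) i j) (poly_at P w / poly_at Q w)"
  "reg_at (pser w (edge_count e) i j) (M_euler i j e P Q w)"
proof -
 let ?S = "M_series n N i j"
 obtain p where p: "series_at E w (lk P) = fps_of_poly p" "poly p 1 = poly_at P w"
  using poly_series[OF PQ(1)] by blast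
 obtain q where q: "series_at E w (lk Q) = fps_of_poly q" "poly q 1 = poly_at Q w"
  using poly_series[OF PQ(2)] by blast
 obtain p' where p': "series_at E w (euler e (lk P)) = fps_of_poly p'" "poly p' 1 = poly_euler e P w"
  using poly_euler_series[OF PQ(1)] by blast
 obtain q' where q': "series_at E w (euler e (lk Q)) = fps_of_poly q'" "poly q' 1 = poly_euler e Q w"
  using poly_euler_series[OF PQ(2)] by blast
 have c: "conv (lk Q) ?S = lk P"
  using rep by (auto simp: represents_fraction_def conv_def)
 have S: "series_at E w ?S = pser w (%_. 1) i j"
  using pser_series_at[OF io, of w "%_. 1"] by simp
 have S': "series_at E w (euler e ?S) = pser w (edge_count e) i j"
  using pser_series_at[OF io, of w "%m. real (count m e)"] by (simp add: euler_def[abs_def])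
 have 1: "fps_of_poly q * pser w (%_. 1) i j = fps_of_poly p"
  using series_at_conv[OF finite_edges, of w "lk Q" ?S] unfolding c S p q by simp
 show "reg_at (pser w (%_. 1) i j) (poly_at P w / poly_at Q w)"
  by (rule reg_atI[OF 1]) (use nz p q in auto)
 have "euler e (lk P) = (%m. conv (euler e (lk Q)) ?S m + conv (lk Q) (euler e ?S) m)"
  unfolding c[symmetric] by (rule ext) (rule euler_conv)
 hence "fps_of_poly p' = fps_of_poly q' * pser w (%_. 1) i j + fps_of_poly q * pser w (edge_count e) i j"
  unfolding p'(1)[symmetric] by (simp add: series_at_add series_at_conv[OF finite_edges] S S' q q')
 hence "fps_of_poly q * fps_of_poly p' = fps_of_poly q' * fps_of_poly p + fps_of_poly q * (fps_of_poly q * pser w (edge_count e) i j)"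
  unfolding 1[symmetric] by (simp add: algebra_simps)
 hence 2: "fps_of_poly (q * q) * pser w (edge_count e) i j = fps_of_poly (q * p' - q' * p)"
  by (simp add: fps_of_poly_mult fps_of_poly_diff algebra_simps)
 show "reg_at (pser w (edge_count e) i j) (M_euler i j e P Q w)"
  by (rule reg_atI[OF 2]) (use nz p q p' q' in \<open>auto simp: M_euler_def power2_eq_square algebra_simps\<close>)
qed

lemma M_value_eq:
 assumes io: "i : Src" "j : Snk" and PQ: "P : edge_polys N" "Q : edge_polys N"
  and rep: "represents_fraction (M_series n N i j) P Q" and nz: "poly_at Q w ~= 0"
 shows "M_value n N i j w = poly_at P w / poly_at Q w"
 unfolding M_value_def
proof (rule the_equality)
 show "EX P':edge_polys N. EX Q':edge_polys N. represents_fraction (M_series n N i j) P' Q' & poly_at Q' w ~= 0 &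
   poly_at P w / poly_at Q w = poly_at P' w / poly_at Q' w" using PQ rep nz by blast
 fix c assume "EX P':edge_polys N. EX Q':edge_polys N. represents_fraction (M_series n N i j) P' Q' & poly_at Q' w ~= 0 &
   c = poly_at P' w / poly_at Q' w"
 hence "reg_at (pser w (%_. 1) i j) c" using fraction_series(1)[OF io] by blast
 thus "c = poly_at P w / poly_at Q w"
  using reg_at_unique fraction_series(1)[OF io PQ rep nz] by blast
qed

definition M_fraction :: "nat => nat => weights => edge_poly => edge_poly => bool" where
 "M_fraction i j w P Q <-> i : Src & j : Snk & P : edge_polys N & Q : edge_polys N &
  represents_fraction (M_series n N i j) P Q & poly_at Q w ~= 0"

text \<open>Both sides are values at \<open>t = 1\<close> of the two sides of
  \<open>bracket_series\<close>, and such values are unique.\<close>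

lemma M_bracket:
 assumes sk: "skew3 p" "skew3 q" and al: "al = p 2 3 + p 1 3 - p 1 2" and be: "be = q 2 3 + q 1 3 - q 1 2"
  and fr: "M_fraction i j w P Q" "M_fraction i' j' w P' Q'" and reg: "M_regular n N i j' w" "M_regular n N i' j w"
 shows "(SUM e:E. SUM e':E. ecoef p q e e' * (M_euler i j e P Q w * M_euler i' j' e' P' Q' w)) =
  (al - be) * (swsgn i j i' j' * s_eq i j i' j') * (M_value n N i j' w * M_value n N i' j w) +
  (al + be) * s_times i j i' j' * (M_value n N i j w * M_value n N i' j' w)"
proof (rule reg_at_unique)
 have io: "i : Src" "i' : Src" "j : Snk" "j' : Snk" using fr by (auto simp: M_fraction_def)
 have r: "reg_at (pser w (%_. 1) i j) (M_value n N i j w)" if "M_fraction i j w P Q" for i j P Q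
  using that fraction_series(1)[of i j P Q w] M_value_eq[of i j P Q w] by (simp add: M_fraction_def)
 have r': "reg_at (pser w (%_. 1) i j) (M_value n N i j w)" if "M_regular n N i j w" "i : Src" "j : Snk" for i j
  using that r unfolding M_regular_def M_fraction_def by blast
 have e: "reg_at (pser w (edge_count e) i j) (M_euler i j e P Q w)" if "M_fraction i j w P Q" for i j P Q e
  using that fraction_series(2)[of i j P Q w] by (simp add: M_fraction_def)
 show "reg_at (SUM e:E. SUM e':E. fps_const (ecoef p q e e') *
   (pser w (edge_count e) i j * pser w (edge_count e') i' j'))
  (SUM e:E. SUM e':E. ecoef p q e e' * (M_euler i j e P Q w * M_euler i' j' e' P' Q' w))"
  by (intro reg_at_sum finite_edges reg_at_mult reg_at_const e fr)
 show "reg_at (SUM e:E. SUM e':E. fps_const (ecoef p q e e') *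
   (pser w (edge_count e) i j * pser w (edge_count e') i' j'))
  ((al - be) * (swsgn i j i' j' * s_eq i j i' j') * (M_value n N i j' w * M_value n N i' j w) +
  (al + be) * s_times i j i' j' * (M_value n N i j w * M_value n N i' j' w))"
  unfolding bracket_series[OF sk al be io]
  by (intro reg_at_add reg_at_mult reg_at_const r[OF fr(1)] r[OF fr(2)] r'[OF reg(1)] r'[OF reg(2)] io)
qed

end

section \<open>Smooth functions of finitely many coordinates\<close>

lemma tendsto_fun_iff:
 fixes f :: "'b => 'i => real"
 shows "(f \<longlongrightarrow> l) F <-> (ALL i. ((%x. f x i) \<longlongrightarrow> l i) F)"
proof -
 have "limitin (product_topology (%i::'i. euclidean :: real topology) UNIV) f l F <-> (ALL i. ((%x. f x i) \<longlongrightarrow> l i) F)"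
  by (subst limitin_componentwise) auto
 thus ?thesis by (simp add: euclidean_product_topology)
qed

lemma continuous_on_fun_upd:
 fixes x :: "'i => real"
 assumes "continuous_on S g" "!!j. continuous_on S (%s. f s j)"
 shows "continuous_on S (%s. (f s)(i := g s))"
proof (rule continuous_on_coordinatewise_then_product)
 show "continuous_on S (%s. ((f s)(i := g s)) j)" for j
  by (cases "j = i") (simp_all add: assms)
qed

lemma open_upd_near:
 fixes x :: "'i => real"
 assumes "open U" "x : U"
 shows "\<forall>\<^sub>F t in nhds (x i). x(i := t) : U"
proof -
 have "open ((%t. x(i := t)) -` U)"
  by (intro open_vimage assms continuous_on_fun_upd) auto
 moreover have "x i : (%t. x(i := t)) -` U" using assms by simp
 ultimately show ?thesis unfolding eventually_nhds by blast
qed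

lemma pdiff_cong:
 assumes "open U" "x : U" "!!y. y : U ==> F y = G y"
 shows "pdiff i F x = pdiff i G x"
 unfolding pdiff_def
 by (rule deriv_cong_ev) (use open_upd_near[OF assms(1,2), of i] assms in \<open>auto elim: eventually_mono\<close>)

definition has_pdiff :: "(('i => real) => real) => 'i => real => ('i => real) => bool" where
 "has_pdiff F i D x <-> ((%t. F (x(i := t))) has_real_derivative D) (at (x i))"

lemma has_pdiff_imp_pdiff: "has_pdiff F i D x ==> pdiff i F x = D"
 unfolding has_pdiff_def pdiff_def by (rule DERIV_imp_deriv)

lemma has_pdiff_differentiable: "has_pdiff F i D x ==> (%t. F (x(i := t))) differentiable (at (x i))"
 unfolding has_pdiff_def by (rule differentiableI[OF has_field_derivative_imp_has_derivative])

lemma has_pdiffI: "(%t. F (x(i := t))) differentiable (at (x i)) ==> has_pdiff F i (pdiff i F x) x"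
 unfolding has_pdiff_def pdiff_def by (simp add: DERIV_deriv_iff_real_differentiable)

lemma Ck_on_cong:
 assumes "open U" "!!y. y : U ==> F y = G y"
 shows "Ck_on r K U F <-> Ck_on r K U G"
 using assms(2)
proof (induction r arbitrary: F G)
 case 0
 thus ?case by (simp cong: continuous_on_cong)
next
 case (Suc r)
 have "Ck_on r K U (pdiff i F) <-> Ck_on r K U (pdiff i G)" for i
  using Suc.prems by (intro Suc.IH pdiff_cong[OF assms(1)])
 moreover have "(%t. F (x(i := t))) differentiable (at (x i)) <-> (%t. G (x(i := t))) differentiable (at (x i))" if "x : U" for x i
 proof -
  have ev: "\<forall>\<^sub>F t in nhds (x i). t : UNIV --> F (x(i := t)) = G (x(i := t))"
   using open_upd_near[OF assms(1) that, of i] by (rule eventually_mono) (use Suc.prems in auto)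
  show ?thesis unfolding real_differentiable_def using has_field_derivative_cong_ev[OF refl ev refl refl UNIV_I] by auto
 qed
 moreover have "continuous_on U F <-> continuous_on U G" using Suc.prems by (simp cong: continuous_on_cong)
 ultimately show ?case by auto
qed

lemma Ck_on_SucI:
 assumes U: "open U" and c: "continuous_on U F"
  and d: "!!i x. i : K ==> x : U ==> has_pdiff F i (D i x) x" and D: "!!i. i : K ==> Ck_on r K U (D i)"
 shows "Ck_on (Suc r) K U F"
proof -
 have "Ck_on r K U (pdiff i F)" if "i : K" for i
  using D[OF that] Ck_on_cong[OF U, of "pdiff i F" "D i" r K] has_pdiff_imp_pdiff[OF d[OF that]] by blast
 thus ?thesis using c has_pdiff_differentiable[OF d] by auto
qed

lemma Ck_on_continuous: "Ck_on r K U F ==> continuous_on U F"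
 by (cases r) auto

lemma Ck_on_mono: "Ck_on (Suc r) K U F ==> Ck_on r K U F"
proof (induction r arbitrary: F)
 case (Suc r)
 thus ?case by (metis Ck_on.simps(2))
qed auto

lemma Ck_on_has_pdiff: "Ck_on (Suc r) K U F ==> i : K ==> x : U ==> has_pdiff F i (pdiff i F x) x"
 by (auto intro: has_pdiffI)

lemma Ck_on_pdiff: "Ck_on (Suc r) K U F ==> i : K ==> Ck_on r K U (pdiff i F)"
 by auto

lemma Ck_on_const: "open U ==> Ck_on r K U (%_. c)"
proof (induction r arbitrary: c)
 case (Suc r)
 show ?case by (rule Ck_on_SucI[where D = "%_ _. 0"]) (use Suc in \<open>auto simp: has_pdiff_def\<close>)
qed simp

lemma Ck_on_coord: "open U ==> Ck_on r K U (%x. x i)"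
proof (cases r)
 case (Suc q)
 assume U: "open U"
 show ?thesis unfolding Suc
 proof (rule Ck_on_SucI[OF U, where D = "%j _. if j = i then 1 else 0"])
  show "has_pdiff (%x. x i) j (if j = i then 1 else 0) x" for j x
   by (cases "j = i") (auto simp: has_pdiff_def)
 qed (auto intro: continuous_on_subset[OF continuous_on_product_coordinates] Ck_on_const[OF U])
qed (auto intro: continuous_on_subset[OF continuous_on_product_coordinates])

lemma Ck_on_add: "open U ==> Ck_on r K U F ==> Ck_on r K U G ==> Ck_on r K U (%x. F x + G x)"
proof (induction r arbitrary: F G)
 case (Suc r)
 show ?case
 proof (rule Ck_on_SucI[OF Suc.prems(1), where D = "%i x. pdiff i F x + pdiff i G x"])
  show "has_pdiff (%x. F x + G x) i (pdiff i F x + pdiff i G x) x" if "i : K" "x : U" for i x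
   using Ck_on_has_pdiff[OF Suc.prems(2) that] Ck_on_has_pdiff[OF Suc.prems(3) that]
   unfolding has_pdiff_def by (rule DERIV_add)
 qed (use Suc in \<open>auto intro: continuous_on_add\<close>)
qed (auto intro: continuous_on_add)

lemma Ck_on_mult: "open U ==> Ck_on r K U F ==> Ck_on r K U G ==> Ck_on r K U (%x. F x * G x)"
proof (induction r arbitrary: F G)
 case (Suc r)
 show ?case
 proof (rule Ck_on_SucI[OF Suc.prems(1), where D = "%i x. pdiff i F x * G x + pdiff i G x * F x"])
  show "has_pdiff (%x. F x * G x) i (pdiff i F x * G x + pdiff i G x * F x) x" if "i : K" "x : U" for i x
   using DERIV_mult[OF Ck_on_has_pdiff[OF Suc.prems(2) that, unfolded has_pdiff_def] Ck_on_has_pdiff[OF Suc.prems(3) that, unfolded has_pdiff_def]]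
   unfolding has_pdiff_def by simp
  show "Ck_on r K U (%x. pdiff i F x * G x + pdiff i G x * F x)" if "i : K" for i
   using Ck_on_pdiff[OF Suc.prems(2) that] Ck_on_pdiff[OF Suc.prems(3) that] Ck_on_mono[OF Suc.prems(2)] Ck_on_mono[OF Suc.prems(3)]
   by (intro Ck_on_add Suc.IH Suc.prems(1))
 qed (use Suc Ck_on_continuous in \<open>blast intro: continuous_on_mult\<close>)
qed (auto intro: continuous_on_mult)

lemma Ck_on_inverse: "open U ==> Ck_on r K U F ==> (!!x. x : U ==> F x ~= 0) ==> Ck_on r K U (%x. inverse (F x))"
proof (induction r)
 case (Suc r)
 have inv: "Ck_on r K U (%x. inverse (F x))" using Suc Ck_on_mono by blast
 show ?case
 proof (rule Ck_on_SucI[OF Suc.prems(1), where D = "%i x. (-1) * (inverse (F x) * (inverse (F x) * pdiff i F x))"])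
  show "has_pdiff (%x. inverse (F x)) i ((-1) * (inverse (F x) * (inverse (F x) * pdiff i F x))) x" if "i : K" "x : U" for i x
   using DERIV_inverse_fun[OF Ck_on_has_pdiff[OF Suc.prems(2) that, unfolded has_pdiff_def]] Suc.prems(3)[OF that(2)]
   unfolding has_pdiff_def by (simp add: mult_ac)
  show "Ck_on r K U (%x. (-1) * (inverse (F x) * (inverse (F x) * pdiff i F x)))" if "i : K" for i
   using Ck_on_pdiff[OF Suc.prems(2) that] by (intro Ck_on_mult Ck_on_const Suc.prems(1) inv)
  show "continuous_on U (%x. inverse (F x))"
   using Ck_on_continuous[OF Suc.prems(2)] Suc.prems(3) by (intro continuous_on_inverse) auto
 qed
qed (auto intro: continuous_on_inverse)

lemma Ck_on_sum: "open U ==> (!!a. a : A ==> Ck_on r K U (F a)) ==> Ck_on r K U (%x. SUM a:A. F a x)"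
proof (induction A rule: infinite_finite_induct)
 case (insert a A)
 thus ?case using Ck_on_add[of U r K "F a" "%x. SUM a:A. F a x"] by simp
qed (auto intro: Ck_on_const)

lemma Ck_on_prod: "open U ==> (!!a. a : A ==> Ck_on r K U (F a)) ==> Ck_on r K U (%x. PROD a:A. F a x)"
proof (induction A rule: infinite_finite_induct)
 case (insert a A)
 thus ?case using Ck_on_mult[of U r K "F a" "%x. PROD a:A. F a x"] by simp
qed (auto intro: Ck_on_const)

lemma Cinf_on_cong: "open U ==> (!!y. y : U ==> F y = G y) ==> Cinf_on K U F <-> Cinf_on K U G"
 unfolding Cinf_on_def using Ck_on_cong[of U F G] by blast

lemma Cinf_on_const: "open U ==> Cinf_on K U (%_. c)"
 unfolding Cinf_on_def by (intro allI Ck_on_const)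

lemma Cinf_on_coord: "open U ==> Cinf_on K U (%x. x i)"
 unfolding Cinf_on_def by (intro allI Ck_on_coord)

lemma Cinf_on_add: "open U ==> Cinf_on K U F ==> Cinf_on K U G ==> Cinf_on K U (%x. F x + G x)"
 unfolding Cinf_on_def by (intro allI Ck_on_add) auto

lemma Cinf_on_mult: "open U ==> Cinf_on K U F ==> Cinf_on K U G ==> Cinf_on K U (%x. F x * G x)"
 unfolding Cinf_on_def by (intro allI Ck_on_mult) auto

lemma Cinf_on_inverse:
 "open U ==> Cinf_on K U F ==> (!!x. x : U ==> F x ~= 0) ==> Cinf_on K U (%x. inverse (F x))"
 unfolding Cinf_on_def by (intro allI Ck_on_inverse) auto

lemma Cinf_on_sum:
 "open U ==> (!!a. a : A ==> Cinf_on K U (H a)) ==> Cinf_on K U (%x. SUM a:A. H a x)"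
 unfolding Cinf_on_def by (intro allI Ck_on_sum) auto

lemma Cinf_on_prod:
 "open U ==> (!!a. a : A ==> Cinf_on K U (H a)) ==> Cinf_on K U (%x. PROD a:A. H a x)"
 unfolding Cinf_on_def by (intro allI Ck_on_prod) auto

lemma Cinf_on_Ck: "Cinf_on K U F ==> Ck_on r K U F"
 unfolding Cinf_on_def by (rule spec)

lemma Cinf_on_pdiff: "Cinf_on K U F ==> i : K ==> Cinf_on K U (pdiff i F)"
 unfolding Cinf_on_def[of K U "pdiff i F"] by (intro allI Ck_on_pdiff[OF Cinf_on_Ck])

lemma Cinf_on_has_pdiff: "Cinf_on K U F ==> i : K ==> x : U ==> has_pdiff F i (pdiff i F x) x"
 by (rule Ck_on_has_pdiff[OF Cinf_on_Ck[where r = "Suc 0"]])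

lemma Cinf_on_continuous: "Cinf_on K U F ==> continuous_on U F"
 by (rule Ck_on_continuous[OF Cinf_on_Ck[where r = 0]])

lemma pdiff_add: "Cinf_on K U F ==> Cinf_on K U G ==> i : K ==> x : U ==>
  pdiff i (%x. F x + G x) x = pdiff i F x + pdiff i G x"
 using Cinf_on_has_pdiff[of K U F i x] Cinf_on_has_pdiff[of K U G i x]
 by (intro has_pdiff_imp_pdiff) (auto simp: has_pdiff_def intro: DERIV_add)

lemma pdiff_mult: "Cinf_on K U F ==> Cinf_on K U G ==> i : K ==> x : U ==>
  pdiff i (%x. F x * G x) x = pdiff i F x * G x + F x * pdiff i G x"
proof -
 assume a: "Cinf_on K U F" "Cinf_on K U G" "i : K" "x : U"
 show ?thesis
  using DERIV_mult[OF Cinf_on_has_pdiff[OF a(1,3,4), unfolded has_pdiff_def] Cinf_on_has_pdiff[OF a(2,3,4), unfolded has_pdiff_def]]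
  by (intro has_pdiff_imp_pdiff) (simp add: has_pdiff_def add.commute mult.commute)
qed

lemma pdiff_const [simp]: "pdiff i (%_. c) x = 0"
 by (simp add: pdiff_def)

lemma pdiff_coord: "pdiff i (%x. x j) x = (if i = j then 1 else 0)"
 by (rule has_pdiff_imp_pdiff) (cases "i = j"; auto simp: has_pdiff_def)

lemma pdiff_sum: "open U ==> (!!a. a : A ==> Cinf_on K U (F a)) ==> i : K ==> x : U ==>
  pdiff i (%x. SUM a:A. F a x) x = (SUM a:A. pdiff i (F a) x)"
proof (induction A rule: infinite_finite_induct)
 case (insert a A)
 thus ?case using pdiff_add[of K U "F a" "%x. SUM a:A. F a x" i x] Cinf_on_sum[of U A K F] by simp
qed auto

section \<open>Symmetry of second derivatives and the chain rule\<close>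

lemma mixed_mvt:
 fixes g g1 g12 :: "real => real => real"
 assumes h: "h > 0"
  and d1: "!!s t. a <= s ==> s <= a + h ==> c <= t ==> t <= c + h ==> ((%s. g s t) has_real_derivative g1 s t) (at s)"
  and d2: "!!s t. a <= s ==> s <= a + h ==> c <= t ==> t <= c + h ==> ((%t. g1 s t) has_real_derivative g12 s t) (at t)"
 obtains xe et where "a < xe" "xe < a + h" "c < et" "et < c + h"
  "g (a + h) (c + h) - g (a + h) c - g a (c + h) + g a c = h * h * g12 xe et"
proof -
 have "EX xe>a. xe < a + h & (g (a + h) (c + h) - g (a + h) c) - (g a (c + h) - g a c) = (a + h - a) * (g1 xe (c + h) - g1 xe c)"
  using h by (intro MVT2[of a "a + h" "%s. g s (c + h) - g s c"] DERIV_diff d1) auto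
 then obtain xe where x: "a < xe" "xe < a + h" "(g (a + h) (c + h) - g (a + h) c) - (g a (c + h) - g a c) = h * (g1 xe (c + h) - g1 xe c)"
  by auto
 have "EX et>c. et < c + h & g1 xe (c + h) - g1 xe c = (c + h - c) * g12 xe et"
  using h x by (intro MVT2[of c "c + h" "%t. g1 xe t"] d2) auto
 then obtain et where e: "c < et" "et < c + h" "g1 xe (c + h) - g1 xe c = h * g12 xe et" by auto
 show ?thesis using that[OF x(1,2) e(1,2)] x(3) e(3) by simp
qed

text \<open>In the plane through \<open>x\<close> spanned by the coordinates \<open>u\<close> and
  \<open>v\<close>, the second difference of \<open>F\<close> over a small square is a mixed
  derivative at some point of the square, for either order of differentiation; both derivatives are
  continuous.\<close>

lemma pdiff_commute:
 assumes U: "open U" and F: "Cinf_on K U F" and uv: "u : K" "v : K" and x: "x : U"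
 shows "pdiff u (pdiff v F) x = pdiff v (pdiff u F) x"
proof (cases "u = v")
 case False
 define P where "P p = x(u := fst p, v := snd p)" for p :: "real \<times> real"
 have contP: "continuous_on UNIV P"
  unfolding P_def
 proof (rule continuous_on_fun_upd)
  show "continuous_on UNIV (%p::real \<times> real. (x(u := fst p)) j)" for j
   by (cases "j = u") (auto intro: continuous_on_fst continuous_on_id)
 qed (auto intro: continuous_on_snd continuous_on_id)
 have P0: "P (x u, x v) = x" using False by (auto simp: P_def fun_eq_iff)
 have cont: "continuous_on (P -` U) (%p. pdiff a (pdiff d F) (P p))" if "a : K" "d : K" for a d
 proof (rule continuous_on_compose2[OF Cinf_on_continuous[OF Cinf_on_pdiff[OF Cinf_on_pdiff[OF F that(2)] that(1)]]])
  show "continuous_on (P -` U) P" by (rule continuous_on_subset[OF contP subset_UNIV])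
  show "P ` (P -` U) <= U" by (rule image_vimage_subset)
 qed
 have opP: "open (P -` U)" by (rule open_vimage[OF U contP])
 show ?thesis
 proof (rule ccontr)
  assume ne: "pdiff u (pdiff v F) x ~= pdiff v (pdiff u F) x"
  \<comment> \<open>Half the distance of the two derivatives, so that numbers closer than this to
    one and to the other cannot agree.\<close>
  define eps where "eps = \<bar>pdiff u (pdiff v F) x - pdiff v (pdiff u F) x\<bar> / 2"
  have eps: "eps > 0" using ne by (simp add: eps_def)
  define S where "S = P -` U Int {p. \<bar>pdiff v (pdiff u F) (P p) - pdiff v (pdiff u F) x\<bar> < eps} Int 
   (P -` U Int {p. \<bar>pdiff u (pdiff v F) (P p) - pdiff u (pdiff v F) x\<bar> < eps})"
  have "open S"
  proof -
   have op: "open (P -` U Int {p. \<bar>pdiff a (pdiff d F) (P p) - pdiff a (pdiff d F) x\<bar> < eps})" if "a : K" "d : K" for a d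
   proof -
    have "open (P -` U Int (%p. pdiff a (pdiff d F) (P p)) -` ball (pdiff a (pdiff d F) x) eps)"
     using continuous_open_preimage[OF cont[OF that] opP] by simp
    also have "P -` U Int (%p. pdiff a (pdiff d F) (P p)) -` ball (pdiff a (pdiff d F) x) eps =
     P -` U Int {p. \<bar>pdiff a (pdiff d F) (P p) - pdiff a (pdiff d F) x\<bar> < eps}"
     by (auto simp: dist_real_def abs_minus_commute)
    finally show ?thesis .
   qed
   show ?thesis unfolding S_def by (rule open_Int[OF op[OF uv(2,1)] op[OF uv]])
  qed
  moreover have "(x u, x v) : S" using x eps by (simp add: S_def P0)
  ultimately obtain A B where AB: "open A" "open B" "(x u, x v) : A \<times> B" "A \<times> B <= S"
   by (rule open_prod_elim)
  obtain de1 where de1: "de1 > 0" "ball (x u) de1 <= A" using AB by (meson SigmaD1 openE)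
  obtain de2 where de2: "de2 > 0" "ball (x v) de2 <= B" using AB by (meson SigmaD2 openE)
  define h where "h = min de1 de2 / 2"
  have h: "h > 0" "h < de1" "h < de2" using de1(1) de2(1) by (auto simp: h_def min_def)
  have inS: "(s, t) : S" if "x u <= s" "s <= x u + h" "x v <= t" "t <= x v + h" for s t
  proof -
   have "s : ball (x u) de1" "t : ball (x v) de2" using that h by (auto simp: dist_real_def)
   thus ?thesis using de1(2) de2(2) AB(4) by blast
  qed
  have inU: "P (s, t) : U" if "x u <= s" "s <= x u + h" "x v <= t" "t <= x v + h" for s t
   using inS[OF that] by (simp add: S_def)
  have du: "((%s. G (P (s, t))) has_real_derivative pdiff u G (P (s, t))) (at s)"
   if "P (s, t) : U" "Cinf_on K U G" for G s t
  proof -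
   have "(P (s, t))(u := s') = P (s', t)" for s' using False by (auto simp: P_def fun_eq_iff)
   moreover have "P (s, t) u = s" using False by (simp add: P_def)
   ultimately show ?thesis using Cinf_on_has_pdiff[OF that(2) uv(1) that(1)] by (simp add: has_pdiff_def)
  qed
  have dv: "((%t. G (P (s, t))) has_real_derivative pdiff v G (P (s, t))) (at t)"
   if "P (s, t) : U" "Cinf_on K U G" for G s t
  proof -
   have "(P (s, t))(v := t') = P (s, t')" for t' by (auto simp: P_def fun_eq_iff)
   moreover have "P (s, t) v = t" by (simp add: P_def)
   ultimately show ?thesis using Cinf_on_has_pdiff[OF that(2) uv(2) that(1)] by (simp add: has_pdiff_def)
  qed
  obtain xe et where e1: "x u < xe" "xe < x u + h" "x v < et" "et < x v + h"
   "F (P (x u + h, x v + h)) - F (P (x u + h, x v)) - F (P (x u, x v + h)) + F (P (x u, x v)) =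
   h * h * pdiff v (pdiff u F) (P (xe, et))"
   by (rule mixed_mvt[OF h(1), of "x u" "x v" "%s t. F (P (s, t))" "%s t. pdiff u F (P (s, t))" "%s t. pdiff v (pdiff u F) (P (s, t))"])
    (auto intro!: du dv inU F Cinf_on_pdiff[OF F] uv)
  obtain et' xe' where e2: "x v < et'" "et' < x v + h" "x u < xe'" "xe' < x u + h"
   "F (P (x u + h, x v + h)) - F (P (x u, x v + h)) - F (P (x u + h, x v)) + F (P (x u, x v)) =
   h * h * pdiff u (pdiff v F) (P (xe', et'))"
   by (rule mixed_mvt[OF h(1), of "x v" "x u" "%t s. F (P (s, t))" "%t s. pdiff v F (P (s, t))" "%t s. pdiff u (pdiff v F) (P (s, t))"])
    (auto intro!: du dv inU F Cinf_on_pdiff[OF F] uv)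
  have "h * h * pdiff v (pdiff u F) (P (xe, et)) = h * h * pdiff u (pdiff v F) (P (xe', et'))"
   using e1(5) e2(5) by linarith
  hence eq: "pdiff v (pdiff u F) (P (xe, et)) = pdiff u (pdiff v F) (P (xe', et'))" using h by simp
  have "(xe, et) : S" "(xe', et') : S" using e1 e2 by (auto intro!: inS)
  thus False using eq unfolding S_def eps_def by (auto simp: abs_if split: if_splits)
 qed
qed simp

lemma sum_swap4:
 "(SUM a:A. SUM b:B. SUM u:C. SUM v:D. h a b u v) = (SUM u:C. SUM v:D. SUM a:A. SUM b:B. h a b u v)"
 unfolding sum.swap[of _ C B] sum.swap[of _ C A] sum.swap[of _ D B] sum.swap[of _ D A] ..

lemma mvt_closed_segment:
 fixes f :: "real => real"
 assumes "!!s. s : closed_segment a b ==> (f has_real_derivative f' s) (at s)"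
 shows "EX s:closed_segment a b. f b - f a = (b - a) * f' s"
proof (cases a b rule: linorder_cases)
 case less
 show ?thesis using MVT2[OF less, of f f'] assms less by (fastforce simp: closed_segment_eq_real_ivl)
next
 case greater
 obtain z where "b < z" "z < a" "f a - f b = (a - b) * f' z"
  using MVT2[OF greater, of f f'] assms greater by (auto simp: closed_segment_eq_real_ivl)
 thus ?thesis by (intro bexI[of _ z]) (auto simp: closed_segment_eq_real_ivl algebra_simps)
qed auto

text \<open>Smoothness is given by partial derivatives only, so the coordinates in \<open>K\<close>
  are released one at a time and the mean value theorem is applied in each of them.\<close>

lemma chain_rule:
 assumes K: "finite K" and U: "open U" and F: "Cinf_on K' U F" and KK: "K <= K'"
  and ga0: "ga t0 : U" and d: "!!u. u : K ==> ((%t. ga t u) has_real_derivative ga' u) (at t0)"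
  and out: "!!u t. u ~: K ==> ga t u = ga t0 u"
 shows "((%t. F (ga t)) has_real_derivative (SUM u:K. pdiff u F (ga t0) * ga' u)) (at t0)"
 using K KK ga0 d out
proof (induction K arbitrary: ga rule: finite_induct)
 case empty
 have eq: "ga t = ga t0" for t by (intro ext empty.prems(4)) simp
 have "(%t. F (ga t)) = (%t. F (ga t0))"
 proof
  show "F (ga t) = F (ga t0)" for t by (rule arg_cong[OF eq])
 qed
 thus ?case by simp
next
 case (insert u K)
 \<comment> \<open>The curve with its coordinate \<open>u\<close> frozen at the value at
   \<open>t0\<close>; the induction hypothesis applies to it, and the difference to the original
   curve is a mean value in the coordinate \<open>u\<close>.\<close>
 define ga2 where "ga2 t = (ga t)(u := ga t0 u)" for t
 have ga20: "ga2 t0 = ga t0" by (simp add: ga2_def)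
 have IH: "((%t. F (ga2 t)) has_real_derivative (SUM v:K. pdiff v F (ga t0) * ga' v)) (at t0)"
 proof -
  have "((%t. F (ga2 t)) has_real_derivative (SUM v:K. pdiff v F (ga2 t0) * ga' v)) (at t0)"
  proof (rule insert.IH)
   show "((%t. ga2 t v) has_real_derivative ga' v) (at t0)" if "v : K" for v
    using insert.prems(3)[of v] insert.hyps(2) that by (cases "v = u") (simp_all add: ga2_def)
   show "ga2 t v = ga2 t0 v" if "v ~: K" for v t
    using insert.prems(4)[of v t] that by (cases "v = u") (simp_all add: ga2_def)
   show "K <= K'" using insert.prems(1) by simp
   show "ga2 t0 : U" using insert.prems(2) by (simp only: ga20)
  qed
  thus ?thesis by (simp add: ga20)
 qed
 have cont: "((%t. ga t v) \<longlongrightarrow> ga t0 v) (at t0)" for v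
 proof (cases "v : insert u K")
  case True
  show ?thesis using DERIV_isCont[OF insert.prems(3)[OF True]] by (simp add: isCont_def)
 next
  case False
  have "(%t. ga t v) = (%_. ga t0 v)" by (intro ext insert.prems(4)[OF False])
  thus ?thesis by simp
 qed
 have near: "((%t. (ga t)(u := s t)) \<longlongrightarrow> ga t0) (at t0)"
  if s: "!!t. s t : closed_segment (ga t0 u) (ga t u)" for s
 proof -
  have "((%t. s t - ga t0 u) \<longlongrightarrow> 0) (at t0)"
  proof (rule Lim_null_comparison)
   show "\<forall>\<^sub>F t in at t0. norm (s t - ga t0 u) <= norm (ga t u - ga t0 u)"
    using segment_bound(1)[OF s] by (intro always_eventually) (auto simp: norm_minus_commute)
   show "((%t. norm (ga t u - ga t0 u)) \<longlongrightarrow> 0) (at t0)"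
    using cont[of u] by (intro tendsto_norm_zero) (simp add: LIM_zero)
  qed
  hence "(s \<longlongrightarrow> ga t0 u) (at t0)" by (rule LIM_zero_cancel)
  hence "((%t. ((ga t)(u := s t)) v) \<longlongrightarrow> ga t0 v) (at t0)" for v
   using cont[of v] by (cases "v = u") simp_all
  thus ?thesis unfolding tendsto_fun_iff by blast
 qed
 have u: "u : K'" using insert.prems(1) by simp
 have "EX s. s : closed_segment (ga t0 u) (ga t u) & ((ga t)(u := s) : U -->
  F (ga t) - F (ga2 t) = (ga t u - ga t0 u) * pdiff u F ((ga t)(u := s)))" for t
 proof (cases "ALL s:closed_segment (ga t0 u) (ga t u). (ga t)(u := s) : U")
  case True
  have "EX s:closed_segment (ga t0 u) (ga t u). F ((ga t)(u := ga t u)) - F ((ga t)(u := ga t0 u)) =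
   (ga t u - ga t0 u) * pdiff u F ((ga t)(u := s))"
   by (rule mvt_closed_segment[where f = "%s. F ((ga t)(u := s))"])
    (use Cinf_on_has_pdiff[OF F u] True in \<open>force simp: has_pdiff_def\<close>)
  thus ?thesis by (auto simp: ga2_def)
 qed blast
 then obtain s where s: "!!t. s t : closed_segment (ga t0 u) (ga t u)"
  "!!t. (ga t)(u := s t) : U ==> F (ga t) - F (ga2 t) = (ga t u - ga t0 u) * pdiff u F ((ga t)(u := s t))"
  by metis
 have good: "\<forall>\<^sub>F t in at t0. (ga t)(u := s t) : U" by (rule topological_tendstoD[OF near[OF s(1)] U insert.prems(2)])
 have lim: "((%t. pdiff u F ((ga t)(u := s t))) \<longlongrightarrow> pdiff u F (ga t0)) (at t0)"
  using continuous_on_tendsto_compose[OF Cinf_on_continuous[OF Cinf_on_pdiff[OF F u]] near[OF s(1)] insert.prems(2)] good by blast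
 have q: "((%t. (ga t u - ga t0 u) / (t - t0)) \<longlongrightarrow> ga' u) (at t0)"
  using insert.prems(3)[of u] by (simp add: has_field_derivative_iff)
 have "((%t. pdiff u F ((ga t)(u := s t)) * ((ga t u - ga t0 u) / (t - t0))) \<longlongrightarrow> pdiff u F (ga t0) * ga' u) (at t0)"
  by (rule tendsto_mult[OF lim q])
 moreover have "\<forall>\<^sub>F t in at t0. pdiff u F ((ga t)(u := s t)) * ((ga t u - ga t0 u) / (t - t0)) = ((F (ga t) - F (ga2 t)) - (F (ga t0) - F (ga2 t0))) / (t - t0)"
  using good by (rule eventually_mono) (use s(2) in \<open>simp add: ga20 mult.commute\<close>)
 ultimately have "((%t. F (ga t) - F (ga2 t)) has_real_derivative pdiff u F (ga t0) * ga' u) (at t0)"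
  unfolding has_field_derivative_iff by (rule Lim_transform_eventually)
 from DERIV_add[OF this IH] show ?case using insert.hyps by simp
qed

section \<open>Cells and charts of the Grassmannian\<close>

lemma lookup_scaleR [simp]:
 "lk (c *\<^sub>R v) a = c * lk v a" for v :: "'a \<Rightarrow>\<^sub>0 real"
proof -
 have "finite {a. c *\<^sub>R lk v a ~= 0}"
  by (rule finite_subset[OF _ finite_keys[of v]]) (auto simp: in_keys_iff)
 thus ?thesis by (simp add: scaleR_poly_mapping_def)
qed

lemma lookup_row_vec: "lk (row_vec n A p) a = (if a : {1..n} then A p a else 0)"
 unfolding row_vec_def lookup_sum lookup_single by (auto simp: when_def)

lemma row_span_iff:
 "v : row_span k n A <->
  (EX c. ALL a. lk v a = (if a : {1..n} then SUM p:{1..k}. c p * A p a else 0))" (is "_ <-> ?R v")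
proof
 assume "v : row_span k n A"
 hence "v : span (row_vec n A ` {1..k})" by (simp add: row_span_def)
 thus "?R v"
 proof (rule real_vector.span_induct)
  show "subspace {v. ?R v}"
  proof (rule real_vector.subspaceI)
   show "0 : {v. ?R v}" by (auto intro!: exI[of _ "%_. 0"])
  next
   fix v w assume "v : {v. ?R v}" "w : {v. ?R v}"
   then obtain c d where cd: "ALL a. lk v a = (if a : {1..n} then SUM p:{1..k}. c p * A p a else 0)"
    "ALL a. lk w a = (if a : {1..n} then SUM p:{1..k}. d p * A p a else 0)" by auto
   have "ALL a. lk (v + w) a = (if a : {1..n} then SUM p:{1..k}. (c p + d p) * A p a else 0)"
    using cd by (simp add: lookup_add sum.distrib ring_distribs)
   thus "v + w : {v. ?R v}" by (intro CollectI exI)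
  next
   fix v and r :: real assume "v : {v. ?R v}"
   then obtain c where cd: "ALL a. lk v a = (if a : {1..n} then SUM p:{1..k}. c p * A p a else 0)" by auto
   have "ALL a. lk (r *\<^sub>R v) a = (if a : {1..n} then SUM p:{1..k}. (r * c p) * A p a else 0)"
    using cd by (simp add: sum_distrib_left mult.assoc)
   thus "r *\<^sub>R v : {v. ?R v}" by (intro CollectI exI)
  qed
 next
  fix x assume "x : row_vec n A ` {1..k}"
  then obtain q where q: "q : {1..k}" "x = row_vec n A q" by auto
  show "?R x"
   unfolding q(2)
  proof (intro exI allI)
   show "lk (row_vec n A q) a = (if a : {1..n} then SUM p:{1..k}. (if p = q then 1 else 0) * A p a else 0)" for a
    using q(1) sum.delta[of "{1..k}" q "%p. A p a"] by (simp add: lookup_row_vec if_distrib[of "%x. x * _"] cong: if_cong)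
  qed
 qed
next
 assume "?R v"
 then obtain c where c: "!!a. lk v a = (if a : {1..n} then SUM p:{1..k}. c p * A p a else 0)" by blast
 have "v = (SUM p:{1..k}. c p *\<^sub>R row_vec n A p)"
  by (rule poly_mapping_eqI) (auto simp: c lookup_sum lookup_row_vec)
 also have "... : row_span k n A" unfolding row_span_def
  by (intro real_vector.span_sum real_vector.span_scale real_vector.span_base) auto
 finally show "v : row_span k n A" .
qed

lemma elt_bij: "finite I ==> bij_betw (elt I) {1..card I} I"
proof -
 assume I: "finite I"
 have b: "bij_betw ((!) (sorted_list_of_set I)) {..<card I} I"
  by (rule bij_betw_nth) (use I in auto)
 have "bij_betw (%p. p - 1) {1..card I} {..<card I}"
  by (rule bij_betw_byWitness[where f' = Suc]) auto
 from bij_betw_trans[OF this b] show ?thesis by (simp add: elt_def[abs_def] o_def)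
qed

lemma matrix_row_span:
 assumes "!!q. q : {1..k} ==> (!!a. a : {1..n} ==> B q a = (SUM p:{1..k}. C q p * A p a))"
 shows "row_span k n B <= row_span k n A"
proof
 fix v assume "v : row_span k n B"
 then obtain c where c: "!!a. lk v a = (if a : {1..n} then SUM p:{1..k}. c p * B p a else 0)"
  unfolding row_span_iff by blast
 show "v : row_span k n A" unfolding row_span_iff
 proof (intro exI allI)
  fix a
  show "lk v a = (if a : {1..n} then SUM p:{1..k}. (SUM q:{1..k}. c q * C q p) * A p a else 0)"
  proof (cases "a : {1..n}")
   case True
   have "(SUM q:{1..k}. c q * B q a) = (SUM q:{1..k}. SUM p:{1..k}. c q * C q p * A p a)"
    using True by (intro sum.cong) (auto simp: assms sum_distrib_left mult.assoc)
   also have "... = (SUM p:{1..k}. (SUM q:{1..k}. c q * C q p) * A p a)"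
    by (subst sum.swap) (simp add: sum_distrib_right)
   finally show ?thesis using True by (simp add: c)
  next
   case False
   thus ?thesis using c[of a] by (simp only: if_False)
  qed
 qed
qed

definition minor_mat :: "nat => nat set => (nat => nat => real) => real mat" where
 "minor_mat k I A = Matrix.mat k k (%(r, c). A (r + 1) (elt I (c + 1)))"

lemma minor_eq: "minor k I A = Determinant.det (minor_mat k I A)"
 by (simp add: minor_def minor_mat_def)

lemma minor_mat_carrier [simp]: "minor_mat k I A : carrier_mat k k"
 by (simp add: minor_mat_def)

text \<open>The entries of the matrix with the same row span and identity columns \<open>I\<close>,
  for a nonzero minor. The form with the adjugate shows that they are smooth in the entries of
  \<open>A\<close>.\<close>

definition row_reduce :: "nat => nat set => (nat => nat => real) => nat \<times> nat => real" where
 "row_reduce k I A = (%(p, j). (SUM q:{1..k}. adj_mat (minor_mat k I A) $$ (p - 1, q - 1) * A q j) * inverse (minor k I A))"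

lemma sum_shift: "(SUM r:{0..<k}. f (Suc r)) = (SUM p:{1..k}. f p)" for f :: "nat => 'a::comm_monoid_add"
 by (rule sum.reindex_bij_betw) (rule bij_betw_byWitness[where f' = "%p. p - 1"]; auto)

lemma cell_matrix_in: "finite I ==> p : {1..card I} ==> q : {1..card I} ==>
  cell_matrix I x p (elt I q) = (if p = q then 1 else 0)"
 using inj_on_eq_iff[OF bij_betw_imp_inj_on[OF elt_bij[of I]], of q p] bij_betwE[OF elt_bij[of I]]
 by (simp add: cell_matrix_def eq_commute[of p q])

context
 fixes k n :: nat and I :: "nat set"
 assumes I: "I <= {1..n}" and kI: "card I = k"
begin

lemma finite_index: "finite I"
 using I by (rule finite_subset) simp

lemma elt_image: "p : {1..k} ==> elt I p : I"
 using bij_betwE[OF elt_bij[OF finite_index]] kI by simp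

lemma elt_obtain: assumes "i : I" obtains p where "p : {1..k}" "i = elt I p"
proof -
 have "i : elt I ` {1..k}" using bij_betw_imp_surj_on[OF elt_bij[OF finite_index]] kI assms by simp
 thus thesis by (rule imageE) (rule that)
qed

lemma elt_eq_iff: "p : {1..k} ==> q : {1..k} ==> elt I p = elt I q <-> p = q"
 using inj_on_eq_iff[OF bij_betw_imp_inj_on[OF elt_bij[OF finite_index]], of p q] kI by simp

lemma cell_matrix_elt: "p : {1..k} ==> q : {1..k} ==> cell_matrix I x p (elt I q) = (if p = q then 1 else 0)"
 using cell_matrix_in[OF finite_index] kI by simp

text \<open>The identity columns force the coefficients: a vector of the span is the combination of
  the rows with its own entries at \<open>I\<close>.\<close>

lemma cell_param_iff:
 "v : cell_param k n I x <-> (ALL a. lk v a =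
  (if a : {1..n} then SUM p:{1..k}. lk v (elt I p) * cell_matrix I x p a else 0))"
proof
 assume "v : cell_param k n I x"
 then obtain c where c: "!!a. lk v a = (if a : {1..n} then SUM p:{1..k}. c p * cell_matrix I x p a else 0)"
  unfolding cell_param_def row_span_iff by blast
 have "lk v (elt I q) = c q" if "q : {1..k}" for q
 proof -
  have "(SUM p:{1..k}. c p * cell_matrix I x p (elt I q)) = (SUM p:{1..k}. if p = q then c p else 0)"
   by (rule sum.cong[OF refl]) (simp add: cell_matrix_elt[OF _ that])
  thus ?thesis using c[of "elt I q"] elt_image[OF that] I that by auto
 qed
 thus "ALL a. lk v a =
  (if a : {1..n} then SUM p:{1..k}. lk v (elt I p) * cell_matrix I x p a else 0)"
  using c by simp
next
 assume "ALL a. lk v a =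
  (if a : {1..n} then SUM p:{1..k}. lk v (elt I p) * cell_matrix I x p a else 0)"
 thus "v : cell_param k n I x" unfolding cell_param_def row_span_iff
  by (intro exI[of _ "%p. lk v (elt I p)"])
qed

lemma cell_matrix_graph:
 assumes a: "a : I"
 shows "(SUM p:{1..k}. g (elt I p) * cell_matrix I x p a) = g a"
proof -
 from a obtain q where q: "q : {1..k}" "a = elt I q" by (rule elt_obtain)
 have "(SUM p:{1..k}. g (elt I p) * cell_matrix I x p (elt I q)) = (SUM p:{1..k}. if p = q then g (elt I p) else 0)"
  by (rule sum.cong[OF refl]) (simp add: cell_matrix_elt[OF _ q(1)])
 thus ?thesis using q by simp
qed

text \<open>The subspace is the graph of a linear map from the coordinates in \<open>I\<close> to
  the remaining ones.\<close>

lemma cell_graph: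
 "v : cell_param k n I x <-> (ALL a. a ~: {1..n} --> lk v a = 0) &
  (ALL j:{1..n} - I. lk v j = (SUM p:{1..k}. lk v (elt I p) * x (p, j)))"
proof -
 have sum: "(SUM p:{1..k}. lk v (elt I p) * cell_matrix I x p j) =
   (SUM p:{1..k}. lk v (elt I p) * x (p, j))" if "j ~: I" for j
  using that by (simp add: cell_matrix_def)
 show ?thesis unfolding cell_param_iff
 proof (intro iffI conjI allI impI ballI)
  fix a assume h: "ALL a. lk v a =
   (if a : {1..n} then SUM p:{1..k}. lk v (elt I p) * cell_matrix I x p a else 0)"
  show "a ~: {1..n} ==> lk v a = 0" using h[rule_format, of a] by (simp only: if_False)
  assume "a : {1..n} - I"
  thus "lk v a = (SUM p:{1..k}. lk v (elt I p) * x (p, a))"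
   using h[rule_format, of a] sum[of a] by (simp only: if_True Diff_iff not_False_eq_True)
 next
  fix a assume h: "(ALL a. a ~: {1..n} --> lk v a = 0) &
   (ALL j:{1..n} - I. lk v j = (SUM p:{1..k}. lk v (elt I p) * x (p, j)))"
  show "lk v a =
   (if a : {1..n} then SUM p:{1..k}. lk v (elt I p) * cell_matrix I x p a else 0)"
  proof (cases "a : {1..n}")
   case True
   show ?thesis
   proof (cases "a : I")
    case aI: True
    show ?thesis unfolding if_P[OF True] cell_matrix_graph[OF aI, of "lk v"] ..
   next
    case False
    show ?thesis unfolding if_P[OF True] sum[OF False] using h True False by simp
   qed
  qed (use h in \<open>simp only: if_False simp_thms\<close>)
 qed
qed

lemma row_in_cell_param: "p : {1..k} ==> row_vec n (cell_matrix I x) p : cell_param k n I x"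
 unfolding cell_param_def row_span_def by (intro real_vector.span_base) auto

lemma cell_param_inj:
 assumes "cell_param k n I x <= cell_param k n I y" "u : coord_idx k n I"
 shows "x u = y u"
proof -
 obtain p j where u: "u = (p, j)" "p : {1..k}" "j : {1..n} - I" using assms(2) by auto
 have "row_vec n (cell_matrix I x) p : cell_param k n I y" using row_in_cell_param[OF u(2)] assms(1) by blast
 hence "lk (row_vec n (cell_matrix I x) p) j =
   (SUM q:{1..k}. lk (row_vec n (cell_matrix I x) p) (elt I q) * y (q, j))"
  using u(3) unfolding cell_graph by blast
 also have "... = (SUM q:{1..k}. if q = p then y (q, j) else 0)"
 proof (rule sum.cong[OF refl])
  fix q assume q: "q : {1..k}"
  show "lk (row_vec n (cell_matrix I x) p) (elt I q) * y (q, j) = (if q = p then y (q, j) else 0)"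
   using elt_image[OF q] I cell_matrix_elt[OF u(2) q, of x] by (auto simp: lookup_row_vec)
 qed
 finally show ?thesis using u by (simp add: lookup_row_vec cell_matrix_def)
qed

lemma cell_param_cong:
 assumes "!!u. u : coord_idx k n I ==> x u = y u"
 shows "cell_param k n I x = cell_param k n I y"
proof -
 have "(SUM p:{1..k}. lk v (elt I p) * x (p, j)) = (SUM p:{1..k}. lk v (elt I p) * y (p, j))"
  if "j : {1..n} - I" for v j using that assms by (intro sum.cong) auto
 thus ?thesis by (auto simp: set_eq_iff cell_graph)
qed

lemma subspace_cell_param: "subspace (cell_param k n I x)"
 unfolding cell_param_def row_span_def by (rule real_vector.subspace_span)

lemma dim_unit_vectors:
 assumes X: "subspace X" and g: "!!i. i : I ==> g i : X"
  and unit: "!!i i'. i : I ==> i' : I ==> lk (g i) i' = (if i = i' then 1 else 0)"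
  and ker: "!!v. v : X ==> (!!i. i : I ==> lk v i = 0) ==> v = (0 :: nat \<Rightarrow>\<^sub>0 real)"
 shows "dim X = k"
proof (rule real_vector.dim_unique)
 have inj: "inj_on g I"
 proof (rule inj_onI)
  fix i i' assume a: "i : I" "i' : I" "g i = g i'"
  show "i = i'"
  proof (rule ccontr)
   assume "i ~= i'"
   thus False using unit[OF a(1) a(1)] unit[OF a(2) a(1)] unfolding a(3) by simp
  qed
 qed
 show "card (g ` I) = k" using card_image[OF inj] kI by simp
 show "g ` I <= X" using g by auto
 show "X <= span (g ` I)"
 proof
  fix v assume v: "v : X"
  let ?w = "SUM i:I. lk v i *\<^sub>R g i"
  have "v - ?w = 0"
  proof (rule ker)
   show "v - ?w : X" by (intro real_vector.subspace_diff X v real_vector.subspace_sum real_vector.subspace_scale g)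
   fix i assume i: "i : I"
   have "lk ?w i = (SUM i':I. if i' = i then lk v i' else 0)"
    unfolding lookup_sum by (rule sum.cong[OF refl]) (simp add: unit i)
   thus "lk (v - ?w) i = 0" using i finite_index by (simp add: lookup_minus)
  qed
  hence "v = ?w" by simp
  also have "?w : span (g ` I)" by (intro real_vector.span_sum real_vector.span_scale real_vector.span_base imageI)
  finally show "v : span (g ` I)" .
 qed
 show "independent (g ` I)"
 proof (rule real_vector.independent_if_scalars_zero)
  fix f x assume f: "(SUM x:g ` I. f x *\<^sub>R x) = 0" and "x : g ` I"
  then obtain i where i: "i : I" "x = g i" by auto
  have "(SUM i':I. f (g i') *\<^sub>R g i') = 0" using f unfolding sum.reindex[OF inj] by (simp add: o_def)
  hence "lk (SUM i':I. f (g i') *\<^sub>R g i') i = 0" by simp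
  also have "lk (SUM i':I. f (g i') *\<^sub>R g i') i = (SUM i':I. if i' = i then f (g i') else 0)"
   unfolding lookup_sum by (rule sum.cong[OF refl]) (simp add: unit i)
  finally show "f x = 0" using i finite_index by simp
 qed (use finite_index in simp)
qed

lemma cell_param_zero:
 assumes v: "v : cell_param k n I x" and 0: "!!i. i : I ==> lk v i = 0"
 shows "v = 0"
proof (rule poly_mapping_eqI)
 show "lk v a = lk 0 a" for a
  using v[unfolded cell_param_iff, rule_format, of a] 0[OF elt_image] by simp
qed

lemma cell_param_Gr: "cell_param k n I x : Gr k n"
proof -
 define r where "r i = row_vec n (cell_matrix I x) (the_inv_into {1..k} (elt I) i)" for i
 have r: "r (elt I p) = row_vec n (cell_matrix I x) p" if "p : {1..k}" for p
  using that elt_bij[OF finite_index] kI unfolding r_def by (simp add: the_inv_into_f_f bij_betw_def)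
 have "dim (cell_param k n I x) = k"
 proof (rule dim_unit_vectors[of _ r])
  fix i assume i: "i : I"
  then obtain p where p: "p : {1..k}" "i = elt I p" by (rule elt_obtain)
  show "r i : cell_param k n I x" using row_in_cell_param r p by simp
  fix i' assume "i' : I"
  then obtain q where q: "q : {1..k}" "i' = elt I q" by (rule elt_obtain)
  show "lk (r i) i' = (if i = i' then 1 else 0)"
   using p q r elt_eq_iff[OF p(1) q(1)] cell_matrix_elt[OF p(1) q(1), of x] \<open>i' : I\<close> I by (auto simp: lookup_row_vec)
 qed (use cell_param_zero subspace_cell_param in auto)
 moreover have "Poly_Mapping.keys v <= {1..n}" if "v : cell_param k n I x" for v
  using that unfolding cell_graph by (auto simp: in_keys_iff)
 ultimately show ?thesis unfolding Gr_def using subspace_cell_param by simp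
qed

lemma row_span_eq_cell_param:
 assumes m: "minor k I A ~= 0"
 shows "row_span k n A = cell_param k n I (row_reduce k I A)"
proof -
 let ?D = "minor_mat k I A" let ?C = "adj_mat (minor_mat k I A)" let ?d = "minor k I A"
 let ?B = "cell_matrix I (row_reduce k I A)"
 have Cc: "?C : carrier_mat k k" by (rule adj_mat(1)) simp
 have CD: "(SUM r:{1..k}. ?C $$ (p - 1, r - 1) * A r (elt I q)) = (if p = q then ?d else 0)"
  and DC: "(SUM r:{1..k}. A p (elt I r) * ?C $$ (r - 1, q - 1)) = (if p = q then ?d else 0)"
  if pq: "p : {1..k}" "q : {1..k}" for p q
 proof -
  have i: "p - 1 < k" "q - 1 < k" "p - 1 = q - 1 <-> p = q" using pq by auto
  have "(?C * ?D) $$ (p - 1, q - 1) = (if p = q then ?d else 0)"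
   using adj_mat(3)[OF minor_mat_carrier[of k I A]] i by (simp add: minor_eq)
  moreover have "(?C * ?D) $$ (p - 1, q - 1) = (SUM r:{0..<k}. ?C $$ (p - 1, r) * ?D $$ (r, q - 1))"
   using i Cc by (simp add: scalar_prod_def minor_mat_def)
  moreover have "... = (SUM r:{0..<k}. ?C $$ (p - 1, Suc r - 1) * A (Suc r) (elt I q))"
   using i pq by (intro sum.cong) (auto simp: minor_mat_def)
  ultimately show "(SUM r:{1..k}. ?C $$ (p - 1, r - 1) * A r (elt I q)) = (if p = q then ?d else 0)"
   unfolding sum_shift[of "%r. ?C $$ (p - 1, r - 1) * A r (elt I q)"] by simp
  have "(?D * ?C) $$ (p - 1, q - 1) = (if p = q then ?d else 0)"
   using adj_mat(2)[OF minor_mat_carrier[of k I A]] i by (simp add: minor_eq)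
  moreover have "(?D * ?C) $$ (p - 1, q - 1) = (SUM r:{0..<k}. ?D $$ (p - 1, r) * ?C $$ (r, q - 1))"
   using i Cc by (simp add: scalar_prod_def minor_mat_def)
  moreover have "... = (SUM r:{0..<k}. A p (elt I (Suc r)) * ?C $$ (Suc r - 1, q - 1))"
   using i pq by (intro sum.cong) (auto simp: minor_mat_def)
  ultimately show "(SUM r:{1..k}. A p (elt I r) * ?C $$ (r - 1, q - 1)) = (if p = q then ?d else 0)"
   unfolding sum_shift[of "%r. A p (elt I r) * ?C $$ (r - 1, q - 1)"] by simp
 qed
 have B: "?B q a = (SUM p:{1..k}. (?C $$ (q - 1, p - 1) * inverse ?d) * A p a)" if q: "q : {1..k}" for q a
 proof -
  have e: "(SUM p:{1..k}. (?C $$ (q - 1, p - 1) * inverse ?d) * A p a) = (SUM p:{1..k}. ?C $$ (q - 1, p - 1) * A p a) * inverse ?d"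
   by (simp add: sum_distrib_left sum_distrib_right mult_ac)
  show ?thesis
  proof (cases "a : I")
   case True
   then obtain r where r: "r : {1..k}" "a = elt I r" by (rule elt_obtain)
   show ?thesis unfolding r(2) e[unfolded r(2)] CD[OF q r(1)] cell_matrix_elt[OF q r(1)] using m by simp
  next
   case False
   thus ?thesis unfolding e by (simp add: cell_matrix_def row_reduce_def)
  qed
 qed
 have A: "A q a = (SUM p:{1..k}. A q (elt I p) * ?B p a)" if q: "q : {1..k}" for q a
 proof -
  have "(SUM p:{1..k}. A q (elt I p) * ?B p a) = (SUM p:{1..k}. SUM r:{1..k}. A q (elt I p) * (?C $$ (p - 1, r - 1) * inverse ?d) * A r a)"
   by (intro sum.cong) (auto simp: B sum_distrib_left mult.assoc)
  also have "... = (SUM r:{1..k}. (SUM p:{1..k}. A q (elt I p) * ?C $$ (p - 1, r - 1)) * (inverse ?d * A r a))"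
   by (subst sum.swap) (simp add: sum_distrib_right mult.assoc)
  also have "... = (SUM r:{1..k}. if r = q then A r a else 0)"
  proof (rule sum.cong[OF refl])
   fix r assume r: "r : {1..k}"
   show "(SUM p:{1..k}. A q (elt I p) * ?C $$ (p - 1, r - 1)) * (inverse ?d * A r a) = (if r = q then A r a else 0)"
    unfolding DC[OF q r] using m by simp
  qed
  finally show ?thesis using q by simp
 qed
 show ?thesis unfolding cell_param_def
  by (intro equalityI matrix_row_span[where C = "%q p. A q (elt I p)"]
   matrix_row_span[where C = "%q p. ?C $$ (q - 1, p - 1) * inverse ?d"] A B)
qed

lemma minor_cell_matrix: "minor k I (cell_matrix I x) = 1"
proof -
 have "minor_mat k I (cell_matrix I x) = 1\<^sub>m k"
  by (rule eq_matI) (auto simp: minor_mat_def cell_matrix_elt)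
 thus ?thesis by (simp add: minor_eq)
qed

lemma cell_param_cell: "cell_param k n I x : cell k n I"
 unfolding cell_def using cell_param_Gr minor_cell_matrix[of x] by (auto simp: cell_param_def)

lemma cell_obtain:
 assumes "X : cell k n I" obtains x where "x : extensional (coord_idx k n I)" "X = cell_param k n I x"
proof -
 obtain A where A: "row_span k n A = X" "minor k I A ~= 0" using assms unfolding cell_def by blast
 have "X = cell_param k n I (restrict (row_reduce k I A) (coord_idx k n I))"
  using row_span_eq_cell_param[OF A(2)] A(1) cell_param_cong[of "restrict (row_reduce k I A) (coord_idx k n I)" "row_reduce k I A"] by simp
 thus thesis by (rule that[OF restrict_extensional])
qed

lemma cell_coord_param:
 assumes "(p, j) : coord_idx k n I"
 shows "cell_coord k n I p j (cell_param k n I x) = x (p, j)"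
proof -
 let ?r = "restrict x (coord_idx k n I)"
 have r: "cell_param k n I ?r = cell_param k n I x" by (rule cell_param_cong) auto
 have "(THE y. y : extensional (coord_idx k n I) & cell_param k n I y = cell_param k n I x) = ?r"
 proof (rule the_equality)
  fix y assume y: "y : extensional (coord_idx k n I) & cell_param k n I y = cell_param k n I x"
  show "y = ?r"
   by (rule extensionalityI[of _ "coord_idx k n I"]) (use y cell_param_inj[of y ?r] r in auto)
 qed (use r in simp)
 thus ?thesis unfolding cell_coord_def using cell_param_cell assms by simp
qed

end

section \<open>Transition maps and overlaps of charts\<close>

lemma Cinf_on_det:
 assumes U: "open U" and M: "!!x. M x : carrier_mat m m"
  and e: "!!i j. i < m ==> j < m ==> Cinf_on K U (%x. M x $$ (i, j))"
 shows "Cinf_on K U (%x. Determinant.det (M x) :: real)"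
 unfolding det_def'[OF M]
proof (intro Cinf_on_sum Cinf_on_mult Cinf_on_const Cinf_on_prod U)
 fix p i assume "p : {p. p permutes {0..<m}}" "i : {0..<m}"
 hence "i < m" "p i < m" using permutes_in_image[of p "{0..<m}" i] by auto
 thus "Cinf_on K U (%x. M x $$ (i, p i))" by (rule e)
qed

lemma Cinf_on_adj_mat:
 assumes U: "open U" and M: "!!x. M x : carrier_mat m m"
  and e: "!!i j. i < m ==> j < m ==> Cinf_on K U (%x. M x $$ (i, j) :: real)"
  and ij: "i < m" "j < m"
 shows "Cinf_on K U (%x. adj_mat (M x) $$ (i, j))"
proof -
 have d: "dim_row (M x) = m" "dim_col (M x) = m" for x using M[of x] by auto
 have eq: "(%x. adj_mat (M x) $$ (i, j)) = (%x. (-1) ^ (j + i) * Determinant.det (mat_delete (M x) j i))"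
  using ij by (simp add: adj_mat_def cofactor_def d)
 show ?thesis unfolding eq
 proof (intro Cinf_on_mult Cinf_on_const U Cinf_on_det[where m = "m - 1"])
  show "mat_delete (M x) j i : carrier_mat (m - 1) (m - 1)" for x using M mat_delete_carrier by blast
  fix r c assume rc: "r < m - 1" "c < m - 1"
  have "(%x. mat_delete (M x) j i $$ (r, c)) = (%x. M x $$ (if r < j then r else Suc r, if c < i then c else Suc c))"
   using rc by (simp add: mat_delete_def d)
  thus "Cinf_on K U (%x. mat_delete (M x) j i $$ (r, c))" using rc by (auto intro: e)
 qed
qed

lemma Cinf_on_cell_matrix: "open U ==> Cinf_on K U (%x. cell_matrix I x p j)"
 unfolding cell_matrix_def by (cases "j : I") (auto intro: Cinf_on_const Cinf_on_coord)

lemma Cinf_on_minor: "open U ==> Cinf_on K U (%x. minor k I' (cell_matrix I x))"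
 unfolding minor_eq by (rule Cinf_on_det[where m = k]) (auto simp: minor_mat_def intro: Cinf_on_cell_matrix)

text \<open>The part of the chart for \<open>I\<close> that lies in the cell of
  \<open>I'\<close>.\<close>

definition covl :: "nat => nat set => nat set => (nat \<times> nat => real) set" where
 "covl k I I' = {x. minor k I' (cell_matrix I x) ~= 0}"

lemma open_covl: "open (covl k I I')"
proof -
 have "continuous_on UNIV (%x. minor k I' (cell_matrix I x))"
  by (rule Cinf_on_continuous[OF Cinf_on_minor[where K = "{}"]]) simp
 from open_Collect_neq[OF this continuous_on_const[of _ 0]] show ?thesis by (simp add: covl_def)
qed

lemma Cinf_on_row_reduce:
 assumes p: "p : {1..k}"
 shows "Cinf_on K (covl k I I') (%x. row_reduce k I' (cell_matrix I x) (p, j))"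
 unfolding row_reduce_def prod.case
proof (intro Cinf_on_mult Cinf_on_sum Cinf_on_inverse open_covl Cinf_on_minor Cinf_on_cell_matrix)
 fix q assume "q : {1..k}"
 thus "Cinf_on K (covl k I I') (%x. adj_mat (minor_mat k I' (cell_matrix I x)) $$ (p - 1, q - 1))"
  using p by (intro Cinf_on_adj_mat[where m = k] open_covl)
   (auto simp: minor_mat_def intro: Cinf_on_cell_matrix[OF open_covl])
qed (simp add: covl_def)

text \<open>The condition on the right says that the projection of the subspace to the coordinates
  in \<open>I'\<close> is injective. If the minor vanishes, a left null vector of it combines the
  rows to a nonzero vector with zero entries at \<open>I'\<close>.\<close>

lemma minor_nonzero_iff:
 assumes I: "I <= {1..n}" "card I = k" and I': "I' <= {1..n}" "card I' = k"
 shows "minor k I' (cell_matrix I x) ~= 0 <->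
  (ALL v:cell_param k n I x. (ALL i:I'. lk v i = 0) --> v = 0)" (is "_ <-> ?R")
proof
 assume "minor k I' (cell_matrix I x) ~= 0"
 from row_span_eq_cell_param[OF I' this] have e: "cell_param k n I x = cell_param k n I' (row_reduce k I' (cell_matrix I x))"
  by (simp add: cell_param_def)
 show ?R unfolding e
 proof (intro ballI impI)
  fix v assume v: "v : cell_param k n I' (row_reduce k I' (cell_matrix I x))" "ALL i:I'. lk v i = 0"
  show "v = 0" by (rule cell_param_zero[OF I' v(1)]) (use v(2) in blast)
 qed
next
 assume R: ?R
 show "minor k I' (cell_matrix I x) ~= 0"
 proof
  let ?M = "minor_mat k I' (cell_matrix I x)"
  assume "minor k I' (cell_matrix I x) = 0"
  hence "Determinant.det (?M\<^sup>T) = 0" by (simp add: minor_eq det_transpose[of _ k])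
  then obtain c where c: "c : carrier_vec k" "c ~= 0\<^sub>v k" "?M\<^sup>T *\<^sub>v c = 0\<^sub>v k"
   using det_0_iff_vec_prod_zero_field[of "?M\<^sup>T" k] by auto
  define v where "v = (SUM p:{1..k}. (vec_index c (p - 1)) *\<^sub>R row_vec n (cell_matrix I x) p)"
  have vX: "v : cell_param k n I x" unfolding v_def cell_param_def row_span_def
   by (intro real_vector.span_sum real_vector.span_scale real_vector.span_base) auto
  have lv: "lk v a = (SUM p:{1..k}. vec_index c (p - 1) * cell_matrix I x p a)" if "a : {1..n}" for a
   using that by (simp add: v_def lookup_sum lookup_row_vec)
  have "v = 0"
  proof (rule R[rule_format, OF vX])
   fix i assume i: "i : I'"
   then obtain q where q: "q : {1..k}" "i = elt I' q" by (rule elt_obtain[OF I'])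
   have "vec_index (?M\<^sup>T *\<^sub>v c) (q - 1) = (SUM r:{0..<k}. vec_index c (Suc r - 1) * cell_matrix I x (Suc r) (elt I' q))"
    using q c(1) by (auto simp: scalar_prod_def minor_mat_def mult.commute intro!: sum.cong)
   also have "... = lk v i"
    unfolding sum_shift[of "%r. vec_index c (r - 1) * cell_matrix I x r (elt I' q)"] using lv[of i] i I' q by auto
   finally have "lk v i = vec_index (0\<^sub>v k) (q - 1)" using c(3) by simp
   moreover have "q - 1 < k" using q(1) by auto
   ultimately show "lk v i = 0" by (simp only: index_zero_vec)
  qed
  have "vec_index c r = 0" if r: "r < k" for r
  proof -
   have q: "Suc r : {1..k}" using r by simp
   have "elt I (Suc r) : {1..n}" using elt_image[OF I q] I(1) by blast
   hence "lk v (elt I (Suc r)) = (SUM p:{1..k}. vec_index c (p - 1) * cell_matrix I x p (elt I (Suc r)))"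
    by (rule lv)
   also have "... = (SUM p:{1..k}. if p = Suc r then vec_index c (p - 1) else 0)"
    by (rule sum.cong[OF refl]) (simp add: cell_matrix_elt[OF I _ q])
   finally have "lk v (elt I (Suc r)) = (SUM p:{1..k}. if p = Suc r then vec_index c (p - 1) else 0)" .
   thus ?thesis using q \<open>v = 0\<close> by simp
  qed
  hence "c = 0\<^sub>v k" using c(1) by (intro eq_vecI) auto
  thus False using c(2) by simp
 qed
qed

lemma cell_param_in_cell_iff:
 assumes I: "I <= {1..n}" "card I = k" and I': "I' <= {1..n}" "card I' = k"
 shows "cell_param k n I x : cell k n I' <-> x : covl k I I'"
proof
 assume "cell_param k n I x : cell k n I'"
 then obtain y where y: "cell_param k n I x = cell_param k n I' y" by (rule cell_obtain[OF I'])
 have "minor k I' (cell_matrix I x) ~= 0" unfolding minor_nonzero_iff[OF I I'] y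
 proof (intro ballI impI)
  fix v assume v: "v : cell_param k n I' y" "ALL i:I'. lk v i = 0"
  show "v = 0" by (rule cell_param_zero[OF I' v(1)]) (use v(2) in blast)
 qed
 thus "x : covl k I I'" by (simp add: covl_def)
next
 assume "x : covl k I I'"
 thus "cell_param k n I x : cell k n I'"
  using cell_param_Gr[OF I, of x] unfolding cell_def covl_def cell_param_def by blast
qed

lemma cell_preimage:
 assumes "I <= {1..n}" "card I = k" "I' <= {1..n}" "card I' = k"
 shows "{x. cell_param k n I x : cell k n I'} = covl k I I'"
 using cell_param_in_cell_iff[OF assms] by blast

lemma cell_param_transition:
 assumes I: "I <= {1..n}" "card I = k" and I': "I' <= {1..n}" "card I' = k" and x: "x : covl k I I'"
 shows "cell_param k n I x = cell_param k n I' (row_reduce k I' (cell_matrix I x))"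
proof -
 have "minor k I' (cell_matrix I x) ~= 0" using x by (simp add: covl_def)
 from row_span_eq_cell_param[OF I' this] show ?thesis by (simp add: cell_param_def)
qed

lemma cell_coord_smooth:
 assumes I: "I <= {1..n}" "card I = k" and pj: "p : {1..k}" "j : {1..n} - I"
 shows "cell_coord k n I p j : Gr_smooth k n (cell k n I)"
 unfolding Gr_smooth_def
proof (intro CollectI conjI allI impI)
 show "cell_coord k n I p j : extensional (cell k n I)" unfolding cell_coord_def by simp
 fix I' assume I': "I' <= {1..n} & card I' = k"
 hence I'': "I' <= {1..n}" "card I' = k" by auto
 show "Cinf_on (coord_idx k n I') {x. cell_param k n I' x : cell k n I} (%x. cell_coord k n I p j (cell_param k n I' x))"
  unfolding cell_preimage[OF I'' I]
 proof (rule Cinf_on_cong[OF open_covl, THEN iffD2, OF _ Cinf_on_row_reduce[OF pj(1)]])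
  fix x assume "x : covl k I' I"
  from cell_param_transition[OF I'' I this] show "cell_coord k n I p j (cell_param k n I' x) = row_reduce k I (cell_matrix I' x) (p, j)"
   using cell_coord_param[OF I] pj by simp
 qed
qed

lemma Gr_unit_basis_cell:
 assumes I: "I <= {1..n}" and X: "X : Gr k n" and g: "!!i. i : I ==> g i : X"
  and unit: "!!i i'. i : I ==> i' : I ==> lk (g i) i' = (if i = i' then 1 else 0)"
  and ker: "!!v. v : X ==> (!!i. i : I ==> lk v i = 0) ==> v = 0"
 shows "card I = k & X : cell k n I"
proof -
 have sub: "subspace X" "dim X = k" "!!v. v : X ==> Poly_Mapping.keys v <= {1..n}" using X unfolding Gr_def by auto
 have "dim X = card I"
 proof (rule dim_unit_vectors[OF I refl sub(1), of g])
  fix v assume "v : X" "!!i. i : I ==> lk v i = 0"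
  thus "v = 0" by (rule ker)
 qed (rule g unit; assumption)+
 hence k: "card I = k" using sub(2) by (rule trans[OF sym])
 let ?x = "%(p, j). lk (g (elt I p)) j"
 have gi: "!!p. p : {1..k} ==> g (elt I p) : X" using g elt_image[OF I k] by blast
 have expand: "v = (SUM p:{1..k}. lk v (elt I p) *\<^sub>R g (elt I p))" if v: "v : X" for v
 proof -
  let ?w = "SUM p:{1..k}. lk v (elt I p) *\<^sub>R g (elt I p)"
  have "v - ?w = 0"
  proof (rule ker)
   show "v - ?w : X" by (intro real_vector.subspace_diff sub(1) v real_vector.subspace_sum real_vector.subspace_scale gi)
   fix i assume "i : I"
   then obtain q where q: "q : {1..k}" "i = elt I q" by (rule elt_obtain[OF I k])
   have "lk ?w (elt I q) = (SUM p:{1..k}. if p = q then lk v (elt I p) else 0)"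
    unfolding lookup_sum by (rule sum.cong[OF refl])
     (simp add: unit[OF elt_image[OF I k] elt_image[OF I k q(1)]] elt_eq_iff[OF I k _ q(1)])
   thus "lk (v - ?w) i = 0" using q by (simp add: lookup_minus)
  qed
  thus ?thesis by simp
 qed
 have "X = cell_param k n I ?x"
 proof (rule Set.set_eqI)
  fix v
  show "v : X <-> v : cell_param k n I ?x"
  proof
   assume v: "v : X"
   have l: "lk v a = (SUM p:{1..k}. lk v (elt I p) * lk (g (elt I p)) a)" for a
    using arg_cong[OF expand[OF v], of "%v. lk v a"] by (simp add: lookup_sum)
   show "v : cell_param k n I ?x" unfolding cell_graph[OF I k]
   proof (intro conjI allI ballI impI)
    show "lk v a = 0" if "a ~: {1..n}" for a using sub(3)[OF v] that by (auto simp: in_keys_iff)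
    show "lk v j = (SUM p:{1..k}. lk v (elt I p) * ?x (p, j))" for j using l[of j] by simp
   qed
  next
   assume v: "v : cell_param k n I ?x"
   let ?w = "SUM p:{1..k}. lk v (elt I p) *\<^sub>R g (elt I p)"
   have w: "?w : X" by (intro sub(1) real_vector.subspace_sum real_vector.subspace_scale gi)
   have "v = ?w"
   proof (rule poly_mapping_eqI)
    fix a
    consider "a ~: {1..n}" | "a : I" | "a : {1..n} - I" by blast
    thus "lk v a = lk ?w a"
    proof cases
     case 1
     have "lk ?w a = 0" using sub(3)[OF w] 1 by (auto simp: in_keys_iff)
     thus ?thesis using v 1 unfolding cell_graph[OF I k] by simp
    next
     case 2
     then obtain q where q: "q : {1..k}" "a = elt I q" by (rule elt_obtain[OF I k])
     have "lk ?w (elt I q) = (SUM p:{1..k}. if p = q then lk v (elt I p) else 0)"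
      unfolding lookup_sum by (rule sum.cong[OF refl])
       (simp add: unit[OF elt_image[OF I k] elt_image[OF I k q(1)]] elt_eq_iff[OF I k _ q(1)])
     thus ?thesis using q by simp
    next
     case 3
     thus ?thesis using v unfolding cell_graph[OF I k] by (simp add: lookup_sum)
    qed
   qed
   thus "v : X" using w by simp
  qed
 qed
 thus ?thesis using k cell_param_cell[OF I k, of ?x] by simp
qed

text \<open>\<open>I\<close> is a smallest set of indices such that only the zero vector of
  \<open>X\<close> vanishes on it. By minimality every \<open>i\<close> in \<open>I\<close> has a
  vector of \<open>X\<close> that vanishes on the rest of \<open>I\<close> and not at
  \<open>i\<close>; scaled to 1 at \<open>i\<close>, these vectors are the rows of the matrix in the
  chart.\<close>

lemma Gr_cell_cover:
 assumes X: "X : Gr k n"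
 obtains I where "I <= {1..n}" "card I = k" "X : cell k n I"
proof -
 have sub: "subspace X" "!!v. v : X ==> Poly_Mapping.keys v <= {1..n}" using X unfolding Gr_def by auto
 define Q where "Q I <-> I <= {1..n} & (ALL v:X. (ALL i:I. lk v i = 0) --> v = 0)" for I
 have "Q {1..n}" unfolding Q_def
 proof (intro conjI ballI impI subset_refl)
  fix v assume v: "v : X" "ALL i:{1..n}. lk v i = 0"
  show "v = 0"
  proof (rule poly_mapping_eqI)
   show "lk v a = lk 0 a" for a
    using v(2) sub(2)[OF v(1)] by (cases "a : {1..n}") (auto simp: in_keys_iff)
  qed
 qed
 from ex_has_least_nat[of Q, OF this, of card] obtain I where I: "Q I" and min: "!!I'. Q I' ==> card I <= card I'" by blast
 have In: "I <= {1..n}" and ker: "!!v. v : X ==> (!!i. i : I ==> lk v i = 0) ==> v = 0"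
  using I unfolding Q_def by auto
 have fI: "finite I" using In by (rule finite_subset) simp
 have "EX g. g : X & (ALL i':I. lk g i' = (if i = i' then 1 else 0))" if i: "i : I" for i
 proof -
  have "~ Q (I - {i})" using min[of "I - {i}"] card_Diff1_less[OF fI i] by auto
  hence "~ (ALL v:X. (ALL i':I - {i}. lk v i' = 0) --> v = 0)"
   unfolding Q_def using subset_trans[OF Diff_subset In, of "{i}"] by (simp only: simp_thms)
  hence "EX v:X. (ALL i':I - {i}. lk v i' = 0) & v ~= 0"
   by (simp only: ball_simps not_all not_imp Bex_def)
  then obtain v where "v : X" "(ALL i':I - {i}. lk v i' = 0) & v ~= 0" by (rule bexE)
  hence v: "v : X" "ALL i':I - {i}. lk v i' = 0" "v ~= 0" by iprover+
  have "lk v i ~= 0"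
  proof
   assume 0: "lk v i = 0"
   have "v = 0" by (rule ker[OF v(1)]) (use v(2) 0 in blast)
   thus False using v(3) by simp
  qed
  thus ?thesis using v by (intro exI[of _ "inverse (lk v i) *\<^sub>R v"] conjI ballI real_vector.subspace_scale sub(1)) auto
 qed
 hence "ALL i:I. EX g. g : X & (ALL i':I. lk g i' = (if i = i' then 1 else 0))" by (rule ballI)
 from bchoice[OF this] obtain g where g: "ALL i:I. g i : X & (ALL i':I. lk (g i) i' = (if i = i' then 1 else 0))"
  by (rule exE)
 have "card I = k & X : cell k n I"
 proof (rule Gr_unit_basis_cell[OF In X, of g])
  fix i assume i: "i : I"
  from bspec[OF g i] show "g i : X" by (rule conjunct1)
  fix i' assume "i' : I"
  with bspec[OF g i, THEN conjunct2] show "lk (g i) i' = (if i = i' then 1 else 0)" by (rule bspec)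
 next
  fix v assume "v : X" "!!i. i : I ==> lk v i = 0"
  thus "v = 0" by (rule ker)
 qed
 with In show thesis by (intro that) iprover+
qed

text \<open>A bijection from \<open>I - I'\<close> to \<open>I' - I\<close> gives a matrix with
  identity columns \<open>I\<close> in which the columns \<open>I'\<close> form a permutation
  matrix.\<close>

lemma cells_meet:
 assumes I: "I <= {1..n}" "card I = k" and I': "I' <= {1..n}" "card I' = k"
 shows "EX y. y : covl k I I'"
proof -
 have fin: "finite I" "finite I'" using I(1) I'(1) finite_subset by blast+
 have "card (I - I') = card (I' - I)"
 proof -
  have "card (I - I') + card (I Int I') = k" "card (I' - I) + card (I Int I') = k"
   using card_Diff_subset_Int[of I I'] card_Diff_subset_Int[of I' I] fin I(2) I'(2)
    card_mono[of I "I Int I'"] card_mono[of I' "I Int I'"] by (auto simp: Int_commute)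
  thus ?thesis by simp
 qed
 then obtain s where s: "bij_betw s (I - I') (I' - I)"
  using finite_same_card_bij[of "I - I'" "I' - I"] fin by auto
 let ?y = "%(p, j). if elt I p : I - I' & j = s (elt I p) then 1 else 0 :: real"
 have "minor k I' (cell_matrix I ?y) ~= 0" unfolding minor_nonzero_iff[OF I I']
 proof (intro ballI impI)
  fix v assume v: "v : cell_param k n I ?y" and 0: "ALL i:I'. lk v i = 0"
  show "v = 0"
  proof (rule cell_param_zero[OF I v])
   fix i assume i: "i : I"
   show "lk v i = 0"
   proof (cases "i : I'")
    case False
    hence si: "s i : I'" "s i : {1..n} - I" using i bij_betwE[OF s] I'(1) by auto
    obtain q where q: "q : {1..k}" "i = elt I q" using i by (rule elt_obtain[OF I])
    have iff: "elt I p : I - I' & s i = s (elt I p) <-> p = q" if p: "p : {1..k}" for p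
     using inj_on_eq_iff[OF bij_betw_imp_inj_on[OF s], of i "elt I p"] i False q elt_eq_iff[OF I p q(1)] by auto
    have "lk v (s i) = (SUM p:{1..k}. lk v (elt I p) * ?y (p, s i))"
     using v si(2) unfolding cell_graph[OF I] by blast
    also have "... = (SUM p:{1..k}. if p = q then lk v (elt I p) else 0)"
     by (rule sum.cong[OF refl]) (simp only: prod.case iff mult_1_right mult_zero_right if_distrib[of "%z. _ * z"])
    finally show ?thesis using q 0 si by simp
   qed (use 0 in blast)
  qed
 qed
 thus ?thesis unfolding covl_def by blast
qed

text \<open>On the line from any point to a point of the overlap the minor is a polynomial that does
  not vanish identically, so it is nonzero arbitrarily close to the given point.\<close>

lemma covl_dense:
 assumes I: "I <= {1..n}" "card I = k" and I': "I' <= {1..n}" "card I' = k"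
 shows "closure (covl k I I') = UNIV"
proof -
 obtain y where y: "y : covl k I I'" using cells_meet[OF assms] by blast
 have "x : closure (covl k I I')" for x
 proof -
  define ga where "ga t = (%u. x u + t * (y u - x u))" for t :: real
  have "EX P. ALL t. cell_matrix I (ga t) p j = poly P t" for p j
   by (rule exI[of _ "[:cell_matrix I x p j, if j : I then 0 else y (p, j) - x (p, j):]"])
    (simp add: cell_matrix_def ga_def)
  then obtain P where P: "!!p j t. cell_matrix I (ga t) p j = poly (P p j) t" by metis
  define D where "D = (SUM sm:{sm. sm permutes {0..<k}}. Polynomial.smult (signof sm) (\<Prod>i=0..<k. P (i + 1) (elt I' (sm i + 1))))"
  have D: "minor k I' (cell_matrix I (ga t)) = poly D t" for t
  proof -
   have "(\<Prod>i = 0..<k. minor_mat k I' (cell_matrix I (ga t)) $$ (i, sm i)) = (\<Prod>i=0..<k. poly (P (i + 1) (elt I' (sm i + 1))) t)"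
    if "sm permutes {0..<k}" for sm
    using permutes_in_image[OF that] by (intro prod.cong) (auto simp: minor_mat_def P)
   thus ?thesis unfolding minor_eq det_def'[OF minor_mat_carrier] D_def by (simp add: poly_sum poly_prod)
  qed
  have "ga 1 = y" by (simp add: ga_def)
  hence "poly D 1 ~= 0" using D[of 1] y by (simp add: covl_def)
  hence "D ~= 0" by auto
  hence fin: "finite {t. poly D t = 0}" by (rule poly_roots_finite)
  have "open (- ({t. poly D t = 0} - {0}))" by (intro open_Compl finite_imp_closed finite_Diff fin)
  hence "eventually (%t. t : - ({t. poly D t = 0} - {0})) (nhds 0)"
   by (rule eventually_nhds_in_open) simp
  hence ev: "eventually (%t. ga t : covl k I I') (at 0)"
   unfolding eventually_at_filter by (rule eventually_mono) (auto simp: covl_def D)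
  have "((%t. ga t) \<longlongrightarrow> x) (at 0)"
   unfolding tendsto_fun_iff ga_def
  proof
   fix u
   have "((%t. x u + t * (y u - x u)) \<longlongrightarrow> x u + 0 * (y u - x u)) (at 0)" by (intro tendsto_intros)
   thus "((%t. x u + t * (y u - x u)) \<longlongrightarrow> x u) (at 0)" by simp
  qed
  moreover have "eventually (%t. ga t : closure (covl k I I')) (at 0)"
   using ev by (rule eventually_mono) (rule subsetD[OF closure_subset])
  ultimately show ?thesis by (intro Lim_in_closed_set[OF closed_closure]) simp_all
 qed
 thus ?thesis by blast
qed

section \<open>The Poisson bracket on the Grassmannian\<close>

text \<open>Going around three numbers, the signs of the differences cannot all agree. This is the
  quadratic relation behind the Jacobi identity.\<close>

lemma isgn_triangle:
 "isgn a b * isgn b c + isgn b c * isgn c a + isgn c a * isgn a b = (if a = b & b = c then 0 else -1)"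
 unfolding isgn_def by auto

lemma s_eq_isgn:
 assumes "i ~= j" "i ~= j'" "i' ~= j" "i' ~= j'"
 shows "s_eq i j i' j' = (isgn j' j - isgn j' i' - isgn i j + isgn i i') / 2"
 unfolding s_eq_s_times[OF assms] s_times_isgn[OF assms(2,1,4,3)] by (simp add: field_simps)

lemma s_eq_antisym:
 assumes "i ~= j" "i ~= j'" "i' ~= j" "i' ~= j'"
 shows "s_eq i' j' i j = - s_eq i j i' j'"
 using assms isgn_swap[of j j'] isgn_swap[of i i'] isgn_swap[of i j] isgn_swap[of i' j'] by (simp add: s_eq_isgn field_simps)

lemma s_times_antisym:
 assumes "i ~= j" "i ~= j'" "i' ~= j" "i' ~= j'"
 shows "s_times i' j' i j = - s_times i j i' j'"
 using assms isgn_swap[of j j'] isgn_swap[of i i'] isgn_swap[of j i'] isgn_swap[of j' i]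
 by (simp add: s_times_isgn field_simps)

text \<open>Written with \<open>isgn\<close>, the products group into eight triangles of indices.
  The six triangles that mix \<open>p\<close>, \<open>q\<close>, \<open>r\<close> with
  \<open>j\<close>, \<open>k\<close>, \<open>l\<close> cancel; the two pure ones degenerate when
  their three indices are equal, and this is the right hand side.\<close>

lemma s_eq_cyclic_sum:
 assumes "!!a b. a : {p, q, r} ==> b : {j, k, l} ==> a ~= b"
 shows "s_eq q k r l * s_eq p j r k + s_eq r l p j * s_eq q k p l + s_eq p j q k * s_eq r l q j
  = (of_bool (j = k & k = l) - of_bool (p = q & q = r)) / 4"
proof -
 have ne: "p ~= j" "p ~= k" "p ~= l" "q ~= j" "q ~= k" "q ~= l" "r ~= j" "r ~= k" "r ~= l" by (rule assms; simp)+
 note sw = isgn_swap[of k l] isgn_swap[of j k] isgn_swap[of l j] isgn_swap[of r q] isgn_swap[of p r] isgn_swap[of q p]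
  isgn_swap[of p j] isgn_swap[of p k] isgn_swap[of p l] isgn_swap[of q j] isgn_swap[of q k] isgn_swap[of q l]
  isgn_swap[of r j] isgn_swap[of r k] isgn_swap[of r l]
 note tri = isgn_triangle[of l k j] isgn_triangle[of q r p] isgn_triangle[of l k r] isgn_triangle[of k j q]
  isgn_triangle[of j l p] isgn_triangle[of q r k] isgn_triangle[of r p l] isgn_triangle[of p q j]
 define A B C a b c where v: "A = isgn l k" "B = isgn k j" "C = isgn j l" "a = isgn q r" "b = isgn r p" "c = isgn p q"
 define jp jq jr kp kq kr lp lq lr where w: "jp = isgn j p" "jq = isgn j q" "jr = isgn j r" "kp = isgn k p" "kq = isgn k q"
  "kr = isgn k r" "lp = isgn l p" "lq = isgn l q" "lr = isgn l r"
 have 1: "A * B + B * C + C * A = of_bool (j = k & k = l) - 1" using tri(1) by (auto simp: v split: if_splits)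
 have 2: "a * b + b * c + c * a = of_bool (p = q & q = r) - 1" using tri(2) by (auto simp: v split: if_splits)
 have 3: "A * kr - kr * lr - lr * A = -1" using tri(3) ne by (simp add: v w sw)
 have 4: "B * jq - jq * kq - kq * B = -1" using tri(4) ne by (simp add: v w sw)
 have 5: "C * lp - lp * jp - jp * C = -1" using tri(5) ne by (simp add: v w sw)
 have 6: "- a * kr - kr * kq + kq * a = -1" using tri(6) ne by (simp add: v w sw)
 have 7: "- b * lp - lp * lr + lr * b = -1" using tri(7) ne by (simp add: v w sw)
 have 8: "- c * jq - jq * jp + jp * c = -1" using tri(8) ne by (simp add: v w sw)
 have e: "4 * (s_eq q k r l * s_eq p j r k + s_eq r l p j * s_eq q k p l + s_eq p j q k * s_eq r l q j) =
  (A - lr + kq + a) * (B - kr + jp - b) + (C - jp + lr + b) * (A - lp + kq - c) + (B - kq + jp + c) * (C - jq + lr - a)"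
  using ne by (simp add: s_eq_isgn sw v w field_simps)
 have "(A - lr + kq + a) * (B - kr + jp - b) + (C - jp + lr + b) * (A - lp + kq - c) + (B - kq + jp + c) * (C - jq + lr - a)
  = (A * B + B * C + C * A) - (a * b + b * c + c * a) - (A * kr - kr * lr - lr * A) - (B * jq - jq * kq - kq * B) - (C * lp - lp * jp - jp * C)
   + (- a * kr - kr * kq + kq * a) + (- b * lp - lp * lr + lr * b) + (- c * jq - jq * jp + jp * c)"
  by (simp add: algebra_simps)
 with e show ?thesis unfolding 1 2 3 4 5 6 7 8 by simp
qed

section \<open>Brackets of chart coordinates and the Jacobi identity\<close>

definition cpi :: "real => real => nat set => nat \<times> nat => nat \<times> nat => (nat \<times> nat => real) => real" where
 "cpi al be I u v x =
  (al - be) * s_eq (elt I (fst u)) (snd u) (elt I (fst v)) (snd v) * (x (fst u, snd v) * x (fst v, snd u)) +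
  (al + be) * s_times (elt I (fst u)) (snd u) (elt I (fst v)) (snd v) * (x u * x v)"

lemma Cinf_on_cpi: "open U ==> Cinf_on K U (cpi al be I u v)"
 unfolding cpi_def by (intro Cinf_on_add Cinf_on_mult Cinf_on_const Cinf_on_coord)

text \<open>The terms with \<open>c2 * c2\<close> cancel identically and those with
  \<open>c1 * c2\<close> by the linear relations \<open>T\<close>. The terms with
  \<open>c1 * c1\<close> contain two cubic monomials with the opposite coefficients \<open>D\<close>
  and \<open>- D\<close>; when \<open>D\<close> is nonzero, the monomials coincide.\<close>

lemma jacobi_quadratic:
 fixes c1 c2 :: real
 assumes T: "Tu_ql + Tu_rk = Tuv - Twu" "Tv_rj + Tv_pl = Tvw - Tuv" "Tw_pk + Tw_qj = Twu - Tvw"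
  and s1: "Svw * Su_rk + Swu * Sv_pl + Suv * Sw_qj = D" and s2: "Svw * Su_ql + Swu * Sv_rj + Suv * Sw_pk = - D"
  and D: "D ~= 0 ==> xrj * xql * xpk = xrk * xpl * (xqj :: real)"
 shows "c1 * Svw * ((c1 * Su_ql * (xpl * xqj) + c2 * Tu_ql * (xpj * xql)) * xrk + xql * (c1 * Su_rk * (xpk * xrj) + c2 * Tu_rk * (xpj * xrk)))
   + c2 * Tvw * ((c1 * Suv * (xpk * xqj) + c2 * Tuv * (xpj * xqk)) * xrl + xqk * (c1 * (- Swu) * (xpl * xrj) + c2 * (- Twu) * (xpj * xrl)))
   + (c1 * Swu * ((c1 * Sv_rj * (xqj * xrk) + c2 * Tv_rj * (xqk * xrj)) * xpl + xrj * (c1 * Sv_pl * (xql * xpk) + c2 * Tv_pl * (xqk * xpl)))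
   + c2 * Twu * ((c1 * Svw * (xql * xrk) + c2 * Tvw * (xqk * xrl)) * xpj + xrl * (c1 * (- Suv) * (xqj * xpk) + c2 * (- Tuv) * (xqk * xpj))))
   + (c1 * Suv * ((c1 * Sw_pk * (xrk * xpl) + c2 * Tw_pk * (xrl * xpk)) * xqj + xpk * (c1 * Sw_qj * (xrj * xql) + c2 * Tw_qj * (xrl * xqj)))
   + c2 * Tuv * ((c1 * Swu * (xrj * xpl) + c2 * Twu * (xrl * xpj)) * xqk + xpj * (c1 * (- Svw) * (xrk * xql) + c2 * (- Tvw) * (xrl * xqk))))
   = 0" (is "?L = 0")
proof -
 have "?L = c1 * c1 * ((Svw * Su_rk + Swu * Sv_pl + Suv * Sw_qj) * (xrj * xql * xpk) + (Svw * Su_ql + Swu * Sv_rj + Suv * Sw_pk) * (xrk * xpl * xqj))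
  + c1 * c2 * (Svw * xpj * xql * xrk * (Tu_ql + Tu_rk - Tuv + Twu) + Swu * xqk * xrj * xpl * (Tv_rj + Tv_pl - Tvw + Tuv)
   + Suv * xrl * xpk * xqj * (Tw_pk + Tw_qj - Twu + Tvw))"
  by (simp add: algebra_simps)
 also have "... = 0" unfolding s1 s2 T using D by (cases "D = 0") auto
 finally show ?thesis .
qed

lemma pdiff_cpi:
 "(SUM s:K. q s * pdiff s (cpi al be I v w) x) =
  (al - be) * s_eq (elt I (fst v)) (snd v) (elt I (fst w)) (snd w) *
    (q (fst v, snd w) * x (fst w, snd v) + x (fst v, snd w) * q (fst w, snd v)) +
  (al + be) * s_times (elt I (fst v)) (snd v) (elt I (fst w)) (snd w) * (q v * x w + x v * q w)"
 if K: "finite K" "v : K" "w : K" "(fst v, snd w) : K" "(fst w, snd v) : K"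
proof -
 define de :: "nat \<times> nat => nat \<times> nat => real" where "de a s = of_bool (s = a)" for a s
 note c = Cinf_on_coord[OF open_UNIV, of K] Cinf_on_const[OF open_UNIV, of K] Cinf_on_mult[OF open_UNIV, of K]
 have d: "pdiff s (%x. A * (x a * x b)) x = A * (de a s * x b + x a * de b s)" if "s : K" for s A a b
  using that by (simp add: pdiff_mult[of K UNIV _ _ s x] c pdiff_coord de_def)
 have pd: "pdiff s (cpi al be I v w) x =
  (al - be) * s_eq (elt I (fst v)) (snd v) (elt I (fst w)) (snd w) *
    (de (fst v, snd w) s * x (fst w, snd v) + x (fst v, snd w) * de (fst w, snd v) s) +
  (al + be) * s_times (elt I (fst v)) (snd v) (elt I (fst w)) (snd w) *
    (de v s * x w + x v * de w s)" if "s : K" for s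
  unfolding cpi_def[abs_def] by (subst pdiff_add[of K UNIV _ _ s x]) (use that in \<open>auto intro!: c simp only: d\<close>)
 have e: "(SUM s:K. q s * pdiff s (cpi al be I v w) x) =
  (al - be) * s_eq (elt I (fst v)) (snd v) (elt I (fst w)) (snd w) *
    ((SUM s:K. q s * de (fst v, snd w) s) * x (fst w, snd v) + x (fst v, snd w) * (SUM s:K. q s * de (fst w, snd v) s)) +
  (al + be) * s_times (elt I (fst v)) (snd v) (elt I (fst w)) (snd w) *
    ((SUM s:K. q s * de v s) * x w + x v * (SUM s:K. q s * de w s))"
  by (simp only: sum_distrib_left sum_distrib_right sum.distrib[symmetric]) (rule sum.cong[OF refl], simp only: pd, simp add: algebra_simps)
 have pick: "(SUM s:K. q s * de a s) = q a" if "a : K" for a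
  using that K(1) unfolding de_def by (simp add: if_distrib[of "%z. _ * z"] cong: if_cong)
 show ?thesis unfolding e pick[OF K(2)] pick[OF K(3)] pick[OF K(4)] pick[OF K(5)] by (rule refl)
qed

lemma cpi_antisym:
 assumes "I <= {1..n}" "card I = k" "u : coord_idx k n I" "v : coord_idx k n I"
 shows "cpi al be I v u x = - cpi al be I u v x"
proof -
 have ne: "elt I (fst u) ~= snd u" "elt I (fst u) ~= snd v" "elt I (fst v) ~= snd u" "elt I (fst v) ~= snd v"
  using elt_image[OF assms(1,2), of "fst u"] elt_image[OF assms(1,2), of "fst v"] assms(3,4) by auto
 show ?thesis unfolding cpi_def s_eq_antisym[OF ne] s_times_antisym[OF ne] by (simp add: mult_ac)
qed

lemma cpi_jacobi:
 fixes x :: "nat \<times> nat => real" and al be :: real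
 assumes I: "I <= {1..n}" "card I = k" and u: "u : coord_idx k n I" and v: "v : coord_idx k n I" and w: "w : coord_idx k n I"
 defines "J \<equiv> %u v w. SUM s:coord_idx k n I. cpi al be I u s x * pdiff s (cpi al be I v w) x"
 shows "J u v w + J v w u + J w u v = 0"
proof -
 obtain p j where u': "u = (p, j)" "p : {1..k}" "j : {1..n} - I" using u by auto
 obtain q h where v': "v = (q, h)" "q : {1..k}" "h : {1..n} - I" using v by auto
 obtain r l where w': "w = (r, l)" "r : {1..k}" "l : {1..n} - I" using w by auto
 have fin: "finite (coord_idx k n I)" by simp
 let ?e = "elt I"
 have ne: "a ~= b" if "a : {?e p, ?e q, ?e r}" "b : {j, h, l}" for a b
  using that elt_image[OF I u'(2)] elt_image[OF I v'(2)] elt_image[OF I w'(2)] u' v' w' by auto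
 have ne': "?e p ~= j" "?e p ~= h" "?e p ~= l" "?e q ~= j" "?e q ~= h" "?e q ~= l" "?e r ~= j" "?e r ~= h" "?e r ~= l"
  by (rule ne; simp)+
 have Jx: "J u v w = (al - be) * s_eq (?e q) h (?e r) l *
    (cpi al be I (p, j) (q, l) x * x (r, h) + x (q, l) * cpi al be I (p, j) (r, h) x) +
  (al + be) * s_times (?e q) h (?e r) l * (cpi al be I (p, j) (q, h) x * x (r, l) + x (q, h) * cpi al be I (p, j) (r, l) x)"
  "J v w u = (al - be) * s_eq (?e r) l (?e p) j *
    (cpi al be I (q, h) (r, j) x * x (p, l) + x (r, j) * cpi al be I (q, h) (p, l) x) +
  (al + be) * s_times (?e r) l (?e p) j * (cpi al be I (q, h) (r, l) x * x (p, j) + x (r, l) * cpi al be I (q, h) (p, j) x)"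
  "J w u v = (al - be) * s_eq (?e p) j (?e q) h *
    (cpi al be I (r, l) (p, h) x * x (q, j) + x (p, h) * cpi al be I (r, l) (q, j) x) +
  (al + be) * s_times (?e p) j (?e q) h * (cpi al be I (r, l) (p, j) x * x (q, h) + x (p, j) * cpi al be I (r, l) (q, h) x)"
  unfolding J_def using u' v' w' by (simp_all only: pdiff_cpi[OF fin] u v w fst_conv snd_conv mem_Sigma_iff simp_thms)
 have s: "s_eq (?e p) j (?e r) l = - s_eq (?e r) l (?e p) j" "s_eq (?e q) h (?e p) j = - s_eq (?e p) j (?e q) h"
   "s_eq (?e r) l (?e q) h = - s_eq (?e q) h (?e r) l" "s_times (?e p) j (?e r) l = - s_times (?e r) l (?e p) j"
   "s_times (?e q) h (?e p) j = - s_times (?e p) j (?e q) h" "s_times (?e r) l (?e q) h = - s_times (?e q) h (?e r) l"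
  by (rule s_eq_antisym s_times_antisym; rule ne' ne'[symmetric])+
 \<comment> \<open>If the defect is nonzero, the three columns or the three rows are all equal, and
   both monomials are the same product.\<close>
 have D: "x (r, j) * x (q, l) * x (p, h) = x (r, h) * x (p, l) * x (q, j)"
  if "(of_bool (j = h & h = l) - of_bool (?e p = ?e q & ?e q = ?e r)) / 4 ~= (0::real)"
  using that elt_eq_iff[OF I u'(2) v'(2)] elt_eq_iff[OF I v'(2) w'(2)] by (auto simp: mult_ac split: if_splits)
 have c2: "s_eq (?e q) h (?e r) l * s_eq (?e p) j (?e q) l + s_eq (?e r) l (?e p) j * s_eq (?e q) h (?e r) j + s_eq (?e p) j (?e q) h * s_eq (?e r) l (?e p) h
   = - ((of_bool (j = h & h = l) - of_bool (?e p = ?e q & ?e q = ?e r)) / 4)"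
 proof -
  have "s_eq (?e r) l (?e q) h * s_eq (?e p) j (?e q) l + s_eq (?e q) h (?e p) j * s_eq (?e r) l (?e p) h + s_eq (?e p) j (?e r) l * s_eq (?e q) h (?e r) j
   = (of_bool (j = l & l = h) - of_bool (?e p = ?e r & ?e r = ?e q)) / 4"
   by (rule s_eq_cyclic_sum) (use ne in blast)
  moreover have "j = l & l = h <-> j = h & h = l" "?e p = ?e r & ?e r = ?e q <-> ?e p = ?e q & ?e q = ?e r" by auto
  ultimately show ?thesis unfolding s by (simp add: field_simps)
 qed
 note sw = isgn_swap[of h l] isgn_swap[of j h] isgn_swap[of l j] isgn_swap[of "?e r" "?e q"] isgn_swap[of "?e p" "?e r"] isgn_swap[of "?e q" "?e p"]
  isgn_swap[of "?e p" j] isgn_swap[of "?e p" h] isgn_swap[of "?e p" l]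
  isgn_swap[of "?e q" j] isgn_swap[of "?e q" h] isgn_swap[of "?e q" l]
  isgn_swap[of "?e r" j] isgn_swap[of "?e r" h] isgn_swap[of "?e r" l]
 have T: "s_times (?e p) j (?e q) l + s_times (?e p) j (?e r) h = s_times (?e p) j (?e q) h - s_times (?e r) l (?e p) j"
  "s_times (?e q) h (?e r) j + s_times (?e q) h (?e p) l = s_times (?e q) h (?e r) l - s_times (?e p) j (?e q) h"
  "s_times (?e r) l (?e p) h + s_times (?e r) l (?e q) j = s_times (?e r) l (?e p) j - s_times (?e q) h (?e r) l"
  using ne' by (simp_all add: s_times_isgn sw field_simps)
 show ?thesis unfolding Jx cpi_def[of al be I] fst_conv snd_conv s
  by (rule jacobi_quadratic[OF T s_eq_cyclic_sum c2 D]) (use ne in blast)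
qed

text \<open>The biderivation with the values \<open>pp u v\<close> on pairs of coordinates.\<close>

definition cbr ::
  "'i set => ('i => 'i => ('i => real) => real) => (('i => real) => real) => (('i => real) => real) => ('i => real) => real" where
 "cbr K pp F G x = (SUM u:K. SUM v:K. pdiff u F x * pdiff v G x * pp u v x)"

lemma Cinf_on_cbr:
 assumes "open U" "Cinf_on K U F" "Cinf_on K U G" "!!u v. u : K ==> v : K ==> Cinf_on K U (pp u v)"
 shows "Cinf_on K U (cbr K pp F G)"
 unfolding cbr_def[abs_def] using assms by (intro Cinf_on_sum Cinf_on_mult Cinf_on_pdiff)

lemma pdiff_cbr:
 assumes U: "open U" and G: "Cinf_on K U G" and H: "Cinf_on K U H"
  and pp: "!!u v. u : K ==> v : K ==> Cinf_on K U (pp u v)" and s: "s : K" and x: "x : U"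
 shows "pdiff s (cbr K pp G H) x = (SUM v:K. SUM w:K.
  pdiff s (pdiff v G) x * (pdiff w H x * pp v w x) + pdiff v G x * (pdiff s (pdiff w H) x * pp v w x)
   + pdiff v G x * (pdiff w H x * pdiff s (pp v w) x))"
proof -
 have "pdiff s (%x. pdiff v G x * pdiff w H x * pp v w x) x =
  pdiff s (pdiff v G) x * (pdiff w H x * pp v w x) + pdiff v G x * (pdiff s (pdiff w H) x * pp v w x)
   + pdiff v G x * (pdiff w H x * pdiff s (pp v w) x)" if vw: "v : K" "w : K" for v w
  unfolding pdiff_mult[OF Cinf_on_mult[OF U Cinf_on_pdiff[OF G vw(1)] Cinf_on_pdiff[OF H vw(2)]] pp[OF vw] s x]
   pdiff_mult[OF Cinf_on_pdiff[OF G vw(1)] Cinf_on_pdiff[OF H vw(2)] s x] by (simp add: algebra_simps)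
 moreover have "pdiff s (cbr K pp G H) x = (SUM v:K. SUM w:K. pdiff s (%x. pdiff v G x * pdiff w H x * pp v w x) x)"
  unfolding cbr_def[abs_def]
  by (subst pdiff_sum[OF U _ s x], intro Cinf_on_sum Cinf_on_mult Cinf_on_pdiff U G H pp, assumption+, rule sum.cong[OF refl],
   rule pdiff_sum[OF U _ s x], intro Cinf_on_mult Cinf_on_pdiff U G H pp, assumption+)
 ultimately show ?thesis by (simp cong: sum.cong)
qed

lemma sum_cyclic3:
 fixes A :: "'i => 'i => 'i => real"
 shows "(SUM u:K. SUM v:K. SUM w:K. f u * g v * h w * A u v w) + (SUM u:K. SUM v:K. SUM w:K. g u * h v * f w * A u v w)
  + (SUM u:K. SUM v:K. SUM w:K. h u * f v * g w * A u v w)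
  = (SUM u:K. SUM v:K. SUM w:K. f u * g v * h w * (A u v w + A v w u + A w u v))"
proof -
 have "(SUM u:K. SUM v:K. SUM w:K. g u * h v * f w * A u v w) = (SUM u:K. SUM v:K. SUM w:K. g v * h w * f u * A v w u)"
  by (subst sum.swap[of _ K K]) (subst sum.swap[of _ K K], subst (2) sum.swap[of _ K K], rule sum.swap)
 moreover have "(SUM u:K. SUM v:K. SUM w:K. h u * f v * g w * A u v w) = (SUM u:K. SUM v:K. SUM w:K. h w * f u * g v * A w u v)"
  by (subst sum.swap) (rule sum.cong[OF refl], rule sum.swap)
 ultimately show ?thesis by (simp add: sum.distrib[symmetric] algebra_simps)
qed

text \<open>Terms with second derivatives cancel in pairs because these are symmetric; the other
  terms are combinations of the Jacobi sums of coordinates, which vanish by assumption.\<close>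

lemma cbr_jacobi:
 fixes F G H :: "('i => real) => real"
 assumes U: "open U" and F: "Cinf_on K U F" and G: "Cinf_on K U G" and H: "Cinf_on K U H"
  and pp: "!!u v. u : K ==> v : K ==> Cinf_on K U (pp u v)" and x: "x : U"
  and anti: "!!u v. u : K ==> v : K ==> pp v u x = - pp u v x"
  and jac: "!!u v w. u : K ==> v : K ==> w : K ==> (SUM s:K. pp u s x * pdiff s (pp v w) x)
   + (SUM s:K. pp v s x * pdiff s (pp w u) x) + (SUM s:K. pp w s x * pdiff s (pp u v) x) = 0"
 shows "cbr K pp F (cbr K pp G H) x + cbr K pp G (cbr K pp H F) x
  + cbr K pp H (cbr K pp F G) x = 0"
proof -
 \<comment> \<open>\<open>hat F\<close> is the Hamiltonian vector field of \<open>F\<close>.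
   \<open>Q G\<close> collects the terms with second derivatives of \<open>G\<close>, and
   \<open>R\<close> those with derivatives of the coefficients \<open>pp\<close>.\<close>
 define hat where "hat F s = (SUM u:K. pdiff u F x * pp u s x)" for F s
 define Q where "Q G A B = (SUM s:K. SUM v:K. pdiff s (pdiff v G) x * (hat A s * hat B v))" for G A B
 define J where "J u v w = (SUM s:K. pp u s x * pdiff s (pp v w) x)" for u v w
 define R where "R F G H = (SUM u:K. SUM v:K. SUM w:K. pdiff u F x * pdiff v G x * pdiff w H x * J u v w)" for F G H
 have Qsym: "Q G A B = Q G B A" if G: "Cinf_on K U G" for G A B
 proof -
  have "Q G A B = (SUM s:K. SUM v:K. pdiff v (pdiff s G) x * (hat A s * hat B v))"
   unfolding Q_def by (intro sum.cong refl) (simp add: pdiff_commute[OF U G _ _ x])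
  also have "... = Q G B A" unfolding Q_def by (subst sum.swap) (simp add: mult.commute)
  finally show ?thesis .
 qed
 have out: "(SUM w:K. pdiff w H x * pp v w x) = - hat H v" if "v : K" for H v
 proof -
  have "(SUM w:K. pdiff w H x * pp v w x) = (SUM w:K. - (pdiff w H x * pp w v x))"
   by (rule sum.cong[OF refl]) (simp add: anti[OF _ that])
  thus ?thesis by (simp add: hat_def sum_negf)
 qed
 have main: "cbr K pp F (cbr K pp G H) x = - Q G F H + Q H F G + R F G H"
  if F: "Cinf_on K U F" and G: "Cinf_on K U G" and H: "Cinf_on K U H" for F G H
 proof -
  have "cbr K pp F (cbr K pp G H) x = (SUM s:K. hat F s * pdiff s (cbr K pp G H) x)"
   unfolding cbr_def[of K pp F] hat_def sum_distrib_right by (subst sum.swap) (simp add: mult_ac)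
  also have "... = (SUM s:K. hat F s * ((SUM v:K. pdiff s (pdiff v G) x * (- hat H v)) + (SUM w:K. pdiff s (pdiff w H) x * hat G w)
   + (SUM v:K. SUM w:K. pdiff v G x * (pdiff w H x * pdiff s (pp v w) x))))"
  proof (rule sum.cong[OF refl])
   fix s assume s: "s : K"
   have 1: "(SUM v:K. SUM w:K. pdiff s (pdiff v G) x * (pdiff w H x * pp v w x)) = (SUM v:K. pdiff s (pdiff v G) x * (- hat H v))"
    by (rule sum.cong[OF refl]) (simp only: sum_distrib_left[symmetric] out)
   have 2: "(SUM v:K. SUM w:K. pdiff v G x * (pdiff s (pdiff w H) x * pp v w x)) = (SUM w:K. pdiff s (pdiff w H) x * hat G w)"
    unfolding hat_def sum_distrib_left by (subst sum.swap) (simp add: mult_ac)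
   show "hat F s * pdiff s (cbr K pp G H) x = hat F s * ((SUM v:K. pdiff s (pdiff v G) x * (- hat H v)) + (SUM w:K. pdiff s (pdiff w H) x * hat G w)
   + (SUM v:K. SUM w:K. pdiff v G x * (pdiff w H x * pdiff s (pp v w) x)))"
    by (subst pdiff_cbr[OF U G H _ s x]) (erule (1) pp, simp only: sum.distrib 1 2)
  qed
  also have "... = - Q G F H + Q H F G + (SUM s:K. hat F s * (SUM v:K. SUM w:K. pdiff v G x * (pdiff w H x * pdiff s (pp v w) x)))"
  proof -
   have "(SUM s:K. hat F s * (SUM v:K. pdiff s (pdiff v G) x * (- hat H v))) = - Q G F H"
    unfolding Q_def sum_distrib_left sum_negf[symmetric] by (intro sum.cong refl) simp
   moreover have "(SUM s:K. hat F s * (SUM w:K. pdiff s (pdiff w H) x * hat G w)) = Q H F G"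
    unfolding Q_def sum_distrib_left by (intro sum.cong refl) simp
   ultimately show ?thesis by (simp only: ring_distribs sum.distrib)
  qed
  also have "(SUM s:K. hat F s * (SUM v:K. SUM w:K. pdiff v G x * (pdiff w H x * pdiff s (pp v w) x))) = R F G H"
  proof -
   have "(SUM s:K. hat F s * (SUM v:K. SUM w:K. pdiff v G x * (pdiff w H x * pdiff s (pp v w) x)))
    = (SUM s:K. SUM u:K. SUM v:K. SUM w:K. pdiff u F x * pdiff v G x * pdiff w H x * (pp u s x * pdiff s (pp v w) x))"
    unfolding hat_def sum_distrib_left sum_distrib_right
    by (rule sum.cong[OF refl]) (subst sum.swap, rule sum.cong[OF refl], subst sum.swap, intro sum.cong refl, simp only: mult_ac)
   also have "... = R F G H" unfolding R_def J_def sum_distrib_left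
    by (subst sum.swap, rule sum.cong[OF refl], subst sum.swap, rule sum.cong[OF refl], rule sum.swap)
   finally show ?thesis .
  qed
  finally show ?thesis .
 qed
 have "R F G H + R G H F + R H F G = (SUM u:K. SUM v:K. SUM w:K. pdiff u F x * pdiff v G x * pdiff w H x * (J u v w + J v w u + J w u v))"
  unfolding R_def by (rule sum_cyclic3)
 also have "... = 0" using jac unfolding J_def by (intro sum.neutral ballI) simp
 finally have "R F G H + R G H F + R H F G = 0" .
 thus ?thesis unfolding main[OF F G H] main[OF G H F] main[OF H F G]
  using Qsym[OF F, of G H] Qsym[OF G, of H F] Qsym[OF H, of F G] by simp
qed

section \<open>The bracket through the action of the general linear group\<close>

definition act :: "nat => nat => real => subsp => subsp" where
 "act a b t X = (%v. v + Poly_Mapping.single b (t * lk v a)) ` X"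

text \<open>\<open>act a b t\<close> is the image under \<open>1 + t * E\<close>, where the
  elementary matrix \<open>E\<close> sends the unit vector \<open>a\<close> to the unit vector
  \<open>b\<close>. The derivative at \<open>t = 0\<close> is the infinitesimal action of
  \<open>E\<close>, and no chart enters its definition.\<close>

definition act_deriv :: "nat => nat => (subsp => real) => subsp => real" where
 "act_deriv a b f X = deriv (%t. f (act a b t X)) 0"

text \<open>The coordinate \<open>j\<close> of the unit vector \<open>b\<close> in the quotient by
  the subspace, for the basis of the quotient given by the unit vectors outside
  \<open>I\<close>.\<close>

definition unit_graph :: "nat => nat set => (nat \<times> nat => real) => nat => nat => real" where
 "unit_graph k I x b j = of_bool (b = j) - (SUM p:{1..k}. of_bool (elt I p = b) * x (p, j))"

definition act_den :: "nat => nat set => (nat \<times> nat => real) => nat => nat => real => real" where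
 "act_den k I x a b t = 1 + t * (SUM p:{1..k}. of_bool (elt I p = b) * cell_matrix I x p a)"

definition act_field :: "nat => nat set => (nat \<times> nat => real) => nat => nat => nat \<times> nat => real" where
 "act_field k I x a b u = cell_matrix I x (fst u) a * unit_graph k I x b (snd u)"

text \<open>The action in chart coordinates. The matrix changes by a matrix of rank one; the
  denominator comes from restoring the identity columns.\<close>

definition act_flow :: "nat => nat => nat set => (nat \<times> nat => real) => nat => nat => real => nat \<times> nat => real" where
 "act_flow k n I x a b t = (%u. if u : coord_idx k n I then x u + t / act_den k I x a b t * act_field k I x a b u else x u)"

lemma act_cell_param:
 assumes I: "I <= {1..n}" "card I = k" and a: "a : {1..n}" and b: "b : {1..n}" and den: "act_den k I x a b t ~= 0"
 shows "act a b t (cell_param k n I x) = cell_param k n I (act_flow k n I x a b t)"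
proof
 let ?A = "cell_matrix I x" and ?l = "lk" and ?d = "act_den k I x a b t" and ?y = "act_flow k n I x a b t"
 let ?g = "%b j. SUM p:{1..k}. of_bool (elt I p = b) * x (p, j)"
 have y: "(SUM p:{1..k}. c p * ?y (p, j)) = (SUM p:{1..k}. c p * x (p, j)) + t / ?d * (SUM p:{1..k}. c p * ?A p a) * unit_graph k I x b j"
  if "j : {1..n} - I" for c j
 proof -
  have "(SUM p:{1..k}. c p * ?y (p, j)) = (SUM p:{1..k}. c p * x (p, j) + t / ?d * (c p * ?A p a) * unit_graph k I x b j)"
   using that by (intro sum.cong refl) (simp add: act_flow_def act_field_def ring_distribs mult_ac)
  thus ?thesis by (simp add: sum.distrib sum_distrib_left sum_distrib_right)
 qed
 have xA: "?l v a = (SUM p:{1..k}. ?l v (elt I p) * ?A p a)" if "v : cell_param k n I x" for v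
  using that a unfolding cell_param_iff[OF I] by (metis (no_types, lifting))
 have bs: "(SUM p:{1..k}. (c p + r * of_bool (b = elt I p)) * ?A p a) = (SUM p:{1..k}. c p * ?A p a) + r * (SUM p:{1..k}. of_bool (elt I p = b) * ?A p a)" for c r
  by (simp only: ring_distribs sum.distrib sum_distrib_left mult_ac eq_commute[of b])
 have bx: "(SUM p:{1..k}. (c p + r * of_bool (b = elt I p)) * x (p, j)) = (SUM p:{1..k}. c p * x (p, j)) + r * (SUM p:{1..k}. of_bool (elt I p = b) * x (p, j))" for c r j
  by (simp only: ring_distribs sum.distrib sum_distrib_left mult_ac eq_commute[of b])
 show "act a b t (cell_param k n I x) <= cell_param k n I ?y"
 proof
  fix v' assume "v' : act a b t (cell_param k n I x)"
  then obtain v where v: "v : cell_param k n I x" "v' = v + Poly_Mapping.single b (t * ?l v a)" unfolding act_def by (rule imageE)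
  have l: "?l v' c = ?l v c + t * ?l v a * of_bool (b = c)" for c unfolding v(2) by (simp add: lookup_add lookup_single when_def)
  have "(SUM p:{1..k}. ?l v' (elt I p) * ?A p a) = ?l v a * ?d"
   unfolding l bs xA[OF v(1), symmetric] by (simp add: act_den_def algebra_simps)
  hence "(SUM p:{1..k}. ?l v' (elt I p) * ?y (p, j)) = ?l v' j" if "j : {1..n} - I" for j
   unfolding y[OF that] unfolding l bx using v(1) that den unfolding cell_graph[OF I]
   by (simp add: unit_graph_def algebra_simps)
  moreover have "?l v' c = 0" if "c ~: {1..n}" for c
   using v(1) b that unfolding l cell_graph[OF I] by auto
  ultimately show "v' : cell_param k n I ?y" unfolding cell_graph[OF I] by auto
 qed
 show "cell_param k n I ?y <= act a b t (cell_param k n I x)"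
 proof
  fix v' assume v': "v' : cell_param k n I ?y"
  \<comment> \<open>The entry at \<open>a\<close> of the preimage that is to be found, computed from
    \<open>v'\<close> by the identity of the other inclusion.\<close>
  define s where "s = (SUM p:{1..k}. ?l v' (elt I p) * ?A p a) / ?d"
  define v where "v = v' + Poly_Mapping.single b (- (t * s))"
  have l: "?l v c = ?l v' c + - (t * s) * of_bool (b = c)" for c unfolding v_def by (simp add: lookup_add lookup_single when_def)
  have "?l v j = (SUM p:{1..k}. ?l v (elt I p) * x (p, j))" if j: "j : {1..n} - I" for j
  proof -
   have "?l v' j = (SUM p:{1..k}. ?l v' (elt I p) * x (p, j)) + t * s * unit_graph k I x b j"
    using v'[unfolded cell_graph[OF I], THEN conjunct2, rule_format, OF j] unfolding y[OF j] by (simp add: s_def)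
   thus ?thesis unfolding l bx by (simp add: unit_graph_def algebra_simps)
  qed
  moreover have "?l v c = 0" if "c ~: {1..n}" for c
   using v' b that unfolding l cell_graph[OF I] by auto
  ultimately have vx: "v : cell_param k n I x" unfolding cell_graph[OF I] by auto
  have "s * ?d = (SUM p:{1..k}. ?l v' (elt I p) * ?A p a)" using den by (simp add: s_def)
  hence "?l v a = s" unfolding xA[OF vx] unfolding l bs by (simp add: act_den_def algebra_simps)
  hence "v' = v + Poly_Mapping.single b (t * ?l v a)" unfolding v_def by (simp add: single_add[symmetric])
  thus "v' : act a b t (cell_param k n I x)" unfolding act_def using vx by (rule image_eqI)
 qed
qed

lemma act_deriv_chart:
 assumes I: "I <= {1..n}" "card I = k" and a: "a : {1..n}" and b: "b : {1..n}"
  and U: "open U" and f: "Cinf_on (coord_idx k n I) U (%x. f (cell_param k n I x))" and x: "x : U"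
 shows "act_deriv a b f (cell_param k n I x) =
  (SUM u:coord_idx k n I. pdiff u (%x. f (cell_param k n I x)) x * act_field k I x a b u)"
proof -
 let ?ga = "act_flow k n I x a b"
 have 0: "?ga 0 = x" by (auto simp: act_flow_def)
 have dd: "((%t. t / act_den k I x a b t) has_real_derivative 1) (at 0)"
  unfolding act_den_def by (auto intro!: derivative_eq_intros)
 have "((%t. f (cell_param k n I (?ga t))) has_real_derivative
   (SUM u:coord_idx k n I. pdiff u (%x. f (cell_param k n I x)) (?ga 0) * act_field k I x a b u)) (at 0)"
 proof (rule chain_rule[OF _ U f subset_refl])
  fix u assume u: "u : coord_idx k n I"
  have "((%t. x u + t / act_den k I x a b t * act_field k I x a b u) has_real_derivative act_field k I x a b u) (at 0)"
   by (rule derivative_eq_intros dd refl | simp)+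
  thus "((%t. ?ga t u) has_real_derivative act_field k I x a b u) (at 0)" using u by (simp add: act_flow_def)
 next
  show "?ga t u = ?ga 0 u" if "u ~: coord_idx k n I" for u t using that by (simp only: act_flow_def if_False)
 qed (use 0 x in auto)
 hence d: "deriv (%t. f (cell_param k n I (?ga t))) 0 =
   (SUM u:coord_idx k n I. pdiff u (%x. f (cell_param k n I x)) x * act_field k I x a b u)"
  unfolding 0 by (rule DERIV_imp_deriv)
 have "continuous_on UNIV (act_den k I x a b)" unfolding act_den_def by (intro continuous_intros)
 from open_Collect_neq[OF this continuous_on_const[of _ 0]] have o: "open {t. act_den k I x a b t ~= 0}" .
 have "0 : {t. act_den k I x a b t ~= 0}" by (simp add: act_den_def)
 from eventually_nhds_in_open[OF o this]
 have "\<forall>\<^sub>F t in nhds 0. f (act a b t (cell_param k n I x)) = f (cell_param k n I (?ga t))"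
  by (rule eventually_mono) (simp add: act_cell_param[OF I a b])
 hence "deriv (%t. f (act a b t (cell_param k n I x))) 0 = deriv (%t. f (cell_param k n I (?ga t))) 0"
  by (rule deriv_cong_ev) simp
 thus ?thesis unfolding act_deriv_def d .
qed

text \<open>The first term is built from the standard skew r-matrix of \<open>gl(n)\<close>, which
  pairs opposite elementary matrices, and the second from a skew form on diagonal matrices. As no
  chart occurs, the bracket is defined on the whole Grassmannian at once.\<close>

definition gr_bracket :: "nat => real => real => (subsp => real) => (subsp => real) => subsp => real" where
 "gr_bracket n al be f g X = (SUM a:{1..n}. SUM b:{1..n}. isgn a b *
  ((al - be) / 2 * (act_deriv a b f X * act_deriv b a g X) - (al + be) / 2 * (act_deriv a a f X * act_deriv b b g X)))"

lemma Ck_on_subset: "Ck_on r K U F ==> V <= U ==> Ck_on r K V F"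
 by (induction r arbitrary: F) (auto intro: continuous_on_subset)

lemma Cinf_on_subset: "Cinf_on K U F ==> V <= U ==> Cinf_on K V F"
 unfolding Cinf_on_def using Ck_on_subset by iprover

lemma sum_of_bool_diff:
 fixes g :: "'a => real"
 assumes "finite S" "c : S" "d : S"
 shows "(SUM a:S. g a * (of_bool (a = c) - of_bool (a = d))) = g c - g d"
proof -
 have "(SUM a:S. g a * of_bool (a = e)) = g e" if "e : S" for e
  using assms(1) that by (simp add: of_bool_def if_distrib[of "%z. _ * z"] cong: if_cong)
 thus ?thesis using assms by (simp only: right_diff_distrib sum_subtractf)
qed

lemma sum2_of_bool_diff:
 fixes g :: "'a => 'a => real"
 assumes "finite S" "c : S" "d : S" "c' : S" "d' : S"
 shows "(SUM a:S. SUM b:S. g a b * ((of_bool (a = c) - of_bool (a = d)) * (of_bool (b = c') - of_bool (b = d'))))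
  = g c c' - g c d' - g d c' + g d d'"
proof -
 have "(SUM b:S. g a b * ((of_bool (a = c) - of_bool (a = d)) * (of_bool (b = c') - of_bool (b = d'))))
  = (g a c' - g a d') * (of_bool (a = c) - of_bool (a = d))" for a
  using sum_of_bool_diff[OF assms(1,4,5), of "%b. g a b * (of_bool (a = c) - of_bool (a = d))"] by (simp only: mult.assoc left_diff_distrib)
 thus ?thesis using sum_of_bool_diff[OF assms(1-3), of "%a. g a c' - g a d'"] by simp
qed

context
 fixes k n :: nat and I :: "nat set"
 assumes I: "I <= {1..n}" "card I = k"
begin

text \<open>For \<open>b\<close> in \<open>I\<close> the factor from the identity columns selects
  the index of the row \<open>p\<close>; for \<open>b\<close> outside \<open>I\<close> the other
  factor selects the column \<open>j\<close>. So the product is supported at two values of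
  \<open>b\<close>.\<close>

lemma cell_matrix_unit_graph:
 assumes p: "p : {1..k}" and j: "j ~: I"
 shows "cell_matrix I x p b * unit_graph k I x b j = x (p, j) * (of_bool (b = j) - of_bool (b = elt I p))"
proof (cases "b : I")
 case True
 then obtain q where q: "q : {1..k}" "b = elt I q" by (rule elt_obtain[OF I])
 have "(SUM r:{1..k}. of_bool (elt I r = elt I q) * x (r, j)) = (SUM r:{1..k}. if r = q then x (r, j) else 0)"
  by (rule sum.cong[OF refl]) (simp add: elt_eq_iff[OF I _ q(1)])
 moreover have qj: "elt I q ~= j" using elt_image[OF I q(1)] j by auto
 ultimately have "unit_graph k I x (elt I q) j = - x (q, j)" using q(1) by (simp add: unit_graph_def)
 thus ?thesis unfolding q(2) cell_matrix_elt[OF I p q(1)]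
  using qj elt_eq_iff[OF I q(1) p] by (cases "p = q") simp_all
next
 case False
 have "(SUM r:{1..k}. of_bool (elt I r = b) * x (r, j)) = 0"
  using elt_image[OF I] False by (intro sum.neutral ballI) auto
 thus ?thesis using elt_image[OF I p] False by (auto simp: unit_graph_def cell_matrix_def)
qed

text \<open>Each double sum collapses to four signs by \<open>cell_matrix_unit_graph\<close>, and
  these are the four-term formulas for \<open>s_eq\<close> and \<open>s_times\<close>.\<close>

lemma act_field_bracket:
 assumes u: "u : coord_idx k n I" and v: "v : coord_idx k n I"
 shows "(SUM a:{1..n}. SUM b:{1..n}. isgn a b *
  ((al - be) / 2 * (act_field k I x a b u * act_field k I x b a v) - (al + be) / 2 * (act_field k I x a a u * act_field k I x b b v)))
  = cpi al be I u v x"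
proof -
 obtain p j where u': "u = (p, j)" "p : {1..k}" "j : {1..n}" "j ~: I" using u by auto
 obtain q l where v': "v = (q, l)" "q : {1..k}" "l : {1..n}" "l ~: I" using v by auto
 have ei: "elt I p : {1..n}" "elt I q : {1..n}" using elt_image[OF I u'(2)] elt_image[OF I v'(2)] I(1) by auto
 have ne: "elt I p ~= j" "elt I p ~= l" "elt I q ~= j" "elt I q ~= l"
  using elt_image[OF I u'(2)] elt_image[OF I v'(2)] u'(4) v'(4) by auto
 let ?de = "%a c d. of_bool (a = c) - of_bool (a = d) :: real"
 \<comment> \<open>Regrouping the factors pairs each row with the column of the other coordinate,
   which produces the monomial with exchanged columns.\<close>
 have 1: "act_field k I x a b u * act_field k I x b a v = x (p, l) * x (q, j) * (?de a l (elt I p) * ?de b j (elt I q))" for a b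
 proof -
  have "act_field k I x a b u * act_field k I x b a v =
   (cell_matrix I x p a * unit_graph k I x a l) * (cell_matrix I x q b * unit_graph k I x b j)"
   unfolding act_field_def u'(1) v'(1) fst_conv snd_conv by (simp only: mult_ac)
  thus ?thesis unfolding cell_matrix_unit_graph[OF u'(2) v'(4)] cell_matrix_unit_graph[OF v'(2) u'(4)] by (simp only: mult_ac)
 qed
 have 2: "act_field k I x a a u * act_field k I x b b v = x u * x v * (?de a j (elt I p) * ?de b l (elt I q))" for a b
  unfolding act_field_def u'(1) v'(1) fst_conv snd_conv cell_matrix_unit_graph[OF u'(2) u'(4)] cell_matrix_unit_graph[OF v'(2) v'(4)]
  by (simp only: mult_ac)
 have "(SUM a:{1..n}. SUM b:{1..n}. isgn a b *
  ((al - be) / 2 * (act_field k I x a b u * act_field k I x b a v) - (al + be) / 2 * (act_field k I x a a u * act_field k I x b b v)))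
  = (SUM a:{1..n}. SUM b:{1..n}. (al - be) / 2 * (x (p, l) * x (q, j)) * (isgn a b * (?de a l (elt I p) * ?de b j (elt I q)))
    - (al + be) / 2 * (x u * x v) * (isgn a b * (?de a j (elt I p) * ?de b l (elt I q))))"
  unfolding 1 2 by (intro sum.cong refl) (simp only: right_diff_distrib mult_ac)
 also have "... = (al - be) / 2 * (x (p, l) * x (q, j)) * (SUM a:{1..n}. SUM b:{1..n}. isgn a b * (?de a l (elt I p) * ?de b j (elt I q)))
    - (al + be) / 2 * (x u * x v) * (SUM a:{1..n}. SUM b:{1..n}. isgn a b * (?de a j (elt I p) * ?de b l (elt I q)))"
  by (simp only: sum_subtractf sum_distrib_left)
 also have "(SUM a:{1..n}. SUM b:{1..n}. isgn a b * (?de a l (elt I p) * ?de b j (elt I q))) =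
   2 * s_eq (elt I p) j (elt I q) l"
  unfolding sum2_of_bool_diff[OF finite_atLeastAtMost v'(3) ei(1) u'(3) ei(2)] s_eq_isgn[OF ne] by simp
 also have "(SUM a:{1..n}. SUM b:{1..n}. isgn a b * (?de a j (elt I p) * ?de b l (elt I q))) =
   - (2 * s_times (elt I p) j (elt I q) l)"
  unfolding sum2_of_bool_diff[OF finite_atLeastAtMost u'(3) ei(1) v'(3) ei(2)] s_times_isgn[OF ne] by (simp add: field_simps)
 finally show ?thesis unfolding cpi_def u'(1) v'(1) fst_conv snd_conv by (simp add: mult_ac)
qed

lemma gr_bracket_chart:
 assumes U: "open U" and f: "Cinf_on (coord_idx k n I) U (%x. f (cell_param k n I x))"
  and g: "Cinf_on (coord_idx k n I) U (%x. g (cell_param k n I x))" and x: "x : U"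
 shows "gr_bracket n al be f g (cell_param k n I x) =
  cbr (coord_idx k n I) (cpi al be I) (%x. f (cell_param k n I x)) (%x. g (cell_param k n I x)) x"
proof -
 let ?K = "coord_idx k n I" and ?f = "%u. pdiff u (%x. f (cell_param k n I x)) x" and ?g = "%u. pdiff u (%x. g (cell_param k n I x)) x"
 let ?v = "%a b u. act_field k I x a b u"
 have "gr_bracket n al be f g (cell_param k n I x) = (SUM a:{1..n}. SUM b:{1..n}. SUM u:?K. SUM v:?K.
  ?f u * ?g v * (isgn a b * ((al - be) / 2 * (?v a b u * ?v b a v) - (al + be) / 2 * (?v a a u * ?v b b v))))"
  unfolding gr_bracket_def
 proof (intro sum.cong refl)
  fix a b assume ab: "a : {1..n}" "b : {1..n}"
  have d: "act_deriv a b f (cell_param k n I x) = (SUM u:?K. ?f u * ?v a b u)" "act_deriv a b g (cell_param k n I x) = (SUM u:?K. ?g u * ?v a b u)"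
   if "a : {1..n}" "b : {1..n}" for a b by (rule act_deriv_chart[OF I that U f x] act_deriv_chart[OF I that U g x])+
  show "isgn a b * ((al - be) / 2 * (act_deriv a b f (cell_param k n I x) * act_deriv b a g (cell_param k n I x)) -
   (al + be) / 2 * (act_deriv a a f (cell_param k n I x) * act_deriv b b g (cell_param k n I x))) = (SUM u:?K. SUM v:?K.
  ?f u * ?g v * (isgn a b * ((al - be) / 2 * (?v a b u * ?v b a v) - (al + be) / 2 * (?v a a u * ?v b b v))))"
   unfolding d(1)[OF ab] d(2)[OF ab(2,1)] d(1)[OF ab(1,1)] d(2)[OF ab(2,2)] sum_product
   by (simp only: sum_distrib_left sum_subtractf[symmetric]) (intro sum.cong refl, simp only: right_diff_distrib mult_ac)
 qed
 also have "... = (SUM u:?K. SUM v:?K. SUM a:{1..n}. SUM b:{1..n}.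
  ?f u * ?g v * (isgn a b * ((al - be) / 2 * (?v a b u * ?v b a v) - (al + be) / 2 * (?v a a u * ?v b b v))))"
  by (rule sum_swap4)
 also have "... = cbr ?K (cpi al be I) (%x. f (cell_param k n I x)) (%x. g (cell_param k n I x)) x"
  unfolding cbr_def by (intro sum.cong refl) (simp only: sum_distrib_left[symmetric] act_field_bracket)
 finally show ?thesis .
qed

end

section \<open>The bracket on open subsets of the Grassmannian\<close>

definition gr_open :: "nat => nat => subsp set => bool" where
 "gr_open k n W <-> W <= Gr k n & (ALL I. I <= {1..n} & card I = k --> open {x. cell_param k n I x : W})"

lemma cbr_antisym:
 assumes "!!u v. u : K ==> v : K ==> pp v u x = - pp u v x"
 shows "cbr K pp F G x = - cbr K pp G F x"
 unfolding cbr_def sum_negf[symmetric]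
proof (subst sum.swap, intro sum.cong refl)
 fix u v assume uv: "u : K" "v : K"
 show "pdiff v F x * pdiff u G x * pp v u x = - (pdiff u G x * pdiff v F x * pp u v x)"
  unfolding assms[OF uv] by simp
qed

lemma gr_open_Gr: "gr_open k n (Gr k n)"
 unfolding gr_open_def
proof (intro conjI allI impI subset_refl)
 fix I assume I: "I <= {1..n} & card I = k"
 have "{x. cell_param k n I x : Gr k n} = UNIV" using cell_param_Gr[OF conjunct1[OF I] conjunct2[OF I]] by simp
 thus "open {x. cell_param k n I x : Gr k n}" by simp
qed

lemma gr_open_cell:
 assumes "I <= {1..n}" "card I = k"
 shows "gr_open k n (cell k n I)"
 unfolding gr_open_def
proof (intro conjI allI impI)
 show "cell k n I <= Gr k n" unfolding cell_def by (rule Collect_subset)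
 fix I' assume "I' <= {1..n} & card I' = k"
 thus "open {x. cell_param k n I' x : cell k n I}"
  by (subst cell_preimage[OF _ _ assms]) (simp_all add: open_covl)
qed

definition gr_poisson ::
  "nat => nat => real => real => subsp set => (subsp => real) => (subsp => real) => subsp => real" where
 "gr_poisson k n al be W = (\<lambda>f\<in>Gr_smooth k n W. \<lambda>g\<in>Gr_smooth k n W. \<lambda>X\<in>W. gr_bracket n al be f g X)"

context
 fixes k n :: nat and W :: "subsp set"
 assumes W: "gr_open k n W"
begin

lemma gr_chart_open: "I <= {1..n} ==> card I = k ==> open {x. cell_param k n I x : W}"
 using W by (simp add: gr_open_def)

lemma gr_chart_obtain:
 assumes "X : W"
 obtains I x where "I <= {1..n}" "card I = k" "x : {x. cell_param k n I x : W}" "X = cell_param k n I x"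
proof -
 have "X : Gr k n" using assms W by (auto simp: gr_open_def)
 then obtain I where I: "I <= {1..n}" "card I = k" "X : cell k n I" by (rule Gr_cell_cover)
 from cell_obtain[OF I] obtain x where "X = cell_param k n I x" .
 thus thesis using that[OF I(1,2)] assms by simp
qed

lemma Gr_chart: "f : Gr_smooth k n W ==> I <= {1..n} ==> card I = k ==>
  Cinf_on (coord_idx k n I) {x. cell_param k n I x : W} (%x. f (cell_param k n I x))"
 unfolding Gr_smooth_def by simp

lemma Gr_smooth_ext: "f : Gr_smooth k n W ==> f : extensional W"
 unfolding Gr_smooth_def by simp

lemma Gr_smoothI:
 assumes "!!I. I <= {1..n} ==> card I = k ==> EX F. Cinf_on (coord_idx k n I) {x. cell_param k n I x : W} F &
  (ALL x. cell_param k n I x : W --> F x = h (cell_param k n I x))"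
 shows "(\<lambda>X\<in>W. h X) : Gr_smooth k n W"
 unfolding Gr_smooth_def
proof (intro CollectI conjI allI impI restrict_extensional)
 fix I assume I: "I <= {1..n} & card I = k"
 then obtain F where F: "Cinf_on (coord_idx k n I) {x. cell_param k n I x : W} F" "!!x. cell_param k n I x : W ==> F x = h (cell_param k n I x)"
  using assms by blast
 show "Cinf_on (coord_idx k n I) {x. cell_param k n I x : W} (%x. (\<lambda>X\<in>W. h X) (cell_param k n I x))"
  by (rule Cinf_on_cong[THEN iffD1, OF gr_chart_open _ F(1)]) (use I F(2) in auto)
qed

lemma Gr_smooth_add:
 assumes "f : Gr_smooth k n W" "g : Gr_smooth k n W"
 shows "(\<lambda>X\<in>W. a * f X + b * g X) : Gr_smooth k n W"
proof (rule Gr_smoothI)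
 fix I assume I: "I <= {1..n}" "card I = k"
 have "Cinf_on (coord_idx k n I) {x. cell_param k n I x : W} (%x. a * f (cell_param k n I x) + b * g (cell_param k n I x))"
  using gr_chart_open[OF I] Gr_chart[OF _ I] assms by (intro Cinf_on_add Cinf_on_mult Cinf_on_const) auto
 thus "EX F. Cinf_on (coord_idx k n I) {x. cell_param k n I x : W} F &
  (ALL x. cell_param k n I x : W --> F x = a * f (cell_param k n I x) + b * g (cell_param k n I x))" by (intro exI conjI) auto
qed

lemma Gr_smooth_mult:
 assumes "f : Gr_smooth k n W" "g : Gr_smooth k n W"
 shows "(\<lambda>X\<in>W. f X * g X) : Gr_smooth k n W"
proof (rule Gr_smoothI)
 fix I assume I: "I <= {1..n}" "card I = k"
 have "Cinf_on (coord_idx k n I) {x. cell_param k n I x : W} (%x. f (cell_param k n I x) * g (cell_param k n I x))"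
  using gr_chart_open[OF I] Gr_chart[OF _ I] assms by (intro Cinf_on_mult) auto
 thus "EX F. Cinf_on (coord_idx k n I) {x. cell_param k n I x : W} F &
  (ALL x. cell_param k n I x : W --> F x = f (cell_param k n I x) * g (cell_param k n I x))" by (intro exI conjI) auto
qed

lemma gr_bracket_smooth:
 assumes f: "f : Gr_smooth k n W" and g: "g : Gr_smooth k n W"
 shows "(\<lambda>X\<in>W. gr_bracket n al be f g X) : Gr_smooth k n W"
proof (rule Gr_smoothI)
 fix I assume I: "I <= {1..n}" "card I = k"
 note o = gr_chart_open[OF I] and ff = Gr_chart[OF f I] and gg = Gr_chart[OF g I]
 have "Cinf_on (coord_idx k n I) {x. cell_param k n I x : W}
   (cbr (coord_idx k n I) (cpi al be I) (%x. f (cell_param k n I x)) (%x. g (cell_param k n I x)))"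
  by (rule Cinf_on_cbr[OF o ff gg Cinf_on_cpi[OF o]])
 thus "EX F. Cinf_on (coord_idx k n I) {x. cell_param k n I x : W} F &
  (ALL x. cell_param k n I x : W --> F x = gr_bracket n al be f g (cell_param k n I x))"
  using gr_bracket_chart[OF I o ff gg] by (intro exI conjI) auto
qed

lemma gr_poisson_apply: "f : Gr_smooth k n W ==> g : Gr_smooth k n W ==>
  gr_poisson k n al be W f g = (\<lambda>X\<in>W. gr_bracket n al be f g X)"
 by (simp add: gr_poisson_def)

text \<open>\<open>F\<close> and \<open>G\<close> are any expressions for \<open>f\<close> and
  \<open>g\<close> in the chart. This makes it possible to insert coordinate functions as well as
  brackets, and thus to iterate.\<close>

lemma gr_poisson_chart:
 assumes f: "f : Gr_smooth k n W" and g: "g : Gr_smooth k n W" and I: "I <= {1..n}" "card I = k" and x: "x : {x. cell_param k n I x : W}"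
  and F: "!!x. x : {x. cell_param k n I x : W} ==> F x = f (cell_param k n I x)"
  and G: "!!x. x : {x. cell_param k n I x : W} ==> G x = g (cell_param k n I x)"
 shows "gr_poisson k n al be W f g (cell_param k n I x) = cbr (coord_idx k n I) (cpi al be I) F G x"
proof -
 have "gr_poisson k n al be W f g (cell_param k n I x) =
  cbr (coord_idx k n I) (cpi al be I) (%x. f (cell_param k n I x)) (%x. g (cell_param k n I x)) x"
  using gr_bracket_chart[OF I gr_chart_open[OF I] Gr_chart[OF f I] Gr_chart[OF g I] x] x
  by (simp add: gr_poisson_apply[OF f g])
 also have "... = cbr (coord_idx k n I) (cpi al be I) F G x"
  unfolding cbr_def
  by (intro sum.cong refl arg_cong2[of _ _ _ _ "(*)"]) (auto intro!: pdiff_cong[OF gr_chart_open[OF I] x] simp: F G)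
 finally show ?thesis .
qed

lemma gr_poisson_smooth: "f : Gr_smooth k n W ==> g : Gr_smooth k n W ==> gr_poisson k n al be W f g : Gr_smooth k n W"
 using gr_bracket_smooth by (simp add: gr_poisson_apply)

lemma poisson_bracket_gr_poisson: "poisson_bracket W (Gr_smooth k n W) (gr_poisson k n al be W)"
 unfolding poisson_bracket_def
proof (intro conjI ballI allI)
 show "gr_poisson k n al be W : Gr_smooth k n W \<rightarrow>\<^sub>E Gr_smooth k n W \<rightarrow>\<^sub>E Gr_smooth k n W"
  using gr_poisson_smooth by (auto simp: gr_poisson_def PiE_def extensional_def)
next
 fix f g h :: "subsp => real" and a b :: real
 assume f: "f : Gr_smooth k n W" and g: "g : Gr_smooth k n W" and h: "h : Gr_smooth k n W"
 note ext = Gr_smooth_ext[OF gr_poisson_smooth]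
 let ?B = "gr_poisson k n al be W"
 show "?B (\<lambda>X\<in>W. a * f X + b * g X) h = (\<lambda>X\<in>W. a * ?B f h X + b * ?B g h X)"
 proof (rule extensionalityI[OF ext[OF Gr_smooth_add[OF f g] h] restrict_extensional])
  fix X assume X: "X : W"
  then obtain I x where I: "I <= {1..n}" "card I = k" "x : {x. cell_param k n I x : W}" "X = cell_param k n I x" by (rule gr_chart_obtain)
  note o = gr_chart_open[OF I(1,2)] and ff = Gr_chart[OF f I(1,2)] and gg = Gr_chart[OF g I(1,2)]
  let ?F = "%x. f (cell_param k n I x)" and ?G = "%x. g (cell_param k n I x)" and ?K = "coord_idx k n I"
  have "?B (\<lambda>X\<in>W. a * f X + b * g X) h (cell_param k n I x) =
   cbr ?K (cpi al be I) (%x. a * ?F x + b * ?G x) (%x. h (cell_param k n I x)) x"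
   by (rule gr_poisson_chart[OF Gr_smooth_add[OF f g] h I(1-3)]) auto
  also have "... = a * cbr ?K (cpi al be I) ?F (%x. h (cell_param k n I x)) x + b * cbr ?K (cpi al be I) ?G (%x. h (cell_param k n I x)) x"
  proof -
   have d: "pdiff u (%x. a * ?F x + b * ?G x) x = a * pdiff u ?F x + b * pdiff u ?G x" if u: "u : ?K" for u
    unfolding pdiff_add[OF Cinf_on_mult[OF o Cinf_on_const[OF o] ff] Cinf_on_mult[OF o Cinf_on_const[OF o] gg] u I(3)]
     pdiff_mult[OF Cinf_on_const[OF o] ff u I(3)] pdiff_mult[OF Cinf_on_const[OF o] gg u I(3)] by simp
   show ?thesis unfolding cbr_def sum_distrib_left sum.distrib[symmetric]
    by (intro sum.cong refl) (simp add: d algebra_simps)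
  qed
  finally show "?B (\<lambda>X\<in>W. a * f X + b * g X) h X = (\<lambda>X\<in>W. a * ?B f h X + b * ?B g h X) X"
   using X unfolding I(4) by (simp add: gr_poisson_chart[OF f h I(1-3)] gr_poisson_chart[OF g h I(1-3)])
 qed
 show "?B f g = (\<lambda>X\<in>W. - ?B g f X)"
 proof (rule extensionalityI[OF ext[OF f g] restrict_extensional])
  fix X assume X: "X : W"
  then obtain I x where I: "I <= {1..n}" "card I = k" "x : {x. cell_param k n I x : W}" "X = cell_param k n I x" by (rule gr_chart_obtain)
  let ?F = "%x. f (cell_param k n I x)" and ?G = "%x. g (cell_param k n I x)" and ?K = "coord_idx k n I"
  have 1: "?B f g X = cbr ?K (cpi al be I) ?F ?G x"
   unfolding I(4) by (rule gr_poisson_chart[OF f g I(1-3) refl refl])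
  have 2: "?B g f X = cbr ?K (cpi al be I) ?G ?F x"
   unfolding I(4) by (rule gr_poisson_chart[OF g f I(1-3) refl refl])
  have "?B f g X = - ?B g f X"
   unfolding 1 2 by (rule cbr_antisym) (rule cpi_antisym[OF I(1,2)])
  thus "?B f g X = (\<lambda>X\<in>W. - ?B g f X) X" using X by simp
 qed
 show "?B (\<lambda>X\<in>W. f X * g X) h = (\<lambda>X\<in>W. f X * ?B g h X + ?B f h X * g X)"
 proof (rule extensionalityI[OF ext[OF Gr_smooth_mult[OF f g] h] restrict_extensional])
  fix X assume X: "X : W"
  then obtain I x where I: "I <= {1..n}" "card I = k" "x : {x. cell_param k n I x : W}" "X = cell_param k n I x" by (rule gr_chart_obtain)
  note o = gr_chart_open[OF I(1,2)] and ff = Gr_chart[OF f I(1,2)] and gg = Gr_chart[OF g I(1,2)]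
  let ?F = "%x. f (cell_param k n I x)" and ?G = "%x. g (cell_param k n I x)" and ?K = "coord_idx k n I"
  have "?B (\<lambda>X\<in>W. f X * g X) h (cell_param k n I x) =
   cbr ?K (cpi al be I) (%x. ?F x * ?G x) (%x. h (cell_param k n I x)) x"
   by (rule gr_poisson_chart[OF Gr_smooth_mult[OF f g] h I(1-3)]) auto
  also have "... = ?F x * cbr ?K (cpi al be I) ?G (%x. h (cell_param k n I x)) x + cbr ?K (cpi al be I) ?F (%x. h (cell_param k n I x)) x * ?G x"
   unfolding cbr_def sum_distrib_left sum_distrib_right sum.distrib[symmetric]
   by (intro sum.cong refl) (simp add: pdiff_mult[OF ff gg _ I(3)] algebra_simps)
  finally show "?B (\<lambda>X\<in>W. f X * g X) h X = (\<lambda>X\<in>W. f X * ?B g h X + ?B f h X * g X) X"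
   using X unfolding I(4) by (simp add: gr_poisson_chart[OF f h I(1-3)] gr_poisson_chart[OF g h I(1-3)])
 qed
 show "(\<lambda>X\<in>W. ?B f (?B g h) X + ?B g (?B h f) X + ?B h (?B f g) X) = (\<lambda>X\<in>W. 0)"
 proof (rule restrict_ext)
  fix X assume X: "X : W"
  then obtain I x where I: "I <= {1..n}" "card I = k" "x : {x. cell_param k n I x : W}" "X = cell_param k n I x" by (rule gr_chart_obtain)
  note o = gr_chart_open[OF I(1,2)]
  let ?c = "%f x. f (cell_param k n I x)" and ?K = "coord_idx k n I" and ?p = "cpi al be I"
  have B: "?B f (?B g h) X = cbr ?K ?p (?c f) (cbr ?K ?p (?c g) (?c h)) x"
   if "f : Gr_smooth k n W" "g : Gr_smooth k n W" "h : Gr_smooth k n W" for f g h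
   unfolding I(4) by (rule gr_poisson_chart[OF that(1) gr_poisson_smooth[OF that(2,3)] I(1-3) refl])
    (rule gr_poisson_chart[OF that(2,3) I(1,2) _ refl refl, symmetric])
  show "?B f (?B g h) X + ?B g (?B h f) X + ?B h (?B f g) X = 0"
   unfolding B[OF f g h] B[OF g h f] B[OF h f g]
   by (rule cbr_jacobi[OF o Gr_chart[OF f I(1,2)] Gr_chart[OF g I(1,2)] Gr_chart[OF h I(1,2)]
    Cinf_on_cpi[OF o] I(3) cpi_antisym[OF I(1,2)] cpi_jacobi[OF I(1,2)]])
 qed
qed

end

lemma gr_poisson_coord:
 assumes I: "I <= {1..n}" "card I = k" and u: "(p, j) : coord_idx k n I" and v: "(q, l) : coord_idx k n I" and X: "X : cell k n I"
 shows "gr_poisson k n al be (cell k n I) (cell_coord k n I p j) (cell_coord k n I q l) X =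
  (al - be) * s_eq (elt I p) j (elt I q) l * cell_coord k n I p l X * cell_coord k n I q j X +
  (al + be) * s_times (elt I p) j (elt I q) l * cell_coord k n I p j X * cell_coord k n I q l X"
proof -
 from X obtain x where x: "X = cell_param k n I x" by (rule cell_obtain[OF I])
 have cc: "cell_coord k n I a b (cell_param k n I y) = y (a, b)" if "(a, b) : coord_idx k n I" for a b y
  by (rule cell_coord_param[OF I that])
 have "gr_poisson k n al be (cell k n I) (cell_coord k n I p j) (cell_coord k n I q l) X =
  cbr (coord_idx k n I) (cpi al be I) (%x. x (p, j)) (%x. x (q, l)) x"
  unfolding x by (rule gr_poisson_chart[OF gr_open_cell[OF I] cell_coord_smooth[OF I] cell_coord_smooth[OF I] I])
   (use u v X x cc in auto)
 also have "... = (SUM a:coord_idx k n I. SUM b:coord_idx k n I. if b = (q, l) then (if a = (p, j) then cpi al be I a b x else 0) else 0)"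
  unfolding cbr_def by (intro sum.cong refl) (simp add: pdiff_coord)
 also have "... = cpi al be I (p, j) (q, l) x" using u v by (simp add: sum.delta)
 finally show ?thesis unfolding x cpi_def using cc[of p j x] cc[of q l x] cc[of p l x] cc[of q j x] u v by simp
qed

lemma gr_poisson_restricts:
 assumes I: "I <= {1..n}" "card I = k"
 shows "bracket_restricts (Gr_smooth k n (Gr k n)) (gr_poisson k n al be (Gr k n)) (cell k n I) (gr_poisson k n al be (cell k n I))"
 unfolding bracket_restricts_def
proof (intro ballI)
 fix f g assume f: "f : Gr_smooth k n (Gr k n)" and g: "g : Gr_smooth k n (Gr k n)"
 let ?W = "cell k n I"
 have WG: "?W <= Gr k n" by (auto simp: cell_def)
 have rs: "restrict f ?W : Gr_smooth k n ?W" if f: "f : Gr_smooth k n (Gr k n)" for f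
 proof (rule Gr_smoothI[OF gr_open_cell[OF I]])
  fix I' assume I': "I' <= {1..n}" "card I' = k"
  have sub: "{x. cell_param k n I' x : ?W} <= {x. cell_param k n I' x : Gr k n}" using WG by auto
  have "Cinf_on (coord_idx k n I') {x. cell_param k n I' x : ?W} (%x. f (cell_param k n I' x))"
   by (rule Cinf_on_subset[OF Gr_chart[OF gr_open_Gr f I'] sub])
  thus "EX F. Cinf_on (coord_idx k n I') {x. cell_param k n I' x : ?W} F & (ALL x. cell_param k n I' x : ?W --> F x = f (cell_param k n I' x))"
   by (intro exI conjI) auto
 qed
 show "restrict (gr_poisson k n al be (Gr k n) f g) ?W = gr_poisson k n al be ?W (restrict f ?W) (restrict g ?W)"
 proof (rule extensionalityI[OF restrict_extensional Gr_smooth_ext[OF gr_open_cell[OF I] gr_poisson_smooth[OF gr_open_cell[OF I] rs[OF f] rs[OF g]]]])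
  fix X assume X: "X : ?W"
  then obtain x where x: "X = cell_param k n I x" by (rule cell_obtain[OF I])
  have "gr_poisson k n al be ?W (restrict f ?W) (restrict g ?W) X =
   cbr (coord_idx k n I) (cpi al be I) (%x. f (cell_param k n I x)) (%x. g (cell_param k n I x)) x"
   unfolding x by (rule gr_poisson_chart[OF gr_open_cell[OF I] rs[OF f] rs[OF g] I]) (use X x in auto)
  also have "... = gr_poisson k n al be (Gr k n) f g X"
   unfolding x by (rule gr_poisson_chart[OF gr_open_Gr f g I _ refl refl, symmetric]) (use X x WG in auto)
  finally show "restrict (gr_poisson k n al be (Gr k n) f g) ?W X = gr_poisson k n al be ?W (restrict f ?W) (restrict g ?W) X"
   using X by simp
 qed
qed

lemma DERIV_mono_val:
 assumes "w e ~= 0"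
 shows "((%s. mono_val (w(e := s)) m) has_real_derivative real (count m e) * mono_val w m / w e) (at (w e))"
proof (induction m)
 case (add e' m)
 have eq: "(%s. mono_val (w(e := s)) (add_mset e' m)) = (%s. (w(e := s)) e' * mono_val (w(e := s)) m)"
  by (simp add: mono_val_def)
 have d: "((%s. (w(e := s)) e') has_real_derivative (if e' = e then 1 else 0)) (at (w e))"
  by (cases "e' = e") auto
 from DERIV_mult[OF d add.IH] show ?case unfolding eq
  by (rule DERIV_cong) (use assms in \<open>auto simp: mono_val_def field_simps\<close>)
qed (simp add: mono_val_def)

lemma poly_at_mono_val: "poly_at P w = (SUM m:Poly_Mapping.keys P. lk P m * mono_val w m)"
 by (simp add: poly_at_def mono_val_def)

lemma DERIV_poly_at:
 assumes "w e ~= 0"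
 shows "((%s. poly_at P (w(e := s))) has_real_derivative poly_euler e P w / w e) (at (w e))"
proof -
 have "((%s. SUM m:Poly_Mapping.keys P. lk P m * mono_val (w(e := s)) m) has_real_derivative
  (SUM m:Poly_Mapping.keys P. lk P m * (real (count m e) * mono_val w m / w e))) (at (w e))"
  by (intro DERIV_sum DERIV_cmult DERIV_mono_val assms)
 moreover have "(SUM m:Poly_Mapping.keys P. lk P m * (real (count m e) * mono_val w m / w e)) = poly_euler e P w / w e"
  unfolding poly_euler_def sum_divide_distrib by (intro sum.cong refl) simp
 ultimately show ?thesis by (simp add: poly_at_mono_val)
qed

section \<open>The boundary measurement map is Poisson\<close>

context planar_network
begin

text \<open>The sources between \<open>i\<close> and \<open>j\<close> are counted as a difference of
  the numbers of sources below \<open>i\<close> and below \<open>j\<close>. The source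
  \<open>i\<close> itself is among those below \<open>j\<close> exactly if \<open>i < j\<close>,
  which accounts for \<open>- osgn i j\<close>.\<close>

lemma num_between_sign:
 assumes I: "finite I" and i: "i : I" and j: "j ~: I"
 shows "(-1) ^ num_between I i j = - osgn i j * ((-1) ^ card {a : I. a < i} * (-1) ^ card {a : I. a < j} :: real)"
proof (cases "i < j")
 case True
 have e: "{a : I. a < j} = {a : I. a < i} Un insert i {i' : I. min i j < i' & i' < max i j}"
  using True i by auto
 have "card {a : I. a < j} = card {a : I. a < i} + Suc (num_between I i j)"
  unfolding e num_between_def using I True by (subst card_Un_disjoint) auto
 moreover have "(-1) ^ card {a : I. a < i} * (-1) ^ card {a : I. a < i} = (1::real)" by (simp flip: power_mult_distrib)
 ultimately show ?thesis using True by (simp add: osgn_def power_add mult.assoc[symmetric])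
next
 case False
 hence ji: "j < i" using i j by (metis linorder_neqE_nat)
 have e: "{a : I. a < i} = {a : I. a < j} Un {i' : I. min i j < i' & i' < max i j}"
  using ji j by (auto simp: linorder_not_less le_less)
 have "card {a : I. a < i} = card {a : I. a < j} + num_between I i j"
  unfolding e num_between_def using I ji by (subst card_Un_disjoint) auto
 moreover have "(-1) ^ card {a : I. a < j} * (-1) ^ card {a : I. a < j} = (1::real)" by (simp flip: power_mult_distrib)
 ultimately show ?thesis using ji by (simp add: osgn_def power_add mult.left_commute mult.commute)
qed

text \<open>Factors of single indices cancel by \<open>num_between_sign\<close>. So the signs of the
  matrix entries remove the sign \<open>swsgn\<close> of an exchange of tails.\<close>

lemma num_between_swap:
 assumes "finite I" "i : I" "i' : I" "j ~: I" "j' ~: I"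
 shows "(-1) ^ num_between I i j * (-1) ^ num_between I i' j' * swsgn i j i' j'
  = ((-1) ^ num_between I i j' * (-1) ^ num_between I i' j :: real)"
 using assms by (simp add: num_between_sign swsgn_def osgn_def)

abbreviation "kk \<equiv> card Src"
abbreviation "Kc \<equiv> coord_idx kk n Src"

definition msgn :: "nat \<times> nat => real" where
 "msgn u = (-1) ^ num_between Src (elt Src (fst u)) (snd u)"

text \<open>The chart coordinates of the image of \<open>w\<close>. The value zero outside the index
  set keeps a curve of weights fixed in all other coordinates, as the chain rule requires.\<close>

definition Ycoord :: "weights => nat \<times> nat => real" where
 "Ycoord w u = (if u : Kc then msgn u * M_value n N (elt Src (fst u)) (snd u) w else 0)"

lemma Src_subset: "Src <= {1..n}" by (auto simp: sources_def)

lemma X_map_cell_param: "X_map n N w = cell_param kk n Src (Ycoord w)"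
proof -
 have "X_matrix n N w = cell_matrix Src (%u. msgn u * M_value n N (elt Src (fst u)) (snd u) w)"
  by (intro ext) (simp add: X_matrix_def cell_matrix_def msgn_def Let_def)
 hence "X_map n N w = cell_param kk n Src (%u. msgn u * M_value n N (elt Src (fst u)) (snd u) w)"
  by (simp add: X_map_def cell_param_def)
 also have "... = cell_param kk n Src (Ycoord w)"
  by (rule cell_param_cong[OF Src_subset refl]) (simp only: Ycoord_def if_True)
 finally show ?thesis .
qed

lemma Kc_source_sink: "u : Kc ==> elt Src (fst u) : Src & snd u : Snk"
 using elt_image[OF Src_subset refl, of "fst u"] by (auto simp: sinks_eq)

text \<open>A fraction that represents the boundary measurement at \<open>w\<close> does so at all
  nearby weights, because its denominator stays nonzero.\<close>

lemma DERIV_M_value: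
 assumes fr: "M_fraction i j w P Q" and w: "w e ~= 0"
 shows "((%s. M_value n N i j (w(e := s))) has_real_derivative M_euler i j e P Q w / w e) (at (w e))"
proof -
 have f: "i : Src" "j : Snk" "P : edge_polys N" "Q : edge_polys N" "represents_fraction (M_series n N i j) P Q" "poly_at Q w ~= 0"
  using fr unfolding M_fraction_def by iprover+
 have dP: "((%s. poly_at P (w(e := s))) has_real_derivative poly_euler e P w / w e) (at (w e))"
  by (rule DERIV_poly_at[of w e, OF w])
 have dQ: "((%s. poly_at Q (w(e := s))) has_real_derivative poly_euler e Q w / w e) (at (w e))" by (rule DERIV_poly_at[of w e, OF w])
 have "\<forall>\<^sub>F s in at (w e). poly_at Q (w(e := s)) ~= 0"
  by (rule tendsto_imp_eventually_ne[OF isContD[OF DERIV_isCont[OF dQ]]]) (use f(6) in simp)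
 hence "\<forall>\<^sub>F s in nhds (w e). poly_at Q (w(e := s)) ~= 0"
  using f(6) by (simp add: eventually_nhds_conv_at)
 hence ev: "\<forall>\<^sub>F s in nhds (w e). M_value n N i j (w(e := s)) = poly_at P (w(e := s)) / poly_at Q (w(e := s))"
  by (rule eventually_mono) (rule M_value_eq[OF f(1-5)])
 have "((%s. poly_at P (w(e := s)) / poly_at Q (w(e := s))) has_real_derivative
  (poly_euler e P w / w e * poly_at Q (w(e := w e)) - poly_at P (w(e := w e)) * (poly_euler e Q w / w e)) / (poly_at Q (w(e := w e)) * poly_at Q (w(e := w e)))) (at (w e))"
  by (rule DERIV_divide[OF dP dQ]) (use f(6) in simp)
 moreover have "(poly_euler e P w / w e * poly_at Q (w(e := w e)) - poly_at P (w(e := w e)) * (poly_euler e Q w / w e)) / (poly_at Q (w(e := w e)) * poly_at Q (w(e := w e)))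
   = M_euler i j e P Q w / w e"
  using f(6) w by (simp add: M_euler_def power2_eq_square field_simps)
 ultimately have "((%s. poly_at P (w(e := s)) / poly_at Q (w(e := s))) has_real_derivative M_euler i j e P Q w / w e) (at (w e))" by simp
 thus ?thesis by (subst DERIV_cong_ev[OF refl ev refl])
qed

lemma flag_cases:
 assumes "phi : flags N" obtains s e where "e : E" "phi = (edge_end s e, e)"
proof -
 obtain v e where phi: "phi = (v, e)" by (cases phi)
 hence e: "e : E" "v = fst e | v = snd e" using assms unfolding flags_def by auto
 show thesis using e(2) that[OF e(1), of True] that[OF e(1), of False] phi by (auto simp: edge_end_def)
qed

lemma flag_edge: "phi : flags N ==> snd phi : E"
 unfolding flags_def by auto

lemma sum_flags: "(SUM phi:flags N. h phi) = (SUM e:E. h (edge_end True e, e) + h (edge_end False e, e))" for h :: "flag => real"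
proof -
 let ?g = "%s e. (edge_end s e, e)"
 have fl: "flags N = ?g True ` E Un ?g False ` E" unfolding flags_def edge_end_def by auto
 have "?g True ` E Int ?g False ` E = {}" using edge_ne by (auto simp: edge_end_def)
 thus ?thesis unfolding fl using finite_edges
  by (subst sum.union_disjoint) (auto simp: sum.reindex inj_on_def sum.distrib)
qed

text \<open>Every flag belongs to one edge, so moving one flag coordinate scales a single
  weight.\<close>

lemma weight_map_upd:
 assumes x: "x : flag_space N" and e: "e : E" and phi: "phi = (edge_end s e, e)"
 shows "weight_map N (x(phi := t)) = (weight_map N x)(e := t * (weight_map N x e / x phi))"
proof -
 have ne: "fst e ~= snd e" using edge_ne[of "fst e" "snd e"] e by simp
 have "phi : flags N" using e phi unfolding flags_def edge_end_def by auto
 hence "x phi ~= 0" using x unfolding flag_space_def by auto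
 thus ?thesis
  using ne e phi by (intro ext) (auto simp: weight_map_def edge_end_def field_simps)
qed

lemma DERIV_Ycoord:
 assumes x: "x : flag_space N" and phi: "phi : flags N" and u: "u : Kc"
  and fr: "M_fraction (elt Src (fst u)) (snd u) (weight_map N x) P Q"
 shows "((%t. Ycoord (weight_map N (x(phi := t))) u) has_real_derivative
  msgn u * (M_euler (elt Src (fst u)) (snd u) (snd phi) P Q (weight_map N x) / x phi)) (at (x phi))"
proof -
 obtain s e where e: "e : E" "phi = (edge_end s e, e)" using phi by (rule flag_cases)
 have fl: "(fst e, e) : flags N" "(snd e, e) : flags N" using e(1) by (auto simp: flags_def)
 let ?w = "weight_map N x" let ?c = "?w e / x phi"
 have "x psi ~= 0" if "psi : flags N" for psi using PiE_mem[OF x[unfolded flag_space_def] that] by simp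
 from this[OF phi] this[OF fl(1)] this[OF fl(2)] have nz: "x phi ~= 0" "?w e ~= 0" using e(1) by (simp_all add: weight_map_def)
 have c: "x phi * ?c = ?w e" using nz by simp
 have "((%s. M_value n N (elt Src (fst u)) (snd u) (?w(e := s))) has_real_derivative M_euler (elt Src (fst u)) (snd u) e P Q ?w / ?w e) (at (x phi * ?c))"
  unfolding c by (rule DERIV_M_value[OF fr nz(2)])
 moreover have "((%t. t * ?c) has_real_derivative ?c) (at (x phi))"
  by (rule DERIV_cong[OF DERIV_cmult_right[OF DERIV_ident]]) (rule mult_1_left)
 ultimately have "((%t. M_value n N (elt Src (fst u)) (snd u) (?w(e := t * ?c))) has_real_derivative
  M_euler (elt Src (fst u)) (snd u) e P Q ?w / ?w e * ?c) (at (x phi))"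
  by (rule DERIV_chain2)
 from DERIV_cmult[OF this, of "msgn u"] show ?thesis
  unfolding Ycoord_def if_P[OF u] weight_map_upd[OF x e] by (rule DERIV_cong) (use nz in \<open>simp add: e(2)\<close>)
qed

lemma ecoef_flags:
 "ecoef p q e e' = flag_coeff p q N (edge_end True e, e) (edge_end True e', e') + flag_coeff p q N (edge_end True e, e) (edge_end False e', e')
  + flag_coeff p q N (edge_end False e, e) (edge_end True e', e') + flag_coeff p q N (edge_end False e, e) (edge_end False e', e')"
proof -
 have "(if edge_end s e = edge_end s' e' then flag_coeff p q N (edge_end s e, e) (edge_end s' e', e') else 0) =
   flag_coeff p q N (edge_end s e, e) (edge_end s' e', e')" for s s'
  by (simp add: flag_coeff_def)
 thus ?thesis unfolding ecoef_def Let_def at_ends_def by (simp only:)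
qed

text \<open>The factors \<open>x phi\<close> turn derivatives in the flag coordinates into Euler
  derivatives in the edge weights, and these depend only on the weights. The sum over flags becomes
  a sum over edges with the coefficients \<open>ecoef\<close>; by \<open>M_bracket\<close> and the
  signs of the matrix entries it is the bracket in the chart of the sources.\<close>

lemma flag_bracket_X_map:
 assumes sk: "skew3 p" "skew3 q" and al: "al = p 2 3 + p 1 3 - p 1 2" and be: "be = q 2 3 + q 1 3 - q 1 2"
  and f: "f : Gr_smooth kk n (Gr kk n)" and g: "g : Gr_smooth kk n (Gr kk n)"
  and x: "x : flag_space N" and w: "weight_map N x : X_domain n N"
 shows "flag_bracket p q N ((f \<circ> X_map n N) \<circ> weight_map N) ((g \<circ> X_map n N) \<circ> weight_map N) x =
  gr_poisson kk n al be (Gr kk n) f g (X_map n N (weight_map N x))"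
proof -
 let ?L = "%f. (f \<circ> X_map n N) \<circ> weight_map N" and ?c = "%f y. f (cell_param kk n Src y)"
 let ?w = "weight_map N x" let ?Y = "Ycoord (weight_map N x)"
 have reg: "M_regular n N i j ?w" if "i : Src" "j : Snk" for i j
  using w that unfolding X_domain_def by blast
 have "ALL u. EX PQ. u : Kc --> M_fraction (elt Src (fst u)) (snd u) ?w (fst PQ) (snd PQ)"
 proof
  fix u
  show "EX PQ. u : Kc --> M_fraction (elt Src (fst u)) (snd u) ?w (fst PQ) (snd PQ)"
  proof (cases "u : Kc")
   case True
   note io = Kc_source_sink[OF True]
   from reg[OF conjunct1[OF io] conjunct2[OF io]] obtain P Q where "P : edge_polys N" "Q : edge_polys N"
    "represents_fraction (M_series n N (elt Src (fst u)) (snd u)) P Q" "poly_at Q ?w ~= 0" unfolding M_regular_def by blast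
   thus ?thesis using io by (intro exI[of _ "(P, Q)"]) (simp add: M_fraction_def)
  qed simp
 qed
 then obtain PQ where PQ: "!!u. u : Kc ==> M_fraction (elt Src (fst u)) (snd u) ?w (fst (PQ u)) (snd (PQ u))" by metis
 define Eu where "Eu u e = M_euler (elt Src (fst u)) (snd u) e (fst (PQ u)) (snd (PQ u)) ?w" for u e
 have chart: "Cinf_on Kc UNIV (?c f)" if "f : Gr_smooth kk n (Gr kk n)" for f
  using Gr_chart[OF gr_open_Gr that Src_subset refl] cell_param_Gr[OF Src_subset refl] by simp
 have der: "x phi * pdiff phi (?L f) x =
   (SUM u:Kc. pdiff u (?c f) ?Y * (msgn u * Eu u (snd phi)))"
  if f: "f : Gr_smooth kk n (Gr kk n)" and phi: "phi : flags N" for f phi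
 proof -
  have nz: "x phi ~= 0" using x phi unfolding flag_space_def by auto
  let ?ga = "%t. Ycoord (weight_map N (x(phi := t)))"
  have 0: "?ga (x phi) = ?Y" by simp
  have "((%t. f (cell_param kk n Src (?ga t))) has_real_derivative
   (SUM u:Kc. pdiff u (?c f) (?ga (x phi)) * (msgn u * (Eu u (snd phi) / x phi)))) (at (x phi))"
  proof (rule chain_rule[OF _ open_UNIV chart[OF f] subset_refl])
   show "((%t. ?ga t u) has_real_derivative msgn u * (Eu u (snd phi) / x phi)) (at (x phi))" if u: "u : Kc" for u
    unfolding Eu_def by (rule DERIV_Ycoord[OF x phi u PQ[OF u]])
   show "?ga t u = ?ga (x phi) u" if "u ~: Kc" for u t unfolding Ycoord_def if_not_P[OF that] ..
  qed auto
  hence "pdiff phi (?L f) x =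
   (SUM u:Kc. pdiff u (?c f) ?Y * (msgn u * (Eu u (snd phi) / x phi)))"
   unfolding pdiff_def[of phi] 0 comp_def X_map_cell_param by (rule DERIV_imp_deriv)
  thus ?thesis using nz by (simp add: sum_distrib_left)
 qed
 define F where "F u = pdiff u (?c f) ?Y" for u
 define G where "G u = pdiff u (?c g) ?Y" for u
 define a where "a e = (SUM u:Kc. F u * (msgn u * Eu u e))" for e
 define c where "c e = (SUM u:Kc. G u * (msgn u * Eu u e))" for e
 have pi: "msgn u * msgn v * (SUM e:E. SUM e':E. ecoef p q e e' * (Eu u e * Eu v e')) = cpi al be Src u v ?Y"
  if u: "u : Kc" and v: "v : Kc" for u v
 proof -
  obtain r j where u': "u = (r, j)" "r : {1..kk}" "j : {1..n} - Src" using u by auto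
  obtain s l where v': "v = (s, l)" "s : {1..kk}" "l : {1..n} - Src" using v by auto
  let ?i = "elt Src r" and ?h = "elt Src s"
  have i: "?i : Src" "?h : Src" "j : Snk" "l : Snk" using Kc_source_sink[OF u] Kc_source_sink[OF v] u' v' by auto
  have fS: "finite Src" using Src_subset by (rule finite_subset) simp
  have br: "(SUM e:E. SUM e':E. ecoef p q e e' * (Eu u e * Eu v e')) =
   (al - be) * (swsgn ?i j ?h l * s_eq ?i j ?h l) * (M_value n N ?i l ?w * M_value n N ?h j ?w) +
   (al + be) * s_times ?i j ?h l * (M_value n N ?i j ?w * M_value n N ?h l ?w)"
   unfolding Eu_def using M_bracket[OF sk al be PQ[OF u] PQ[OF v]] reg i u' v' by simp
  have Y: "?Y (r, j) = msgn (r, j) * M_value n N ?i j ?w" "?Y (s, l) = msgn (s, l) * M_value n N ?h l ?w"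
   "?Y (r, l) = msgn (r, l) * M_value n N ?i l ?w" "?Y (s, j) = msgn (s, j) * M_value n N ?h j ?w"
   using u' v' by (simp_all add: Ycoord_def)
  have sg: "msgn (r, j) * msgn (s, l) * swsgn ?i j ?h l = msgn (r, l) * msgn (s, j)"
   using num_between_swap[OF fS i(1,2), of j l] u' v' by (simp add: msgn_def)
  have "msgn (r, j) * msgn (s, l) * ((al - be) * (swsgn ?i j ?h l * s_eq ?i j ?h l) * (M_value n N ?i l ?w * M_value n N ?h j ?w) +
   (al + be) * s_times ?i j ?h l * (M_value n N ?i j ?w * M_value n N ?h l ?w)) =
   (al - be) * s_eq ?i j ?h l * (msgn (r, j) * msgn (s, l) * swsgn ?i j ?h l) * (M_value n N ?i l ?w * M_value n N ?h j ?w) +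
   (al + be) * s_times ?i j ?h l * (msgn (r, j) * msgn (s, l)) * (M_value n N ?i j ?w * M_value n N ?h l ?w)"
   by (simp add: algebra_simps)
  thus ?thesis unfolding br unfolding u'(1) v'(1) cpi_def fst_conv snd_conv Y sg by (simp only: mult_ac)
 qed
 have "flag_bracket p q N (?L f) (?L g) x =
  (SUM phi:flags N. SUM psi:flags N. flag_coeff p q N phi psi * (a (snd phi) * c (snd psi)))"
  unfolding flag_bracket_def
 proof (intro sum.cong refl)
  fix phi psi assume fl: "phi : flags N" "psi : flags N"
  have "flag_coeff p q N phi psi * x phi * x psi * pdiff phi (?L f) x * pdiff psi (?L g) x =
   flag_coeff p q N phi psi * ((x phi * pdiff phi (?L f) x) * (x psi * pdiff psi (?L g) x))"
   by (simp only: mult_ac)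
  thus "flag_coeff p q N phi psi * x phi * x psi * pdiff phi (?L f) x * pdiff psi (?L g) x =
   flag_coeff p q N phi psi * (a (snd phi) * c (snd psi))"
   unfolding der[OF f fl(1)] der[OF g fl(2)] a_def c_def F_def G_def .
 qed
 also have "... = (SUM e:E. SUM e':E. ecoef p q e e' * (a e * c e'))"
  unfolding sum_flags ecoef_flags snd_conv sum.distrib[symmetric]
  by (intro sum.cong refl) (simp add: algebra_simps)
 also have "... = (SUM e:E. SUM e':E. SUM u:Kc. SUM v:Kc. F u * G v * (msgn u * msgn v * (ecoef p q e e' * (Eu u e * Eu v e'))))"
  unfolding a_def c_def sum_product unfolding sum_distrib_left by (intro sum.cong refl) (simp only: mult_ac)
 also have "... = (SUM u:Kc. SUM v:Kc. SUM e:E. SUM e':E. F u * G v * (msgn u * msgn v * (ecoef p q e e' * (Eu u e * Eu v e'))))"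
  by (rule sum_swap4)
 also have "... = (SUM u:Kc. SUM v:Kc. F u * G v * cpi al be Src u v ?Y)"
  by (intro sum.cong refl) (simp only: sum_distrib_left[symmetric] pi)
 also have "... = cbr Kc (cpi al be Src) (?c f) (?c g) ?Y"
  unfolding cbr_def F_def G_def ..
 also have "... = gr_poisson kk n al be (Gr kk n) f g (cell_param kk n Src ?Y)"
  by (rule gr_poisson_chart[OF gr_open_Gr f g Src_subset refl _ refl refl, symmetric])
   (simp add: cell_param_Gr[OF Src_subset refl])
 finally show ?thesis unfolding X_map_cell_param .
qed

lemma weight_map_surj:
 assumes "w : weight_space N"
 obtains x where "x : flag_space N" "weight_map N x = w"
proof
 \<comment> \<open>The whole weight of an edge is put on the flag at its start.\<close>
 let ?x = "\<lambda>phi\<in>flags N. if fst phi = fst (snd phi) then w (snd phi) else 1"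
 have "w e ~= 0" if "e : E" for e using PiE_mem[OF assms[unfolded weight_space_def] that] by simp
 thus "?x : flag_space N" using flag_edge unfolding flag_space_def by (intro restrict_PiE_iff[THEN iffD2]) simp
 show "weight_map N ?x = w"
 proof
  fix e
  show "weight_map N ?x e = w e"
  proof (cases "e : E")
   case True
   hence "fst e ~= snd e" using edge_ne[of "fst e" "snd e"] by simp
   thus ?thesis using True by (simp add: weight_map_def flags_def)
  next
   case False
   thus ?thesis using assms unfolding weight_space_def weight_map_def by auto
  qed
 qed
qed

lemma X_poisson_gr_poisson:
 assumes "skew3 p" "skew3 q" "al = p 2 3 + p 1 3 - p 1 2" "be = q 2 3 + q 1 3 - q 1 2"
 shows "X_poisson kk n p q N (gr_poisson kk n al be (Gr kk n))"
 unfolding X_poisson_def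
proof (intro ballI)
 fix f g w
 assume f: "f : Gr_smooth kk n (Gr kk n)" and g: "g : Gr_smooth kk n (Gr kk n)" and w: "w : X_domain n N"
 have "w : weight_space N" using w by (simp add: X_domain_def)
 then obtain x where x: "x : flag_space N" "weight_map N x = w" by (rule weight_map_surj)
 note fb = flag_bracket_X_map[OF assms f g]
 show "edge_bracket p q N (f \<circ> X_map n N) (g \<circ> X_map n N) w = gr_poisson kk n al be (Gr kk n) f g (X_map n N w)"
  unfolding edge_bracket_def
 proof (rule the_equality)
  show "ALL x:flag_space N. weight_map N x = w --> gr_poisson kk n al be (Gr kk n) f g (X_map n N w) =
   flag_bracket p q N ((f \<circ> X_map n N) \<circ> weight_map N) ((g \<circ> X_map n N) \<circ> weight_map N) x"
   using fb w by auto
  fix c assume c: "ALL x:flag_space N. weight_map N x = w -->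
   c = flag_bracket p q N ((f \<circ> X_map n N) \<circ> weight_map N) ((g \<circ> X_map n N) \<circ> weight_map N) x"
  thus "c = gr_poisson kk n al be (Gr kk n) f g (X_map n N w)" using x fb[OF x(1)] w by auto
 qed
qed

end

lemma network_compatible_gr_poisson: "network_compatible k n al be (gr_poisson k n al be (Gr k n))"
 unfolding network_compatible_def
proof (intro conjI allI impI poisson_bracket_gr_poisson gr_open_Gr)
 fix p q N
 assume a: "skew3 p & skew3 q & al = p 2 3 + p 1 3 - p 1 2 & be = q 2 3 + q 1 3 - q 1 2 & network n N & card (sources n N) = k"
 then interpret planar_network n N by unfold_locales blast
 show "X_poisson k n p q N (gr_poisson k n al be (Gr k n))"
  using X_poisson_gr_poisson[of p q al be] a by blast
qed

text \<open>Vertices of a grid with \<open>k\<close> rows and \<open>m\<close> columns. The crossing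
  of row \<open>p\<close> and column \<open>c\<close> is drawn as an edge from a black vertex
  \<open>In p c\<close>, where row and column arrive, to a white vertex \<open>Ex p c\<close>, where
  they leave. \<open>Bd i\<close> is the boundary vertex \<open>i\<close>.\<close>

datatype gv = In nat nat | Ex nat nat | Bd nat

section \<open>The grid network\<close>

lemma zip_tl_snoc: "vs ~= [] ==> zip (vs @ [v]) (tl (vs @ [v])) = zip vs (tl vs) @ [(last vs, v)]"
 by (induction vs rule: induct_list012) auto

locale grid =
 fixes k m :: nat
 assumes k1: "1 <= k" and m1: "1 <= m"
begin

text \<open>Nothing arrives along the columns in row 1, and nothing leaves along the rows in column
  \<open>m\<close>. A crossing there is a single vertex, and the corner \<open>(1, m)\<close>, which
  would have degree two, is left out. The auxiliary functions take this into account: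
  \<open>ext\<close> is the last vertex of a crossing, \<open>lft\<close> and \<open>blw\<close> are
  the vertices before it in its row and its column, \<open>up\<close> is the vertex after it in its
  column, and \<open>ent\<close> is the vertex where it is entered, with \<open>up 1 m\<close> for
  the missing corner.\<close>

definition ext :: "nat => nat => gv" where
 "ext p c = (if 2 <= p & c < m then Ex p c else In p c)"

definition lft :: "nat => nat => gv" where
 "lft p c = (if c = 1 then Bd p else ext p (c - 1))"

definition blw :: "nat => nat => gv" where
 "blw p c = (if p = 2 & c = m then lft 1 m else ext (p - 1) c)"

definition up :: "nat => nat => gv" where
 "up p c = (if p < k then In (Suc p) c else Bd (k + c))"

definition ent :: "nat => nat => gv" where
 "ent p c = (if p = 1 & c = m then up 1 m else In p c)"

definition inn :: "gv set" where
 "inn = {In p c | p c. 1 <= p & p <= k & 1 <= c & c <= m & ~ (p = 1 & c = m)} Un 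
  {Ex p c | p c. 2 <= p & p <= k & 1 <= c & c < m}"

definition VV :: "gv set" where "VV = inn Un Bd ` {1..k + m}"

fun preds :: "gv => gv set" where
 "preds (In p c) = (if 2 <= p then {lft p c, blw p c} else {lft p c})"
| "preds (Ex p c) = {In p c}"
| "preds (Bd i) = (if k < i then {blw (Suc k) (i - k)} else {})"

fun succs :: "gv => gv set" where
 "succs (In p c) = (if 2 <= p & c < m then {Ex p c} else if c < m then {ent p (Suc c), up p c} else {up p c})"
| "succs (Ex p c) = {ent p (Suc c), up p c}"
| "succs (Bd i) = (if i <= k then {ent i 1} else {})"

definition EE :: "(gv \<times> gv) set" where "EE = {(u, v). v : VV & u : preds v}"

lemma In_VV: "In p c : VV <-> 1 <= p & p <= k & 1 <= c & c <= m & ~ (p = 1 & c = m)"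
 and Ex_VV: "Ex p c : VV <-> 2 <= p & p <= k & 1 <= c & c < m"
 and Bd_VV: "Bd i : VV <-> 1 <= i & i <= k + m"
 by (auto simp: VV_def inn_def)

lemma finite_VV: "finite VV"
proof -
 have "inn <= (%(p, c). In p c) ` ({1..k} \<times> {1..m}) Un (%(p, c). Ex p c) ` ({1..k} \<times> {1..m})"
  unfolding inn_def by force
 hence "finite inn" by (rule finite_subset) simp
 thus ?thesis by (simp add: VV_def)
qed

lemmas grid_defs = ext_def lft_def blw_def up_def ent_def

lemma EE_In: "(u, In p c) : EE <-> In p c : VV & (u = lft p c | 2 <= p & u = blw p c)"
 and EE_Ex: "(u, Ex p c) : EE <-> Ex p c : VV & u = In p c"
 and EE_Bd: "(u, Bd i) : EE <-> k < i & i <= k + m & u = blw (Suc k) (i - k)"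
 by (auto simp: EE_def Bd_VV)

lemma blw_ext: "~ (p = 1 & c = m) ==> 1 <= p ==> blw (Suc p) c = ext p c"
 by (auto simp: blw_def)

lemma up_EE: "1 <= p ==> p <= k ==> 1 <= c ==> c <= m ==> (blw (Suc p) c, up p c) : EE"
 by (cases "p < k") (simp_all add: up_def EE_In EE_Bd In_VV)

lemma ent_EE: "1 <= p ==> p <= k ==> 1 <= c ==> c <= m ==> (lft p c, ent p c) : EE"
proof (cases "p = 1 & c = m")
 case True
 hence "lft p c = blw (Suc 1) c" "ent p c = up 1 c" by (simp_all add: blw_def ent_def)
 thus ?thesis using up_EE[of 1 c] k1 m1 True by simp
next
 case False
 assume a: "1 <= p" "p <= k" "1 <= c" "c <= m"
 have "ent p c = In p c" unfolding ent_def if_not_P[OF False] ..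
 thus ?thesis using a False by (simp add: EE_In In_VV)
qed

lemma ext_succs: "1 <= p ==> c < m ==> succs (ext p c) = {ent p (Suc c), up p c}"
 by (simp add: ext_def)

lemma lft_succs: "1 <= p ==> p <= k ==> 1 <= c ==> c <= m ==> ent p c : succs (lft p c)"
 by (cases "c = 1") (simp_all add: lft_def ext_succs)

lemma blw_succs:
 assumes "1 <= p" "p <= k" "1 <= c" "c <= m"
 shows "up p c : succs (blw (Suc p) c)"
proof (cases "p = 1 & c = m")
 case True
 hence "blw (Suc p) c = lft 1 m" "up p c = ent 1 m" by (simp_all add: blw_def ent_def)
 thus ?thesis using lft_succs[of 1 m] k1 m1 by simp
next
 case False
 show ?thesis unfolding blw_ext[OF False assms(1)] using assms False
  by (cases "c < m") (simp_all add: ext_succs, auto simp: ext_def)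
qed

lemma ext_VV: "1 <= p ==> p <= k ==> 1 <= c ==> c <= m ==> ~ (p = 1 & c = m) ==> ext p c : VV"
 by (simp add: ext_def In_VV Ex_VV)

lemma lft_VV: "1 <= p ==> p <= k ==> 1 <= c ==> c <= m ==> lft p c : VV"
proof (cases "c = 1")
 case False
 assume a: "1 <= p" "p <= k" "1 <= c" "c <= m"
 have "1 <= c - 1" "c - 1 <= m" "~ (p = 1 & c - 1 = m)" using a False by auto
 with ext_VV[OF a(1,2)] show ?thesis using False by (simp add: lft_def)
qed (simp add: lft_def Bd_VV)

lemma blw_VV: "1 <= p ==> p <= k ==> 1 <= c ==> c <= m ==> blw (Suc p) c : VV"
 using ext_VV[of p c] lft_VV[of 1 m] k1 m1 by (cases "p = 1 & c = m") (simp_all add: blw_ext, simp add: blw_def)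

text \<open>Edges are defined by predecessors, which gives the incoming edges at once; the
  description by successors gives the outgoing ones.\<close>

lemma EE_succs: "(u, v) : EE <-> u : VV & v : succs u"
proof
 assume e: "(u, v) : EE"
 show "u : VV & v : succs u"
 proof (cases v)
  case (In p c)
  hence v: "1 <= p" "p <= k" "1 <= c" "c <= m" "~ (p = 1 & c = m)" using e by (simp_all add: EE_In In_VV)
  consider "u = lft p c" | "2 <= p" "u = blw p c" using e In by (auto simp: EE_In)
  thus ?thesis
  proof cases
   case 1
   have "In p c = ent p c" unfolding ent_def if_not_P[OF v(5)] ..
   thus ?thesis unfolding 1 In using lft_succs[OF v(1-4)] lft_VV[OF v(1-4)] by simp
  next
   case 2
   define q where "q = p - 1"
   have q: "p = Suc q" "1 <= q" "q <= k" "q < k" using 2 v(2) by (simp_all add: q_def)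
   have "In p c = up q c" using q by (simp add: up_def)
   thus ?thesis unfolding 2 In using blw_succs[OF q(2,3) v(3,4)] blw_VV[OF q(2,3) v(3,4)] q(1) by simp
  qed
 next
  case (Ex p c)
  thus ?thesis using e by (simp add: EE_Ex Ex_VV In_VV)
 next
  case (Bd i)
  define c where "c = i - k"
  have c: "u = blw (Suc k) c" "1 <= c" "c <= m" "Bd i = up k c" using e Bd by (auto simp: EE_Bd c_def up_def)
  show ?thesis unfolding Bd c(1,4) using blw_succs[OF k1 order_refl c(2,3)] blw_VV[OF k1 order_refl c(2,3)] by simp
 qed
next
 assume a: "u : VV & v : succs u"
 have x: "(ext p c, ent p (Suc c)) : EE" "(ext p c, up p c) : EE" if "1 <= p" "p <= k" "1 <= c" "c < m" for p c
  using ent_EE[of p "Suc c"] up_EE[of p c] that blw_ext[of p c] by (simp_all add: lft_def)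
 show "(u, v) : EE"
 proof (cases u)
  case (In p c)
  have "1 <= p" "c <= m" "~ (p = 1 & c = m)" using a In by (simp_all add: In_VV)
  hence "2 <= p & c < m | p = 1 & c < m | 2 <= p & c = m" by arith
  then consider "2 <= p" "c < m" | "p = 1" "c < m" | "2 <= p" "c = m" by blast
  thus ?thesis
  proof cases
   case 1
   thus ?thesis using a In by (simp add: EE_Ex In_VV Ex_VV)
  next
   case 2
   hence "u = ext p c" "v = ent p (Suc c) | v = up p c" "1 <= p" "p <= k" "1 <= c" using a In by (simp_all add: ext_def In_VV)
   thus ?thesis using x[of p c] 2 by auto
  next
   case 3
   hence "u = blw (Suc p) c" "v = up p c" "1 <= p" "p <= k" "1 <= c" "c <= m" using a In by (simp_all add: blw_def ext_def In_VV)
   thus ?thesis using up_EE[of p c] by simp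
  qed
 next
  case (Ex p c)
  hence "u = ext p c" "v = ent p (Suc c) | v = up p c" "1 <= p" "p <= k" "1 <= c" "c < m" using a by (simp_all add: ext_def Ex_VV)
  thus ?thesis using x[of p c] by auto
 next
  case (Bd i)
  hence "u = lft i 1" "v = ent i 1" "1 <= i" "i <= k" using a by (auto simp: lft_def Bd_VV split: if_splits)
  thus ?thesis using ent_EE[of i 1] m1 by simp
 qed
qed

lemma EE_VV: "(u, v) : EE ==> u : VV & v : VV"
 using EE_succs[of u v] by (auto simp: EE_def)

section \<open>Monotone functions, paths and pivots of the grid\<close>

fun rw :: "gv => nat" where
 "rw (In p c) = p" | "rw (Ex p c) = p" | "rw (Bd i) = (if i <= k then i else Suc k)"

fun cl :: "gv => nat" where
 "cl (In p c) = c" | "cl (Ex p c) = c" | "cl (Bd i) = i - k"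

text \<open>A height that grows along every edge, so that the grid has no cycles. The factor 3
  leaves room for the step from \<open>In\<close> to \<open>Ex\<close> inside a crossing.\<close>

fun rk :: "gv => nat" where
 "rk (In p c) = 3 * (p + c)" | "rk (Ex p c) = 3 * (p + c) + 2" | "rk (Bd i) = (if i <= k then 3 * i else 3 * (k + m + 1))"

lemma EE_cases:
 assumes "(u, v) : EE"
 obtains (lft) p c where "u = lft p c" "v = In p c" "1 <= p" "p <= k" "1 <= c" "c <= m"
 | (up) p c where "u = blw (Suc p) c" "v = up p c" "1 <= p" "p <= k" "1 <= c" "c <= m"
 | (ext) p c where "u = In p c" "v = Ex p c"
proof (cases v)
 case (In p c)
 hence v: "1 <= p" "p <= k" "1 <= c" "c <= m" "u = lft p c | 2 <= p & u = blw p c" using assms by (auto simp: EE_In In_VV)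
 thus thesis using lft[of p c] up[of "p - 1" c] In by (auto simp: up_def)
next
 case (Ex p c)
 thus thesis using ext assms by (simp add: EE_Ex)
next
 case (Bd i)
 thus thesis using up[of k "i - k"] assms k1 by (auto simp: EE_Bd up_def)
qed

lemma rw_ext [simp]: "rw (ext p c) = p" and cl_ext [simp]: "cl (ext p c) = c"
 by (auto simp: ext_def)

lemma rw_lft: "p <= k ==> rw (lft p c) = p" and cl_lft: "p <= k ==> cl (lft p c) = c - 1"
 by (simp_all add: lft_def)

lemma rw_blw: "1 <= p ==> rw (blw (Suc p) c) = p" and cl_blw: "1 <= p ==> cl (blw (Suc p) c) <= c"
 using k1 rw_lft[of 1 m] cl_lft[of 1 m] by (simp_all add: blw_def)

lemma rw_up: "1 <= c ==> p <= k ==> rw (up p c) = Suc p" and cl_up: "cl (up p c) = c"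
 by (simp_all add: up_def)

lemma rk_ext: "rk (ext p c) <= 3 * (p + c) + 2"
 by (simp add: ext_def)

lemma rk_lft: "1 <= c ==> p <= k ==> rk (lft p c) < 3 * (p + c)"
 using rk_ext[of p "c - 1"] by (cases "c = 1") (simp_all add: lft_def)

lemma rk_blw: "1 <= p ==> 1 <= c ==> rk (blw (Suc p) c) < 3 * (Suc p + c)"
 using rk_ext[of p c] rk_lft[of m 1] k1 m1 by (simp add: blw_def)

lemma rk_up: "c <= m ==> 1 <= c ==> p <= k ==> 3 * (Suc p + c) <= rk (up p c)"
 by (simp add: up_def)

lemma rk_mono: "(u, v) : EE ==> rk u < rk v"
proof (elim EE_cases)
 fix p c assume a: "u = lft p c" "v = In p c" "1 <= c" "p <= k"
 show "rk u < rk v" using rk_lft[OF a(3,4)] by (simp add: a)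
next
 fix p c assume a: "u = blw (Suc p) c" "v = up p c" "1 <= p" "p <= k" "1 <= c" "c <= m"
 show "rk u < rk v" using rk_blw[OF a(3,5)] rk_up[OF a(6,5,4)] by (simp add: a)
qed simp

lemma rw_mono: "(u, v) : EE ==> rw u <= rw v"
proof (elim EE_cases)
 fix p c assume a: "u = blw (Suc p) c" "v = up p c" "1 <= p" "p <= k" "1 <= c" "c <= m"
 show "rw u <= rw v" using rw_blw[OF a(3)] rw_up[OF a(5,4)] by (simp add: a)
qed (simp_all add: rw_lft)

lemma cl_mono: "(u, v) : EE ==> cl u <= cl v"
proof (elim EE_cases)
 fix p c assume a: "u = blw (Suc p) c" "v = up p c" "1 <= p" "p <= k" "1 <= c" "c <= m"
 show "cl u <= cl v" using cl_blw[OF a(3)] cl_up by (simp add: a)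
qed (simp_all add: cl_lft)

text \<open>The edge that leaves the crossing \<open>u\<close> along its column. There is one for
  each matrix entry, and these edges carry the free weights.\<close>

definition piv :: "nat \<times> nat => gv \<times> gv" where
 "piv u = (blw (Suc (fst u)) (snd u), up (fst u) (snd u))"

lemma piv_EE: "u : {1..k} \<times> {1..m} ==> piv u : EE"
 using up_EE[of "fst u" "snd u"] by (auto simp: piv_def)

lemma piv_inj: "inj_on piv ({1..k} \<times> {1..m})"
proof (rule inj_onI)
 fix u v assume a: "u : {1..k} \<times> {1..m}" "v : {1..k} \<times> {1..m}" "piv u = piv v"
 hence "up (fst u) (snd u) = up (fst v) (snd v)" by (simp add: piv_def)
 with a(1,2) rw_up[of "snd u" "fst u"] rw_up[of "snd v" "fst v"] cl_up[of "fst u" "snd u"] cl_up[of "fst v" "snd v"]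
 show "u = v" by (cases u; cases v) auto
qed

definition gpath :: "gv => gv => gv list => bool" where
 "gpath u v vs <-> vs ~= [] & hd vs = u & last vs = v & successively (%x y. (x, y) : EE) vs"

lemma gpath_sorted:
 assumes "gpath u v vs" and mono: "!!x y. (x, y) : EE ==> R x y" and tr: "transp R"
 shows "sorted_wrt R vs"
proof -
 have "successively R vs" using assms(1) mono unfolding gpath_def by (auto elim: successively_mono)
 thus ?thesis using successively_conv_sorted_wrt[OF tr] by blast
qed

lemma gpath_rk: "gpath u v vs ==> sorted_wrt (%x y. rk x < rk y) vs"
 by (rule gpath_sorted[where R = "%x y. rk x < rk y"]) (auto simp: rk_mono transp_def)

lemma gpath_rw: "gpath u v vs ==> sorted_wrt (%x y. rw x <= rw y) vs"
 by (rule gpath_sorted[where R = "%x y. rw x <= rw y"]) (auto simp: rw_mono transp_def)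

lemma gpath_cl: "gpath u v vs ==> sorted_wrt (%x y. cl x <= cl y) vs"
 by (rule gpath_sorted[where R = "%x y. cl x <= cl y"]) (auto simp: cl_mono transp_def)

lemma gpath_distinct:
 assumes "gpath u v vs"
 shows "distinct vs"
proof -
 have "sorted_wrt (%x y. rk x < rk y) ws ==> distinct ws" for ws by (induction ws) auto
 thus ?thesis using gpath_rk[OF assms] .
qed

lemma gpath_VV: "gpath u v vs ==> u : VV ==> set vs <= VV"
proof -
 assume "gpath u v vs" "u : VV"
 hence "successively (%x y. (x, y) : EE) vs" "vs ~= []" "hd vs : VV" by (auto simp: gpath_def)
 thus ?thesis
 proof (induction vs rule: induct_list012)
  case (3 x y zs)
  thus ?case using EE_VV[of x y] by auto
 qed auto
qed

lemma finite_gpaths: "u : VV ==> finite {vs. gpath u v vs}"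
proof (rule finite_subset)
 assume u: "u : VV"
 show "{vs. gpath u v vs} <= {vs. set vs <= VV & length vs <= card VV}"
 proof
  fix vs assume "vs : {vs. gpath u v vs}"
  hence g: "gpath u v vs" by simp
  have "length vs = card (set vs)" using distinct_card[OF gpath_distinct[OF g]] by simp
  also have "... <= card VV" by (rule card_mono[OF finite_VV gpath_VV[OF g u]])
  finally show "vs : {vs. set vs <= VV & length vs <= card VV}" using gpath_VV[OF g u] by simp
 qed
 show "finite {vs. set vs <= VV & length vs <= card VV}" by (rule finite_lists_length_le[OF finite_VV])
qed

text \<open>A linear order of the matrix entries: later rows come before earlier ones, and within a
  row smaller columns come before larger ones.\<close>

definition prank :: "nat \<times> nat => nat" where
 "prank u = (k - fst u) * m + snd u"

lemma gpath_edge_split: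
 assumes "(x, y) : set (zip vs (tl vs))"
 obtains xs ys where "vs = xs @ x # y # ys"
proof -
 obtain i where i: "i < length (tl vs)" "x = vs ! i" "y = tl vs ! i" using assms by (auto simp: in_set_zip)
 hence "vs = take i vs @ vs ! i # vs ! Suc i # drop (Suc (Suc i)) vs"
  using id_take_nth_drop[of i vs] Cons_nth_drop_Suc[of "Suc i" vs] by auto
 thus thesis using i by (intro that[of "take i vs" "drop (Suc (Suc i)) vs"]) (simp add: nth_tl)
qed

text \<open>Rows and columns never decrease along a path, so a path from the source \<open>p\<close>
  to the sink of column \<open>c\<close> uses only pivots in rows from \<open>p\<close> on and in
  columns up to \<open>c\<close>. This makes the boundary measurements triangular in the weights of
  the pivots.\<close>

lemma prank_gpath:
 assumes g: "gpath (Bd p) (Bd (k + c)) vs" and p: "p : {1..k}" and c: "c : {1..m}"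
  and u: "u : {1..k} \<times> {1..m}" "piv u : set (zip vs (tl vs))"
 shows "prank u <= prank (p, c)"
proof -
 obtain p' c' where u': "u = (p', c')" "p' : {1..k}" "c' : {1..m}" using u(1) by auto
 obtain xs ys where vs: "vs = xs @ blw (Suc p') c' # up p' c' # ys"
  using gpath_edge_split[OF u(2)[unfolded piv_def u' fst_conv snd_conv]] .
 have "p <= p'"
 proof (cases xs)
  case Nil
  thus ?thesis using g vs rw_blw[of p' c'] u'(2) p by (simp add: gpath_def)
 next
  case (Cons x xs')
  hence "x = Bd p" using g vs by (simp add: gpath_def)
  thus ?thesis using gpath_rw[OF g] rw_blw[of p' c'] u'(2) p unfolding vs Cons by simp
 qed
 moreover have "c' <= c"
 proof (cases ys rule: rev_cases)
  case Nil
  thus ?thesis using g vs cl_up[of p' c'] by (simp add: gpath_def)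
 next
  case (snoc ys' y)
  hence "y = Bd (k + c)" using g vs by (simp add: gpath_def)
  thus ?thesis using gpath_cl[OF g] cl_up[of p' c'] unfolding vs snoc by (simp add: sorted_wrt_append)
 qed
 ultimately show ?thesis unfolding prank_def u' fst_conv snd_conv
  by (intro add_le_mono mult_le_mono1 diff_le_mono2)
qed

lemma prank_inj: "inj_on prank ({1..k} \<times> {1..m})"
proof (rule inj_onI)
 fix u v assume a: "u : {1..k} \<times> {1..m}" "v : {1..k} \<times> {1..m}" "prank u = prank v"
 obtain p c q d where uv: "u = (p, c)" "v = (q, d)" by (cases u; cases v)
 have e: "(k - p) * m + (c - 1) = (k - q) * m + (d - 1)" using a uv by (auto simp: prank_def)
 have lt: "c - 1 < m" "d - 1 < m" using a uv by auto
 have "k - p = k - q" using arg_cong[OF e, of "%x. x div m"] lt by simp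
 moreover have "c - 1 = d - 1" using arg_cong[OF e, of "%x. x mod m"] lt by simp
 ultimately show "u = v" using a uv by auto
qed

text \<open>The vertex before \<open>v\<close> on a path that follows row \<open>p\<close> and
  afterwards a single column: the step comes along the column if the row exceeds \<open>p\<close>,
  and along the row otherwise.\<close>

definition bpred :: "nat => gv => gv" where
 "bpred p v = (case v of In q c => (if p < q then blw q c else lft q c) | Ex q c => In q c | Bd i => blw (Suc k) (i - k))"

definition bp_step :: "nat => gv => gv => bool" where
 "bp_step p x y <-> (x, y) : EE & x = bpred p y"

text \<open>Up to the pivot the row is at most \<open>p\<close>, hence equal to \<open>p\<close>;
  after the pivot the column is at least \<open>c\<close>, hence equal to \<open>c\<close>. So every
  step of the path is forced.\<close>

lemma piv_path_step:
 assumes g: "gpath (Bd p) (Bd (k + c)) vs" and p: "p : {1..k}" and c: "c : {1..m}"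
  and pv: "piv (p, c) : set (zip vs (tl vs))"
 shows "successively (bp_step p) vs"
proof -
 obtain xs ys where vs: "vs = (xs @ [blw (Suc p) c]) @ (up p c # ys)"
  using gpath_edge_split[OF pv[unfolded piv_def fst_conv snd_conv]] by (metis append.assoc append_Cons append_Nil)
 have r0: "p <= rw x" if "x : set vs" for x
 proof -
  obtain zs where zs: "vs = Bd p # zs" using g by (cases vs) (auto simp: gpath_def)
  show ?thesis using gpath_rw[OF g] that p unfolding zs by auto
 qed
 have r1: "rw x <= p" if "x : set (xs @ [blw (Suc p) c])" for x
  using gpath_rw[OF g] that rw_blw[of p c] p unfolding vs by (auto simp: sorted_wrt_append)
 have c1: "c <= cl x & p < rw x" if "x : set (up p c # ys)" for x
  using gpath_cl[OF g] gpath_rw[OF g] that cl_up[of p c] rw_up[of c p] p c unfolding vs by (auto simp: sorted_wrt_append)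
 have c2: "cl x <= c" if "x : set vs" for x
 proof -
  obtain zs where zs: "vs = zs @ [Bd (k + c)]" using g by (cases vs rule: rev_cases) (auto simp: gpath_def)
  show ?thesis using gpath_cl[OF g] that unfolding zs by (auto simp: sorted_wrt_append)
 qed
 have step: "bp_step p x y" if xy: "(x, y) : EE" and mem: "x : set vs" "y : set vs" for x y
 proof -
  have "x = bpred p y"
  proof (cases y)
   case (In q d)
   show ?thesis
   proof (cases "p < q")
    case True
    have y: "y : set (up p c # ys)" using mem(2) r1[of y] True In unfolding vs by auto
    have "x ~= lft q d"
    proof
     assume x: "x = lft q d"
     have q: "q <= k" "1 <= d" using xy In by (auto simp: EE_In In_VV)
     have "rw x = q" "cl x = d - 1" using x q by (simp_all add: rw_lft cl_lft)
     hence xm: "x : set (up p c # ys)" using mem(1) r1[of x] True unfolding vs by auto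
     have "c <= d - 1" using c1[OF xm] \<open>cl x = d - 1\<close> by simp
     moreover have "d <= c" using c2[OF mem(2)] In by simp
     ultimately show False using q by linarith
    qed
    thus ?thesis using xy True by (simp add: In EE_In bpred_def)
   next
    case False
    hence "q = p" using r0[OF mem(2)] In by simp
    have "x ~= blw q d" if "2 <= q"
    proof
     assume "x = blw q d"
     hence "rw x = q - 1" using rw_blw[of "q - 1" d] that \<open>q = p\<close> p by simp
     thus False using r0[OF mem(1)] \<open>q = p\<close> that by simp
    qed
    thus ?thesis using xy False by (auto simp: In EE_In bpred_def)
   qed
  qed (use xy in \<open>auto simp: EE_Ex EE_Bd bpred_def\<close>)
  thus ?thesis using xy by (simp add: bp_step_def)
 qed
 have "successively (%x y. (x, y) : EE) vs" using g by (simp add: gpath_def)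
 thus ?thesis by (rule successively_mono) (rule step)
qed

text \<open>Read backwards from its last vertex, such a path is determined by \<open>bpred\<close>,
  and it ends at \<open>Bd p\<close>, which no edge enters.\<close>

lemma bpath_unique:
 assumes "vs ~= []" "ws ~= []" "successively (bp_step p) vs" "successively (bp_step p) ws" "last vs = last ws"
  and "hd vs = Bd p" "hd ws = Bd p" and p: "p <= k"
 shows "vs = ws"
 using assms(1-7)
proof (induction vs arbitrary: ws rule: rev_induct)
 case (snoc v vs)
 have no: "~ bp_step p x (Bd p)" for x using p by (auto simp: bp_step_def EE_Bd)
 obtain ws' where ws: "ws = ws' @ [v]" using snoc.prems(2,5) by (cases ws rule: rev_cases) auto
 show ?case
 proof (cases "vs = []")
  case True
  hence "v = Bd p" using snoc.prems(6) by simp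
  moreover have "ws' = []"
  proof (rule ccontr)
   assume "ws' ~= []"
   hence "bp_step p (last ws') v" using snoc.prems(4) unfolding ws by (simp add: successively_append_iff)
   thus False using no \<open>v = Bd p\<close> by simp
  qed
  ultimately show ?thesis using True ws by simp
 next
  case False
  hence 1: "bp_step p (last vs) v" using snoc.prems(3) by (simp add: successively_append_iff)
  have "ws' ~= []"
  proof
   assume "ws' = []"
   hence "v = Bd p" using snoc.prems(7) ws by simp
   thus False using 1 no by simp
  qed
  hence 2: "bp_step p (last ws') v" using snoc.prems(4) unfolding ws by (simp add: successively_append_iff)
  have "last vs = last ws'" using 1 2 by (simp add: bp_step_def)
  hence "vs = ws'" using snoc.prems False \<open>ws' ~= []\<close> unfolding ws
   by (intro snoc.IH) (auto simp: successively_append_iff)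
  thus ?thesis using ws by simp
 qed
qed simp

lemma row_path:
 assumes p: "p : {1..k}"
 shows "v : VV ==> rw v = p ==> EX vs. gpath (Bd p) v vs"
proof (induction v rule: measure_induct_rule[of rk])
 case (less v)
 consider "v = Bd p" | u where "(u, v) : EE" "rw u = p"
 proof (cases v)
  case (In q c)
  hence "(lft q c, v) : EE" using less.prems by (simp add: EE_In)
  moreover have "rw (lft q c) = p" using In less.prems p by (simp add: rw_lft)
  ultimately show ?thesis using that(2) by blast
 next
  case (Ex q c)
  hence "(In q c, v) : EE" using less.prems by (simp add: EE_Ex)
  thus ?thesis using that(2)[of "In q c"] Ex less.prems by simp
 next
  case (Bd i)
  thus ?thesis using that(1) less.prems p by (auto split: if_splits)
 qed
 thus ?case
 proof cases
  case 1
  thus ?thesis by (intro exI[of _ "[Bd p]"]) (simp add: gpath_def)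
 next
  case (2 u)
  then obtain vs where "gpath (Bd p) u vs" using less.IH[OF rk_mono[OF 2(1)]] EE_VV[OF 2(1)] by blast
  thus ?thesis using 2(1) by (intro exI[of _ "vs @ [v]"]) (auto simp: gpath_def successively_append_iff)
 qed
qed

lemma column_path:
 assumes p: "p : {1..k}" and c: "c : {1..m}"
 shows "v : VV ==> p < rw v ==> cl v = c ==> EX vs. gpath (Bd p) v vs & piv (p, c) : set (zip vs (tl vs))"
proof (induction v rule: measure_induct_rule[of rk])
 case (less v)
 consider "v = up p c" | u where "(u, v) : EE" "p < rw u" "cl u = c"
 proof (cases "v = up p c")
  case False
  show ?thesis
  proof (cases v)
   case (In q d)
   have q: "p < q" "q <= k" "d = c" using less.prems In by (auto simp: In_VV)
   hence "q ~= Suc p" using False In by (auto simp: up_def)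
   moreover have "(blw q d, v) : EE" using less.prems q p In by (auto simp: EE_In)
   moreover have "blw q d = ext (q - 1) c" using q p \<open>q ~= Suc p\<close> by (auto simp: blw_def)
   ultimately show ?thesis using that(2)[of "blw q d"] q by auto
  next
   case (Ex q d)
   thus ?thesis using that(2)[of "In q d"] less.prems by (simp add: EE_Ex)
  next
   case (Bd i)
   have i: "k < i" "i = k + c" "p < k" using less.prems Bd False p c by (auto simp: up_def split: if_splits)
   hence "(blw (Suc k) (i - k), v) : EE" using Bd c by (simp add: EE_Bd)
   moreover have "blw (Suc k) (i - k) = ext k c" using i p by (auto simp: blw_def)
   ultimately show ?thesis using that(2)[of "ext k c"] i by simp
  qed
 qed (rule that(1))
 thus ?case
 proof cases
  case 1
  have e: "(blw (Suc p) c, v) : EE" using piv_EE[of "(p, c)"] p c 1 by (simp add: piv_def)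
  have r: "rw (blw (Suc p) c) = p" using rw_blw[of p c] p by simp
  obtain vs where vs: "gpath (Bd p) (blw (Suc p) c) vs" using row_path[OF p conjunct1[OF EE_VV[OF e]] r] by (rule exE)
  have "gpath (Bd p) v (vs @ [v])" using vs e by (auto simp: gpath_def successively_append_iff)
  moreover have "piv (p, c) : set (zip (vs @ [v]) (tl (vs @ [v])))"
   using zip_tl_snoc[of vs v] vs 1 by (auto simp: piv_def gpath_def)
  ultimately show ?thesis by blast
 next
  case (2 u)
  then obtain vs where vs: "gpath (Bd p) u vs" "piv (p, c) : set (zip vs (tl vs))" using less.IH[OF rk_mono[OF 2(1)]] EE_VV[OF 2(1)] by blast
  have "zip (vs @ [v]) (tl (vs @ [v])) = zip vs (tl vs) @ [(last vs, v)]"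
   using vs(1) by (intro zip_tl_snoc) (simp add: gpath_def)
  thus ?thesis using vs 2(1) by (intro exI[of _ "vs @ [v]"]) (auto simp: gpath_def successively_append_iff)
 qed
qed

lemma unique_piv_path:
 assumes p: "p : {1..k}" and c: "c : {1..m}"
 shows "EX vs0. {vs. gpath (Bd p) (Bd (k + c)) vs & piv (p, c) : set (zip vs (tl vs))} = {vs0}"
proof -
 have "Bd (k + c) : VV" "p < rw (Bd (k + c))" "cl (Bd (k + c)) = c" using p c by (auto simp: Bd_VV)
 from column_path[OF p c this] obtain vs0 where vs0: "gpath (Bd p) (Bd (k + c)) vs0" "piv (p, c) : set (zip vs0 (tl vs0))" by blast
 have uniq: "vs = vs0" if vs: "gpath (Bd p) (Bd (k + c)) vs" "piv (p, c) : set (zip vs (tl vs))" for vs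
  by (rule bpath_unique[OF _ _ piv_path_step[OF vs(1) p c vs(2)] piv_path_step[OF vs0(1) p c vs0(2)]])
   (use vs vs0 p in \<open>auto simp: gpath_def\<close>)
 show ?thesis
 proof (intro exI equalityI subsetI)
  fix vs assume "vs : {vs. gpath (Bd p) (Bd (k + c)) vs & piv (p, c) : set (zip vs (tl vs))}"
  thus "vs : {vs0}" using uniq[of vs] by simp
 next
  fix vs assume "vs : {vs0}"
  thus "vs : {vs. gpath (Bd p) (Bd (k + c)) vs & piv (p, c) : set (zip vs (tl vs))}" using vs0 by simp
 qed
qed

end

lemma open_segment_sphere:
 fixes a b :: complex
 assumes "norm a <= 1" "norm b <= 1" "z : open_segment a b"
 shows "norm z < 1"
 using dist_decreases_open_segment[OF assms(3), of 0] assms(1,2) by auto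

context grid
begin

section \<open>Drawing the grid in the disk\<close>

definition eps :: real where "eps = 1 / (100 * real (k + m))"

text \<open>Column and row as lattice coordinates. The vertices \<open>Ex\<close> are moved by 1/3
  in both directions, so that edges along rows and along columns lie on different sides of the
  diagonal of a unit square.\<close>

fun ci :: "gv => real" where
 "ci (In p c) = real c" | "ci (Ex p c) = real c + 1/3" | "ci (Bd i) = 0"

fun ri :: "gv => real" where
 "ri (In p c) = real p" | "ri (Ex p c) = real p + 1/3" | "ri (Bd i) = 0"

text \<open>A shift of the columns that puts the first sink, if it is not the last one, at the angle
  \<open>pi / 2\<close>.\<close>

definition X0 :: real where "X0 = ci (ext k 1)"

text \<open>\<open>Xf\<close> and \<open>Yf\<close> recover lattice coordinates from points of the
  plane. Columns are numbered from right to left, since the sources on the right and the sinks at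
  the top must be labelled counterclockwise.\<close>

definition Xf :: "complex => real" where "Xf z = X0 - Re z / eps"
definition Yf :: "complex => real" where "Yf z = 2 + Im z / eps"

text \<open>Sources from the second on are level with their rows and sinks before the last are above
  their columns, so their edges are horizontal or vertical. The first source and the last sink are
  moved far apart, to rational points from the Pythagorean triples (3, 4, 5) and (7, 24, 25); with
  them the convex hull contains a disk of fixed size around the small grid.\<close>

definition ang :: "nat => real" where
 "ang i = (if i = 1 then - arcsin (4/5) else if i <= k then arcsin (eps * (real i - 2))
  else if i < k + m then arccos (- (eps * (ci (ext k (i - k)) - X0))) else arccos (- (24/25)))"

fun pos :: "gv => complex" where
 "pos (Bd i) = cis (ang i)"
| "pos v = Complex (- (eps * (ci v - X0))) (eps * (ri v - 2))"

lemma eps_pos: "0 < eps" and eps_km: "eps * real (k + m) = 1 / 100"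
 using k1 by (auto simp: eps_def)

lemma eps_le: "\<bar>x\<bar> <= real (k + m) ==> \<bar>eps * x\<bar> <= 1 / 100"
proof -
 assume "\<bar>x\<bar> <= real (k + m)"
 hence "eps * \<bar>x\<bar> <= eps * real (k + m)" using eps_pos by (intro mult_left_mono) auto
 thus ?thesis using eps_pos unfolding eps_km by (simp add: abs_mult)
qed

lemma X0_range: "1 <= X0" "X0 <= 4/3"
 by (auto simp: X0_def ext_def)

lemma inner_range: "v : inn ==> 1 <= ci v & ci v <= real m & 1 <= ri v & ri v <= real k + 1/3"
 unfolding inn_def by auto

lemma Xf_inner: "v : inn ==> Xf (pos v) = ci v" and Yf_inner: "v : inn ==> Yf (pos v) = ri v"
 using eps_pos by (auto simp: inn_def Xf_def Yf_def)

lemma inner_bound: "v : inn ==> \<bar>Re (pos v)\<bar> <= 1/100 & \<bar>Im (pos v)\<bar> <= 1/100"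
proof -
 assume v: "v : inn"
 have "\<bar>ci v - X0\<bar> <= real (k + m)" "\<bar>ri v - 2\<bar> <= real (k + m)"
  using inner_range[OF v] X0_range k1 m1 by auto
 from eps_le[OF this(1)] eps_le[OF this(2)] show ?thesis using v by (auto simp: inn_def)
qed

lemma source_angle: "2 <= i ==> i <= k ==> \<bar>eps * (real i - 2)\<bar> <= 1/100"
 by (rule eps_le) auto

lemma sink_angle: "k < i ==> i < k + m ==> \<bar>eps * (ci (ext k (i - k)) - X0)\<bar> <= 1/100"
 using X0_range m1 by (intro eps_le) (auto simp: ext_def)

lemma pos_first: "pos (Bd 1) = Complex (3/5) (- (4/5))"
proof -
 have "sqrt (1 - (4/5)\<^sup>2) = 3/5" by (rule real_sqrt_unique) (simp_all add: power2_eq_square)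
 thus ?thesis by (auto simp: complex_eq_iff ang_def cos_arcsin)
qed

lemma pos_last: "pos (Bd (k + m)) = Complex (- (24/25)) (7/25)"
proof -
 have "sqrt (1 - (24/25)\<^sup>2) = 7/25" by (rule real_sqrt_unique) (simp_all add: power2_eq_square)
 thus ?thesis using k1 m1 by (auto simp: complex_eq_iff ang_def sin_arccos)
qed

lemma sqrt_bound: "\<bar>x\<bar> <= 1/100 ==> 1/2 <= sqrt (1 - x\<^sup>2)"
proof (rule real_le_rsqrt)
 assume "\<bar>x\<bar> <= 1/100"
 hence "x\<^sup>2 <= (1/100)\<^sup>2" using power_mono[of "\<bar>x\<bar>" "1/100" 2] by simp
 thus "(1/2)\<^sup>2 <= 1 - x\<^sup>2" by (simp add: power2_eq_square)
qed

lemma pos_source: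
 assumes "2 <= i" "i <= k"
 shows "Im (pos (Bd i)) = eps * (real i - 2)" "1/2 <= Re (pos (Bd i))"
 using source_angle[OF assms] sqrt_bound[OF source_angle[OF assms]] assms by (auto simp: ang_def cos_arcsin)

lemma pos_sink:
 assumes "k < i" "i < k + m"
 shows "Re (pos (Bd i)) = - (eps * (ci (ext k (i - k)) - X0))" "1/2 <= Im (pos (Bd i))"
 using sink_angle[OF assms] sqrt_bound[OF sink_angle[OF assms]] assms k1 by (auto simp: ang_def sin_arccos)

lemma half_eps: "1/2 <= x ==> 50 * real (k + m) <= x / eps"
 using eps_pos eps_km by (simp add: field_simps)

lemma XY_first: "Yf (pos (Bd 1)) < 1"
proof -
 have "(4/5) / eps >= 50 * real (k + m)" by (rule half_eps) simp
 thus ?thesis using k1 m1 unfolding pos_first by (simp add: Yf_def)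
qed

lemma XY_source: "2 <= i ==> i <= k ==> Yf (pos (Bd i)) = real i" "2 <= i ==> i <= k ==> Xf (pos (Bd i)) < 1"
 using pos_source[of i] half_eps[of "Re (pos (Bd i))"] X0_range eps_pos k1 m1 by (auto simp: Yf_def Xf_def)

lemma XY_sink: "1 <= c ==> c < m ==> Xf (pos (Bd (k + c))) = ci (ext k c)" "1 <= c ==> c < m ==> real k + 1 < Yf (pos (Bd (k + c)))"
 using pos_sink[of "k + c"] half_eps[of "Im (pos (Bd (k + c)))"] eps_pos k1 m1 by (auto simp: Yf_def Xf_def)

lemma XY_last: "real m < Xf (pos (Bd (k + m)))" "2 < Yf (pos (Bd (k + m)))"
proof -
 have "(24/25) / eps >= 50 * real (k + m)" by (rule half_eps) simp
 thus "real m < Xf (pos (Bd (k + m)))" using k1 m1 X0_range unfolding pos_last by (simp add: Xf_def)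
 show "2 < Yf (pos (Bd (k + m)))" using eps_pos unfolding pos_last by (simp add: Yf_def)
qed

lemma open_segment_XY:
 assumes "z : open_segment a b"
 obtains s where "0 < s" "s < 1" "Xf z = (1 - s) * Xf a + s * Xf b" "Yf z = (1 - s) * Yf a + s * Yf b"
proof -
 obtain s where s: "0 < s" "s < 1" "z = (1 - s) *\<^sub>R a + s *\<^sub>R b" using assms by (auto simp: in_segment)
 show thesis
  by (rule that[OF s(1,2)]) (simp_all add: s(3) Xf_def Yf_def algebra_simps add_divide_distrib diff_divide_distrib)
qed

text \<open>Bounds of a lattice box around the inner vertices. The exceptional values come from the
  missing corner, which is all of row 1 if \<open>m = 1\<close> and the end of the only row if
  \<open>k = 1\<close>.\<close>

definition Ymin :: real where "Ymin = (if m = 1 then 2 else 1)"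
definition Xmax :: real where "Xmax = (if k = 1 then real m - 1 else real m)"
definition Ytop :: real where "Ytop = (if k = 1 then 1 else real k + 1/3)"

lemma inn_box: "v : inn ==> Ymin <= ri v & ci v <= Xmax & ri v <= Ytop"
 unfolding inn_def Ymin_def Xmax_def Ytop_def by auto

lemma ext_inn: "1 <= p ==> p <= k ==> 1 <= c ==> c <= m ==> ~ (p = 1 & c = m) ==> ext p c : inn"
 by (simp add: ext_def inn_def)

lemma In_inn: "1 <= p ==> p <= k ==> 1 <= c ==> c <= m ==> ~ (p = 1 & c = m) ==> In p c : inn"
 by (simp add: inn_def)

text \<open>In lattice coordinates the open edges occupy disjoint regions: edges at the boundary
  vertices leave the box on different sides, and an edge between inner vertices stays on the
  diagonal of a unit square, above it or below it.\<close>

lemma open_edge_kinds: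
 assumes e: "(u, v) : EE" and km: "~ (k = 1 & m = 1)" and z: "z : open_segment (pos u) (pos v)"
 obtains (first) "u = Bd 1" "v = ent 1 1" "Yf z < Ymin"
 | (source) p where "u = Bd p" "v = In p 1" "2 <= p" "p <= k" "Yf z = real p" "Xf z < 1"
 | (last) "u = blw (Suc k) m" "v = Bd (k + m)" "Xmax < Xf z" "Ymin <= Yf z" "1 <= Xmax"
 | (sink) c where "u = ext k c" "v = Bd (k + c)" "1 <= c" "c < m" "Xf z = ci (ext k c)" "Ytop < Yf z"
 | (diag) p c s where "u = In p c" "v = Ex p c" "2 <= p" "p <= k" "1 <= c" "c < m" "Xf z = real c + s" "Yf z = real p + s" "0 < s" "s < 1/3"
 | (corner) s where "u = blw 2 m" "v = up 1 m" "2 <= k" "2 <= m" "Xf z = real (m - 1) + s" "Yf z = 1 + s" "0 < s" "s < 1"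
 | (row) p c s r where "u = ext p c" "v = In p (Suc c)" "1 <= p" "p <= k" "1 <= c" "c < m" "~ (p = 1 & Suc c = m)"
   "Xf z = real c + s" "Yf z = real p + r" "0 <= r" "r < s" "s < 1" "r <= 1/3" "p = 1 ==> r = 0" "r = 0 | 1/3 < s"
 | (col) p c s r where "u = ext p c" "v = In (Suc p) c" "1 <= p" "p < k" "1 <= c" "c <= m" "~ (p = 1 & c = m)"
   "Xf z = real c + r" "Yf z = real p + s" "0 <= r" "r < s" "s < 1" "c = m ==> r = 0" "r = 0 | 1/3 < s"
proof -
 obtain s where s: "0 < s" "s < 1" and X: "Xf z = (1 - s) * Xf (pos u) + s * Xf (pos v)" and Y: "Yf z = (1 - s) * Yf (pos u) + s * Yf (pos v)"
  using open_segment_XY[OF z] .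
 have cvx1: "(1 - s) * a + s * b < t" if "a < t" "b <= t" for a b t :: real
 proof -
  have "(1 - s) * a < (1 - s) * t" "s * b <= s * t" using s that by (auto intro: mult_strict_left_mono mult_left_mono)
  moreover have "(1 - s) * t + s * t = t" by (simp add: algebra_simps)
  ultimately show ?thesis by linarith
 qed
 have cvx2: "t < (1 - s) * a + s * b" if "t <= a" "t < b" for a b t :: real
 proof -
  have "(1 - s) * t <= (1 - s) * a" "s * t < s * b" using s that by (auto intro: mult_strict_left_mono mult_left_mono)
  moreover have "(1 - s) * t + s * t = t" by (simp add: algebra_simps)
  ultimately show ?thesis by linarith
 qed
 from e show thesis
 proof (cases rule: EE_cases)
  case (lft p c)
  have iv: "In p c : inn" using e EE_VV lft(2) by (auto simp: VV_def)
  hence nm: "~ (p = 1 & c = m)" by (simp add: inn_def)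
  show thesis
  proof (cases "c = 1")
   case True
   show thesis
   proof (cases "p = 1")
    case p1: True
    have m2: "m ~= 1" using nm True p1 by simp
    have "Yf z < 1" unfolding Y using XY_first Yf_inner[OF iv] lft True p1 by (intro cvx1) (simp_all add: lft_def)
    thus thesis using first lft True p1 m2 by (simp add: lft_def ent_def Ymin_def)
   next
    case False
    have p: "2 <= p" "p <= k" using lft False by auto
    have "Yf z = real p" unfolding Y using XY_source(1)[OF p] Yf_inner[OF iv] lft True by (simp add: lft_def algebra_simps)
    moreover have "Xf z < 1" unfolding X using XY_source(2)[OF p] Xf_inner[OF iv] lft True by (intro cvx1) (simp_all add: lft_def)
    ultimately show thesis using source[OF _ _ p] lft True by (simp add: lft_def)
   qed
  next
   case False
   define d where "d = c - 1"
   have d: "c = Suc d" "1 <= d" "d < m" using lft False by (auto simp: d_def)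
   have u: "u = ext p d" using lft False by (simp add: lft_def d_def)
   have iu: "ext p d : inn" using lft d nm by (intro ext_inn) auto
   show thesis
   proof (cases "2 <= p")
    case True
    have "Xf z = real d + (1/3 + 2/3 * s)" "Yf z = real p + 1/3 * (1 - s)"
     unfolding X Y u lft(2) Xf_inner[OF iu] Yf_inner[OF iu] Xf_inner[OF iv] Yf_inner[OF iv]
     using True d by (simp_all add: ext_def field_simps)
    thus thesis using lft u d True nm s
     by (intro row[of p d "1/3 + 2/3 * s" "1/3 * (1 - s)"]) auto
   next
    case False
    have "Xf z = real d + s" "Yf z = real p + 0"
     unfolding X Y u lft(2) Xf_inner[OF iu] Yf_inner[OF iu] Xf_inner[OF iv] Yf_inner[OF iv]
     using False d by (simp_all add: ext_def algebra_simps)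
    thus thesis using lft u d False nm s by (intro row[of p d s 0]) auto
   qed
  qed
 next
  case (up p c)
  show thesis
  proof (cases "p = k")
   case True
   show thesis
   proof (cases "c = m")
    case cm: True
    have v: "v = Bd (k + m)" using up True cm by (simp add: up_def)
    have "u : inn & Xmax <= ci u & 1 <= Xmax & Ymin <= 2 & Xmax <= real m"
    proof (cases "k = 1")
     case k: True
     hence "u = In 1 (m - 1)" "2 <= m" using up True cm km m1 by (auto simp: blw_def lft_def ext_def)
     moreover have "In 1 (m - 1) : inn" by (rule In_inn) (use k1 \<open>2 <= m\<close> in auto)
     moreover have "Xmax = real m - 1" unfolding Xmax_def using k by (rule if_P)
     ultimately show ?thesis by (simp add: Ymin_def of_nat_diff)
    next
     case False
     hence "u = In k m" "2 <= k" using up True cm k1 by (auto simp: blw_def ext_def)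
     thus ?thesis using False m1 by (auto simp: inn_def Xmax_def Ymin_def)
    qed
    hence u: "u : inn" "Xmax <= ci u" "1 <= Xmax" "Ymin <= 2" "Xmax <= real m" by auto
    have "Xmax < Xf z" unfolding X v using u XY_last(1) Xf_inner[OF u(1)] by (intro cvx2) simp_all
    moreover have "Ymin < Yf z" unfolding Y v using u XY_last(2) Yf_inner[OF u(1)] inn_box[OF u(1)] by (intro cvx2) simp_all
    ultimately show thesis using last v up True cm u by simp
   next
    case False
    have v: "v = Bd (k + c)" and c: "c < m" and u: "u = ext k c" using up True False by (auto simp: up_def blw_def)
    have iu: "ext k c : inn" using up c k1 by (intro ext_inn) auto
    have "Xf z = ci (ext k c)" unfolding X u v Xf_inner[OF iu] XY_sink(1)[OF up(5) c] by (simp add: algebra_simps)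
    moreover have "Ytop < Yf z" unfolding Y u v Yf_inner[OF iu]
     using XY_sink(2)[OF up(5) c] c k1 by (intro cvx2) (auto simp: Ytop_def ext_def)
    ultimately show thesis by (rule sink[OF u v up(5) c])
   qed
  next
   case False
   hence pk: "p < k" using up by simp
   have v: "v = In (Suc p) c" using up pk by (simp add: up_def)
   have iv: "In (Suc p) c : inn" using up pk by (intro In_inn) auto
   show thesis
   proof (cases "p = 1 & c = m")
    case pc: True
    show thesis
    proof (cases "m = 1")
     case True
     have "u = blw 2 m" using up pc by (simp add: numeral_2_eq_2)
     also have "blw 2 m = lft 1 m" by (simp add: blw_def)
     also have "lft 1 m = Bd 1" unfolding lft_def using True by (rule if_P)
     finally have u: "u = Bd 1" .
     have "Yf z < 2" unfolding Y u v using XY_first Yf_inner[OF iv] pc by (intro cvx1) simp_all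
     moreover have "v = ent 1 1"
     proof -
      have "v = up 1 m" using up pc by simp
      also have "... = ent 1 m" by (simp add: ent_def)
      also have "... = ent 1 1" by (simp only: True)
      finally show ?thesis .
     qed
     moreover have "Ymin = 2" unfolding Ymin_def using True by (rule if_P)
     ultimately show thesis by (intro first[OF u]) simp_all
    next
     case m2: False
     hence u: "u = In 1 (m - 1)" "u = blw 2 m" using up pc m1 by (simp_all add: blw_def lft_def ext_def numeral_2_eq_2)
     have iu: "In 1 (m - 1) : inn" using m2 m1 k1 by (intro In_inn) auto
     have "Xf z = real (m - 1) + s" "Yf z = 1 + s"
      unfolding X Y u(1) v Xf_inner[OF iu] Yf_inner[OF iu] Xf_inner[OF iv] Yf_inner[OF iv] using pc m2 m1 by (simp_all add: algebra_simps of_nat_diff)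
     thus thesis using corner[of s] u up pc pk m2 m1 s by simp
    qed
   next
    case npc: False
    have u: "u = ext p c" using up npc blw_ext[of p c] by simp
    have iu: "ext p c : inn" using up npc by (intro ext_inn) auto
    show thesis
    proof (cases "2 <= p & c < m")
     case True
     have "Xf z = real c + 1/3 * (1 - s)" "Yf z = real p + (1/3 + 2/3 * s)"
      unfolding X Y u v Xf_inner[OF iu] Yf_inner[OF iu] Xf_inner[OF iv] Yf_inner[OF iv]
      using True by (simp_all add: ext_def field_simps)
     thus thesis using u v up pk True npc s
      by (intro col[of p c "1/3 * (1 - s)" "1/3 + 2/3 * s"]) auto
    next
     case False
     hence ee: "ext p c = In p c" unfolding ext_def by (rule if_not_P)
     have "Xf z = real c + 0" "Yf z = real p + s"
      unfolding X Y u v Xf_inner[OF iu] Yf_inner[OF iu] Xf_inner[OF iv] Yf_inner[OF iv]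
      by (simp_all add: ee algebra_simps)
     thus thesis using u v up pk npc s by (intro col[of p c 0 s]) auto
    qed
   qed
  qed
 next
  case (ext p c)
  have pc: "2 <= p" "p <= k" "1 <= c" "c < m" using EE_VV[OF e] ext by (auto simp: Ex_VV)
  have i: "In p c : inn" "Ex p c : inn" using pc by (auto simp: inn_def)
  have "Xf z = real c + s / 3" "Yf z = real p + s / 3"
   unfolding X Y ext Xf_inner[OF i(1)] Yf_inner[OF i(1)] Xf_inner[OF i(2)] Yf_inner[OF i(2)] by (simp_all add: algebra_simps)
  thus thesis using ext pc s by (intro diag[of p c "s / 3"]) auto
 qed
qed

end

context grid
begin

text \<open>Recovers an edge from a point inside it. The existence of this function shows that
  different open edges are disjoint, without a comparison of all pairs of kinds.\<close>

definition edge_at :: "complex => gv \<times> gv" where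
 "edge_at z = (let X = Xf z; Y = Yf z; c = nat \<lfloor>X\<rfloor>; p = nat \<lfloor>Y\<rfloor> in
  if Y < Ymin then (Bd 1, ent 1 1)
  else if X < 1 then (Bd p, In p 1)
  else if Xmax < X then (blw (Suc k) m, Bd (k + m))
  else if Ytop < Y then (ext k c, Bd (k + c))
  else if frac X = frac Y then (if p = 1 then (blw 2 m, up 1 m) else (In p c, Ex p c))
  else if frac X < frac Y then (ext p c, In (Suc p) c)
  else (ext p c, In p (Suc c)))"

lemma floor_frac: "0 <= s ==> s < 1 ==> nat \<lfloor>real c + s\<rfloor> = c & frac (real c + s) = s"
proof -
 assume s: "0 <= s" "s < 1"
 hence "\<lfloor>real c + s\<rfloor> = int c" by (intro floor_unique) auto
 thus ?thesis by (simp add: frac_def)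
qed

lemma edge_at_box:
 assumes "Xf z = real c + s" "Yf z = real p + r" "0 <= s" "s < 1" "0 <= r" "r < 1"
  and "Ymin <= Yf z" "1 <= c" "Xf z <= Xmax" "Yf z <= Ytop"
 shows "edge_at z = (if s = r then (if p = 1 then (blw 2 m, up 1 m) else (In p c, Ex p c))
  else if s < r then (ext p c, In (Suc p) c) else (ext p c, In p (Suc c)))"
proof -
 have X: "nat \<lfloor>Xf z\<rfloor> = c" "frac (Xf z) = s" and Y: "nat \<lfloor>Yf z\<rfloor> = p" "frac (Yf z) = r"
  using floor_frac[OF assms(3,4), of c] floor_frac[OF assms(5,6), of p] assms(1,2) by simp_all
 have "~ Yf z < Ymin" "~ Xf z < 1" "~ Xmax < Xf z" "~ Ytop < Yf z" using assms by auto
 thus ?thesis unfolding edge_at_def Let_def X Y by (simp only: if_False)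
qed

lemma edge_at_open:
 assumes e: "(u, v) : EE" and km: "~ (k = 1 & m = 1)" and z: "z : open_segment (pos u) (pos v)"
 shows "edge_at z = (u, v)"
 using e km z
proof (cases rule: open_edge_kinds)
 case first
 thus ?thesis by (simp add: edge_at_def Let_def)
next
 case (source p)
 have "~ Yf z < Ymin" using source by (auto simp: Ymin_def)
 thus ?thesis using source by (simp add: edge_at_def Let_def)
next
 case last
 hence "~ Yf z < Ymin" "~ Xf z < 1" by auto
 thus ?thesis using last by (simp add: edge_at_def Let_def)
next
 case (sink c)
 have f: "nat \<lfloor>Xf z\<rfloor> = c" using floor_frac[of 0 c] floor_frac[of "1/3" c] sink by (auto simp: ext_def)
 have "ext k c : inn" using sink k1 by (intro ext_inn) auto
 from inn_box[OF this] inner_range[OF this] sink have "~ Xf z < 1" "~ Xmax < Xf z" by auto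
 moreover have "~ Yf z < Ymin" using sink k1 by (auto simp: Ymin_def Ytop_def split: if_splits)
 ultimately show ?thesis using sink f by (simp add: edge_at_def Let_def)
next
 case (diag p c s)
 have "edge_at z = (if s = s then (if p = 1 then (blw 2 m, up 1 m) else (In p c, Ex p c))
  else if s < s then (ext p c, In (Suc p) c) else (ext p c, In p (Suc c)))"
  by (rule edge_at_box) (use diag in \<open>auto simp: Ymin_def Xmax_def Ytop_def\<close>)
 thus ?thesis using diag by simp
next
 case (corner s)
 have "edge_at z = (if s = s then (if 1 = (1::nat) then (blw 2 m, up 1 m) else (In 1 (m - 1), Ex 1 (m - 1)))
  else if s < s then (ext 1 (m - 1), In (Suc 1) (m - 1)) else (ext 1 (m - 1), In 1 (Suc (m - 1))))"
  by (rule edge_at_box) (use corner in \<open>auto simp: Ymin_def Xmax_def Ytop_def\<close>)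
 thus ?thesis using corner by simp
next
 case (row p c s r)
 have "edge_at z = (if s = r then (if p = 1 then (blw 2 m, up 1 m) else (In p c, Ex p c))
  else if s < r then (ext p c, In (Suc p) c) else (ext p c, In p (Suc c)))"
 proof (rule edge_at_box)
  show "Ymin <= Yf z" using row by (auto simp: Ymin_def)
  show "Xf z <= Xmax"
  proof (cases "k = 1")
   case True
   hence "Suc (Suc c) <= m" using row by auto
   hence "real c + 2 <= real m" by linarith
   moreover have "Xmax = real m - 1" unfolding Xmax_def using True by (rule if_P)
   ultimately show ?thesis using row(8,12) by linarith
  qed (use row in \<open>auto simp: Xmax_def\<close>)
  show "Yf z <= Ytop"
  proof (cases "k = 1")
   case True
   hence "Ytop = 1" unfolding Ytop_def by (rule if_P)
   moreover have "p = 1" using row True by simp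
   ultimately show ?thesis using row by simp
  qed (use row in \<open>auto simp: Ytop_def\<close>)
 qed (use row in auto)
 thus ?thesis using row by simp
next
 case (col p c s r)
 have "edge_at z = (if r = s then (if p = 1 then (blw 2 m, up 1 m) else (In p c, Ex p c))
  else if r < s then (ext p c, In (Suc p) c) else (ext p c, In p (Suc c)))"
 proof (rule edge_at_box)
  show "Ymin <= Yf z" using col by (auto simp: Ymin_def)
  show "Xf z <= Xmax" using col by (cases "c = m") (auto simp: Xmax_def)
  show "Yf z <= Ytop" using col by (auto simp: Ytop_def)
 qed (use col in auto)
 thus ?thesis using col by simp
qed

lemma norm_pos_Bd [simp]: "norm (pos (Bd i)) = 1"
 by simp

lemma norm_pos_inn: "v : inn ==> norm (pos v) < 1"
 using inner_bound[of v] cmod_le[of "pos v"] by simp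

lemma norm_pos_le: "v : VV ==> norm (pos v) <= 1"
 using norm_pos_inn[of v] by (auto simp: VV_def)

lemma inner_coords:
 assumes "w : inn"
 obtains (lattice) p c where "ci w = real c" "ri w = real p"
 | (third) p c where "ci w = real c + 1/3" "ri w = real p + 1/3" "2 <= p"
 using assms unfolding inn_def by auto

text \<open>An inner vertex has two integral lattice coordinates or two that exceed an integer by
  1/3. Inside an edge between inner vertices this occurs only on the edge past the missing corner,
  at a place in row 1 where there is no vertex of the second kind. Inside the other edges points are
  outside the box.\<close>

lemma vertex_not_open:
 assumes e: "(u, v) : EE" and km: "~ (k = 1 & m = 1)" and w: "w : VV"
 shows "pos w ~: open_segment (pos u) (pos v)"
proof
 assume z: "pos w : open_segment (pos u) (pos v)"
 have "norm (pos w) < 1"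
  using open_segment_sphere[OF _ _ z] norm_pos_le EE_VV[OF e] by auto
 hence wi: "w : inn" using w by (auto simp: VV_def)
 note X = Xf_inner[OF wi] and Y = Yf_inner[OF wi] and r = inner_range[OF wi] inn_box[OF wi]
 have int: "~ (0 < s & s < 1)" if "real a = real b + s" for a b s
 proof
  assume "0 < s & s < 1"
  hence ab: "real b < real a" "real a < real b + 1" using that by auto
  hence "real (Suc b) <= real a" by (simp only: of_nat_le_iff of_nat_less_iff Suc_le_eq)
  thus False using ab(2) by simp
 qed
 have third: "s = 1/3" if "real a + 1/3 = real b + s" "0 <= s" "s < 1" for a b s
 proof -
  have "nat \<lfloor>real a + 1/3\<rfloor> = a" "nat \<lfloor>real b + s\<rfloor> = b" using floor_frac[of "1/3" a] floor_frac[OF that(2,3), of b] by auto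
  thus ?thesis using that(1) by simp
 qed
 from e km z show False
 proof (cases rule: open_edge_kinds)
  case first
  thus False using r Y by simp
 next
  case (source p)
  thus False using r X by simp
 next
  case last
  thus False using r X by simp
 next
  case (sink c)
  thus False using r Y by simp
 next
  case (diag p c s)
  from wi show False by (cases rule: inner_coords) (use diag X int[of _ c s] third[of _ c s] in auto)
 next
  case (corner s)
  from wi show False
  proof (cases rule: inner_coords)
   case (lattice q d)
   thus False using corner X int[of d "m - 1" s] by auto
  next
   case (third q d)
   hence "2 <= ri w" by simp
   thus False using corner Y by simp
  qed
 next
  case (row p c s r)
  from wi show False by (cases rule: inner_coords) (use row X Y int[of _ c s] third[of _ c s] third[of _ p r] in auto)
 next
  case (col p c s r)
  from wi show False by (cases rule: inner_coords) (use col X Y int[of _ p s] third[of _ p s] third[of _ c r] in auto)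
 qed
qed

lemma ang_mono:
 assumes "1 <= i" "i < j" "j <= k + m"
 shows "ang i < ang j"
proof -
 have src: "ang i < pi / 2" if "i <= k" "1 <= i" for i
 proof (cases "i = 1")
  case True
  have "0 <= arcsin (4/5 :: real)" by (rule arcsin_nonneg) auto
  moreover have "ang i = - arcsin (4/5)" using True by (simp add: ang_def)
  ultimately show ?thesis using pi_gt_zero by linarith
 next
  case False
  hence "\<bar>eps * (real i - 2)\<bar> <= 1/100" using that by (intro source_angle) auto
  thus ?thesis using arcsin_lt_bounded[of "eps * (real i - 2)"] False that by (simp add: ang_def)
 qed
 have snk: "pi / 2 <= ang j & ang j < ang (k + m)" if j: "k < j" "j < k + m" for j
 proof -
  let ?x = "eps * (ci (ext k (j - k)) - X0)"
  have "X0 <= ci (ext k (j - k))" using j by (auto simp: X0_def ext_def)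
  hence 0: "0 <= ?x" using eps_pos by simp
  have b: "\<bar>?x\<bar> <= 1/100" by (rule sink_angle[OF j])
  have a: "ang j = arccos (- ?x)" "ang (k + m) = arccos (- (24/25))" using j k1 m1 by (simp_all add: ang_def)
  have "arccos 0 <= arccos (- ?x)" using 0 b by (subst arccos_le_mono) auto
  moreover have "arccos (- ?x) < arccos (- (24/25))" using b by (subst arccos_less_mono) auto
  ultimately show ?thesis unfolding a by simp
 qed
 have lst: "pi / 2 < ang (k + m)"
 proof -
  have "arccos 0 < arccos (- (24/25) :: real)" by (subst arccos_less_mono) auto
  thus ?thesis using k1 m1 by (simp add: ang_def)
 qed
 consider "j <= k" | "i <= k" "k < j" "j < k + m" | "i <= k" "j = k + m" | "k < i" "j < k + m" | "k < i" "j = k + m"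
  using assms by linarith
 thus ?thesis
 proof cases
  case 1
  have j: "ang j = arcsin (eps * (real j - 2))" "0 <= eps * (real j - 2)" "\<bar>eps * (real j - 2)\<bar> <= 1/100"
   using 1 assms eps_pos source_angle[of j] by (simp_all add: ang_def)
  show ?thesis
  proof (cases "i = 1")
   case True
   have "0 < arcsin (4/5 :: real)" using arcsin_less_mono[of 0 "4/5"] by simp
   moreover have "0 <= ang j" unfolding j(1) using j(2,3) by (intro arcsin_nonneg) auto
   ultimately show ?thesis using True by (simp add: ang_def)
  next
   case False
   have i: "ang i = arcsin (eps * (real i - 2))" "\<bar>eps * (real i - 2)\<bar> <= 1/100"
    using 1 assms False source_angle[of i] by (simp_all add: ang_def)
   have "eps * (real i - 2) < eps * (real j - 2)" using assms eps_pos by simp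
   thus ?thesis unfolding i(1) j(1) using i(2) j(3) by (subst arcsin_less_mono) auto
  qed
 next
  case 2
  thus ?thesis using src[of i] snk[of j] assms by linarith
 next
  case 3
  thus ?thesis using src[of i] lst assms by simp
 next
  case 4
  have i: "k < i" "i < k + m" and j: "k < j" "j < k + m" using 4 assms by auto
  have "ci (ext k (i - k)) < ci (ext k (j - k))" using i j assms by (auto simp: ext_def)
  hence "eps * (ci (ext k (i - k)) - X0) < eps * (ci (ext k (j - k)) - X0)" using eps_pos by simp
  thus ?thesis using i j k1 sink_angle[OF i] sink_angle[OF j] by (simp add: ang_def arccos_less_mono)
 next
  case 5
  thus ?thesis using snk[of i] assms by simp
 qed
qed

end

context grid
begin

lemma pos_inj: "inj_on pos VV"
proof (rule inj_onI)
 have ang_range: "- pi < ang i & ang i <= pi" if "1 <= i" "i <= k + m" for i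
 proof -
  have "arcsin (4/5 :: real) <= pi / 2" using arcsin_bounded[of "4/5"] by simp
  moreover have "ang 1 = - arcsin (4/5)" by (simp add: ang_def)
  ultimately have "- pi < ang 1" using pi_gt_zero by linarith
  moreover have "ang (k + m) <= pi" using arccos_bounded[of "- (24/25)"] k1 m1 by (simp add: ang_def)
  moreover have "ang 1 <= ang i" "ang i <= ang (k + m)"
   using ang_mono[of 1 i] ang_mono[of i "k + m"] that by (cases "i = 1"; cases "i = k + m"; force)+
  ultimately show ?thesis by linarith
 qed
 fix u v assume u: "u : VV" and v: "v : VV" and e: "pos u = pos v"
 show "u = v"
 proof (cases "u : inn")
  case True
  hence "v : inn" using norm_pos_inn[OF True] e v by (auto simp: VV_def)
  have "ci u = ci v" "ri u = ri v"
   using e Xf_inner[OF True] Xf_inner[OF \<open>v : inn\<close>] Yf_inner[OF True] Yf_inner[OF \<open>v : inn\<close>] by simp_all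
  moreover have nt: "real a ~= real b + 1/3" for a b
  proof
   assume h: "real a = real b + 1/3"
   have "frac (real b + 1/3) = 1/3" using floor_frac[of "1/3" b] by simp
   hence "frac (real a) = 1/3" unfolding h .
   moreover have "frac (real a) = 0" by (simp add: frac_eq_0_iff)
   ultimately show False by linarith
  qed
  moreover have "real b + 1/3 ~= real a" for a b using nt[of a b] by simp
  ultimately show ?thesis using True \<open>v : inn\<close> unfolding inn_def by auto
 next
  case False
  hence "norm (pos u) = 1" using u by (auto simp: VV_def)
  hence "v ~: inn" using norm_pos_inn[of v] e by auto
  then obtain i j where ij: "u = Bd i" "v = Bd j" "1 <= i" "i <= k + m" "1 <= j" "j <= k + m" using False u v by (auto simp: VV_def)
  have "Arg (cis (ang i)) = Arg (cis (ang j))" using e ij by simp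
  hence "ang i = ang j" using ang_range[OF ij(3,4)] ang_range[OF ij(5,6)] by (simp add: Arg_cis)
  thus ?thesis using ang_mono[of i j] ang_mono[of j i] ij by (cases i j rule: linorder_cases) auto
 qed
qed

section \<open>The grid as a network\<close>

definition gnet :: network where
 "gnet = \<lparr>bdry = %i. pos (Bd i), inner = pos ` inn, edges = map_prod pos pos ` EE\<rparr>"

lemma gnet_simps [simp]: "bdry gnet i = pos (Bd i)" "inner gnet = pos ` inn" "edges gnet = map_prod pos pos ` EE"
 by (simp_all add: gnet_def)

lemma pos_eq_iff: "u : VV ==> v : VV ==> pos u = pos v <-> u = v"
 using inj_on_eq_iff[OF pos_inj] by blast

lemma edges_gnet_iff: "u : VV ==> v : VV ==> (pos u, pos v) : edges gnet <-> (u, v) : EE"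
 using EE_VV by (auto simp: pos_eq_iff)

lemma preds_VV: "v : VV ==> u : preds v ==> u : VV"
 using EE_VV[of u v] by (simp add: EE_def)

lemma in_edges_gnet: "v : VV ==> in_edges gnet (pos v) = (%u. (pos u, pos v)) ` preds v"
proof -
 assume v: "v : VV"
 have "in_edges gnet (pos v) = map_prod pos pos ` {e : EE. snd e = v}"
  unfolding in_edges_def using EE_VV v by (auto simp: pos_eq_iff)
 also have "{e : EE. snd e = v} = (%u. (u, v)) ` preds v" using v by (auto simp: EE_def)
 finally show ?thesis by (simp add: image_image)
qed

lemma out_edges_gnet: "u : VV ==> out_edges gnet (pos u) = (%v. (pos u, pos v)) ` succs u"
proof -
 assume u: "u : VV"
 have "out_edges gnet (pos u) = map_prod pos pos ` {e : EE. fst e = u}"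
  unfolding out_edges_def using EE_VV u by (auto simp: pos_eq_iff)
 also have "{e : EE. fst e = u} = (%v. (u, v)) ` succs u" using u by (auto simp: EE_succs)
 finally show ?thesis by (simp add: image_image)
qed

lemma card_in_gnet: "v : VV ==> card (in_edges gnet (pos v)) = card (preds v)"
 unfolding in_edges_gnet by (rule card_image) (auto intro!: inj_onI simp: pos_eq_iff preds_VV)

lemma card_out_gnet: "u : VV ==> card (out_edges gnet (pos u)) = card (succs u)"
proof -
 assume u: "u : VV"
 have "v : VV" if "v : succs u" for v using EE_succs[of u v] EE_VV[of u v] u that by auto
 thus ?thesis unfolding out_edges_gnet[OF u] by (intro card_image) (auto intro!: inj_onI simp: pos_eq_iff)
qed

lemma lft_blw: "2 <= p ==> p <= k ==> lft p c ~= blw p c"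
proof
 assume p: "2 <= p" "p <= k" and e: "lft p c = blw p c"
 have "rw (blw (Suc (p - 1)) c) = p - 1" by (rule rw_blw) (use p in auto)
 moreover have "rw (lft p c) = p" by (rule rw_lft[OF p(2)])
 ultimately show False using e p by simp
qed

lemma cl_ent: "cl (ent p c) = c"
 using cl_up[of 1 m] by (simp add: ent_def)

lemma ent_up: "ent p (Suc c) ~= up p c"
proof
 assume "ent p (Suc c) = up p c"
 thus False using cl_ent[of p "Suc c"] cl_up[of p c] by simp
qed

lemma card_preds_In: "In p c : VV ==> card (preds (In p c)) = (if 2 <= p then 2 else 1)"
 using lft_blw[of p c] by (auto simp: In_VV)

lemma card_succs_ext: "ext p c : VV ==> c < m ==> card (succs (ext p c)) = 2"
proof -
 assume v: "ext p c : VV" and c: "c < m"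
 have p: "1 <= p" "p <= k" "1 <= c" using v by (auto simp: ext_def In_VV Ex_VV split: if_splits)
 show ?thesis unfolding ext_succs[OF p(1) c] using ent_up[of p c] by simp
qed

lemma inner_cards:
 assumes "v : inn"
 shows "card (preds v) = 1 & card (succs v) = 2 | card (preds v) = 2 & card (succs v) = 1"
proof -
 have vv: "v : VV" using assms by (simp add: VV_def)
 show ?thesis
 proof (cases v)
  case (In p c)
  show ?thesis
  proof (cases "2 <= p")
   case True
   hence "card (preds v) = 2" using card_preds_In[of p c] vv In by simp
   moreover have "c <= m" using vv In by (simp add: In_VV)
   ultimately show ?thesis using True In by simp
  next
   case False
   hence c: "p = 1" "c < m" using vv In by (auto simp: In_VV)
   hence "v = ext p c" using In by (simp add: ext_def)
   hence "card (succs v) = 2" using card_succs_ext[of p c] vv c by simp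
   moreover have "card (preds v) = 1" using card_preds_In[of p c] vv In False by simp
   ultimately show ?thesis by simp
  qed
 next
  case (Ex p c)
  hence "v = ext p c" "c < m" using vv by (simp_all add: ext_def Ex_VV)
  hence "card (succs v) = 2" using card_succs_ext[of p c] vv by simp
  moreover have "card (preds v) = 1" using Ex by simp
  ultimately show ?thesis by simp
 qed (use assms in \<open>auto simp: inn_def\<close>)
qed

lemma source_gnet: "1 <= i ==> i <= k ==> is_source gnet (pos (Bd i))"
 using card_out_gnet[of "Bd i"] in_edges_gnet[of "Bd i"] unfolding is_source_def by (simp add: Bd_VV)

lemma sink_gnet: "k < i ==> i <= k + m ==> is_sink gnet (pos (Bd i))"
 using card_in_gnet[of "Bd i"] out_edges_gnet[of "Bd i"] unfolding is_sink_def by (simp add: Bd_VV)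

lemma sources_gnet: "sources (k + m) gnet = {1..k}"
proof -
 have "~ is_source gnet (pos (Bd i))" if "k < i" "i <= k + m" for i
  using sink_gnet[OF that] by (auto simp: is_source_def is_sink_def)
 hence le: "i <= k" if "i <= k + m" "is_source gnet (pos (Bd i))" for i using that by (meson not_le)
 show ?thesis
 proof (rule Set.set_eqI, rule iffI)
  fix i assume "i : sources (k + m) gnet"
  hence "1 <= i" "i <= k + m" "is_source gnet (pos (Bd i))" by (simp_all add: sources_def del: pos.simps)
  thus "i : {1..k}" using le[of i] by simp
 next
  fix i assume "i : {1..k}"
  thus "i : sources (k + m) gnet" using source_gnet[of i] by (simp add: sources_def del: pos.simps)
 qed
qed

lemma planar_gnet:
 assumes e: "(u, v) : EE" "(u', v') : EE" and ne: "(u, v) ~= (u', v')"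
 shows "closed_segment (pos u) (pos v) Int closed_segment (pos u') (pos v') <= {pos u, pos v} Int {pos u', pos v'}"
proof -
 \<comment> \<open>With one row and one column the grid is a single edge and the lattice box is
   empty; two different edges exclude this case.\<close>
 have km: "~ (k = 1 & m = 1)"
 proof
  assume km: "k = 1 & m = 1"
  have "a = blw (Suc k) 1 & b = Bd (k + 1)" if ab: "(a, b) : EE" for a b
  proof (cases b)
   case (In q d)
   hence "1 <= q" "q <= k" "1 <= d" "d <= m" "~ (q = 1 & d = m)" using ab by (simp_all add: EE_In In_VV)
   thus ?thesis using km by linarith
  next
   case (Ex q d)
   hence "2 <= q" "q <= k" using ab by (simp_all add: EE_Ex Ex_VV)
   thus ?thesis using km by linarith
  next
   case (Bd j)
   hence j: "k < j" "j <= k + m" "a = blw (Suc k) (j - k)" using ab by (simp_all add: EE_Bd)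
   hence "j = k + 1" using km by linarith
   thus ?thesis using j Bd by simp
  qed
  thus False using e ne by blast
 qed
 have cs: "closed_segment a b = open_segment a b Un {a, b}" for a b :: complex
  by (auto simp: open_segment_def)
 show ?thesis
 proof
  fix z assume z: "z : closed_segment (pos u) (pos v) Int closed_segment (pos u') (pos v')"
  have o: "z ~: open_segment (pos u) (pos v)"
  proof
   assume 1: "z : open_segment (pos u) (pos v)"
   have "z ~= pos u'" "z ~= pos v'" using 1 vertex_not_open[OF e(1) km] EE_VV[OF e(2)] by auto
   hence "z : open_segment (pos u') (pos v')" using z cs by auto
   thus False using edge_at_open[OF e(1) km 1] edge_at_open[OF e(2) km] ne by auto
  qed
  have "z ~: open_segment (pos u') (pos v')"
  proof
   assume 1: "z : open_segment (pos u') (pos v')"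
   have "z ~= pos u" "z ~= pos v" using 1 vertex_not_open[OF e(2) km] EE_VV[OF e(1)] by auto
   thus False using z cs o by auto
  qed
  thus "z : {pos u, pos v} Int {pos u', pos v'}" using z o cs by auto
 qed
qed

text \<open>A triangle of boundary vertices already contains a disk around 0 that covers the grid.
  Its corners are the first source, the last sink, and the second source or, with one row, the first
  sink. The coefficients are the barycentric coordinates of \<open>z\<close>, whose denominators
  168/100 and 216/100 are twice the areas of the two triangles.\<close>

lemma inner_hull:
 assumes n: "3 <= k + m"
 shows "pos ` inn <= interior (convex hull ((%i. pos (Bd i)) ` {1..k + m}))"
proof -
 let ?H = "convex hull ((%i. pos (Bd i)) ` {1..k + m})"
 have mem: "pos (Bd i) : ?H" if "1 <= i" "i <= k + m" for i using that by (intro hull_inc) auto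
 have tri: "u * a + v * b + w * c : ?H" if "u >= 0" "v >= 0" "w >= 0" "u + v + w = (1::real)" "a : ?H" "b : ?H" "c : ?H" for u v w and a b c :: complex
 proof -
  have "u *\<^sub>R a + v *\<^sub>R b + w *\<^sub>R c : convex hull {a, b, c}" unfolding convex_hull_3 using that(1-4) by blast
  moreover have "convex hull {a, b, c} <= ?H" using that(5-7) by (intro hull_minimal) auto
  ultimately show ?thesis by (auto simp: scaleR_conv_of_real)
 qed
 have "ball 0 (1/10) <= ?H"
 proof
  fix z :: complex assume "z : ball 0 (1/10)"
  hence b: "\<bar>Re z\<bar> < 1/10" "\<bar>Im z\<bar> < 1/10" using abs_Re_le_cmod[of z] abs_Im_le_cmod[of z] by auto
  let ?x = "Re z" and ?y = "Im z"
  show "z : ?H"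
  proof (cases "2 <= k")
   case True
   have B: "pos (Bd 2) = Complex 1 0" using True by (simp add: ang_def complex_eq_iff)
   have "complex_of_real ((28/100 - 28/100 * ?x - 196/100 * ?y) / (168/100)) * pos (Bd 1) + complex_of_real ((6/10 + 108/100 * ?x + 156/100 * ?y) / (168/100)) * pos (Bd 2)
    + complex_of_real ((8/10 - 8/10 * ?x + 4/10 * ?y) / (168/100)) * pos (Bd (k + m)) : ?H"
    using b n True by (intro tri mem) (auto simp: field_simps abs_less_iff)
   moreover have "complex_of_real ((28/100 - 28/100 * ?x - 196/100 * ?y) / (168/100)) * pos (Bd 1) + complex_of_real ((6/10 + 108/100 * ?x + 156/100 * ?y) / (168/100)) * pos (Bd 2)
    + complex_of_real ((8/10 - 8/10 * ?x + 4/10 * ?y) / (168/100)) * pos (Bd (k + m)) = z"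
    unfolding pos_first pos_last B by (simp add: complex_eq_iff field_simps)
   ultimately show ?thesis by simp
  next
   case False
   hence k: "k = 1" "2 <= m" using k1 n by auto
   have a: "ang (k + 1) = pi / 2" unfolding ang_def X0_def using k by simp
   have B: "pos (Bd (k + 1)) = Complex 0 1" unfolding pos.simps a by (simp add: complex_eq_iff)
   have "complex_of_real ((96/100 + 72/100 * ?x - 96/100 * ?y) / (216/100)) * pos (Bd 1) + complex_of_real ((6/10 + 108/100 * ?x + 156/100 * ?y) / (216/100)) * pos (Bd (k + 1))
    + complex_of_real ((6/10 - 18/10 * ?x - 6/10 * ?y) / (216/100)) * pos (Bd (k + m)) : ?H"
    using b n k by (intro tri mem) (auto simp: field_simps abs_less_iff)
   moreover have "complex_of_real ((96/100 + 72/100 * ?x - 96/100 * ?y) / (216/100)) * pos (Bd 1) + complex_of_real ((6/10 + 108/100 * ?x + 156/100 * ?y) / (216/100)) * pos (Bd (k + 1))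
    + complex_of_real ((6/10 - 18/10 * ?x - 6/10 * ?y) / (216/100)) * pos (Bd (k + m)) = z"
    unfolding pos_first pos_last B by (simp add: complex_eq_iff field_simps)
   ultimately show ?thesis by simp
  qed
 qed
 hence "ball 0 (1/10) <= interior ?H" by (rule interior_maximal) simp
 moreover have "pos v : ball 0 (1/10)" if "v : inn" for v
  using inner_bound[OF that] cmod_le[of "pos v"] by simp
 ultimately show ?thesis by auto
qed

lemma network_gnet: "network (k + m) gnet"
proof -
 have fin: "finite inn" using finite_VV by (simp add: VV_def)
 have arg: "strict_mono_on {1..k + m} (%i. Arg2pi (bdry gnet i / bdry gnet 1))"
 proof (rule strict_mono_onI)
  have A: "Arg2pi (bdry gnet i / bdry gnet 1) = ang i - ang 1" if "i : {1..k + m}" for i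
  proof (rule Arg2pi_unique)
   show "complex_of_real 1 * exp (\<i> * complex_of_real (ang i - ang 1)) = bdry gnet i / bdry gnet 1"
    by (simp add: cis_divide cis_conv_exp[symmetric] del: of_real_diff)
   show "0 <= ang i - ang 1" using ang_mono[of 1 i] that by (cases "i = 1") auto
   have "arcsin (4/5 :: real) <= pi / 2" using arcsin_bounded[of "4/5"] by simp
   moreover have "ang 1 = - arcsin (4/5)" by (simp add: ang_def)
  ultimately have "- pi < ang 1" using pi_gt_zero by linarith
   moreover have "ang (k + m) <= pi" using arccos_bounded[of "- (24/25)"] k1 m1 by (simp add: ang_def)
   moreover have "ang i <= ang (k + m)" using ang_mono[of i "k + m"] that by (cases "i = k + m") auto
   ultimately show "ang i - ang 1 < 2 * pi" by linarith
  qed simp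
  fix i j assume ij: "i : {1..k + m}" "j : {1..k + m}" "i < j"
  show "Arg2pi (bdry gnet i / bdry gnet 1) < Arg2pi (bdry gnet j / bdry gnet 1)"
   unfolding A[OF ij(1)] A[OF ij(2)] using ang_mono[of i j] ij by simp
 qed
 \<comment> \<open>With at most two boundary vertices there is one source and one sink, joined by a
   single edge.\<close>
 have small: "k + m <= 2 ==> inn = {}" using k1 m1 by (auto simp: inn_def)
 have deg: "card (in_edges gnet (pos v)) + card (out_edges gnet (pos v)) = 3 & (white gnet (pos v) | black gnet (pos v))" if v: "v : inn" for v
  using inner_cards[OF v] card_in_gnet[of v] card_out_gnet[of v] v by (auto simp: white_def black_def VV_def)
 have bd: "is_source gnet (bdry gnet i) | is_sink gnet (bdry gnet i)" if "i : {1..k + m}" for i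
  using source_gnet[of i] sink_gnet[of i] that by (cases "i <= k") auto
 have pV: "pos u : inner gnet Un bdry gnet ` {1..k + m}" if "u : VV" for u
  using that unfolding VV_def gnet_simps by (auto simp del: pos.simps)
 have ee: "EX u v. e = (pos u, pos v) & (u, v) : EE & u : VV & v : VV" if "e : edges gnet" for e
  using that EE_VV by auto
 have nn: "fst e ~= snd e" if he: "e : edges gnet" for e
 proof -
  obtain u v where e: "e = (pos u, pos v)" "(u, v) : EE" "u : VV" "v : VV" using ee[OF he] by blast
  have "u ~= v" using rk_mono[OF e(2)] by auto
  thus ?thesis using e pos_eq_iff by simp
 qed
 have pl: "closed_segment (fst e) (snd e) Int closed_segment (fst e') (snd e') <= {fst e, snd e} Int {fst e', snd e'}"
  if he: "e : edges gnet" "e' : edges gnet" "e ~= e'" for e e'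
 proof -
  obtain u v where e: "e = (pos u, pos v)" "(u, v) : EE" using ee[OF he(1)] by blast
  obtain u' v' where e': "e' = (pos u', pos v')" "(u', v') : EE" using ee[OF he(2)] by blast
  have "(u, v) ~= (u', v')" using he(3) e e' by auto
  from planar_gnet[OF e(2) e'(2) this] show ?thesis unfolding e(1) e'(1) fst_conv snd_conv .
 qed
 have hull: "3 <= k + m --> inner gnet <= interior (convex hull (bdry gnet ` {1..k + m}))"
  using inner_hull by (simp del: pos.simps)
 have two: "k + m <= 2 --> (ALL v:inner gnet. ALL i:sources (k + m) gnet. ALL j:sinks (k + m) gnet.
    left_of (bdry gnet i - bdry gnet j) (v - bdry gnet j))" using small by simp
 show ?thesis unfolding network_def
 proof (intro conjI hull two)
  show "edges gnet <= (inner gnet Un bdry gnet ` {1..k + m}) \<times> (inner gnet Un bdry gnet ` {1..k + m})"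
  proof
   fix e assume "e : edges gnet"
   then obtain u v where e: "e = (pos u, pos v)" "u : VV" "v : VV" using ee by blast
   show "e : (inner gnet Un bdry gnet ` {1..k + m}) \<times> (inner gnet Un bdry gnet ` {1..k + m})"
    unfolding e(1) by (intro SigmaI pV e)
  qed
  show "ALL (u, v):edges gnet. u ~= v"
  proof (rule ballI)
   fix e assume "e : edges gnet"
   hence "fst e ~= snd e" by (rule nn)
   thus "case e of (u, v) => u ~= v" unfolding case_prod_beta .
  qed
  show "ALL (u, v):edges gnet. ALL (u', v'):edges gnet. (u, v) ~= (u', v') -->
    closed_segment u v Int closed_segment u' v' <= {u, v} Int {u', v'}"
   unfolding case_prod_beta prod.collapse by (intro ballI impI pl)
  show "inner gnet <= ball 0 1" using norm_pos_inn by auto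
  show "ALL i:{1..k + m}. is_source gnet (bdry gnet i) | is_sink gnet (bdry gnet i)" using bd by blast
  show "ALL v:inner gnet. card (in_edges gnet v) + card (out_edges gnet v) = 3 & (white gnet v | black gnet v)"
   using deg by auto
 qed (use fin arg in auto)
qed

end

section \<open>Density of the boundary measurements of the grid\<close>

lemma triangular_dense:
 fixes M :: "('u => real) => 'u => real" and r :: "'u => nat"
 assumes K: "finite K" and inj: "inj_on r K" and e: "0 < e"
  and T1: "!!u t t'. u : K ==> (!!v. v : K ==> r v <= r u ==> t v = t' v) ==> M t u = M t' u"
  and T2: "!!u t. u : K ==> (!!v. v : K ==> t v ~= 0) ==> EX A R. A ~= 0 & (ALL s. M (t(u := s)) u = A * s + R)"
 shows "EX t. (ALL v:K. t v ~= 0) & (ALL u:K. \<bar>M t u - x u\<bar> < e)"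
proof -
 \<comment> \<open>The parameters are adjusted in the order of \<open>r\<close>. Changing one of
   them leaves all entries of smaller rank as they are.\<close>
 have step: "EX t. (ALL v:K. t v ~= 0) & (ALL u:K. r u < N --> \<bar>M t u - x u\<bar> < e)" for N
 proof (induction N)
  case 0
  show ?case by (rule exI[of _ "%_. 1"]) simp
 next
  case (Suc N)
  then obtain t where t: "!!v. v : K ==> t v ~= 0" "!!u. u : K ==> r u < N ==> \<bar>M t u - x u\<bar> < e" by auto
  show ?case
  proof (cases "EX u:K. r u = N")
   case False
   have "r u < N" if "u : K" "r u < Suc N" for u using False that by (metis less_SucE)
   thus ?thesis using t by (intro exI[of _ t]) auto
  next
   case True
   then obtain u where u: "u : K" "r u = N" by blast
   have "EX A R. A ~= 0 & (ALL s. M (t(u := s)) u = A * s + R)" by (rule T2[OF u(1)]) (rule t(1))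
   then obtain A R where AR: "A ~= 0 & (ALL s. M (t(u := s)) u = A * s + R)" by (elim exE)
   hence A: "A ~= 0" "!!s. M (t(u := s)) u = A * s + R" by iprover+
   \<comment> \<open>Solving exactly would give zero if \<open>x u = R\<close>, but weights have to
     be nonzero; in that case a small nonzero value is close enough.\<close>
   define s where "s = (if x u - R = 0 then e / (2 * \<bar>A\<bar>) else (x u - R) / A)"
   have s: "s ~= 0" "\<bar>A * s + R - x u\<bar> < e" using A(1) e by (auto simp: s_def abs_mult)
   have close: "\<bar>M (t(u := s)) v - x v\<bar> < e" if v: "v : K" "r v < Suc N" for v
   proof (cases "v = u")
    case True
    thus ?thesis using s A(2) by simp
   next
    case False
    hence "r v ~= N" using inj_onD[OF inj _ v(1) u(1)] u(2) by auto
    hence lt: "r v < N" using v(2) by simp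
    have "M (t(u := s)) v = M t v"
    proof (rule T1[OF v(1)])
     fix w assume "r w <= r v"
     hence "w ~= u" using lt u(2) by auto
     thus "(t(u := s)) w = t w" by simp
    qed
    thus ?thesis using t(2)[OF v(1) lt] by simp
   qed
   have nz: "(t(u := s)) v ~= 0" if "v : K" for v using t(1)[OF that] s(1) by simp
   show ?thesis by (intro exI[of _ "t(u := s)"] conjI ballI impI nz close)
  qed
 qed
 obtain N where N: "!!u. u : K ==> r u < N"
 proof
  fix u assume "u : K"
  thus "r u < Suc (Max (r ` K))" using K by (simp add: less_Suc_eq_le)
 qed
 from step[of N] N show ?thesis by auto
qed

context planar_network
begin

text \<open>With finitely many paths the series is a polynomial and is represented with the
  denominator 1.\<close>

lemma finite_paths_M_value:
 assumes io: "i : Src" "j : Snk" and fin: "finite {vs. net_path N (b i) (b j) vs}"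
 shows "M_regular n N i j w"
  "M_value n N i j w = (SUM vs | net_path N (b i) (b j) vs. (-1) powi (int (concordance (closed_path n N i j vs)) - 1) * mono_val w (path_edges vs))"
proof -
 let ?S = "{vs. net_path N (b i) (b j) vs}" and ?g = "%vs. (-1::real) powi (int (concordance (closed_path n N i j vs)) - 1)"
 define P :: edge_poly where "P = (SUM vs:?S. Poly_Mapping.single (path_edges vs) (?g vs))"
 have lP: "lk P m = M_series n N i j m" for m
 proof -
  have "lk P m = (SUM vs:?S. if path_edges vs = m then ?g vs else 0)"
   unfolding P_def lookup_sum lookup_single by (simp add: when_def)
  also have "... = (SUM vs:{vs : ?S. path_edges vs = m}. ?g vs)" by (rule sum.inter_filter[OF fin, symmetric])
  finally show ?thesis by (simp add: M_series_def)
 qed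
 have keys: "Poly_Mapping.keys P <= path_edges ` ?S"
 proof
  fix m assume m: "m : Poly_Mapping.keys P"
  show "m : path_edges ` ?S"
  proof (rule ccontr)
   assume "m ~: path_edges ` ?S"
   hence "{vs. net_path N (b i) (b j) vs & path_edges vs = m} = {}" by auto
   hence "lk P m = 0" unfolding lP M_series_def by (simp only: sum.empty)
   thus False using m by (simp add: in_keys_iff)
  qed
 qed
 have pe: "set_mset (path_edges vs) <= E" if "net_path N (b i) (b j) vs" for vs
 proof -
  have "successively (%x y. (x, y) : E) vs" using that by (simp add: net_path_def)
  thus ?thesis unfolding path_edges_def by (induction vs rule: induct_list012) auto
 qed
 have "P : edge_polys N" unfolding edge_polys_def using keys pe by blast
 moreover have Q: "1 : edge_polys N" by (simp add: edge_polys_def)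
 moreover have "represents_fraction (M_series n N i j) P 1" unfolding represents_fraction_def
 proof (intro conjI allI)
  fix m
  have "(SUM m':{m'. m' \<subseteq># m}. lk 1 m' * M_series n N i j (m - m')) = (SUM m':{m'. m' \<subseteq># m}. if m' = {#} then M_series n N i j m else 0)"
   by (rule sum.cong[OF refl]) (simp add: lookup_one when_def)
  also have "... = lk P m" unfolding lP using finite_submsets[of m] by simp
  finally show "(SUM m':{m'. m' \<subseteq># m}. lk 1 m' * M_series n N i j (m - m')) = lk P m" .
 qed simp
 moreover have "poly_at 1 w = 1" by (simp add: poly_at_def)
 ultimately have fr: "P : edge_polys N" "1 : edge_polys N" "represents_fraction (M_series n N i j) P 1" "poly_at 1 w ~= 0" "poly_at 1 w = 1" by simp_all
 thus "M_regular n N i j w" unfolding M_regular_def by blast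
 have "M_value n N i j w = poly_at P w" using M_value_eq[OF io fr(1-4)] fr(5) by simp
 also have "... = (SUM m:path_edges ` ?S. lk P m * mono_val w m)"
  unfolding poly_at_mono_val using keys fin by (intro sum.mono_neutral_left) (auto simp: in_keys_iff)
 also have "... = (SUM m:path_edges ` ?S. SUM vs | vs : ?S & path_edges vs = m. ?g vs * mono_val w (path_edges vs))"
  unfolding lP M_series_def sum_distrib_right by (intro sum.cong refl) auto
 also have "... = (SUM vs:?S. ?g vs * mono_val w (path_edges vs))" by (rule sum.group[OF fin]) (use fin in auto)
 finally show "M_value n N i j w = (SUM vs | net_path N (b i) (b j) vs. ?g vs * mono_val w (path_edges vs))" .
qed

end

context grid
begin

lemma net_path_lift:
 assumes "successively (%x y. (x, y) : edges gnet) vs" "vs ~= []" "hd vs = pos u" "u : VV"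
 shows "EX vs'. vs = map pos vs' & vs' ~= [] & hd vs' = u & successively (%x y. (x, y) : EE) vs'"
 using assms
proof (induction vs arbitrary: u)
 case (Cons x vs)
 show ?case
 proof (cases vs)
  case Nil
  thus ?thesis using Cons.prems by (intro exI[of _ "[u]"]) simp
 next
  case (Cons y ws)
  have e: "(pos u, y) : edges gnet" and s: "successively (%x y. (x, y) : edges gnet) vs"
   using Cons.prems Cons by auto
  then obtain u' v where v: "(u', v) : EE" "pos u' = pos u" "y = pos v" by auto
  hence "u' = u" using pos_eq_iff EE_VV Cons.prems(4) by blast
  have "vs ~= []" "hd vs = pos v" using Cons v by auto
  from Cons.IH[OF s this conjunct2[OF EE_VV[OF v(1)]]]
  obtain vs' where vs': "vs = map pos vs'" "vs' ~= []" "hd vs' = v" "successively (%x y. (x, y) : EE) vs'" by (elim exE conjE)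
  thus ?thesis using Cons.prems v \<open>u' = u\<close> by (intro exI[of _ "u # vs'"]) (cases vs'; auto)
 qed
qed simp

lemma net_path_gnet:
 assumes u: "u : VV" and v: "v : VV"
 shows "{vs. net_path gnet (pos u) (pos v) vs} = map pos ` {vs. gpath u v vs}"
proof (rule Set.set_eqI, rule iffI)
 fix vs assume "vs : {vs. net_path gnet (pos u) (pos v) vs}"
 hence vs: "successively (%x y. (x, y) : edges gnet) vs" "vs ~= []" "hd vs = pos u" "last vs = pos v" by (auto simp: net_path_def)
 from net_path_lift[OF vs(1-3) u] obtain vs' where vs': "vs = map pos vs'" "vs' ~= []" "hd vs' = u" "successively (%x y. (x, y) : EE) vs'" by blast
 hence g: "gpath u (last vs') vs'" by (simp add: gpath_def)
 have "last vs' : VV" using gpath_VV[OF g u] vs'(2) by auto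
 moreover have "pos (last vs') = pos v" using vs(4) vs' by (simp add: last_map)
 ultimately have "last vs' = v" using pos_eq_iff v by blast
 thus "vs : map pos ` {vs. gpath u v vs}" using g vs'(1) by auto
next
 fix vs assume "vs : map pos ` {vs. gpath u v vs}"
 then obtain vs' where vs': "vs = map pos vs'" "gpath u v vs'" by auto
 have "successively (%x y. (pos x, pos y) : edges gnet) vs'"
  using vs'(2) unfolding gpath_def by (auto elim: successively_mono)
 thus "vs : {vs. net_path gnet (pos u) (pos v) vs}"
  using vs' by (auto simp: net_path_def gpath_def successively_map hd_map last_map)
qed

abbreviation "KM \<equiv> {1..k} \<times> {1..m}"

definition wt :: "(nat \<times> nat => real) => gv \<times> gv => real" where
 "wt t e = (if e : piv ` KM then t (the_inv_into KM piv e) else 1)"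

lemma wt_piv: "u : KM ==> wt t (piv u) = t u"
 unfolding wt_def by (simp only: imageI if_True the_inv_into_f_f[OF piv_inj])

lemma wt_nonzero:
 assumes "!!u. u : KM ==> t u ~= 0"
 shows "wt t e ~= 0"
proof (cases "e : piv ` KM")
 case True
 then obtain v where "v : KM" "e = piv v" by (elim imageE)
 thus ?thesis using wt_piv[of v t] assms[of v] by simp
qed (simp add: wt_def)

definition gwt :: "(nat \<times> nat => real) => weights" where
 "gwt t = (\<lambda>e\<in>edges gnet. wt t (the_inv_into VV pos (fst e), the_inv_into VV pos (snd e)))"

lemma gwt_edge: "(u, v) : EE ==> gwt t (pos u, pos v) = wt t (u, v)"
 using EE_VV[of u v] edges_gnet_iff[of u v] by (simp add: gwt_def the_inv_into_f_f[OF pos_inj] del: gnet_simps)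

lemma gwt_space:
 assumes "!!u. u : KM ==> t u ~= 0"
 shows "gwt t : weight_space gnet"
 unfolding weight_space_def gwt_def using wt_nonzero[OF assms]
 by (intro restrict_PiE_iff[THEN iffD2] ballI) (simp only: UNIV_I Diff_iff singleton_iff simp_thms)

definition psgn :: "nat \<times> nat => gv list => real" where
 "psgn u vs = (-1) powi (int (concordance (closed_path (k + m) gnet (fst u) (k + snd u) (map pos vs))) - 1)"

definition MM :: "(nat \<times> nat => real) => nat \<times> nat => real" where
 "MM t u = (SUM vs | gpath (Bd (fst u)) (Bd (k + snd u)) vs. psgn u vs * (PROD e:set (zip vs (tl vs)). wt t e))"

lemma MM_cong:
 assumes u: "u : KM" and t: "!!v. v : KM ==> prank v <= prank u ==> t v = t' v"
 shows "MM t u = MM t' u"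
 unfolding MM_def
proof (intro sum.cong refl arg_cong2[of _ _ _ _ "(*)"] prod.cong)
 fix vs e assume vs: "vs : {vs. gpath (Bd (fst u)) (Bd (k + snd u)) vs}" and e: "e : set (zip vs (tl vs))"
 show "wt t e = wt t' e"
 proof (cases "e : piv ` KM")
  case True
  then obtain v where v: "v : KM" "e = piv v" by auto
  have "prank v <= prank (fst u, snd u)" by (rule prank_gpath[of "fst u" "snd u" vs]) (use vs e u v in auto)
  thus ?thesis using t[OF v(1)] v wt_piv by simp
 qed (simp add: wt_def)
qed

text \<open>Exactly one path for the entry \<open>u\<close> runs through the pivot \<open>u\<close>,
  so the entry is affine in the weight of this pivot. The leading coefficient is the sign of that
  path times the weights of its other edges, hence nonzero.\<close>

lemma MM_affine:
 assumes u: "u : KM" and t: "!!v. v : KM ==> t v ~= 0"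
 shows "EX A R. A ~= 0 & (ALL s. MM (t(u := s)) u = A * s + R)"
proof -
 obtain p c where pc: "u = (p, c)" "p : {1..k}" "c : {1..m}" using u by auto
 let ?S = "{vs. gpath (Bd p) (Bd (k + c)) vs}" and ?E = "%vs. set (zip vs (tl vs))"
 have fin: "finite ?S" using pc by (intro finite_gpaths) (simp add: Bd_VV)
 obtain vs0 where vs0: "{vs. gpath (Bd p) (Bd (k + c)) vs & piv u : ?E vs} = {vs0}"
  using unique_piv_path[OF pc(2,3)] pc(1) by auto
 have v0: "vs0 : ?S" "piv u : ?E vs0" using vs0 by auto
 have wt_other: "wt (t(u := s)) e = wt t e" if "e ~= piv u" for s e
 proof (cases "e : piv ` KM")
  case True
  then obtain v where "v : KM" "e = piv v" by auto
  thus ?thesis using that wt_piv by auto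
 qed (simp add: wt_def)
 let ?A = "psgn u vs0 * (PROD e:?E vs0 - {piv u}. wt t e)"
 let ?R = "SUM vs:?S - {vs0}. psgn u vs * (PROD e:?E vs. wt t e)"
 have "MM (t(u := s)) u = ?A * s + ?R" for s
 proof -
  have "MM (t(u := s)) u = psgn u vs0 * (PROD e:?E vs0. wt (t(u := s)) e) + (SUM vs:?S - {vs0}. psgn u vs * (PROD e:?E vs. wt (t(u := s)) e))"
   unfolding MM_def pc(1) fst_conv snd_conv using sum.remove[OF fin v0(1)] by simp
  also have "(PROD e:?E vs0. wt (t(u := s)) e) = s * (PROD e:?E vs0 - {piv u}. wt (t(u := s)) e)"
   using prod.remove[OF _ v0(2), of "wt (t(u := s))"] wt_piv[OF u] by simp
  also have "(PROD e:?E vs0 - {piv u}. wt (t(u := s)) e) = (PROD e:?E vs0 - {piv u}. wt t e)"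
   by (rule prod.cong[OF refl]) (rule wt_other, simp)
  also have "(SUM vs:?S - {vs0}. psgn u vs * (PROD e:?E vs. wt (t(u := s)) e)) = ?R"
  proof (intro sum.cong refl arg_cong2[of _ _ _ _ "(*)"] prod.cong wt_other)
   fix vs e assume vs: "vs : ?S - {vs0}" and e: "e : ?E vs"
   show "e ~= piv u"
   proof
    assume "e = piv u"
    hence "vs : {vs. gpath (Bd p) (Bd (k + c)) vs & piv u : ?E vs}" using vs e by simp
    thus False using vs vs0 by simp
   qed
  qed
  finally show ?thesis by (simp only: mult_ac)
 qed
 moreover have "?A ~= 0"
 proof -
  have "wt t e ~= 0" for e by (rule wt_nonzero) (rule t)
  moreover have "psgn u vs0 ~= 0" by (simp add: psgn_def)
  ultimately show ?thesis by simp
 qed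
 ultimately show ?thesis by (intro exI[of _ ?A] exI[of _ ?R]) simp
qed

sublocale gn: planar_network "k + m" gnet
 by unfold_locales (rule network_gnet)

lemma gnet_M_value:
 assumes u: "u : KM"
 shows "M_regular (k + m) gnet (fst u) (k + snd u) (gwt t)" "M_value (k + m) gnet (fst u) (k + snd u) (gwt t) = MM t u"
proof -
 obtain p c where pc: "u = (p, c)" "p : {1..k}" "c : {1..m}" using u by auto
 have VV: "Bd p : VV" "Bd (k + c) : VV" using pc by (simp_all add: Bd_VV)
 have io: "p : sources (k + m) gnet" "k + c : sinks (k + m) gnet"
  using pc sources_gnet gn.sinks_eq by auto
 let ?S = "{vs. gpath (Bd p) (Bd (k + c)) vs}"
 have np: "{vs. net_path gnet (bdry gnet p) (bdry gnet (k + c)) vs} = map pos ` ?S"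
  using net_path_gnet[OF VV] by (simp only: gnet_simps)
 have fin: "finite {vs. net_path gnet (bdry gnet p) (bdry gnet (k + c)) vs}" unfolding np by (intro finite_imageI finite_gpaths VV)
 show "M_regular (k + m) gnet (fst u) (k + snd u) (gwt t)" using gn.finite_paths_M_value(1)[OF io fin] pc by simp
 have inj: "inj_on (map pos) ?S"
 proof (rule inj_onI)
  fix vs ws assume a: "vs : ?S" "ws : ?S" "map pos vs = map pos ws"
  have "set vs Un set ws <= VV" using gpath_VV[of "Bd p"] a VV by auto
  thus "vs = ws" using map_inj_on[OF a(3)] inj_on_subset[OF pos_inj] by blast
 qed
 have "M_value (k + m) gnet p (k + c) (gwt t) = (SUM vs:?S. psgn u vs * mono_val (gwt t) (path_edges (map pos vs)))"
  unfolding gn.finite_paths_M_value(2)[OF io fin] np sum.reindex[OF inj] by (simp add: psgn_def pc)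
 also have "... = MM t u" unfolding MM_def pc(1) fst_conv snd_conv
 proof (intro sum.cong refl arg_cong2[of _ _ _ _ "(*)"])
  fix vs assume "vs : ?S"
  hence g: "gpath (Bd p) (Bd (k + c)) vs" by simp
  have sub: "set (zip vs (tl vs)) <= EE"
  proof -
   have "successively (%x y. (x, y) : EE) vs" using g by (simp add: gpath_def)
   thus ?thesis by (induction vs rule: induct_list012) auto
  qed
  have "mono_val (gwt t) (path_edges (map pos vs)) = prod_list (map (gwt t) (zip (map pos vs) (tl (map pos vs))))"
   unfolding mono_val_def path_edges_def by (simp only: mset_map[symmetric] prod_mset_prod_list)
  also have "... = prod_list (map (wt t) (zip vs (tl vs)))"
   unfolding map_tl[symmetric] zip_map_map map_map using sub gwt_edge
   by (intro arg_cong[of _ _ prod_list] map_cong refl) auto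
  also have "... = (PROD e:set (zip vs (tl vs)). wt t e)"
   by (rule prod.distinct_set_conv_list[symmetric]) (intro distinct_zipI1 gpath_distinct[OF g])
  finally show "mono_val (gwt t) (path_edges (map pos vs)) = (PROD e:set (zip vs (tl vs)). wt t e)" .
 qed
 finally show "M_value (k + m) gnet (fst u) (k + snd u) (gwt t) = MM t u" by (simp add: pc)
qed

lemma gnet_dense:
 assumes e: "0 < e"
 shows "EX w:X_domain (k + m) gnet. ALL u:coord_idx k (k + m) {1..k}. \<bar>gn.Ycoord w u - x u\<bar> < e"
proof -
 \<comment> \<open>The prescribed chart coordinates with the signs of the matrix entries
   removed.\<close>
 define x' where "x' u = gn.msgn (fst u, k + snd u) * x (fst u, k + snd u)" for u
 have "EX t. (ALL v:KM. t v ~= 0) & (ALL u:KM. \<bar>MM t u - x' u\<bar> < e)"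
 proof (rule triangular_dense[OF _ prank_inj e])
  show "MM t u = MM t' u" if "u : KM" "!!v. v : KM ==> prank v <= prank u ==> t v = t' v" for u t t'
   using that(1) by (rule MM_cong) (rule that(2))
  show "EX A R. A ~= 0 & (ALL s. MM (t(u := s)) u = A * s + R)" if "u : KM" "!!v. v : KM ==> t v ~= 0" for u t
   using that(1) by (rule MM_affine) (rule that(2))
 qed simp
 then obtain t where tt: "(ALL v:KM. t v ~= 0) & (ALL u:KM. \<bar>MM t u - x' u\<bar> < e)" by (elim exE)
 have t: "t v ~= 0" "\<bar>MM t v - x' v\<bar> < e" if "v : KM" for v
  using bspec[OF conjunct1[OF tt] that] bspec[OF conjunct2[OF tt] that] .
 have snk: "sinks (k + m) gnet = {1..k + m} - {1..k}" using gn.sinks_eq sources_gnet by simp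
 have dom: "gwt t : X_domain (k + m) gnet" unfolding X_domain_def sources_gnet snk
 proof (intro CollectI conjI ballI gwt_space t)
  fix i j assume ij: "i : {1..k}" "j : {1..k + m} - {1..k}"
  hence "(i, j - k) : KM" "j = k + (j - k)" by auto
  from gnet_M_value(1)[OF this(1), of t] this(2) show "M_regular (k + m) gnet i j (gwt t)" by simp
 qed
 have elt: "elt {1..k} p = p" if "p : {1..k}" for p
 proof -
  have "sorted_list_of_set {1..k} = [1..<Suc k]"
   by (simp only: atLeastLessThanSuc_atLeastAtMost[symmetric] sorted_list_of_set_range)
  thus ?thesis using that by (simp add: elt_def del: upt_Suc)
 qed
 have "\<bar>gn.Ycoord (gwt t) u - x u\<bar> < e" if u: "u : coord_idx k (k + m) {1..k}" for u
 proof -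
  define v where "v = (fst u, snd u - k)"
  have v: "v : KM" "u = (fst v, k + snd v)" using u by (auto simp: v_def)
  have s: "gn.msgn u * gn.msgn u = 1" by (simp add: gn.msgn_def flip: power_mult_distrib)
  have ab: "\<bar>gn.msgn u\<bar> = 1" by (simp add: gn.msgn_def power_abs)
  have u': "u : coord_idx (card (sources (k + m) gnet)) (k + m) (sources (k + m) gnet)" unfolding sources_gnet using u by simp
  have "gn.Ycoord (gwt t) u = gn.msgn u * MM t v"
  proof -
   have fu: "fst u = fst v" "snd u = k + snd v" using arg_cong[OF v(2), of fst] arg_cong[OF v(2), of snd] by simp_all
   have "fst v : {1..k}" using v(1) unfolding mem_Times_iff by (rule conjunct1)
   hence ev: "elt {1..k} (fst v) = fst v" by (rule elt)
   show ?thesis unfolding gn.Ycoord_def if_P[OF u'] unfolding sources_gnet fu ev gnet_M_value(2)[OF v(1)] by (rule refl)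
  qed
  moreover have "x u = gn.msgn u * x' v" using s v(2) by (simp add: x'_def mult.assoc[symmetric])
  ultimately have "gn.Ycoord (gwt t) u - x u = gn.msgn u * (MM t v - x' v)" by (simp add: right_diff_distrib)
  thus ?thesis using t(2)[OF v(1)] ab by (simp add: abs_mult)
 qed
 thus ?thesis using dom by blast
qed

end

section \<open>Uniqueness of the bracket\<close>

lemma poisson_bracket_closed:
 assumes "poisson_bracket U A B" "f : A" "g : A"
 shows "B f g : A"
proof -
 have "B : A \<rightarrow>\<^sub>E (A \<rightarrow>\<^sub>E A)" using assms(1) unfolding poisson_bracket_def by (rule conjunct1)
 from PiE_mem[OF PiE_mem[OF this assms(2)] assms(3)] show ?thesis .
qed

text \<open>Compatibility speaks about flag brackets with the given parameters, so one such bracket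
  has to be exhibited before it can be applied to the grid.\<close>

lemma skew3_parameter:
 fixes c :: real
 obtains p where "skew3 p" "c = p 2 3 + p 1 3 - p 1 2"
proof
 let ?p = "%(i::nat) (j::nat). if i = 2 & j = 3 then c else if i = 3 & j = 2 then - c else 0"
 show "skew3 ?p" by (auto simp: skew3_def)
 show "c = ?p 2 3 + ?p 1 3 - ?p 1 2" by simp
qed

text \<open>At the images of weights of the grid both brackets equal the bracket on edge weights.
  These points are dense in the cell, and brackets of smooth functions are continuous in the
  chart.\<close>

lemma (in grid) compatible_agree:
 assumes B: "network_compatible k (k + m) al be B" and B': "network_compatible k (k + m) al be B'"
  and f: "f : Gr_smooth k (k + m) (Gr k (k + m))" and g: "g : Gr_smooth k (k + m) (Gr k (k + m))"
 shows "B f g (cell_param k (k + m) {1..k} x) = B' f g (cell_param k (k + m) {1..k} x)"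
proof -
 let ?n = "k + m" and ?I = "{1..k}"
 have I: "?I <= {1..?n}" "card ?I = k" by auto
 have pb: "poisson_bracket (Gr k ?n) (Gr_smooth k ?n (Gr k ?n)) B" "poisson_bracket (Gr k ?n) (Gr_smooth k ?n (Gr k ?n)) B'"
  using B B' unfolding network_compatible_def by (iprover dest: conjunct1)+
 define D where "D y = B f g (cell_param k ?n ?I y) - B' f g (cell_param k ?n ?I y)" for y
 have cont: "continuous_on UNIV (%y. h (cell_param k ?n ?I y))" if "h : Gr_smooth k ?n (Gr k ?n)" for h
  using Cinf_on_continuous[OF Gr_chart[OF gr_open_Gr that I]] cell_param_Gr[OF I] by simp
 have contD: "continuous_on UNIV D" unfolding D_def
  by (intro continuous_on_diff cont poisson_bracket_closed[OF pb(1) f g] poisson_bracket_closed[OF pb(2) f g])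
 obtain p q where pq: "skew3 p" "al = p 2 3 + p 1 3 - p 1 2" "skew3 q" "be = q 2 3 + q 1 3 - q 1 2"
  using skew3_parameter[of al] skew3_parameter[of be] by metis
 have net: "skew3 p & skew3 q & al = p 2 3 + p 1 3 - p 1 2 & be = q 2 3 + q 1 3 - q 1 2 & network ?n gnet & card (sources ?n gnet) = k"
  using pq network_gnet sources_gnet by simp
 have eb: "edge_bracket p q gnet (f \<circ> X_map ?n gnet) (g \<circ> X_map ?n gnet) w = C f g (X_map ?n gnet w)"
  if C: "network_compatible k ?n al be C" and w: "w : X_domain ?n gnet" for C w
 proof -
  have "X_poisson k ?n p q gnet C" using C net unfolding network_compatible_def by iprover
  from bspec[OF bspec[OF bspec[OF this[unfolded X_poisson_def] f] g] w] show ?thesis .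
 qed
 have X: "X_map ?n gnet w = cell_param k ?n ?I (gn.Ycoord w)" for w
  using gn.X_map_cell_param[of w] unfolding sources_gnet by simp
 have D0: "D (gn.Ycoord w) = 0" if "w : X_domain ?n gnet" for w
  unfolding D_def X[symmetric] using eb[OF B that] eb[OF B' that] by simp
 have "ALL i. EX w. w : X_domain ?n gnet & (ALL u:coord_idx k ?n ?I. \<bar>gn.Ycoord w u - x u\<bar> < inverse (real (Suc i)))"
 proof
  fix i :: nat
  have "0 < inverse (real (Suc i))" by simp
  from gnet_dense[OF this, of x] show "EX w. w : X_domain ?n gnet & (ALL u:coord_idx k ?n ?I. \<bar>gn.Ycoord w u - x u\<bar> < inverse (real (Suc i)))"
   unfolding Bex_def .
 qed
 then obtain w where w: "ALL i. w i : X_domain ?n gnet & (ALL u:coord_idx k ?n ?I. \<bar>gn.Ycoord (w i) u - x u\<bar> < inverse (real (Suc i)))"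
  unfolding choice_iff by (rule exE)
 \<comment> \<open>Convergence is required in every coordinate of the function space, so the
   coordinates outside the index set are copied from \<open>x\<close>.\<close>
 define y where "y i u = (if u : coord_idx k ?n ?I then gn.Ycoord (w i) u else x u)" for i u
 have "(y \<longlongrightarrow> x) sequentially" unfolding tendsto_fun_iff
 proof
  fix u
  have "\<bar>y i u - x u\<bar> <= inverse (real (Suc i))" for i
   using w[rule_format, of i] unfolding y_def by (cases "u : coord_idx k ?n ?I") (simp_all only: if_True if_False, auto intro: less_imp_le)
  hence "((%i. y i u - x u) \<longlongrightarrow> 0) sequentially"
   by (intro Lim_null_comparison[OF _ LIMSEQ_inverse_real_of_nat]) (simp add: always_eventually)
  thus "((%i. y i u) \<longlongrightarrow> x u) sequentially" by (simp only: LIM_zero_iff)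
 qed
 from continuous_on_tendsto_compose[OF contD this] have "((%i. D (y i)) \<longlongrightarrow> D x) sequentially" by simp
 moreover have "D (y i) = 0" for i
 proof -
  have "cell_param k ?n ?I (y i) = cell_param k ?n ?I (gn.Ycoord (w i))"
   by (rule cell_param_cong[OF I]) (simp only: y_def if_True)
  hence "D (y i) = D (gn.Ycoord (w i))" by (simp only: D_def)
  thus ?thesis using D0[OF conjunct1[OF spec[OF w, of i]]] by simp
 qed
 ultimately have "D x = 0" by (simp add: LIMSEQ_const_iff)
 thus ?thesis by (simp add: D_def)
qed

text \<open>On a single point, a bracket satisfying the Leibniz rule kills the constants, hence everything.\<close>

lemma poisson_bracket_point:
 assumes pb: "poisson_bracket {X0} (Gr_smooth k n {X0}) B" and one: "(\<lambda>X\<in>{X0}. 1) : Gr_smooth k n {X0}"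
  and f: "f : Gr_smooth k n {X0}" and g: "g : Gr_smooth k n {X0}"
 shows "B f g X0 = 0"
proof -
 let ?A = "Gr_smooth k n {X0}" and ?one = "\<lambda>X\<in>{X0}. 1 :: real"
 have lin: "B (\<lambda>X\<in>{X0}. a * f X + b * g X) h = (\<lambda>X\<in>{X0}. a * B f h X + b * B g h X)"
  if "f : ?A" "g : ?A" "h : ?A" for f g h a b using pb that unfolding poisson_bracket_def by blast
 have leib: "B (\<lambda>X\<in>{X0}. f X * g X) h = (\<lambda>X\<in>{X0}. f X * B g h X + B f h X * g X)"
  if "f : ?A" "g : ?A" "h : ?A" for f g h using pb that unfolding poisson_bracket_def by blast
 have "(\<lambda>X\<in>{X0}. ?one X * ?one X) = ?one" by (auto simp: restrict_def)
 hence "B ?one g X0 = B ?one g X0 + B ?one g X0" using arg_cong[OF leib[OF one one g], of "%F. F X0"] by simp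
 hence 0: "B ?one g X0 = 0" by simp
 have "f : extensional {X0}" using f by (simp add: Gr_smooth_def)
 hence "(\<lambda>X\<in>{X0}. f X0 * ?one X + 0 * ?one X) = f" by (intro extensionalityI[OF restrict_extensional]) auto
 thus ?thesis using arg_cong[OF lin[OF one one g, of "f X0" 0], of "%F. F X0"] 0 by simp
qed

text \<open>There is only one index set, and its chart has no coordinates.\<close>

lemma Gr_point:
 assumes "k = 0 | k = n"
 shows "EX X0. Gr k n = {X0}"
proof -
 have idx: "I = {1..k}" if "I <= {1..n}" "card I = k" for I
 proof -
  have "finite I" using that(1) by (rule finite_subset) simp
  thus ?thesis using that assms card_subset_eq[of "{1..n}" I] by auto
 qed
 have I: "{1..k} <= {1..n}" "card {1..k} = k" using assms by auto
 have "X = cell_param k n {1..k} (%_. 0)" if "X : Gr k n" for X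
 proof -
  from that obtain I where "I <= {1..n}" "card I = k" "X : cell k n I" by (rule Gr_cell_cover)
  hence "X : cell k n {1..k}" using idx by simp
  then obtain x where x: "X = cell_param k n {1..k} x" by (rule cell_obtain[OF I])
  have "coord_idx k n {1..k} = {}" using assms by auto
  hence "cell_param k n {1..k} x = cell_param k n {1..k} (%_. 0)" by (intro cell_param_cong[OF I]) blast
  thus ?thesis using x by simp
 qed
 thus ?thesis using cell_param_Gr[OF I] by (intro exI[of _ "cell_param k n {1..k} (%_. 0)"]) blast
qed

text \<open>The grid has at least one row and one column; for \<open>k = 0\<close> and
  \<open>k = n\<close> the Grassmannian is a point, where both brackets vanish. In all other cases
  equality on the cell of \<open>{1..k}\<close> spreads to every chart, because the overlap is dense
  in it and the brackets are continuous.\<close>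

lemma compatible_unique:
 assumes B: "network_compatible k n al be B" and B': "network_compatible k n al be B'" and kn: "k <= n"
 shows "B = B'"
proof -
 let ?A = "Gr_smooth k n (Gr k n)"
 have pb: "poisson_bracket (Gr k n) ?A B" "poisson_bracket (Gr k n) ?A B'"
  using B B' unfolding network_compatible_def by (iprover dest: conjunct1)+
 have E: "B : ?A \<rightarrow>\<^sub>E (?A \<rightarrow>\<^sub>E ?A)" "B' : ?A \<rightarrow>\<^sub>E (?A \<rightarrow>\<^sub>E ?A)"
  using pb unfolding poisson_bracket_def by (iprover dest: conjunct1)+
 have val: "B f g X = B' f g X" if f: "f : ?A" and g: "g : ?A" and X: "X : Gr k n" for f g X
 proof (cases "k = 0 | k = n")
  case True
  from Gr_point[OF this] obtain X0 where X0: "Gr k n = {X0}" by (rule exE)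
  have one: "(\<lambda>X\<in>Gr k n. 1) : ?A"
  proof (rule Gr_smoothI[OF gr_open_Gr])
   fix I assume I: "I <= {1..n}" "card I = k"
   show "EX F. Cinf_on (coord_idx k n I) {x. cell_param k n I x : Gr k n} F & (ALL x. cell_param k n I x : Gr k n --> F x = 1)"
    using Cinf_on_const[OF gr_chart_open[OF gr_open_Gr I]] by (intro exI[of _ "%_. 1"] conjI) simp_all
  qed
  have "B f g X0 = 0" "B' f g X0 = 0"
   by (rule poisson_bracket_point[OF pb(1)[unfolded X0] one[unfolded X0] f[unfolded X0] g[unfolded X0]]
    poisson_bracket_point[OF pb(2)[unfolded X0] one[unfolded X0] f[unfolded X0] g[unfolded X0]])+
  thus ?thesis using X X0 by simp
 next
  case False
  define m where "m = n - k"
  have km: "n = k + m" "1 <= k" "1 <= m" using False kn by (auto simp: m_def)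
  interpret grid k m by unfold_locales (rule km)+
  have I0: "{1..k} <= {1..n}" "card {1..k} = k" using km by auto
  from X obtain I where I: "I <= {1..n}" "card I = k" "X : cell k n I" by (rule Gr_cell_cover)
  from I(3) obtain x where x: "X = cell_param k n I x" by (rule cell_obtain[OF I(1,2)])
  define D where "D y = B f g (cell_param k n I y) - B' f g (cell_param k n I y)" for y
  have cont: "continuous_on UNIV (%y. h (cell_param k n I y))" if "h : ?A" for h
   using Cinf_on_continuous[OF Gr_chart[OF gr_open_Gr that I(1,2)]] cell_param_Gr[OF I(1,2)] by simp
  have contD: "continuous_on UNIV D" unfolding D_def
   by (intro continuous_on_diff cont poisson_bracket_closed[OF pb(1) f g] poisson_bracket_closed[OF pb(2) f g])
  have "D y = 0" if "y : covl k I {1..k}" for y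
  proof -
   have "cell_param k n I y : cell k n {1..k}" using that cell_param_in_cell_iff[OF I(1,2) I0] by simp
   then obtain z where z: "cell_param k n I y = cell_param k n {1..k} z" by (rule cell_obtain[OF I0])
   have "B f g (cell_param k n {1..k} z) = B' f g (cell_param k n {1..k} z)"
    using compatible_agree[of al be B B' f g z] B B' f g unfolding km(1) by simp
   thus ?thesis unfolding D_def z by simp
  qed
  hence "covl k I {1..k} <= {y. D y = 0}" by blast
  moreover have "closed {y. D y = 0}" using closed_Collect_eq[OF contD continuous_on_const[of _ 0]] .
  ultimately have "closure (covl k I {1..k}) <= {y. D y = 0}" by (rule closure_minimal)
  hence "D x = 0" unfolding covl_dense[OF I(1,2) I0] by blast
  thus ?thesis by (simp add: D_def x)
 qed
 show ?thesis
 proof (rule PiE_ext[OF E])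
  fix f assume f: "f : ?A"
  show "B f = B' f"
  proof (rule PiE_ext[OF PiE_mem[OF E(1) f] PiE_mem[OF E(2) f]])
   fix g assume g: "g : ?A"
   show "B f g = B' f g"
   proof (rule extensionalityI[of _ "Gr k n"])
    show "B f g : extensional (Gr k n)" "B' f g : extensional (Gr k n)"
     using poisson_bracket_closed[OF pb(1) f g] poisson_bracket_closed[OF pb(2) f g] by (simp_all add: Gr_smooth_def)
   qed (rule val[OF f g])
  qed
 qed
qed

theorem theorem4p3:
  fixes n k :: nat and \<alpha> \<beta> :: real
  assumes "k \<le> n"
  shows "(\<exists>!B. network_compatible k n \<alpha> \<beta> B) \<and>
    (\<forall>B. network_compatible k n \<alpha> \<beta> B \<longrightarrow>
      (\<forall>I. I \<subseteq> {1..n} \<and> card I = k \<longrightarrow>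
        (\<exists>B'. poisson_bracket (cell k n I) (Gr_smooth k n (cell k n I)) B' \<and>
          (\<forall>p\<in>{1..k}. \<forall>q\<in>{1..k}. \<forall>j\<in>{1..n} - I. \<forall>l\<in>{1..n} - I. \<forall>X\<in>cell k n I.
            B' (cell_coord k n I p j) (cell_coord k n I q l) X =
              (\<alpha> - \<beta>) * s_eq (elt I p) j (elt I q) l * cell_coord k n I p l X * cell_coord k n I q j X +
              (\<alpha> + \<beta>) * s_times (elt I p) j (elt I q) l * cell_coord k n I p j X * cell_coord k n I q l X) \<and>
          bracket_restricts (Gr_smooth k n (Gr k n)) B (cell k n I) B')))"
proof (intro conjI allI impI)
 show "\<exists>!B. network_compatible k n \<alpha> \<beta> B"
 proof (rule ex1I)
  show "network_compatible k n \<alpha> \<beta> (gr_poisson k n \<alpha> \<beta> (Gr k n))" by (rule network_compatible_gr_poisson)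
  fix C assume "network_compatible k n \<alpha> \<beta> C"
  then show "C = gr_poisson k n \<alpha> \<beta> (Gr k n)" by (rule compatible_unique[OF _ network_compatible_gr_poisson assms])
 qed
next
 fix B I assume B: "network_compatible k n \<alpha> \<beta> B" and I: "I \<subseteq> {1..n} \<and> card I = k"
 have eq: "B = gr_poisson k n \<alpha> \<beta> (Gr k n)" by (rule compatible_unique[OF B network_compatible_gr_poisson assms])
 note I' = conjunct1[OF I] conjunct2[OF I]
 show "\<exists>B'. poisson_bracket (cell k n I) (Gr_smooth k n (cell k n I)) B' \<and>
     (\<forall>p\<in>{1..k}. \<forall>q\<in>{1..k}. \<forall>j\<in>{1..n} - I. \<forall>l\<in>{1..n} - I. \<forall>X\<in>cell k n I.
      B' (cell_coord k n I p j) (cell_coord k n I q l) X =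
       (\<alpha> - \<beta>) * s_eq (elt I p) j (elt I q) l * cell_coord k n I p l X * cell_coord k n I q j X +
       (\<alpha> + \<beta>) * s_times (elt I p) j (elt I q) l * cell_coord k n I p j X * cell_coord k n I q l X) \<and>
     bracket_restricts (Gr_smooth k n (Gr k n)) B (cell k n I) B'"
  unfolding eq
  by (intro exI[of _ "gr_poisson k n \<alpha> \<beta> (cell k n I)"] conjI ballI poisson_bracket_gr_poisson gr_open_cell I'
   gr_poisson_restricts gr_poisson_coord[OF I'] SigmaI)
qed

end
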